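(* Let $\mathcal P$ be an operad over a field that reflects homotopy equivalences, and let $f:A\to B$ be a morphism of $\mathcal P$-algebras. Then $f$ preserves cotriple product sets: if $m:(\mathcal P(\bigoplus_{i=0}^NV_i),d)\to A$ is an $N$-step Sullivan model of $A$ and $\sigma\in I(\bigoplus_{i=1}^NV_i)$ is a cocycle, then $H^*(f)$ maps the $\sigma$-cotriple product set of $A$ into the corresponding $\sigma$-cotriple product set of $B$. If furthermore $f$ is a quasi-isomorphism, then $H^*(f)$ induces a bijection between the corresponding cotriple product sets.
   Context: Operads and algebras are differential graded, in unbounded cochain complexes. $\mathcal P(V)=\bigoplus_{n\ge0}(\mathcal P(n)\otimes V^{\otimes n})_{\mathbb S_n}$ is the free $\mathcal P$-algebra on $V$. $\mathcal P$ reflects homotopy equivalences if $\mathcal P(-)$ sends quasi-isomorphisms of cochain complexes to quasi-isomorphisms of $\mathcal P$-algebras. A Sullivan model of a $\mathcal P$-algebra $A$ is a quasi-free algebra $(\mathcal P(\bigoplus_{i=0}^\infty V_i),d)$ with a quasi-isomorphism to $A$ such that: (1) its restriction $V_0\to A$ is a weak equivalence of dg-vector spaces; (2) $d(V_k)\subseteq\mathcal P(\bigoplus_{i=0}^{k-1}V_i)$ for each $k$, in particular $V_0=H^*(A)$; (3) for each $k$ the map $V_k\oplus\mathcal P(\bigoplus_{i=0}^{k-1}V_i)\to A$ is a weak equivalence. An $N$-step Sullivan model is the restriction $(\mathcal P(\bigoplus_{i=0}^{N}V_i),d)\to A$ of such a model to its first stages. $I(\bigoplus_{i=1}^NV_i)$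 is the ideal of $(\mathcal P(\bigoplus_{i=0}^NV_i),d)$ generated by $\bigoplus_{i=1}^NV_i$. Fix an $N$-step Sullivan model $m$ of $A$. For a cocycle $\sigma\in I(\bigoplus_{i=1}^NV_i)$, a defining system for $\sigma$ is a dg $\mathcal P$-algebra map $g_N:(\mathcal P(\bigoplus_{i=0}^NV_i),d)\to A$ with $H^*(g_N)|_{V_0}=H^*(m)|_{V_0}$. The $\sigma$-cotriple product set of $A$ is the set of all $H^*(g_N)(\sigma)=[g_N(\sigma)]\in H^*(A)$, with $g_N$ ranging over all defining systems. Given $f:A\to B$, the corresponding $\sigma$-cotriple product set of $B$ is the set of all $[h_N(\sigma)]\in H^*(B)$, with $h_N:(\mathcal P(\bigoplus_{i=0}^NV_i),d)\to B$ ranging over dg $\mathcal P$-algebra maps with $H^*(h_N)|_{V_0}=H^*(f)\circ H^*(m)|_{V_0}$. *)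

theory Defs
  imports "HOL-Algebra.Module" "HOL-Algebra.AbelCoset" "HOL-Combinatorics.Permutations"
begin

section \<open>Cochain complexes\<close>

text \<open>
  The grading is internal: the carrier is the total space, the direct sum of the subspaces
  \<open>grade X i\<close>. The fields \<open>mult\<close> and \<open>one\<close> inherited from the library's module record are
  never used.
\<close>

record ('k, 'v) dgvs = "('k, 'v) module" +
  grade :: "int \<Rightarrow> 'v set"
  diff :: "'v \<Rightarrow> 'v"

definition linear_map ::
  "('k, 'c) ring_scheme \<Rightarrow> ('k, 'x, 'd) module_scheme \<Rightarrow> ('k, 'y, 'e) module_scheme \<Rightarrow> ('x \<Rightarrow> 'y) \<Rightarrow> bool"
  where "linear_map R M N f \<longleftrightarrow>
    (\<forall>x\<in>carrier M. f x \<in> carrier N) \<and>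
    (\<forall>x\<in>carrier M. \<forall>y\<in>carrier M. f (x \<oplus>\<^bsub>M\<^esub> y) = f x \<oplus>\<^bsub>N\<^esub> f y) \<and>
    (\<forall>r\<in>carrier R. \<forall>x\<in>carrier M. f (r \<odot>\<^bsub>M\<^esub> x) = r \<odot>\<^bsub>N\<^esub> f x)"

definition decomposes :: "('k, 'v, 'd) module_scheme \<Rightarrow> ('i \<Rightarrow> 'v set) \<Rightarrow> 'v \<Rightarrow> ('i \<Rightarrow> 'v) \<Rightarrow> bool"
  where "decomposes M X x c \<longleftrightarrow>
    (\<forall>i. c i \<in> X i) \<and> finite {i. c i \<noteq> \<zero>\<^bsub>M\<^esub>} \<and> x = (\<Oplus>\<^bsub>M\<^esub>i\<in>{i. c i \<noteq> \<zero>\<^bsub>M\<^esub>}. c i)"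

definition internal_direct_sum ::
  "('k, 'c) ring_scheme \<Rightarrow> ('k, 'v, 'd) module_scheme \<Rightarrow> ('i \<Rightarrow> 'v set) \<Rightarrow> bool"
  where "internal_direct_sum R M X \<longleftrightarrow>
    (\<forall>i. submodule (X i) R M) \<and> (\<forall>x\<in>carrier M. \<exists>!c. decomposes M X x c)"

definition sum_space :: "('k, 'v, 'd) module_scheme \<Rightarrow> ('i \<Rightarrow> 'v set) \<Rightarrow> 'i set \<Rightarrow> 'v set"
  where "sum_space M X K =
    {(\<Oplus>\<^bsub>M\<^esub>i\<in>F. c i) | F c. finite F \<and> F \<subseteq> K \<and> (\<forall>i\<in>F. c i \<in> X i)}"

definition generated_submodule ::
  "('k, 'c) ring_scheme \<Rightarrow> ('k, 'v, 'd) module_scheme \<Rightarrow> 'v set \<Rightarrow> 'v set"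
  where "generated_submodule R M S = \<Inter>{N. submodule N R M \<and> S \<subseteq> N}"

locale graded_space = field R + module R X
  for R :: "('k, 'c) ring_scheme" and X :: "('k, 'v, 'd) dgvs_scheme" +
  assumes grading: "internal_direct_sum R X (grade X)"

locale cochain_complex = graded_space R X
  for R :: "('k, 'c) ring_scheme" and X :: "('k, 'v, 'd) dgvs_scheme" +
  assumes diff_linear: "linear_map R X X (diff X)"
    and diff_grade: "x \<in> grade X i \<Longrightarrow> diff X x \<in> grade X (i + 1)"
    and diff_diff: "x \<in> carrier X \<Longrightarrow> diff X (diff X x) = \<zero>\<^bsub>X\<^esub>"

definition hpart :: "('k, 'v, 'd) dgvs_scheme \<Rightarrow> 'v \<Rightarrow> int \<Rightarrow> 'v"
  where "hpart X x = (THE c. decomposes X (grade X) x c)"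

text \<open>The degree of a homogeneous element; for zero the value is an arbitrary integer.\<close>

definition deg :: "('k, 'v, 'd) dgvs_scheme \<Rightarrow> 'v \<Rightarrow> int"
  where "deg X x = (SOME i. x \<in> grade X i)"

definition graded_subset :: "('k, 'v, 'd) dgvs_scheme \<Rightarrow> 'v set \<Rightarrow> bool"
  where "graded_subset X W \<longleftrightarrow> (\<forall>x\<in>W. \<forall>i. hpart X x i \<in> W)"

definition restrict_to :: "('k, 'v, 'd) dgvs_scheme \<Rightarrow> 'v set \<Rightarrow> ('k, 'v, 'd) dgvs_scheme"
  where "restrict_to X W = X\<lparr>carrier := W, grade := (\<lambda>i. grade X i \<inter> W)\<rparr>"

definition chain_map ::
  "('k, 'c) ring_scheme \<Rightarrow> ('k, 'x, 'd) dgvs_scheme \<Rightarrow> ('k, 'y, 'e) dgvs_scheme \<Rightarrow> ('x \<Rightarrow> 'y) \<Rightarrow> bool"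
  where "chain_map R X Y f \<longleftrightarrow>
    cochain_complex R X \<and> cochain_complex R Y \<and> linear_map R X Y f \<and>
    (\<forall>i. \<forall>x\<in>grade X i. f x \<in> grade Y i) \<and>
    (\<forall>x\<in>carrier X. f (diff X x) = diff Y (f x))"

definition cocycles :: "('k, 'v, 'd) dgvs_scheme \<Rightarrow> 'v set"
  where "cocycles X = {x \<in> carrier X. diff X x = \<zero>\<^bsub>X\<^esub>}"

definition coh_class :: "('k, 'v, 'd) dgvs_scheme \<Rightarrow> 'v \<Rightarrow> 'v set"
  where "coh_class X z = (diff X ` carrier X) +>\<^bsub>X\<^esub> z"

definition cohomology :: "('k, 'v, 'd) dgvs_scheme \<Rightarrow> 'v set set"
  where "cohomology X = coh_class X ` cocycles X"

text \<open>\<open>coh_map Y f\<close> is \<open>H\<^sup>*(f)\<close>: for a chain map \<open>f\<close> to \<open>Y\<close> the union is over equal cosets.\<close>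

definition coh_map :: "('k, 'y, 'd) dgvs_scheme \<Rightarrow> ('x \<Rightarrow> 'y) \<Rightarrow> 'x set \<Rightarrow> 'y set"
  where "coh_map Y f C = (\<Union>z\<in>C. coh_class Y (f z))"

definition quasi_iso ::
  "('k, 'c) ring_scheme \<Rightarrow> ('k, 'x, 'd) dgvs_scheme \<Rightarrow> ('k, 'y, 'e) dgvs_scheme \<Rightarrow> ('x \<Rightarrow> 'y) \<Rightarrow> bool"
  where "quasi_iso R X Y f \<longleftrightarrow>
    chain_map R X Y f \<and> bij_betw (coh_map Y f) (cohomology X) (cohomology Y)"

section \<open>Koszul signs and multilinear maps\<close>

definition ksign :: "('k, 'v, 'd) module_scheme \<Rightarrow> int \<Rightarrow> 'v \<Rightarrow> 'v"
  where "ksign M e x = (if even e then x else \<ominus>\<^bsub>M\<^esub> x)"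

text \<open>
  The library's \<open>permute_list \<sigma> xs\<close> is \<open>[xs ! \<sigma> 0, xs ! \<sigma> 1, \<dots>]\<close>, a right action. The exponent
  \<open>perm_exp \<sigma> ds\<close> is that of the sign of passing from a list of elements of degrees \<open>ds\<close> to the
  permuted list.
\<close>

definition perm_exp :: "(nat \<Rightarrow> nat) \<Rightarrow> int list \<Rightarrow> int"
  where "perm_exp \<sigma> ds = int (card {(i, j). i < j \<and> j < length ds \<and> \<sigma> j < \<sigma> i \<and>
    odd (ds ! \<sigma> i) \<and> odd (ds ! \<sigma> j)})"

text \<open>
  The exponent of the sign of \<open>q\<^sub>1 \<dots> q\<^sub>n w\<^sub>1 \<dots> w\<^sub>n \<leadsto> q\<^sub>1 w\<^sub>1 \<dots> q\<^sub>n w\<^sub>n\<close>, where the \<open>q\<^sub>i\<close> and \<open>w\<^sub>i\<close> have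
  degrees \<open>ds\<close> and \<open>es\<close>.
\<close>

definition shuffle_exp :: "int list \<Rightarrow> int list \<Rightarrow> int"
  where "shuffle_exp ds es = (\<Sum>j<length ds. \<Sum>i<j. ds ! j * es ! i)"

definition elements :: "('k, 'v, 'd) dgvs_scheme list \<Rightarrow> 'v list \<Rightarrow> bool"
  where "elements Xs xs \<longleftrightarrow> list_all2 (\<lambda>X x. x \<in> carrier X) Xs xs"

definition homogeneous :: "('k, 'v, 'd) dgvs_scheme list \<Rightarrow> 'v list \<Rightarrow> int list \<Rightarrow> bool"
  where "homogeneous Xs xs ds \<longleftrightarrow> length xs = length Xs \<and> length ds = length Xs \<and>
    (\<forall>i<length Xs. xs ! i \<in> grade (Xs ! i) (ds ! i))"

text \<open>
  The value on \<open>x \<otimes> y\<^sub>1 \<otimes> \<dots> \<otimes> y\<^sub>n\<close>, with factors of degrees \<open>e\<close> and \<open>ds\<close>, of \<open>\<phi>\<close> after the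
  differential of \<open>X \<otimes> Y\<^sub>1 \<otimes> \<dots> \<otimes> Y\<^sub>n\<close>.
\<close>

definition leibniz ::
  "('k, 'x, 'd) dgvs_scheme \<Rightarrow> ('k, 'y, 'e) dgvs_scheme list \<Rightarrow> ('k, 'z, 'f) module_scheme \<Rightarrow>
   ('x \<Rightarrow> 'y list \<Rightarrow> 'z) \<Rightarrow> int \<Rightarrow> int list \<Rightarrow> 'x \<Rightarrow> 'y list \<Rightarrow> 'z"
  where "leibniz X Ys Z \<phi> e ds x ys =
    \<phi> (diff X x) ys \<oplus>\<^bsub>Z\<^esub>
    (\<Oplus>\<^bsub>Z\<^esub>i\<in>{..<length Ys}.
      ksign Z (e + sum_list (take i ds)) (\<phi> x (ys[i := diff (Ys ! i) (ys ! i)])))"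

text \<open>The following says that \<open>\<phi>\<close> is a chain map \<open>X \<otimes> Y\<^sub>1 \<otimes> \<dots> \<otimes> Y\<^sub>n \<rightarrow> Z\<close>.\<close>

definition dg_multilinear ::
  "('k, 'c) ring_scheme \<Rightarrow> ('k, 'x, 'd) dgvs_scheme \<Rightarrow> ('k, 'y, 'e) dgvs_scheme list \<Rightarrow>
   ('k, 'z, 'f) dgvs_scheme \<Rightarrow> ('x \<Rightarrow> 'y list \<Rightarrow> 'z) \<Rightarrow> bool"
  where "dg_multilinear R X Ys Z \<phi> \<longleftrightarrow>
    (\<forall>ys. elements Ys ys \<longrightarrow> linear_map R X Z (\<lambda>x. \<phi> x ys)) \<and>
    (\<forall>x\<in>carrier X. \<forall>ys i. elements Ys ys \<and> i < length Ys \<longrightarrow>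
      linear_map R (Ys ! i) Z (\<lambda>y. \<phi> x (ys[i := y]))) \<and>
    (\<forall>e x ds ys. x \<in> grade X e \<and> homogeneous Ys ys ds \<longrightarrow>
      \<phi> x ys \<in> grade Z (e + sum_list ds) \<and>
      diff Z (\<phi> x ys) = leibniz X Ys Z \<phi> e ds x ys)"

section \<open>Operads and algebras\<close>

text \<open>
  Symmetric operads with \<open>P(0)\<close> allowed, given by the composition maps
  \<open>op_comp P [k\<^sub>1, \<dots>, k\<^sub>n] : P(n) \<otimes> P(k\<^sub>1) \<otimes> \<dots> \<otimes> P(k\<^sub>n) \<rightarrow> P(k\<^sub>1 + \<dots> + k\<^sub>n)\<close> and right actions \<open>op_sym\<close>
  of the groups of permutations of \<open>{0, \<dots>, n - 1}\<close>.
\<close>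

record ('k, 'p) operad =
  op_space :: "nat \<Rightarrow> ('k, 'p) dgvs"
  op_comp :: "nat list \<Rightarrow> 'p \<Rightarrow> 'p list \<Rightarrow> 'p"
  op_unit :: 'p
  op_sym :: "nat \<Rightarrow> 'p \<Rightarrow> (nat \<Rightarrow> nat) \<Rightarrow> 'p"

definition blocks :: "nat list \<Rightarrow> nat list list"
  where "blocks ks =
    map (\<lambda>i. [sum_list (take i ks)..<sum_list (take (Suc i) ks)]) [0..<length ks]"

text \<open>
  The permutations \<open>\<rho>\<close> with \<open>permute_list \<rho> (concat xss) = concat (permute_list \<sigma> xss)\<close> and with
  \<open>permute_list \<rho> (concat xss) = concat (map2 permute_list \<tau>s xss)\<close>, for lists of lists \<open>xss\<close> with
  block lengths \<open>ks\<close>.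
\<close>

definition block_perm :: "nat list \<Rightarrow> (nat \<Rightarrow> nat) \<Rightarrow> nat \<Rightarrow> nat"
  where "block_perm ks \<sigma> i =
    (if i < sum_list ks then concat (permute_list \<sigma> (blocks ks)) ! i else i)"

definition sum_perm :: "nat list \<Rightarrow> (nat \<Rightarrow> nat) list \<Rightarrow> nat \<Rightarrow> nat"
  where "sum_perm ks \<tau>s i =
    (if i < sum_list ks then concat (map2 permute_list \<tau>s (blocks ks)) ! i else i)"

locale dg_operad = field R
  for R :: "('k, 'c) ring_scheme" and P :: "('k, 'p) operad" +
  assumes op_complex: "cochain_complex R (op_space P n)"
    and unit_cocycle: "op_unit P \<in> grade (op_space P 1) 0 \<inter> cocycles (op_space P 1)"
    and sym_chain_map: "\<sigma> permutes {..<n} \<Longrightarrow>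
      chain_map R (op_space P n) (op_space P n) (\<lambda>p. op_sym P n p \<sigma>)"
    and sym_id: "p \<in> carrier (op_space P n) \<Longrightarrow> op_sym P n p id = p"
    and sym_comp: "\<lbrakk>\<sigma> permutes {..<n}; \<tau> permutes {..<n}; p \<in> carrier (op_space P n)\<rbrakk> \<Longrightarrow>
      op_sym P n p (\<sigma> \<circ> \<tau>) = op_sym P n (op_sym P n p \<sigma>) \<tau>"
    and comp_multilinear: "dg_multilinear R (op_space P (length ks)) (map (op_space P) ks)
      (op_space P (sum_list ks)) (op_comp P ks)"
    and comp_unit_left: "q \<in> carrier (op_space P k) \<Longrightarrow> op_comp P [k] (op_unit P) [q] = q"
    and comp_unit_right: "p \<in> carrier (op_space P n) \<Longrightarrow>
      op_comp P (replicate n 1) p (replicate n (op_unit P)) = p"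
    and comp_assoc: "\<lbrakk>p \<in> carrier (op_space P (length ks));
      homogeneous (map (op_space P) ks) qs ds;
      length jss = length ks; length rss = length ks; length ess = length ks;
      \<And>i. i < length ks \<Longrightarrow>
        length (jss ! i) = ks ! i \<and> homogeneous (map (op_space P) (jss ! i)) (rss ! i) (ess ! i)\<rbrakk> \<Longrightarrow>
      op_comp P (concat jss) (op_comp P ks p qs) (concat rss) =
      ksign (op_space P (sum_list (concat jss))) (shuffle_exp ds (map sum_list ess))
        (op_comp P (map sum_list jss) p
          (map (\<lambda>i. op_comp P (jss ! i) (qs ! i) (rss ! i)) [0..<length ks]))"
    and comp_sym_outer: "\<lbrakk>p \<in> carrier (op_space P (length ks)); \<sigma> permutes {..<length ks};
      homogeneous (map (op_space P) ks) qs ds\<rbrakk> \<Longrightarrow>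
      op_comp P (permute_list \<sigma> ks) (op_sym P (length ks) p \<sigma>) (permute_list \<sigma> qs) =
      ksign (op_space P (sum_list ks)) (perm_exp \<sigma> ds)
        (op_sym P (sum_list ks) (op_comp P ks p qs) (block_perm ks \<sigma>))"
    and comp_sym_inner: "\<lbrakk>p \<in> carrier (op_space P (length ks)); elements (map (op_space P) ks) qs;
      length \<tau>s = length ks; \<And>i. i < length ks \<Longrightarrow> (\<tau>s ! i) permutes {..<ks ! i}\<rbrakk> \<Longrightarrow>
      op_comp P ks p (map (\<lambda>i. op_sym P (ks ! i) (qs ! i) (\<tau>s ! i)) [0..<length ks]) =
      op_sym P (sum_list ks) (op_comp P ks p qs) (sum_perm ks \<tau>s)"

record ('k, 'p, 'a) dg_algebra = "('k, 'a) dgvs" +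
  act :: "'p \<Rightarrow> 'a list \<Rightarrow> 'a"

locale p_algebra = dg_operad R P + cochain_complex R A
  for R :: "('k, 'c) ring_scheme" and P :: "('k, 'p) operad" and A :: "('k, 'p, 'a) dg_algebra" +
  assumes act_multilinear: "dg_multilinear R (op_space P n) (replicate n A) A (act A)"
    and act_unit: "a \<in> carrier A \<Longrightarrow> act A (op_unit P) [a] = a"
    and act_assoc: "\<lbrakk>p \<in> carrier (op_space P (length ks));
      homogeneous (map (op_space P) ks) qs ds;
      length ass = length ks; length ess = length ks;
      \<And>i. i < length ks \<Longrightarrow> homogeneous (replicate (ks ! i) A) (ass ! i) (ess ! i)\<rbrakk> \<Longrightarrow>
      act A (op_comp P ks p qs) (concat ass) =
      ksign A (shuffle_exp ds (map sum_list ess))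
        (act A p (map (\<lambda>i. act A (qs ! i) (ass ! i)) [0..<length ks]))"
    and act_sym: "\<lbrakk>p \<in> carrier (op_space P n); \<sigma> permutes {..<n}; homogeneous (replicate n A) as ds\<rbrakk> \<Longrightarrow>
      act A (op_sym P n p \<sigma>) (permute_list \<sigma> as) = ksign A (perm_exp \<sigma> ds) (act A p as)"

definition p_morphism ::
  "('k, 'c) ring_scheme \<Rightarrow> ('k, 'p) operad \<Rightarrow> ('k, 'p, 'a) dg_algebra \<Rightarrow> ('k, 'p, 'b) dg_algebra \<Rightarrow>
   ('a \<Rightarrow> 'b) \<Rightarrow> bool"
  where "p_morphism R P A B f \<longleftrightarrow> p_algebra R P A \<and> p_algebra R P B \<and> chain_map R A B f \<and>
    (\<forall>n. \<forall>p\<in>carrier (op_space P n). \<forall>as. elements (replicate n A) as \<longrightarrow>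
      f (act A p as) = act B p (map f as))"

definition p_quasi_iso ::
  "('k, 'c) ring_scheme \<Rightarrow> ('k, 'p) operad \<Rightarrow> ('k, 'p, 'a) dg_algebra \<Rightarrow> ('k, 'p, 'b) dg_algebra \<Rightarrow>
   ('a \<Rightarrow> 'b) \<Rightarrow> bool"
  where "p_quasi_iso R P A B f \<longleftrightarrow> p_morphism R P A B f \<and> quasi_iso R A B f"

text \<open>
  Ideals are dg ideals, i.e. subcomplexes stable under the operations. The dg ideal generated by a
  set contains the ideal generated by it in the underlying graded algebra.
\<close>

definition p_ideal ::
  "('k, 'c) ring_scheme \<Rightarrow> ('k, 'p) operad \<Rightarrow> ('k, 'p, 'a) dg_algebra \<Rightarrow> 'a set \<Rightarrow> bool"
  where "p_ideal R P A J \<longleftrightarrow> submodule J R A \<and> diff A ` J \<subseteq> J \<and>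
    (\<forall>n. \<forall>p\<in>carrier (op_space P n). \<forall>as. elements (replicate n A) as \<and> set as \<inter> J \<noteq> {} \<longrightarrow>
      act A p as \<in> J)"

definition generated_ideal ::
  "('k, 'c) ring_scheme \<Rightarrow> ('k, 'p) operad \<Rightarrow> ('k, 'p, 'a) dg_algebra \<Rightarrow> 'a set \<Rightarrow> 'a set"
  where "generated_ideal R P A S = \<Inter>{J. p_ideal R P A J \<and> S \<subseteq> J}"

section \<open>Free algebras\<close>

text \<open>
  The free \<open>P\<close>-algebra on \<open>V\<close> is constructed as the vector space with basis the words
  \<open>(p, [v\<^sub>1, \<dots>, v\<^sub>n])\<close> of homogeneous elements \<open>p \<in> P(n)\<close>, \<open>v\<^sub>i \<in> V\<close>, modulo the relations that make the
  word multilinear and invariant under the symmetric groups, up to the Koszul sign. Its elements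
  are thus cosets of finitely supported functions.
\<close>

definition "words" :: "('k, 'p) operad \<Rightarrow> ('k, 'v, 'd) dgvs_scheme \<Rightarrow> ('p \<times> 'v list) set"
  where "words P V = {(p, vs). (\<exists>e. p \<in> grade (op_space P (length vs)) e) \<and>
    (\<exists>ds. homogeneous (replicate (length vs) V) vs ds)}"

definition formal ::
  "('k, 'c) ring_scheme \<Rightarrow> ('k, 'p) operad \<Rightarrow> ('k, 'v, 'd) dgvs_scheme \<Rightarrow>
   ('k, 'p \<times> 'v list \<Rightarrow> 'k) module"
  where "formal R P V =
    \<lparr>carrier = {c. range c \<subseteq> carrier R \<and> finite {w. c w \<noteq> \<zero>\<^bsub>R\<^esub>} \<and> {w. c w \<noteq> \<zero>\<^bsub>R\<^esub>} \<subseteq> words P V},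
     monoid.mult = undefined, one = undefined,
     zero = (\<lambda>w. \<zero>\<^bsub>R\<^esub>), add = (\<lambda>c c' w. c w \<oplus>\<^bsub>R\<^esub> c' w),
     smult = (\<lambda>r c w. r \<otimes>\<^bsub>R\<^esub> c w)\<rparr>"

definition single :: "('k, 'c) ring_scheme \<Rightarrow> 'w \<Rightarrow> 'w \<Rightarrow> 'k"
  where "single R w = (\<lambda>w'. if w' = w then \<one>\<^bsub>R\<^esub> else \<zero>\<^bsub>R\<^esub>)"

inductive_set relators ::
  "('k, 'c) ring_scheme \<Rightarrow> ('k, 'p) operad \<Rightarrow> ('k, 'v, 'd) dgvs_scheme \<Rightarrow> ('p \<times> 'v list \<Rightarrow> 'k) set"
  for R and P and V where
  op_add: "\<lbrakk>p \<in> grade (op_space P n) e; p' \<in> grade (op_space P n) e;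
      homogeneous (replicate n V) vs ds\<rbrakk> \<Longrightarrow>
    single R (p \<oplus>\<^bsub>op_space P n\<^esub> p', vs) \<ominus>\<^bsub>formal R P V\<^esub>
      (single R (p, vs) \<oplus>\<^bsub>formal R P V\<^esub> single R (p', vs)) \<in> relators R P V"
| op_smult: "\<lbrakk>r \<in> carrier R; p \<in> grade (op_space P n) e; homogeneous (replicate n V) vs ds\<rbrakk> \<Longrightarrow>
    single R (r \<odot>\<^bsub>op_space P n\<^esub> p, vs) \<ominus>\<^bsub>formal R P V\<^esub>
      r \<odot>\<^bsub>formal R P V\<^esub> single R (p, vs) \<in> relators R P V"
| arg_add: "\<lbrakk>p \<in> grade (op_space P n) e; homogeneous (replicate n V) vs ds; i < n;
      v \<in> grade V (ds ! i)\<rbrakk> \<Longrightarrow>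
    single R (p, vs[i := vs ! i \<oplus>\<^bsub>V\<^esub> v]) \<ominus>\<^bsub>formal R P V\<^esub>
      (single R (p, vs) \<oplus>\<^bsub>formal R P V\<^esub> single R (p, vs[i := v])) \<in> relators R P V"
| arg_smult: "\<lbrakk>r \<in> carrier R; p \<in> grade (op_space P n) e; homogeneous (replicate n V) vs ds; i < n\<rbrakk> \<Longrightarrow>
    single R (p, vs[i := r \<odot>\<^bsub>V\<^esub> vs ! i]) \<ominus>\<^bsub>formal R P V\<^esub>
      r \<odot>\<^bsub>formal R P V\<^esub> single R (p, vs) \<in> relators R P V"
| coinvariance: "\<lbrakk>p \<in> grade (op_space P n) e; homogeneous (replicate n V) vs ds;
      \<sigma> permutes {..<n}\<rbrakk> \<Longrightarrow>
    single R (op_sym P n p \<sigma>, permute_list \<sigma> vs) \<ominus>\<^bsub>formal R P V\<^esub>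
      ksign (formal R P V) (perm_exp \<sigma> ds) (single R (p, vs)) \<in> relators R P V"

definition quotient_module :: "('k, 'v, 'd) module_scheme \<Rightarrow> 'v set \<Rightarrow> ('k, 'v set) module"
  where "quotient_module M N =
    \<lparr>carrier = a_rcosets\<^bsub>M\<^esub> N, monoid.mult = undefined, one = undefined, zero = N, add = set_add M,
     smult = (\<lambda>r C. \<Union>c\<in>C. N +>\<^bsub>M\<^esub> (r \<odot>\<^bsub>M\<^esub> c))\<rparr>"

abbreviation relations ::
  "('k, 'c) ring_scheme \<Rightarrow> ('k, 'p) operad \<Rightarrow> ('k, 'v, 'd) dgvs_scheme \<Rightarrow> ('p \<times> 'v list \<Rightarrow> 'k) set"
  where "relations R P V \<equiv> generated_submodule R (formal R P V) (relators R P V)"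

definition free_module ::
  "('k, 'c) ring_scheme \<Rightarrow> ('k, 'p) operad \<Rightarrow> ('k, 'v, 'd) dgvs_scheme \<Rightarrow>
   ('k, ('p \<times> 'v list \<Rightarrow> 'k) set) module"
  where "free_module R P V = quotient_module (formal R P V) (relations R P V)"

text \<open>\<open>tens R P V p [v\<^sub>1, \<dots>, v\<^sub>n]\<close> is the class of \<open>p \<otimes> v\<^sub>1 \<otimes> \<dots> \<otimes> v\<^sub>n\<close> for homogeneous arguments.\<close>

definition tens ::
  "('k, 'c) ring_scheme \<Rightarrow> ('k, 'p) operad \<Rightarrow> ('k, 'v, 'd) dgvs_scheme \<Rightarrow> 'p \<Rightarrow> 'v list \<Rightarrow>
   ('p \<times> 'v list \<Rightarrow> 'k) set"
  where "tens R P V p vs = relations R P V +>\<^bsub>formal R P V\<^esub> single R (p, vs)"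

definition representative :: "('w \<Rightarrow> 'k) set \<Rightarrow> 'w \<Rightarrow> 'k"
  where "representative C = (SOME c. c \<in> C)"

definition support :: "('k, 'c) ring_scheme \<Rightarrow> ('w \<Rightarrow> 'k) \<Rightarrow> 'w set"
  where "support R c = {w. c w \<noteq> \<zero>\<^bsub>R\<^esub>}"

text \<open>
  The linear map out of the free algebra with the given values on words. It is only used for values
  that respect the relations, so that the choice of the representative does not matter.
\<close>

definition extend ::
  "('k, 'c) ring_scheme \<Rightarrow> ('k, 'z, 'f) module_scheme \<Rightarrow> ('p \<Rightarrow> 'v list \<Rightarrow> 'z) \<Rightarrow>
   ('p \<times> 'v list \<Rightarrow> 'k) set \<Rightarrow> 'z"
  where "extend R Z \<phi> C =
    (\<Oplus>\<^bsub>Z\<^esub>w\<in>support R (representative C). representative C w \<odot>\<^bsub>Z\<^esub> \<phi> (fst w) (snd w))"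

definition free_grade ::
  "('k, 'c) ring_scheme \<Rightarrow> ('k, 'p) operad \<Rightarrow> ('k, 'v, 'd) dgvs_scheme \<Rightarrow> int \<Rightarrow>
   ('p \<times> 'v list \<Rightarrow> 'k) set set"
  where "free_grade R P V i = generated_submodule R (free_module R P V)
    {tens R P V p vs | p vs e ds. p \<in> grade (op_space P (length vs)) e \<and>
      homogeneous (replicate (length vs) V) vs ds \<and> e + sum_list ds = i}"

definition free_diff ::
  "('k, 'c) ring_scheme \<Rightarrow> ('k, 'p) operad \<Rightarrow> ('k, 'v, 'd) dgvs_scheme \<Rightarrow>
   ('p \<times> 'v list \<Rightarrow> 'k) set \<Rightarrow> ('p \<times> 'v list \<Rightarrow> 'k) set"
  where "free_diff R P V = extend R (free_module R P V) (\<lambda>p vs.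
    leibniz (op_space P (length vs)) (replicate (length vs) V) (free_module R P V) (tens R P V)
      (deg (op_space P (length vs)) p) (map (deg V) vs) p vs)"

text \<open>
  On words: \<open>p\<close> applied to \<open>q\<^sub>1 \<otimes> w\<^sub>1, \<dots>, q\<^sub>n \<otimes> w\<^sub>n\<close> is \<open>\<plusminus> \<gamma>(p; q\<^sub>1, \<dots>, q\<^sub>n) \<otimes> w\<^sub>1 \<otimes> \<dots> \<otimes> w\<^sub>n\<close>. The general case is
  the multilinear extension; \<open>p\<close> has to be split since words have homogeneous entries.
\<close>

definition free_act ::
  "('k, 'c) ring_scheme \<Rightarrow> ('k, 'p) operad \<Rightarrow> ('k, 'v, 'd) dgvs_scheme \<Rightarrow>
   'p \<Rightarrow> ('p \<times> 'v list \<Rightarrow> 'k) set list \<Rightarrow> ('p \<times> 'v list \<Rightarrow> 'k) set"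
  where "free_act R P V p Cs =
    (let M = free_module R P V; n = length Cs; X = op_space P n; cs = map representative Cs in
     \<Oplus>\<^bsub>M\<^esub>e\<in>{e. hpart X p e \<noteq> \<zero>\<^bsub>X\<^esub>}.
     \<Oplus>\<^bsub>M\<^esub>ws\<in>listset (map (support R) cs).
       (\<Otimes>\<^bsub>R\<^esub>i\<in>{..<n}. (cs ! i) (ws ! i)) \<odot>\<^bsub>M\<^esub>
       ksign M
         (shuffle_exp (map (\<lambda>(q, vs). deg (op_space P (length vs)) q) ws)
           (map (\<lambda>(q, vs). sum_list (map (deg V) vs)) ws))
         (tens R P V (op_comp P (map (length \<circ> snd) ws) (hpart X p e) (map fst ws))
           (concat (map snd ws))))"

definition free_algebra ::
  "('k, 'c) ring_scheme \<Rightarrow> ('k, 'p) operad \<Rightarrow> ('k, 'v, 'd) dgvs_scheme \<Rightarrow>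
   ('k, 'p, ('p \<times> 'v list \<Rightarrow> 'k) set) dg_algebra"
  where "free_algebra R P V =
    \<lparr>carrier = carrier (free_module R P V), monoid.mult = undefined, one = undefined,
     zero = zero (free_module R P V), add = add (free_module R P V),
     smult = smult (free_module R P V),
     grade = free_grade R P V, diff = free_diff R P V, act = free_act R P V\<rparr>"

definition free_map ::
  "('k, 'c) ring_scheme \<Rightarrow> ('k, 'p) operad \<Rightarrow> ('k, 'w, 'd) dgvs_scheme \<Rightarrow> ('v \<Rightarrow> 'w) \<Rightarrow>
   ('p \<times> 'v list \<Rightarrow> 'k) set \<Rightarrow> ('p \<times> 'w list \<Rightarrow> 'k) set"
  where "free_map R P W f = extend R (free_module R P W) (\<lambda>p vs. tens R P W p (map f vs))"

text \<open>
  A formula cannot quantify over all types, so the complexes tested are those whose carriers are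
  subsets of a universe \<open>'u\<close>. As a hypothesis this is weaker than the condition on all complexes.
  The universe \<open>'v list\<close> has room for all finite direct sums of complexes with carriers in \<open>'v\<close>.
\<close>

definition reflects_homotopy_equivalences ::
  "'u itself \<Rightarrow> ('k, 'c) ring_scheme \<Rightarrow> ('k, 'p) operad \<Rightarrow> bool"
  where "reflects_homotopy_equivalences U R P \<longleftrightarrow>
    (\<forall>(X :: ('k, 'u) dgvs) (Y :: ('k, 'u) dgvs) f. quasi_iso R X Y f \<longrightarrow>
      p_quasi_iso R P (free_algebra R P X) (free_algebra R P Y) (free_map R P Y f))"

section \<open>Sullivan models\<close>

text \<open>The quasi-free algebra \<open>(P(V), d)\<close>; the field \<open>diff V\<close> plays no role in it.\<close>

definition quasi_free ::
  "('k, 'c) ring_scheme \<Rightarrow> ('k, 'p) operad \<Rightarrow> ('k, 'v) dgvs \<Rightarrow>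
   (('p \<times> 'v list \<Rightarrow> 'k) set \<Rightarrow> ('p \<times> 'v list \<Rightarrow> 'k) set) \<Rightarrow>
   ('k, 'p, ('p \<times> 'v list \<Rightarrow> 'k) set) dg_algebra"
  where "quasi_free R P V d = (free_algebra R P V)\<lparr>diff := d\<rparr>"

definition generator ::
  "('k, 'c) ring_scheme \<Rightarrow> ('k, 'p) operad \<Rightarrow> ('k, 'v) dgvs \<Rightarrow> 'v \<Rightarrow> ('p \<times> 'v list \<Rightarrow> 'k) set"
  where "generator R P V v =
    (\<Oplus>\<^bsub>free_module R P V\<^esub>i\<in>{i. hpart V v i \<noteq> \<zero>\<^bsub>V\<^esub>}. tens R P V (op_unit P) [hpart V v i])"

text \<open>\<open>P(W)\<close> as a subset of \<open>P(V)\<close>, for a graded subspace \<open>W\<close> of \<open>V\<close>.\<close>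

definition free_on ::
  "('k, 'c) ring_scheme \<Rightarrow> ('k, 'p) operad \<Rightarrow> ('k, 'v) dgvs \<Rightarrow> 'v set \<Rightarrow> ('p \<times> 'v list \<Rightarrow> 'k) set set"
  where "free_on R P V W =
    free_map R P V (\<lambda>v. v) ` carrier (free_algebra R P (restrict_to V W))"

text \<open>
  In condition (3) the stage \<open>k = 0\<close> is left out: there (1) takes its place, and the two are
  compatible only if \<open>P(0)\<close> is acyclic. In (2) the stage \<open>k = 0\<close> says that \<open>d\<close> maps \<open>V 0\<close> to the
  image of \<open>P(0)\<close>; together with (1), by which \<open>V 0\<close> is a subcomplex, it gives \<open>d = 0\<close> on \<open>V 0\<close>.
\<close>

definition sullivan_model ::
  "('k, 'c) ring_scheme \<Rightarrow> ('k, 'p) operad \<Rightarrow> ('k, 'p, 'a) dg_algebra \<Rightarrow>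
   ('k, 'v) dgvs \<Rightarrow> (nat \<Rightarrow> 'v set) \<Rightarrow>
   (('p \<times> 'v list \<Rightarrow> 'k) set \<Rightarrow> ('p \<times> 'v list \<Rightarrow> 'k) set) \<Rightarrow>
   (('p \<times> 'v list \<Rightarrow> 'k) set \<Rightarrow> 'a) \<Rightarrow> bool"
  where "sullivan_model R P A V Vs d m \<longleftrightarrow>
    (let Q = quasi_free R P V d;
         gens = (\<lambda>k. generator R P V ` Vs k);
         below = (\<lambda>k. free_on R P V (sum_space V Vs {..<k})) in
     graded_space R V \<and> internal_direct_sum R V Vs \<and> (\<forall>k. graded_subset V (Vs k)) \<and>
     p_quasi_iso R P Q A m \<and>
     quasi_iso R (restrict_to Q (gens 0)) A m \<and>
     (\<forall>k. d ` gens k \<subseteq> below k) \<and>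
     (\<forall>k\<ge>1. quasi_iso R (restrict_to Q (gens k <+>\<^bsub>Q\<^esub> below k)) A m))"

text \<open>
  The domain of the \<open>N\<close>-step model that is the restriction of \<open>m\<close> in
  \<open>sullivan_model R P A V Vs d m\<close>.
\<close>

definition sullivan_stage ::
  "('k, 'c) ring_scheme \<Rightarrow> ('k, 'p) operad \<Rightarrow> ('k, 'v) dgvs \<Rightarrow> (nat \<Rightarrow> 'v set) \<Rightarrow>
   (('p \<times> 'v list \<Rightarrow> 'k) set \<Rightarrow> ('p \<times> 'v list \<Rightarrow> 'k) set) \<Rightarrow> nat \<Rightarrow>
   ('k, 'p, ('p \<times> 'v list \<Rightarrow> 'k) set) dg_algebra"
  where "sullivan_stage R P V Vs d N =
    restrict_to (quasi_free R P V d) (free_on R P V (sum_space V Vs {..N}))"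

definition higher_ideal ::
  "('k, 'c) ring_scheme \<Rightarrow> ('k, 'p) operad \<Rightarrow> ('k, 'v) dgvs \<Rightarrow> (nat \<Rightarrow> 'v set) \<Rightarrow>
   (('p \<times> 'v list \<Rightarrow> 'k) set \<Rightarrow> ('p \<times> 'v list \<Rightarrow> 'k) set) \<Rightarrow> nat \<Rightarrow> ('p \<times> 'v list \<Rightarrow> 'k) set set"
  where "higher_ideal R P V Vs d N = generated_ideal R P (sullivan_stage R P V Vs d N)
    (generator R P V ` sum_space V Vs {1..N})"

section \<open>Cotriple product sets\<close>

text \<open>
  Here \<open>\<phi>\<close> is the map prescribed on \<open>H\<^sup>*\<close> for the generators in \<open>V 0\<close>: \<open>H\<^sup>*(m)\<close> for the product
  set of \<open>A\<close> itself, \<open>H\<^sup>*(f) \<circ> H\<^sup>*(m)\<close> for the corresponding product set along \<open>f : A \<rightarrow> B\<close>.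
\<close>

definition defining_system ::
  "('k, 'c) ring_scheme \<Rightarrow> ('k, 'p) operad \<Rightarrow> ('k, 'v) dgvs \<Rightarrow> (nat \<Rightarrow> 'v set) \<Rightarrow>
   (('p \<times> 'v list \<Rightarrow> 'k) set \<Rightarrow> ('p \<times> 'v list \<Rightarrow> 'k) set) \<Rightarrow> nat \<Rightarrow>
   ('k, 'p, 'b) dg_algebra \<Rightarrow> (('p \<times> 'v list \<Rightarrow> 'k) set set \<Rightarrow> 'b set) \<Rightarrow>
   (('p \<times> 'v list \<Rightarrow> 'k) set \<Rightarrow> 'b) \<Rightarrow> bool"
  where "defining_system R P V Vs d N B \<phi> h \<longleftrightarrow>
    (let S = sullivan_stage R P V Vs d N in
     p_morphism R P S B h \<and>
     (\<forall>v\<in>Vs 0. coh_map B h (coh_class S (generator R P V v)) =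
        \<phi> (coh_class S (generator R P V v))))"

definition cotriple_product_set ::
  "('k, 'c) ring_scheme \<Rightarrow> ('k, 'p) operad \<Rightarrow> ('k, 'v) dgvs \<Rightarrow> (nat \<Rightarrow> 'v set) \<Rightarrow>
   (('p \<times> 'v list \<Rightarrow> 'k) set \<Rightarrow> ('p \<times> 'v list \<Rightarrow> 'k) set) \<Rightarrow> nat \<Rightarrow>
   ('k, 'p, 'b) dg_algebra \<Rightarrow> (('p \<times> 'v list \<Rightarrow> 'k) set set \<Rightarrow> 'b set) \<Rightarrow>
   ('p \<times> 'v list \<Rightarrow> 'k) set \<Rightarrow> 'b set set"
  where "cotriple_product_set R P V Vs d N B \<phi> \<sigma> =
    {coh_map B h (coh_class (sullivan_stage R P V Vs d N) \<sigma>) | h.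
      defining_system R P V Vs d N B \<phi> h}"

end

theory Submission
 imports "HOL-Library.Multiset_Order" Defs
begin

text \<open>
 Composing a defining system of \<open>A\<close> with \<open>f\<close> gives one for \<open>B\<close>, which is the inclusion. If \<open>f\<close> is a
 quasi-isomorphism, then \<open>H\<^sup>*(f)\<close> is injective, and the point is to find, for a defining system \<open>h\<close> for
 \<open>B\<close>, one of \<open>A\<close> whose value at \<open>\<sigma>\<close> is sent to \<open>[h(\<sigma>)]\<close>. Now \<open>q = f \<circ> m\<close> is a quasi-isomorphism from the
 model \<open>Q = (P(V), d)\<close> to \<open>B\<close>. It suffices to lift \<open>h\<close> along \<open>q\<close> up to homotopy, that is, to find a dg map \<open>g\<close>
 from the stage to \<open>Q\<close> such that \<open>h(z) - q(g(z))\<close> is a boundary for the elements \<open>z\<close> in question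
 (\<open>lift_up_to_boundaries\<close>); then \<open>m \<circ> g\<close> is the defining system sought: \<open>m(g(v)) - m(v)\<close>, for \<open>v\<close> in
 \<open>V\<^sub>0\<close>, is a cocycle that \<open>f\<close> maps to a boundary.

 The homotopy is placed in the source, rather than in a path object of \<open>B\<close>.
 Let \<open>F = P(V \<oplus> cone V)\<close>, with the differential \<open>twisted_diff\<close> that extends \<open>d\<close>. It contains \<open>Q\<close> and retracts
 onto it, and \<open>q\<close> extends to \<open>F\<close> by an arbitrary map of degree \<open>-1\<close> on the cone (\<open>perturb\<close>). Along these
 extensions \<open>h\<close> lifts strictly, one stage \<open>V\<^sub>k\<close> after the other (\<open>partial_lift_step\<close>): the obstruction is a
 cocycle in \<open>F\<close>, a boundary since \<open>F \<rightarrow> Q \<rightarrow> B\<close> is a quasi-isomorphism, and the cone on \<open>V\<^sub>k\<close>, not yet used,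
 absorbs the homotopy. The map \<open>g\<close> is the lift followed by the retraction.

 That the retraction is a quasi-isomorphism is where the hypothesis on \<open>P\<close> enters: applied to the map that
 kills the cone it gives the statement for the differential without \<open>d\<close>. The twist replaces a letter from
 \<open>V\<^sub>j\<close> by words with letters from \<open>V\<^sub>i\<close>, \<open>i < j\<close>. Hence it lowers the weight of a word, the multiset of the
 indices of its letters, and multisets of natural numbers are well-ordered (\<open>perturbed_acyclic\<close>).

 All this needs maps and derivations out of \<open>P(V)\<close> with given values on generators. Here \<open>P(V)\<close> is a
 quotient whose operations are computed on chosen representatives, so the first task is to evaluate them on
 words (\<open>free_act_words\<close>).
\<close>

text \<open>The index of an algebraic operation may also be written as a subscript.\<close>

syntax "_index" :: "logic => index" ("\<^sub>_" [1000])

text \<open>Short forms for elements of free algebras, carriers and degrees in operads, and homogeneous lists in one complex.\<close>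

type_synonym ('k, 'p, 'v) tensors = "('p \<times> 'v list => 'k) set"

abbreviation "opg P n \<equiv> grade (op_space P n)"
abbreviation "opc P n \<equiv> carrier (op_space P n)"
abbreviation "homs n X \<equiv> homogeneous (replicate n X)"

section \<open>Linear algebra over a field\<close>

lemma linear_mapI:
 assumes "!!x. x \<in> carrier M ==> f x \<in> carrier N"
  and "!!x y. [|x \<in> carrier M; y \<in> carrier M|] ==> f (x \<oplus>\<^sub>M y) = f x \<oplus>\<^sub>N f y"
  and "!!r x. [|r \<in> carrier R; x \<in> carrier M|] ==> f (r \<odot>\<^sub>M x) = r \<odot>\<^sub>N f x"
 shows "linear_map R M N f"
 using assms by (auto simp: linear_map_def)

lemma linear_mapD:
 assumes "linear_map R M N f"
 shows lin_closed: "x \<in> carrier M ==> f x \<in> carrier N"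
  and lin_add: "[|x \<in> carrier M; y \<in> carrier M|] ==> f (x \<oplus>\<^sub>M y) = f x \<oplus>\<^sub>N f y"
  and lin_smult: "[|r \<in> carrier R; x \<in> carrier M|] ==> f (r \<odot>\<^sub>M x) = r \<odot>\<^sub>N f x"
 using assms by (auto simp: linear_map_def)

lemma lin_zero:
 assumes "module R M" "module R N" "linear_map R M N f"
 shows "f \<zero>\<^sub>M = \<zero>\<^sub>N"
proof -
 interpret M: module R M by fact
 interpret N: module R N by fact
 have "f (\<zero>\<^sub>R \<odot>\<^sub>M \<zero>\<^sub>M) = \<zero>\<^sub>R \<odot>\<^sub>N f \<zero>\<^sub>M"
  using lin_smult[OF assms(3), of "\<zero>\<^sub>R" "\<zero>\<^sub>M"] by simp
 then show ?thesis using lin_closed[OF assms(3)] by simp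
qed

lemma (in module) smult_minus_one: "x \<in> carrier M ==> (\<ominus> \<one>) \<odot>\<^sub>M x = \<ominus>\<^sub>M x"
 by (simp add: smult_l_minus)

lemma lin_neg:
 assumes "module R M" "module R N" "linear_map R M N f" "x \<in> carrier M"
 shows "f (\<ominus>\<^sub>M x) = \<ominus>\<^sub>N f x"
proof -
 interpret M: module R M by fact
 interpret N: module R N by fact
 show ?thesis
  using lin_smult[OF assms(3), of "\<ominus>\<^sub>R \<one>\<^sub>R" x] assms(4) lin_closed[OF assms(3,4)]
  by (simp add: M.smult_minus_one N.smult_minus_one)
qed

lemma lin_diff:
 assumes "module R M" "module R N" "linear_map R M N f" "x \<in> carrier M" "y \<in> carrier M"
 shows "f (x \<ominus>\<^sub>M y) = f x \<ominus>\<^sub>N f y"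
proof -
 interpret M: module R M by fact
 interpret N: module R N by fact
 show ?thesis using assms
  by (simp add: a_minus_def lin_add[OF assms(3)] lin_neg[OF assms(1-3)])
qed

lemma lin_finsum:
 assumes "module R M" "module R N" "linear_map R M N f" "g \<in> I \<rightarrow> carrier M"
 shows "f (\<Oplus>\<^sub>M i\<in>I. g i) = (\<Oplus>\<^sub>N i\<in>I. f (g i))"
proof -
 interpret M: module R M by fact
 interpret N: module R N by fact
 show ?thesis using assms(4)
 proof (induction I rule: infinite_finite_induct)
  case (insert x I)
  then have "g x \<in> carrier M" "g \<in> I \<rightarrow> carrier M" by auto
  moreover have "(%i. f (g i)) \<in> I \<rightarrow> carrier N" "f (g x) \<in> carrier N"
   using insert.prems lin_closed[OF assms(3)] by (auto simp: Pi_iff)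
  ultimately show ?case using insert.hyps insert.IH
   by (simp add: lin_add[OF assms(3)])
 qed (simp_all add: lin_zero[OF assms(1-3)])
qed

lemma lin_ksign:
 assumes "module R M" "module R N" "linear_map R M N f" "x \<in> carrier M"
 shows "f (ksign M e x) = ksign N e (f x)"
 using lin_neg[OF assms] by (simp add: ksign_def)

lemma lin_comp:
 assumes "linear_map R M N f" "linear_map R N L g"
 shows "linear_map R M L (%x. g (f x))"
 using assms by (auto simp: linear_map_def)

lemma lin_ident: "linear_map R M M (%x. x)"
 by (auto simp: linear_map_def)

lemma lin_const_zero:
 assumes "module R N"
 shows "linear_map R M N (%x. \<zero>\<^sub>N)"
proof -
 interpret N: module R N by fact
 show ?thesis by (auto simp: linear_map_def)
qed

lemma lin_sum:
 assumes "module R N" "linear_map R M N f" "linear_map R M N g"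
 shows "linear_map R M N (%x. f x \<oplus>\<^sub>N g x)"
proof -
 interpret N: module R N by fact
 note fg = linear_mapD[OF assms(2)] linear_mapD[OF assms(3)]
 show ?thesis
  by (rule linear_mapI) (simp_all add: fg N.smult_r_distr N.add.m_ac)
qed

lemma linear_map_minus:
 assumes "module R N" "linear_map R M N f" "linear_map R M N g"
 shows "linear_map R M N (%x. f x \<ominus>\<^sub>N g x)"
proof -
 interpret N: module R N by fact
 note fg = linear_mapD[OF assms(2)] linear_mapD[OF assms(3)]
 show ?thesis
  by (rule linear_mapI)
   (simp_all add: fg a_minus_def N.smult_r_distr N.add.m_ac N.minus_add N.smult_r_minus)
qed

lemma linear_map_ksign_left:
 assumes "module R N" "linear_map R M N f"
 shows "linear_map R M N (%x. ksign N e (f x))"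
proof -
 interpret N: module R N by fact
 note fg = linear_mapD[OF assms(2)]
 show ?thesis
  by (rule linear_mapI) (simp_all add: ksign_def fg N.minus_add N.smult_r_minus)
qed

lemma linear_map_cong:
 assumes "module R M" "linear_map R M N f" "!!x. x \<in> carrier M ==> f x = g x"
 shows "linear_map R M N g"
proof -
 interpret M: module R M by fact
 show ?thesis using assms(2,3) by (simp add: linear_map_def)
qed

lemma linear_map_finsum_left:
 assumes "module R M" "module R N" "!!i. i \<in> I ==> linear_map R M N (f i)"
 shows "linear_map R M N (%x. \<Oplus>\<^sub>N i\<in>I. f i x)"
 using assms(3)
proof (induction I rule: infinite_finite_induct)
 case (insert j I)
 interpret N: module R N by fact
 have "linear_map R M N (%x. f j x \<oplus>\<^sub>N (\<Oplus>\<^sub>N i\<in>I. f i x))"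
  by (rule lin_sum[OF assms(2)]) (use insert in auto)
 then show ?case
 proof (rule linear_map_cong[OF assms(1)])
  fix x assume "x \<in> carrier M"
  then show "f j x \<oplus>\<^sub>N (\<Oplus>\<^sub>N i\<in>I. f i x) = (\<Oplus>\<^sub>N i\<in>insert j I. f i x)"
   by (subst N.finsum_insert) (use insert lin_closed[OF insert.prems] in auto)
 qed
qed (use lin_const_zero[OF assms(2)] assms(2) in
 \<open>simp_all add: module_def abelian_group_def abelian_monoid.finsum_infinite abelian_monoid.finsum_empty\<close>)

subsection \<open>Generated submodules\<close>

lemma submoduleD:
 assumes "module R M" "submodule H R M"
 shows submodule_subset: "H \<subseteq> carrier M"
  and submodule_zero: "\<zero>\<^sub>M \<in> H"
  and submodule_add: "[|x \<in> H; y \<in> H|] ==> x \<oplus>\<^sub>M y \<in> H"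
  and submodule_smult: "[|r \<in> carrier R; x \<in> H|] ==> r \<odot>\<^sub>M x \<in> H"
  and submodule_neg: "x \<in> H ==> \<ominus>\<^sub>M x \<in> H"
  and submodule_minus: "[|x \<in> H; y \<in> H|] ==> x \<ominus>\<^sub>M y \<in> H"
  and submodule_finsum: "(!!i. i \<in> I ==> g i \<in> H) ==> (\<Oplus>\<^sub>M i\<in>I. g i) \<in> H"
  and submodule_ksign: "x \<in> H ==> ksign M e x \<in> H"
proof -
 interpret M: module R M by fact
 note E = M.submoduleE[OF assms(2)]
 show sub: "H \<subseteq> carrier M" by (rule E(1))
 show z: "\<zero>\<^sub>M \<in> H"
  using subgroup.one_closed[OF submodule.axioms(1)[OF assms(2)]] by simp
 show add: "x \<oplus>\<^sub>M y \<in> H" if "x \<in> H" "y \<in> H" for x y using E(5) that by blast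
 show "r \<odot>\<^sub>M x \<in> H" if "r \<in> carrier R" "x \<in> H" for r x using E(4) that by blast
 show neg: "\<ominus>\<^sub>M x \<in> H" if "x \<in> H" for x using E(3) that by blast
 show "x \<ominus>\<^sub>M y \<in> H" if "x \<in> H" "y \<in> H" using add neg that by (simp add: a_minus_def)
 show "(\<Oplus>\<^sub>M i\<in>I. g i) \<in> H" if "!!i. i \<in> I ==> g i \<in> H" using that
 proof (induction I rule: infinite_finite_induct)
  case (insert x F)
  then have "g \<in> F \<rightarrow> carrier M" "g x \<in> carrier M" using sub by auto
  then show ?case using insert add by simp
 qed (simp_all add: z)
 show "ksign M e x \<in> H" if "x \<in> H" using neg that by (simp add: ksign_def)
qed

lemma submodule_restrict_module:
 assumes "module R M" "submodule H R M"
 shows "module R (M\<lparr>carrier := H\<rparr>)"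
 by (rule submodule.submodule_is_module[OF assms(2,1)])

lemma submodule_linear_map:
 assumes "submodule H R M" "module R M" "linear_map R M N f"
 shows "linear_map R (M\<lparr>carrier := H\<rparr>) N f"
 using linear_mapD[OF assms(3)] submodule_subset[OF assms(2,1)] by (intro linear_mapI) (auto simp: subset_iff)

context module
begin

lemma submodule_Inter:
 assumes "!!N. N \<in> S ==> submodule N R M" "S \<noteq> {}"
 shows "submodule (\<Inter>S) R M"
proof (rule submoduleI)
 note D = submoduleD[OF module_axioms assms(1)]
 show "\<Inter>S \<subseteq> carrier M" using assms(2) D(1) by blast
 show "\<zero>\<^sub>M \<in> \<Inter>S" using D(2) by blast
 show "\<ominus>\<^sub>M a \<in> \<Inter>S" if "a \<in> \<Inter>S" for a using D(5) that by blast
 show "a \<oplus>\<^sub>M b \<in> \<Inter>S" if "a \<in> \<Inter>S" "b \<in> \<Inter>S" for a b using D(3) that by blast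
 show "a \<odot>\<^sub>M x \<in> \<Inter>S" if "a \<in> carrier R" "x \<in> \<Inter>S" for a x using D(4) that by blast
qed

lemma generated_sub:
 assumes "S \<subseteq> carrier M"
 shows "submodule (generated_submodule R M S) R M"
 unfolding generated_submodule_def
 by (rule submodule_Inter) (use assms carrier_is_submodule in auto)

lemma generated_incl: "S \<subseteq> generated_submodule R M S"
 by (auto simp: generated_submodule_def)

lemma generated_subset:
 "[|submodule N R M; S \<subseteq> N|] ==> generated_submodule R M S \<subseteq> N"
 by (auto simp: generated_submodule_def)

lemma generated_induct [consumes 2, case_names gen zero add smult]:
 assumes "x \<in> generated_submodule R M S" "S \<subseteq> carrier M"
  and "!!x. x \<in> S ==> Q x" and "Q \<zero>\<^sub>M"
  and "!!x y. [|x \<in> carrier M; y \<in> carrier M; Q x; Q y|] ==> Q (x \<oplus>\<^sub>M y)"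
  and "!!r x. [|r \<in> carrier R; x \<in> carrier M; Q x|] ==> Q (r \<odot>\<^sub>M x)"
 shows "Q x"
proof -
 have "submodule {x \<in> carrier M. Q x} R M"
 proof (rule submoduleI)
  fix a assume "a \<in> {x \<in> carrier M. Q x}"
  then show "\<ominus>\<^sub>M a \<in> {x \<in> carrier M. Q x}"
   using assms(6)[of "\<ominus> \<one>" a] by (simp add: smult_minus_one)
 qed (use assms in auto)
 then have "generated_submodule R M S \<subseteq> {x \<in> carrier M. Q x}"
  by (rule generated_subset) (use assms in auto)
 then show ?thesis using assms(1) by auto
qed

lemma generated_mono:
 "[|S \<subseteq> T; T \<subseteq> carrier M|] ==> generated_submodule R M S \<subseteq> generated_submodule R M T"
 by (auto simp: generated_submodule_def)

end

lemma linear_maps_eq_on_generated: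
 assumes "module R M" "module R N" "linear_map R M N f" "linear_map R M N g"
  and "S \<subseteq> carrier M" "!!x. x \<in> S ==> f x = g x" "x \<in> generated_submodule R M S"
 shows "f x = g x"
proof -
 interpret M: module R M by fact
 show ?thesis using assms(7,5)
  by (induction rule: M.generated_induct)
   (simp_all add: assms(6) linear_mapD[OF assms(3)] linear_mapD[OF assms(4)]
    lin_zero[OF assms(1-3)] lin_zero[OF assms(1,2,4)])
qed

lemma lin_generated_into:
 assumes "module R M" "module R N" "linear_map R M N f" "submodule H R N"
  and "S \<subseteq> carrier M" "!!x. x \<in> S ==> f x \<in> H" "x \<in> generated_submodule R M S"
 shows "f x \<in> H"
proof -
 interpret M: module R M by fact
 note D = submoduleD[OF assms(2,4)]
 show ?thesis using assms(7,5)
  by (induction rule: M.generated_induct)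
   (simp_all add: assms(6) linear_mapD[OF assms(3)] lin_zero[OF assms(1-3)] D)
qed

subsection \<open>Direct sums\<close>

definition component :: "('k, 'v, 'd) module_scheme => ('i => 'v set) => 'i => 'v => 'v"
 where "component M X i x = (THE c. decomposes M X x c) i"

lemma hpart_component: "hpart X x i = component X (grade X) i x"
 by (simp add: hpart_def component_def)

lemma (in module) decomposesI:
 assumes "finite F" "!!i. i \<notin> F ==> c i = \<zero>\<^sub>M" "!!i. c i \<in> X i" "!!i. X i \<subseteq> carrier M"
  and "x = (\<Oplus>\<^sub>M i\<in>F. c i)"
 shows "decomposes M X x c"
proof -
 have sub: "{i. c i \<noteq> \<zero>\<^sub>M} \<subseteq> F" using assms(2) by auto
 have "(\<Oplus>\<^sub>M i\<in>{i. c i \<noteq> \<zero>\<^sub>M}. c i) = (\<Oplus>\<^sub>M i\<in>F. c i)"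
  by (rule add.finprod_mono_neutral_cong_left) (use assms sub in auto)
 then show ?thesis using assms(1,3,5) finite_subset[OF sub] by (simp add: decomposes_def)
qed

locale direct_sum = module R M
 for R :: "('k, 'c) ring_scheme" and M :: "('k, 'v, 'd) module_scheme" +
 fixes X :: "'i => 'v set"
 assumes decomposition: "internal_direct_sum R M X"
begin

lemma summand_submodule: "submodule (X i) R M"
 using decomposition by (simp add: internal_direct_sum_def)

lemmas summandD = submoduleD[OF module_axioms summand_submodule]

lemma component_decomposes:
 assumes "x \<in> carrier M"
 shows "decomposes M X x (%i. component M X i x)"
proof -
 have "\<exists>!c. decomposes M X x c" using decomposition assms by (simp add: internal_direct_sum_def)
 then show ?thesis unfolding component_def by (rule theI')
qed

lemma component_eqI:
 assumes "decomposes M X x c"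
 shows "component M X i x = c i"
proof -
 have "c i \<in> carrier M" for i using assms summandD(1) by (auto simp: decomposes_def)
 then have "x \<in> carrier M" using assms by (auto simp: decomposes_def intro!: finsum_closed)
 then have "\<exists>!c. decomposes M X x c" using decomposition by (simp add: internal_direct_sum_def)
 then show ?thesis using assms by (simp add: component_def the1_equality)
qed

lemma component_in: "x \<in> carrier M ==> component M X i x \<in> X i"
 and component_finite: "x \<in> carrier M ==> finite {i. component M X i x \<noteq> \<zero>\<^sub>M}"
 and component_sum:
  "x \<in> carrier M ==> x = (\<Oplus>\<^sub>M i\<in>{i. component M X i x \<noteq> \<zero>\<^sub>M}. component M X i x)"
 using component_decomposes by (auto simp: decomposes_def)

lemma component_closed [simp]: "x \<in> carrier M ==> component M X i x \<in> carrier M"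
 using component_in summandD(1) by blast

lemma component_sum':
 assumes "x \<in> carrier M" "finite F" "!!i. i \<notin> F ==> component M X i x = \<zero>\<^sub>M"
 shows "x = (\<Oplus>\<^sub>M i\<in>F. component M X i x)"
proof -
 have "(\<Oplus>\<^sub>M i\<in>{i. component M X i x \<noteq> \<zero>\<^sub>M}. component M X i x) = (\<Oplus>\<^sub>M i\<in>F. component M X i x)"
  by (rule add.finprod_mono_neutral_cong_left) (use assms in auto)
 then show ?thesis using component_sum[OF assms(1)] by simp
qed

lemma component_of:
 assumes "x \<in> X j"
 shows "component M X i x = (if i = j then x else \<zero>\<^sub>M)"
proof -
 have x: "x \<in> carrier M" using assms summandD(1) by blast
 have "decomposes M X x (%i. if i = j then x else \<zero>\<^sub>M)"
  by (rule decomposesI[of "{j}"]) (use assms x summandD in auto)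
 then show ?thesis by (rule component_eqI)
qed

lemma component_linear: "linear_map R M M (component M X i)"
proof (rule linear_mapI)
 fix x y assume x: "x \<in> carrier M" and y: "y \<in> carrier M"
 let ?F = "{i. component M X i x \<noteq> \<zero>\<^sub>M} \<union> {i. component M X i y \<noteq> \<zero>\<^sub>M}"
 have F: "finite ?F" using component_finite x y by auto
 have "x \<oplus>\<^sub>M y = (\<Oplus>\<^sub>M i\<in>?F. component M X i x) \<oplus>\<^sub>M (\<Oplus>\<^sub>M i\<in>?F. component M X i y)"
  using component_sum'[OF x F] component_sum'[OF y F] by simp
 also have "... = (\<Oplus>\<^sub>M i\<in>?F. component M X i x \<oplus>\<^sub>M component M X i y)"
  by (rule finsum_addf[symmetric]) (use x y in auto)
 finally have "decomposes M X (x \<oplus>\<^sub>M y) (%i. component M X i x \<oplus>\<^sub>M component M X i y)"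
  by (intro decomposesI[OF F]) (use x y component_in summandD in auto)
 then show "component M X i (x \<oplus>\<^sub>M y) = component M X i x \<oplus>\<^sub>M component M X i y"
  by (rule component_eqI)
next
 fix r x assume r: "r \<in> carrier R" and x: "x \<in> carrier M"
 let ?F = "{i. component M X i x \<noteq> \<zero>\<^sub>M}"
 have F: "finite ?F" using component_finite x by auto
 have "r \<odot>\<^sub>M x = r \<odot>\<^sub>M (\<Oplus>\<^sub>M i\<in>?F. component M X i x)" using component_sum[OF x] by simp
 also have "... = (\<Oplus>\<^sub>M i\<in>?F. r \<odot>\<^sub>M component M X i x)"
  by (rule finsum_smult_ldistr) (use F r x in auto)
 finally have "decomposes M X (r \<odot>\<^sub>M x) (%i. r \<odot>\<^sub>M component M X i x)"
  by (intro decomposesI[OF F]) (use r x component_in summandD in auto)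
 then show "component M X i (r \<odot>\<^sub>M x) = r \<odot>\<^sub>M component M X i x"
  by (rule component_eqI)
qed simp

lemma summands_induct [consumes 1, case_names summand add]:
 assumes "x \<in> carrier M" and "!!i x. x \<in> X i ==> Q x"
  and "!!x y. [|x \<in> carrier M; y \<in> carrier M; Q x; Q y|] ==> Q (x \<oplus>\<^sub>M y)"
 shows "Q x"
proof -
 have "Q (\<Oplus>\<^sub>M i\<in>F. component M X i x)" if "finite F" for F
  using that
 proof (induction F)
  case empty
  then show ?case using assms(2)[OF summandD(2)] by simp
 next
  case (insert j F)
  then show ?case using assms(1,3) assms(2)[OF component_in[OF assms(1)]] by (simp add: Pi_iff)
 qed
 from this[OF component_finite[OF assms(1)]] show ?thesis using component_sum[OF assms(1)] by simp
qed

lemma linear_maps_eq_on_summands: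
 assumes "module R N" "linear_map R M N f" "linear_map R M N g"
  and "!!i x. x \<in> X i ==> f x = g x" "x \<in> carrier M"
 shows "f x = g x"
 using assms(5)
 by (induction rule: summands_induct) (simp_all add: assms(4) linear_mapD[OF assms(2)] linear_mapD[OF assms(3)])

text \<open>Only finitely many components are nonzero, so their images can be added.\<close>

lemma assemble_linear_map:
 assumes N: "module R N" and s: "!!i. linear_map R (M\<lparr>carrier := X i\<rparr>) N (s i)"
 shows "\<exists>f. linear_map R M N f \<and> (\<forall>i. \<forall>x\<in>X i. f x = s i x)"
proof -
 interpret N: module R N by fact
 have sc: "s i x \<in> carrier N" if "x \<in> X i" for i x using s[of i] that by (auto simp: linear_map_def)
 have s0: "s i \<zero>\<^sub>M = \<zero>\<^sub>N" for i
  using lin_zero[OF submodule_restrict_module[OF module_axioms summand_submodule] N s, of i] by simp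
 have sadd: "s i (x \<oplus>\<^sub>M y) = s i x \<oplus>\<^sub>N s i y" if "x \<in> X i" "y \<in> X i" for i x y
  using s[of i] that by (auto simp: linear_map_def)
 have ssm: "s i (r \<odot>\<^sub>M x) = r \<odot>\<^sub>N s i x" if "x \<in> X i" "r \<in> carrier R" for i x r
  using s[of i] that by (auto simp: linear_map_def)
 define f where "f x = (\<Oplus>\<^sub>N i\<in>{i. component M X i x \<noteq> \<zero>\<^sub>M}. s i (component M X i x))" for x
 have f: "f x = (\<Oplus>\<^sub>N i\<in>F. s i (component M X i x))"
  if "x \<in> carrier M" "finite F" "!!i. i \<notin> F ==> component M X i x = \<zero>\<^sub>M" for x F
  unfolding f_def
  by (rule N.add.finprod_mono_neutral_cong_left) (use that s0 component_in sc in auto)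
 have "linear_map R M N f"
 proof (rule linear_mapI)
  fix x assume x: "x \<in> carrier M"
  show "f x \<in> carrier N" unfolding f_def by (rule N.finsum_closed) (use x component_in sc in auto)
  note cx = component_finite[OF x] 
  fix y assume y: "y \<in> carrier M"
  let ?F = "{i. component M X i x \<noteq> \<zero>\<^sub>M} \<union> {i. component M X i y \<noteq> \<zero>\<^sub>M}"
  have F: "finite ?F" using component_finite x y by auto
  have "f (x \<oplus>\<^sub>M y) = (\<Oplus>\<^sub>N i\<in>?F. s i (component M X i (x \<oplus>\<^sub>M y)))"
   by (rule f) (use x y F lin_add[OF component_linear] in auto)
  also have "... = (\<Oplus>\<^sub>N i\<in>?F. s i (component M X i x) \<oplus>\<^sub>N s i (component M X i y))"
   by (rule N.finsum_cong') (use x y sc sadd component_in lin_add[OF component_linear] in auto)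
  also have "... = (\<Oplus>\<^sub>N i\<in>?F. s i (component M X i x)) \<oplus>\<^sub>N (\<Oplus>\<^sub>N i\<in>?F. s i (component M X i y))"
   by (rule N.finsum_addf) (use x y sc component_in in auto)
  also have "... = f x \<oplus>\<^sub>N f y" using f[OF x F] f[OF y F] by simp
  finally show "f (x \<oplus>\<^sub>M y) = f x \<oplus>\<^sub>N f y" .
 next
  fix r x assume x: "x \<in> carrier M" and r: "r \<in> carrier R"
  let ?F = "{i. component M X i x \<noteq> \<zero>\<^sub>M}"
  have F: "finite ?F" using component_finite x by auto
  have "f (r \<odot>\<^sub>M x) = (\<Oplus>\<^sub>N i\<in>?F. s i (component M X i (r \<odot>\<^sub>M x)))"
   by (rule f) (use x r F lin_smult[OF component_linear] in auto)
  also have "... = (\<Oplus>\<^sub>N i\<in>?F. r \<odot>\<^sub>N s i (component M X i x))"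
   by (rule N.finsum_cong') (use x r sc ssm component_in lin_smult[OF component_linear] in auto)
  also have "... = r \<odot>\<^sub>N f x" unfolding f_def
   by (rule N.finsum_smult_ldistr[symmetric]) (use F x r sc component_in in auto)
  finally show "f (r \<odot>\<^sub>M x) = r \<odot>\<^sub>N f x" .
 qed
 moreover have "f x = s i x" if "x \<in> X i" for i x
  using f[of x "{i}"] that component_of[OF that] summandD(1) sc[OF that] by auto
 ultimately show ?thesis by blast
qed

lemma mem_sum_space_iff:
 "x \<in> sum_space M X K \<longleftrightarrow> x \<in> carrier M \<and> (\<forall>i. i \<notin> K --> component M X i x = \<zero>\<^sub>M)"
proof
 assume "x \<in> sum_space M X K"
 then obtain F c where F: "finite F" "F \<subseteq> K" "\<forall>i\<in>F. c i \<in> X i" "x = (\<Oplus>\<^sub>M i\<in>F. c i)"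
  by (auto simp: sum_space_def)
 let ?c = "%i. if i \<in> F then c i else \<zero>\<^sub>M"
 have "x = (\<Oplus>\<^sub>M i\<in>F. ?c i)"
  unfolding F(4) by (rule finsum_cong') (use F(3) summandD(1) in \<open>fastforce+\<close>)
 then have d: "decomposes M X x ?c"
  by (intro decomposesI[OF F(1)]) (use F summandD in auto)
 have "component M X i x = ?c i" for i by (rule component_eqI[OF d])
 moreover have "x \<in> carrier M"
  unfolding F(4) by (rule finsum_closed) (use F(3) summandD(1) in blast)
 ultimately show "x \<in> carrier M \<and> (\<forall>i. i \<notin> K --> component M X i x = \<zero>\<^sub>M)"
  using F(2) by auto
next
 assume x: "x \<in> carrier M \<and> (\<forall>i. i \<notin> K --> component M X i x = \<zero>\<^sub>M)"
 then have "{i. component M X i x \<noteq> \<zero>\<^sub>M} \<subseteq> K" by auto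
 then show "x \<in> sum_space M X K"
  unfolding sum_space_def mem_Collect_eq using x component_finite component_in component_sum
  by (intro exI[of _ "{i. component M X i x \<noteq> \<zero>\<^sub>M}"] exI[of _ "%i. component M X i x"]) blast
qed

lemma sum_space_submodule: "submodule (sum_space M X K) R M"
 by (rule submoduleI)
  (auto simp: mem_sum_space_iff linear_mapD[OF component_linear]
   lin_zero[OF module_axioms module_axioms component_linear]
   lin_neg[OF module_axioms module_axioms component_linear])

lemma summand_subset_sum_space: "i \<in> K ==> X i \<subseteq> sum_space M X K"
 using component_of subsetD[OF summandD(1)] by (auto simp: mem_sum_space_iff)

end

lemma linear_map_component:
 assumes "direct_sum R M X" "direct_sum R N Y" "linear_map R M N f" "inj s"
  and "!!i x. x \<in> X i ==> f x \<in> Y (s i)" "x \<in> carrier M"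
 shows "component N Y (s i) (f x) = f (component M X i x)"
proof -
 interpret M: direct_sum R M X by fact
 interpret N: direct_sum R N Y by fact
 show ?thesis
 proof (rule M.linear_maps_eq_on_summands[where f="%x. component N Y (s i) (f x)"])
  show "module R N" by (rule N.module_axioms)
  show "linear_map R M N (%x. component N Y (s i) (f x))"
   by (rule lin_comp[OF assms(3) N.component_linear])
  show "linear_map R M N (%x. f (component M X i x))"
   by (rule lin_comp[OF M.component_linear assms(3)])
  show "component N Y (s i) (f x) = f (component M X i x)" if "x \<in> X j" for j x
   using N.component_of[OF assms(5)[OF that]] M.component_of[OF that]
    lin_zero[OF M.module_axioms N.module_axioms assms(3)] injD[OF assms(4)] by auto
 qed fact
qed

subsection \<open>Linear selections\<close>

text \<open>
 A linear relation that relates every element of a vector space to something contains the graph of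
 a linear map: by Zorn's lemma there is a maximal subspace of the relation that is the graph of a
 partial map, and a partial map that misses \<open>x\<close> extends to the span of its domain and \<open>x\<close>.
\<close>

lemma linear_selection:
 assumes "field R" "module R M" "module R N"
  and \<Gamma>: "!!x y. \<Gamma> x y ==> x \<in> carrier M \<and> y \<in> carrier N"
  and \<Gamma>add: "!!x y x' y'. [|\<Gamma> x y; \<Gamma> x' y'|] ==> \<Gamma> (x \<oplus>\<^sub>M x') (y \<oplus>\<^sub>N y')"
  and \<Gamma>smult: "!!r x y. [|r \<in> carrier R; \<Gamma> x y|] ==> \<Gamma> (r \<odot>\<^sub>M x) (r \<odot>\<^sub>N y)"
  and total: "!!x. x \<in> carrier M ==> \<exists>y. \<Gamma> x y"
 shows "\<exists>f. linear_map R M N f \<and> (\<forall>x\<in>carrier M. \<Gamma> x (f x))"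
proof -
 interpret R: field R by fact
 interpret M: module R M by fact
 interpret N: module R N by fact
 let ?m1 = "(\<ominus>\<^sub>R \<one>\<^sub>R)"
 let ?z = "(\<zero>\<^sub>M, \<zero>\<^sub>N)"
 let ?add = "%x y x' y'. (x \<oplus>\<^sub>M x', y \<oplus>\<^sub>N y')"
 define graph where "graph G \<longleftrightarrow> (\<forall>(x, y)\<in>G. \<Gamma> x y) \<and> ?z \<in> G \<and>
  (\<forall>(x, y)\<in>G. \<forall>(x', y')\<in>G. ?add x y x' y' \<in> G) \<and>
  (\<forall>r\<in>carrier R. \<forall>(x, y)\<in>G. (r \<odot>\<^sub>M x, r \<odot>\<^sub>N y) \<in> G) \<and>
  (\<forall>y. (\<zero>\<^sub>M, y) \<in> G --> y = \<zero>\<^sub>N)" for G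
 have graphD: "(x, y) \<in> G ==> \<Gamma> x y" "?z \<in> G"
  "(x, y) \<in> G ==> (x', y') \<in> G ==> ?add x y x' y' \<in> G"
  "r \<in> carrier R ==> (x, y) \<in> G ==> (r \<odot>\<^sub>M x, r \<odot>\<^sub>N y) \<in> G"
  "(\<zero>\<^sub>M, y) \<in> G ==> y = \<zero>\<^sub>N"
  if "graph G" for G x y x' y' r using that unfolding graph_def by blast+
 have graphI: "graph G" if "!!x y. (x, y) \<in> G ==> \<Gamma> x y" "?z \<in> G"
  "!!x y x' y'. (x, y) \<in> G ==> (x', y') \<in> G ==> ?add x y x' y' \<in> G"
  "!!r x y. r \<in> carrier R ==> (x, y) \<in> G ==> (r \<odot>\<^sub>M x, r \<odot>\<^sub>N y) \<in> G"
  "!!y. (\<zero>\<^sub>M, y) \<in> G ==> y = \<zero>\<^sub>N" for G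
  unfolding graph_def using that by blast
 obtain y0 where "\<Gamma> \<zero>\<^sub>M y0" using total by blast
 then have \<Gamma>0: "\<Gamma> \<zero>\<^sub>M \<zero>\<^sub>N" using \<Gamma>smult[of "\<zero>\<^sub>R"] \<Gamma> by fastforce
 have "graph {?z}" using \<Gamma>0 by (intro graphI) auto
 then have ne: "Collect graph \<noteq> {}" by blast
 have "\<exists>G\<in>Collect graph. \<forall>G'\<in>Collect graph. G \<subseteq> G' --> G' = G"
 proof (rule subset_Zorn_nonempty[OF ne])
  fix \<C> assume C: "\<C> \<noteq> {}" and chain: "subset.chain (Collect graph) \<C>"
  have g: "graph G" if "G \<in> \<C>" for G using chain that by (auto simp: subset.chain_def)
  have common: "\<exists>G\<in>\<C>. p \<in> G \<and> q \<in> G" if pq: "p \<in> \<Union>\<C>" "q \<in> \<Union>\<C>" for p q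
  proof -
   obtain G1 G2 where G: "G1 \<in> \<C>" "p \<in> G1" "G2 \<in> \<C>" "q \<in> G2" using pq by blast
   then have "G1 \<subseteq> G2 \<or> G2 \<subseteq> G1" using chain by (auto simp: subset_chain_def)
   then show ?thesis using G by blast
  qed
  have "\<Gamma> x y" if "(x, y) \<in> \<Union>\<C>" for x y using that graphD(1)[OF g] by blast
  moreover have "?z \<in> \<Union>\<C>" using C graphD(2)[OF g] by blast
  moreover have "?add x y x' y' \<in> \<Union>\<C>" if xy: "(x, y) \<in> \<Union>\<C>" "(x', y') \<in> \<Union>\<C>" for x x' y y'
  proof -
   obtain G where G: "G \<in> \<C>" "(x, y) \<in> G" "(x', y') \<in> G" using common[OF xy] by blast
   have "?add x y x' y' \<in> G" by (rule graphD(3)[OF g[OF G(1)] G(2,3)])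
   then show ?thesis using G(1) by blast
  qed
  moreover have "(r \<odot>\<^sub>M x, r \<odot>\<^sub>N y) \<in> \<Union>\<C>" if "r \<in> carrier R" "(x, y) \<in> \<Union>\<C>" for r x y
   using that graphD(4)[OF g] by blast
  moreover have "y = \<zero>\<^sub>N" if "(\<zero>\<^sub>M, y) \<in> \<Union>\<C>" for y using that graphD(5)[OF g] by blast
  ultimately show "\<Union>\<C> \<in> Collect graph" unfolding mem_Collect_eq by (rule graphI)
 qed
 then obtain G where G: "graph G" and max: "!!G'. graph G' ==> G \<subseteq> G' ==> G' = G" by auto
 have G\<Gamma>: "\<Gamma> x y" if "(x, y) \<in> G" for x y by (rule graphD(1)[OF G that])
 have Gc: "x \<in> carrier M" "y \<in> carrier N" if "(x, y) \<in> G" for x y using G\<Gamma>[OF that] \<Gamma> by auto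
 have Gadd: "?add x y x' y' \<in> G" if "(x, y) \<in> G" "(x', y') \<in> G" for x y x' y'
  by (rule graphD(3)[OF G that])
 have Gsm: "(r \<odot>\<^sub>M x, r \<odot>\<^sub>N y) \<in> G" if "r \<in> carrier R" "(x, y) \<in> G" for r x y
  by (rule graphD(4)[OF G that])
 have Gz: "?z \<in> G" "!!y. (\<zero>\<^sub>M, y) \<in> G ==> y = \<zero>\<^sub>N" using graphD(2,5)[OF G] by blast+
 have dom: "\<exists>y. (x0, y) \<in> G" if x0: "x0 \<in> carrier M" for x0
 proof (rule ccontr)
  assume no: "\<nexists>y. (x0, y) \<in> G"
  obtain y0 where y0: "\<Gamma> x0 y0" using total x0 by blast
  then have y0c: "y0 \<in> carrier N" using \<Gamma> by blast
  define G' where "G' = {(x \<oplus>\<^sub>M r \<odot>\<^sub>M x0, y \<oplus>\<^sub>N r \<odot>\<^sub>N y0) | x y r. (x, y) \<in> G \<and> r \<in> carrier R}"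
  have G'I: "(x \<oplus>\<^sub>M r \<odot>\<^sub>M x0, y \<oplus>\<^sub>N r \<odot>\<^sub>N y0) \<in> G'" if "(x, y) \<in> G" "r \<in> carrier R" for x y r
   using that by (auto simp: G'_def)
  have sub: "G \<subseteq> G'"
  proof
   fix p assume "p \<in> G"
   then show "p \<in> G'" using G'I[of "fst p" "snd p" "\<zero>\<^sub>R"] x0 y0c Gc[of "fst p" "snd p"] by simp
  qed
  have "graph G'"
  proof (rule graphI)
   fix x y assume "(x, y) \<in> G'"
   then show "\<Gamma> x y" using G\<Gamma> \<Gamma>add \<Gamma>smult y0 by (fastforce simp: G'_def)
  next
   show "?z \<in> G'" using sub Gz by blast
  next
   fix x y x' y' assume "(x, y) \<in> G'" "(x', y') \<in> G'"
   then obtain a b r a' b' r' where *: "(a, b) \<in> G" "r \<in> carrier R" "(a', b') \<in> G" "r' \<in> carrier R"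
    "x = a \<oplus>\<^sub>M r \<odot>\<^sub>M x0" "y = b \<oplus>\<^sub>N r \<odot>\<^sub>N y0" "x' = a' \<oplus>\<^sub>M r' \<odot>\<^sub>M x0" "y' = b' \<oplus>\<^sub>N r' \<odot>\<^sub>N y0"
    by (auto simp: G'_def)
   have "x \<oplus>\<^sub>M x' = (a \<oplus>\<^sub>M a') \<oplus>\<^sub>M (r \<oplus>\<^sub>R r') \<odot>\<^sub>M x0" "y \<oplus>\<^sub>N y' = (b \<oplus>\<^sub>N b') \<oplus>\<^sub>N (r \<oplus>\<^sub>R r') \<odot>\<^sub>N y0"
    using * x0 y0c Gc by (simp_all add: M.smult_l_distr N.smult_l_distr M.add.m_ac N.add.m_ac)
   then show "?add x y x' y' \<in> G'" using G'I Gadd * by auto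
  next
   fix s x y assume s: "s \<in> carrier R" and "(x, y) \<in> G'"
   then obtain a b r where *: "(a, b) \<in> G" "r \<in> carrier R"
    "x = a \<oplus>\<^sub>M r \<odot>\<^sub>M x0" "y = b \<oplus>\<^sub>N r \<odot>\<^sub>N y0"
    by (auto simp: G'_def)
   have "s \<odot>\<^sub>M x = (s \<odot>\<^sub>M a) \<oplus>\<^sub>M (s \<otimes>\<^sub>R r) \<odot>\<^sub>M x0" "s \<odot>\<^sub>N y = (s \<odot>\<^sub>N b) \<oplus>\<^sub>N (s \<otimes>\<^sub>R r) \<odot>\<^sub>N y0"
    using * s x0 y0c Gc by (simp_all add: M.smult_r_distr N.smult_r_distr M.smult_assoc1 N.smult_assoc1)
   then show "(s \<odot>\<^sub>M x, s \<odot>\<^sub>N y) \<in> G'" using G'I Gsm * s by auto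
  next
   fix y assume "(\<zero>\<^sub>M, y) \<in> G'"
   then obtain a b r where *: "(a, b) \<in> G" "r \<in> carrier R"
    "\<zero>\<^sub>M = a \<oplus>\<^sub>M r \<odot>\<^sub>M x0" "y = b \<oplus>\<^sub>N r \<odot>\<^sub>N y0"
    by (auto simp: G'_def)
   have "r = \<zero>\<^sub>R"
   proof (rule ccontr)
    assume r: "r \<noteq> \<zero>\<^sub>R"
    then have ru: "inv\<^bsub>R\<^esub> r \<in> carrier R" "inv\<^bsub>R\<^esub> r \<otimes>\<^sub>R r = \<one>\<^sub>R"
     using *(2) by (auto simp: R.field_Units)
    have "r \<odot>\<^sub>M x0 = \<ominus>\<^sub>M a"
     using *(2,3) x0 Gc[OF *(1)] M.smult_closed[OF *(2) x0] by (metis M.add.m_comm M.minus_equality)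
    then have "inv\<^bsub>R\<^esub> r \<odot>\<^sub>M (?m1 \<odot>\<^sub>M a) = x0"
     using ru *(2) x0 Gc[OF *(1)] by (simp add: M.smult_minus_one M.smult_assoc1[symmetric])
      (metis M.smult_assoc1 M.smult_one)
    then show False using no Gsm[OF ru(1) Gsm[OF _ *(1), of "\<ominus>\<^sub>R \<one>\<^sub>R"]] by auto
   qed
   then show "y = \<zero>\<^sub>N" using * x0 y0c Gc[OF *(1)] Gz(2) by auto
  qed
  then have "G' = G" using max sub by blast
  moreover have "(x0, y0) \<in> G'" using G'I[OF Gz(1), of "\<one>\<^sub>R"] x0 y0c by simp
  ultimately show False using no by blast
 qed
 have unique: "y = y'" if "(x, y) \<in> G" "(x, y') \<in> G" for x y y'
 proof -
  have "(x \<oplus>\<^sub>M ?m1 \<odot>\<^sub>M x, y \<oplus>\<^sub>N ?m1 \<odot>\<^sub>N y') \<in> G"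
   using Gadd[OF that(1) Gsm[OF _ that(2)]] by simp
  then have "y \<oplus>\<^sub>N \<ominus>\<^sub>N y' = \<zero>\<^sub>N"
   using Gz(2) Gc[OF that(1)] Gc[OF that(2)] by (simp add: M.smult_minus_one N.smult_minus_one M.r_neg)
  then show ?thesis using Gc[OF that(1)] Gc[OF that(2)] by (metis N.add.inv_closed N.minus_equality N.minus_minus)
 qed
 define f where "f x = (THE y. (x, y) \<in> G)" for x
 have f: "(x, f x) \<in> G" if "x \<in> carrier M" for x
  unfolding f_def by (rule theI') (use dom[OF that] unique in blast)
 have feq: "f x = y" if "(x, y) \<in> G" for x y using unique[OF that] f Gc(1)[OF that] by metis
 have "linear_map R M N f"
 proof (rule linear_mapI)
  show "f (x \<oplus>\<^sub>M y) = f x \<oplus>\<^sub>N f y" if "x \<in> carrier M" "y \<in> carrier M" for x y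
   by (rule feq) (rule Gadd[OF f f, OF that])
  show "f (r \<odot>\<^sub>M x) = r \<odot>\<^sub>N f x" if "r \<in> carrier R" "x \<in> carrier M" for r x
   by (rule feq) (rule Gsm[OF that(1) f[OF that(2)]])
 qed (use f Gc in blast)
 then show ?thesis using f G\<Gamma> by blast
qed

section \<open>Koszul signs and lists of lists\<close>

context module
begin

lemma ksign_closed [simp]: "x \<in> carrier M ==> ksign M e x \<in> carrier M"
 by (simp add: ksign_def)

lemma ksign_ksign: "x \<in> carrier M ==> ksign M a (ksign M b x) = ksign M (a + b) x"
 by (simp add: ksign_def)

lemma ksign_cong: "even (a + b) ==> ksign M a x = ksign M b x"
 by (simp add: ksign_def) presburger?

lemma ksign_add: "[|x \<in> carrier M; y \<in> carrier M|] ==> ksign M e (x \<oplus>\<^sub>M y) = ksign M e x \<oplus>\<^sub>M ksign M e y"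
 by (simp add: ksign_def minus_add)

lemma ksign_zero [simp]: "ksign M e \<zero>\<^sub>M = \<zero>\<^sub>M"
 by (simp add: ksign_def)

lemma ksign_linear: "linear_map R M M (ksign M e)"
 using linear_map_ksign_left[OF module_axioms lin_ident] .

lemma ksign_finsum:
 assumes "g \<in> I \<rightarrow> carrier M"
 shows "ksign M e (\<Oplus>\<^sub>M i\<in>I. g i) = (\<Oplus>\<^sub>M i\<in>I. ksign M e (g i))"
 by (rule lin_finsum[OF module_axioms module_axioms ksign_linear assms])

lemma ksign_cancel: "x \<in> carrier M ==> ksign M e x \<oplus>\<^sub>M ksign M (e + 1) x = \<zero>\<^sub>M"
 by (auto simp: ksign_def r_neg l_neg)

end

subsection \<open>Parity of the sign exponents\<close>

lemma even_card_filter: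
 "finite A ==> even (int (card {x \<in> A. odd (f x)}) + (\<Sum>x\<in>A. f x :: int))"
proof (induction A rule: finite_induct)
 case (insert x A)
 have "{y \<in> insert x A. odd (f y)} = (if odd (f x) then insert x {y \<in> A. odd (f y)} else {y \<in> A. odd (f y)})"
  by auto
 then show ?case using insert by (auto simp: card_insert_if)
qed simp

lemma perm_exp_parity:
 assumes "length ds = n"
 shows "even (perm_exp \<sigma> ds + (\<Sum>i<n. \<Sum>j<n. if i < j \<and> \<sigma> j < \<sigma> i then ds ! \<sigma> i * ds ! \<sigma> j else 0))"
proof -
 let ?A = "{(i, j) \<in> {..<n} \<times> {..<n}. i < j \<and> \<sigma> j < \<sigma> i}"
 let ?f = "%(i, j). ds ! \<sigma> i * ds ! \<sigma> j"
 have fin: "finite ?A" by (rule finite_subset[of _ "{..<n} \<times> {..<n}"]) auto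
 have "{(i, j). i < j \<and> j < length ds \<and> \<sigma> j < \<sigma> i \<and> odd (ds ! \<sigma> i) \<and> odd (ds ! \<sigma> j)} = {x \<in> ?A. odd (?f x)}"
  using assms by auto
 then have "perm_exp \<sigma> ds = int (card {x \<in> ?A. odd (?f x)})" by (simp add: perm_exp_def)
 moreover have "(\<Sum>x\<in>?A. ?f x) = (\<Sum>x\<in>{..<n} \<times> {..<n}. if fst x < snd x \<and> \<sigma> (snd x) < \<sigma> (fst x) then ?f x else 0)"
  by (rule sum.mono_neutral_cong_left) auto
 moreover have "... = (\<Sum>i<n. \<Sum>j<n. if i < j \<and> \<sigma> j < \<sigma> i then ds ! \<sigma> i * ds ! \<sigma> j else 0)"
  by (subst sum.cartesian_product) (auto intro!: sum.cong)
 ultimately show ?thesis using even_card_filter[OF fin, of ?f] by simp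
qed

lemma sum_list_take: "k \<le> length ds ==> sum_list (take k ds) = (\<Sum>i<k. ds ! i)"
 by (simp add: sum_list_sum_nth atLeast0LessThan)

text \<open>
 Raising the degree of one entry changes the sign of a permutation by the parity of the degrees of
 the entries that this entry passes, and these are the entries that stand before it in exactly one
 of the two lists.
\<close>

lemma perm_exp_raise:
 fixes ds :: "int list"
 assumes \<sigma>: "\<sigma> permutes {..<n}" and n: "length ds = n" and m: "m < n"
 shows "even (perm_exp \<sigma> (ds[\<sigma> m := ds ! \<sigma> m + 1]) + sum_list (take m (permute_list \<sigma> ds)) +
  (perm_exp \<sigma> ds + sum_list (take (\<sigma> m) ds)))"
proof -
 define w where "w i = ds ! \<sigma> i" for i
 define d where "d i = (if i = m then 1 else 0 :: int)" for i
 have \<sigma>n: "\<sigma> i < n" if "i < n" for i using permutes_in_image[OF \<sigma>] that by auto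
 have inj: "\<sigma> i = \<sigma> j \<longleftrightarrow> i = j" for i j using permutes_inj[OF \<sigma>] by (auto dest: injD)
 have w': "ds[\<sigma> m := ds ! \<sigma> m + 1] ! \<sigma> i = w i + d i" if "i < n" for i
  using that m n \<sigma>n by (auto simp: w_def d_def nth_list_update inj)
 let ?I = "%i j. i < j \<and> \<sigma> j < \<sigma> i"
 have 1: "even (perm_exp \<sigma> ds + (\<Sum>i<n. \<Sum>j<n. if ?I i j then w i * w j else 0))"
  using perm_exp_parity[OF n, of \<sigma>] unfolding w_def .
 have "(\<Sum>i<n. \<Sum>j<n. if ?I i j then ds[\<sigma> m := ds ! \<sigma> m + 1] ! \<sigma> i * ds[\<sigma> m := ds ! \<sigma> m + 1] ! \<sigma> j else 0)
   = (\<Sum>i<n. \<Sum>j<n. if ?I i j then (w i + d i) * (w j + d j) else 0)"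
  by (intro sum.cong refl if_cong) (simp_all add: w')
 also have "... = (\<Sum>i<n. \<Sum>j<n. (if ?I i j then w i * w j else 0) +
   ((if j = m then (if ?I i m then w i else 0) else 0) + (if i = m then (if ?I m j then w j else 0) else 0)))"
  by (intro sum.cong refl) (auto simp: d_def algebra_simps)
 also have "... = (\<Sum>i<n. \<Sum>j<n. if ?I i j then w i * w j else 0) +
   ((\<Sum>i<n. if ?I i m then w i else 0) + (\<Sum>i<n. \<Sum>j<n. if i = m then (if ?I m j then w j else 0) else 0))"
  using m by (simp add: sum.distrib)
 also have "(\<Sum>i<n. \<Sum>j<n. if i = m then (if ?I m j then w j else 0) else 0) = (\<Sum>j<n. if ?I m j then w j else 0)"
  by (subst sum.swap) (use m in simp)
 finally have 2: "even (perm_exp \<sigma> (ds[\<sigma> m := ds ! \<sigma> m + 1]) +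
   ((\<Sum>i<n. \<Sum>j<n. if ?I i j then w i * w j else 0) +
   ((\<Sum>i<n. if ?I i m then w i else 0) + (\<Sum>j<n. if ?I m j then w j else 0))))"
  using perm_exp_parity[of "ds[\<sigma> m := ds ! \<sigma> m + 1]" n \<sigma>] n by simp
 have 3: "sum_list (take m (permute_list \<sigma> ds)) = (\<Sum>i<n. if i < m then w i else 0)"
 proof -
  have "sum_list (take m (permute_list \<sigma> ds)) = (\<Sum>i<m. w i)"
   using m n \<sigma> by (simp add: sum_list_take permute_list_nth w_def)
  also have "... = (\<Sum>i<n. if i < m then w i else 0)"
   by (rule sum.mono_neutral_cong_left) (use m in auto)
  finally show ?thesis .
 qed
 have 4: "sum_list (take (\<sigma> m) ds) = (\<Sum>i<n. if \<sigma> i < \<sigma> m then w i else 0)"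
 proof -
  have "sum_list (take (\<sigma> m) ds) = (\<Sum>k<\<sigma> m. ds ! k)"
   using \<sigma>n[OF m] n by (simp add: sum_list_take)
  also have "... = (\<Sum>k<n. if k < \<sigma> m then ds ! k else 0)"
   by (rule sum.mono_neutral_cong_left) (use \<sigma>n[OF m] in auto)
  also have "... = (\<Sum>i<n. if \<sigma> i < \<sigma> m then w i else 0)"
   unfolding w_def using sum.permute[OF \<sigma>, of "%k. if k < \<sigma> m then ds ! k else 0"]
   by (simp add: comp_def)
  finally show ?thesis .
 qed
 have "even ((\<Sum>i<n. if ?I i m then w i else 0) + (\<Sum>j<n. if ?I m j then w j else 0) +
   ((\<Sum>i<n. if i < m then w i else 0) + (\<Sum>i<n. if \<sigma> i < \<sigma> m then w i else 0)))"
  unfolding sum.distrib[symmetric]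
 proof (rule dvd_sum)
  fix i
  show "even ((if ?I i m then w i else 0) + (if ?I m i then w i else 0) +
   ((if i < m then w i else 0) + (if \<sigma> i < \<sigma> m then w i else 0)))"
   using inj[of i m] by (cases i m rule: linorder_cases; cases "\<sigma> i" "\<sigma> m" rule: linorder_cases) auto
 qed
 then show ?thesis using 1 2 unfolding 3 4 by presburger
qed

lemma shuffle_exp_raise_left:
 assumes "k < length ds"
 shows "shuffle_exp (ds[k := ds ! k + 1]) es = shuffle_exp ds es + (\<Sum>i<k. es ! i)"
proof -
 have "shuffle_exp (ds[k := ds ! k + 1]) es =
   (\<Sum>j<length ds. (\<Sum>i<j. ds ! j * es ! i) + (if j = k then \<Sum>i<k. es ! i else 0))"
  unfolding shuffle_exp_def
  by (intro sum.cong) (auto simp: nth_list_update distrib_right sum.distrib)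
 then show ?thesis using assms by (simp add: sum.distrib shuffle_exp_def)
qed

lemma shuffle_exp_raise_right:
 assumes "k < length es" "length es = length ds"
 shows "shuffle_exp ds (es[k := es ! k + 1]) = shuffle_exp ds es + (\<Sum>j\<in>{k<..<length ds}. ds ! j)"
proof -
 have "(\<Sum>i<j. ds ! j * es[k := es ! k + 1] ! i) = (\<Sum>i<j. ds ! j * es ! i) + (if k < j then ds ! j else 0)"
  if "j < length ds" for j
 proof -
  have "(\<Sum>i<j. ds ! j * es[k := es ! k + 1] ! i) = (\<Sum>i<j. ds ! j * es ! i + (if i = k then ds ! j else 0))"
   using that assms by (intro sum.cong) (auto simp: nth_list_update distrib_left)
  then show ?thesis by (simp add: sum.distrib)
 qed
 then have "shuffle_exp ds (es[k := es ! k + 1]) =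
   shuffle_exp ds es + (\<Sum>j<length ds. if k < j then ds ! j else 0)"
  unfolding shuffle_exp_def by (simp add: sum.distrib)
 also have "(\<Sum>j<length ds. if k < j then ds ! j else 0) = (\<Sum>j\<in>{k<..<length ds}. ds ! j)"
  by (rule sum.mono_neutral_cong_right) auto
 finally show ?thesis .
qed

subsection \<open>Concatenations\<close>

abbreviation offset :: "'a list list => nat => nat"
 where "offset xss i \<equiv> length (concat (take i xss))"

lemma sum_list_concat: "sum_list (concat xss) = sum_list (map sum_list xss)"
 by (induction xss) simp_all

lemma concat_split:
 "i < length xss ==> concat xss = concat (take i xss) @ xss ! i @ concat (drop (Suc i) xss)"
 by (metis append_take_drop_id Cons_nth_drop_Suc concat.simps(2) concat_append)

lemma concat_update_split:
 "i < length xss ==> concat (xss[i := ys]) = concat (take i xss) @ ys @ concat (drop (Suc i) xss)"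
 by (simp add: upd_conv_take_nth_drop)

lemma concat_update:
 assumes "i < length xss" "l < length (xss ! i)"
 shows "(concat xss)[offset xss i + l := y] = concat (xss[i := (xss ! i)[l := y]])"
 by (simp add: concat_split[OF assms(1)] concat_update_split[OF assms(1)] list_update_append assms(2))

lemma concat_nth:
 assumes "i < length xss" "l < length (xss ! i)"
 shows "concat xss ! (offset xss i + l) = xss ! i ! l"
 by (simp add: concat_split[OF assms(1)] nth_append assms(2))

lemma offset_bound:
 assumes "i < length xss" "l < length (xss ! i)"
 shows "offset xss i + l < length (concat xss)"
 using assms by (simp add: concat_split[OF assms(1)])

lemma sum_list_concat_nth:
 fixes dss :: "int list list"
 shows "sum_list (concat dss) = (\<Sum>j<length dss. sum_list (dss ! j))"
 unfolding sum_list_concat sum_list_sum_nth[of "map sum_list dss"] atLeast0LessThan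
 by (intro sum.cong) simp_all

lemma sum_list_take_concat:
 assumes "i < length dss" "l \<le> length (dss ! i)"
 shows "sum_list (take (offset dss i + l) (concat dss)) =
  (\<Sum>j<i. sum_list (dss ! j)) + sum_list (take l (dss ! i) :: int list)"
proof -
 have "sum_list (concat (take i dss)) = (\<Sum>j<i. sum_list (dss ! j))"
  unfolding sum_list_concat_nth using assms(1) by (intro sum.cong) simp_all
 then show ?thesis using assms by (simp add: concat_split[OF assms(1)])
qed

lemma (in abelian_monoid) finsum_concat:
 assumes "!!k. k < length (concat xss) ==> g k \<in> carrier G"
 shows "(\<Oplus>k\<in>{..<length (concat xss)}. g k) =
  (\<Oplus>i\<in>{..<length xss}. \<Oplus>l\<in>{..<length (xss ! i)}. g (offset xss i + l))"
proof -
 have "(\<Oplus>k\<in>{..<offset xss n}. g k) = (\<Oplus>i\<in>{..<n}. \<Oplus>l\<in>{..<length (xss ! i)}. g (offset xss i + l))"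
  if "n \<le> length xss" for n
  using that
 proof (induction n)
  case (Suc n)
  then have n: "n < length xss" by simp
  have gc: "g (offset xss i + l) \<in> carrier G" if "i < length xss" "l < length (xss ! i)" for i l
   by (rule assms) (rule offset_bound[OF that])
  have o: "offset xss (Suc n) = offset xss n + length (xss ! n)"
   using n by (simp add: take_Suc_conv_app_nth)
  have le: "offset xss n + length (xss ! n) \<le> length (concat xss)"
   by (simp add: concat_split[OF n])
  have split: "{..<offset xss (Suc n)} = {..<offset xss n} \<union> (%l. offset xss n + l) ` {..<length (xss ! n)}"
   unfolding o by (auto simp: image_iff Bex_def) presburger
  have "(\<Oplus>k\<in>{..<offset xss (Suc n)}. g k) =
   (\<Oplus>k\<in>{..<offset xss n}. g k) \<oplus> (\<Oplus>k\<in>(%l. offset xss n + l) ` {..<length (xss ! n)}. g k)"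
   unfolding split by (rule finsum_Un_disjoint) (use le in \<open>auto intro!: assms\<close>)
  also have "(\<Oplus>k\<in>(%l. offset xss n + l) ` {..<length (xss ! n)}. g k) =
    (\<Oplus>l\<in>{..<length (xss ! n)}. g (offset xss n + l))"
   by (rule finsum_reindex) (use gc n in auto)
  also have "(\<Oplus>k\<in>{..<offset xss n}. g k) = (\<Oplus>i\<in>{..<n}. \<Oplus>l\<in>{..<length (xss ! i)}. g (offset xss i + l))"
   using Suc by simp
  finally show ?case
   unfolding lessThan_Suc
   by (subst finsum_insert) (use n gc in \<open>auto intro!: finsum_closed simp: a_comm Pi_iff\<close>)
 qed simp
 from this[of "length xss"] show ?thesis by simp
qed

subsection \<open>Permuting one block\<close>

definition shift_perm :: "nat => nat => (nat => nat) => nat => nat"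
 where "shift_perm a k \<sigma> i = (if a \<le> i \<and> i < a + k then a + \<sigma> (i - a) else i)"

lemma permute_list_shift:
 assumes "\<sigma> permutes {..<length xs}"
 shows "permute_list (shift_perm (length as) (length xs) \<sigma>) (as @ xs @ cs) = as @ permute_list \<sigma> xs @ cs"
proof (rule nth_equalityI)
 fix i assume "i < length (permute_list (shift_perm (length as) (length xs) \<sigma>) (as @ xs @ cs))"
 then have i: "i < length as + length xs + length cs" by simp
 have \<sigma>: "\<sigma> j < length xs" if "j < length xs" for j using permutes_in_image[OF assms] that by auto
 consider "i < length as" | "length as \<le> i" "i < length as + length xs" | "length as + length xs \<le> i"
  by linarith
 then show "permute_list (shift_perm (length as) (length xs) \<sigma>) (as @ xs @ cs) ! i = (as @ permute_list \<sigma> xs @ cs) ! i"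
 proof cases
  case 2
  then have "i - length as < length xs" by linarith
  then show ?thesis using 2 i \<sigma>[of "i - length as"]
   by (simp add: permute_list_def nth_append shift_perm_def)
 qed (use i in \<open>auto simp: permute_list_def nth_append shift_perm_def\<close>)
qed simp

lemma shift_perm_permutes:
 assumes "\<sigma> permutes {..<k}" "a + k \<le> n"
 shows "shift_perm a k \<sigma> permutes {..<n}"
proof (rule bij_imp_permutes)
 have \<sigma>: "\<sigma> j < k \<longleftrightarrow> j < k" for j using permutes_in_image[OF assms(1)] by auto
 have inj: "inj_on (shift_perm a k \<sigma>) {..<n}"
 proof (rule inj_onI)
  fix x y assume eq: "shift_perm a k \<sigma> x = shift_perm a k \<sigma> y"
  have x: "\<sigma> (x - a) < k" if "a \<le> x" "x < a + k" using that \<sigma>[of "x - a"] by linarith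
  have y: "\<sigma> (y - a) < k" if "a \<le> y" "y < a + k" using that \<sigma>[of "y - a"] by linarith
  show "x = y"
  proof (cases "(a \<le> x \<and> x < a + k) \<and> (a \<le> y \<and> y < a + k)")
   case True
   then have "\<sigma> (x - a) = \<sigma> (y - a)" using eq by (simp add: shift_perm_def)
   then have "x - a = y - a" using permutes_inj[OF assms(1)] by (auto dest: injD)
   then show ?thesis using True by linarith
  next
   case False
   then show ?thesis using eq x y by (auto simp: shift_perm_def split: if_splits)
  qed
 qed
 have sub: "shift_perm a k \<sigma> ` {..<n} \<subseteq> {..<n}"
 proof
  fix y assume "y \<in> shift_perm a k \<sigma> ` {..<n}"
  then obtain x where x: "x < n" "y = shift_perm a k \<sigma> x" by auto
  have "\<sigma> (x - a) < k" if "a \<le> x" "x < a + k" using that \<sigma>[of "x - a"] by linarith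
  then show "y \<in> {..<n}" using x assms(2) by (auto simp: shift_perm_def)
 qed
 show "bij_betw (shift_perm a k \<sigma>) {..<n} {..<n}"
  using inj endo_inj_surj[OF _ sub inj] by (simp add: bij_betw_def)
 show "shift_perm a k \<sigma> x = x" if "x \<notin> {..<n}" for x
  using that assms(2) by (simp add: shift_perm_def)
qed

lemma perm_exp_shift:
 assumes "\<sigma> permutes {..<length ds}"
 shows "perm_exp (shift_perm (length as) (length ds) \<sigma>) (as @ ds @ cs) = perm_exp \<sigma> ds"
proof -
 let ?a = "length as" and ?k = "length ds"
 let ?\<rho> = "shift_perm ?a ?k \<sigma>" and ?ds = "as @ ds @ cs"
 have \<sigma>: "\<sigma> j < ?k" if "j < ?k" for j using permutes_in_image[OF assms] that by auto
 have in1: "shift_perm ?a ?k \<sigma> (?a + i) = ?a + \<sigma> i" if "i < ?k" for i using that by (simp add: shift_perm_def)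
 let ?S = "{(i, j). i < j \<and> j < ?k \<and> \<sigma> j < \<sigma> i \<and> odd (ds ! \<sigma> i) \<and> odd (ds ! \<sigma> j)}"
 let ?T = "{(i, j). i < j \<and> j < length ?ds \<and> ?\<rho> j < ?\<rho> i \<and> odd (?ds ! ?\<rho> i) \<and> odd (?ds ! ?\<rho> j)}"
 have "?T = (%(i, j). (?a + i, ?a + j)) ` ?S"
 proof (rule subset_antisym; rule subsetI)
  fix p assume "p \<in> ?T"
  then obtain i j where p: "p = (i, j)" and ij: "i < j" "j < length ?ds" "?\<rho> j < ?\<rho> i"
   "odd (?ds ! ?\<rho> i)" "odd (?ds ! ?\<rho> j)" by auto
  have in2: "?a \<le> ?\<rho> l \<and> ?\<rho> l < ?a + ?k" if "?a \<le> l" "l < ?a + ?k" for l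
   using that \<sigma>[of "l - ?a"] by (auto simp: shift_perm_def)
  have out: "?\<rho> l = l" if "\<not> (?a \<le> l \<and> l < ?a + ?k)" for l
   using that by (auto simp: shift_perm_def)
  have "?a \<le> i"
  proof (rule ccontr)
   assume "\<not> ?a \<le> i"
   then show False using ij(1,3) out[of i] out[of j] in2[of j] by linarith
  qed
  moreover have "j < ?a + ?k"
  proof (rule ccontr)
   assume "\<not> j < ?a + ?k"
   then show False using ij(1,3) out[of j] out[of i] in2[of i] by linarith
  qed
  ultimately have "i - ?a < ?k" "j - ?a < ?k" "i = ?a + (i - ?a)" "j = ?a + (j - ?a)" using ij(1) by auto
  then obtain i' j' where ij': "i = ?a + i'" "j = ?a + j'" "i' < ?k" "j' < ?k" by metis
  have "(i', j') \<in> ?S" using ij ij' \<sigma> by (auto simp: in1 nth_append)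
  then show "p \<in> (%(i, j). (?a + i, ?a + j)) ` ?S" using p ij' by force
 next
  fix p assume "p \<in> (%(i, j). (?a + i, ?a + j)) ` ?S"
  then obtain i j where p: "p = (?a + i, ?a + j)" and ij: "i < j" "j < ?k" "\<sigma> j < \<sigma> i"
   "odd (ds ! \<sigma> i)" "odd (ds ! \<sigma> j)" by auto
  then have "i < ?k" by simp
  then show "p \<in> ?T"
   unfolding p using ij \<sigma>[OF \<open>i < ?k\<close>] \<sigma>[OF ij(2)] by (simp add: in1 nth_append)
 qed
 moreover have "inj_on (%(i, j). (?a + i, ?a + j)) ?S" by (auto simp: inj_on_def)
 ultimately have "card ?T = card ?S" by (simp add: card_image)
 then show ?thesis by (simp only: perm_exp_def)
qed

lemma concat_blocks: "concat (map (%i. [sum_list (take i ks)..<sum_list (take (Suc i) ks)]) [0..<n]) = [0..<sum_list (take n ks)]"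
 if "n \<le> length ks" for ks :: "nat list"
 using that
proof (induction n)
 case (Suc n)
 then have n: "n < length ks" by simp
 have *: "sum_list (take (Suc n) ks) = sum_list (take n ks) + ks ! n"
  by (simp add: take_Suc_conv_app_nth[OF n])
 have "[0..<sum_list (take n ks) + ks ! n] =
   [0..<sum_list (take n ks)] @ [sum_list (take n ks)..<sum_list (take n ks) + ks ! n]"
  by (rule upt_add_eq_append) simp
 then show ?case using Suc * by simp
qed simp

text \<open>For the equivariance of a composite in one of its arguments: the others are permuted by the identity.\<close>

lemma sum_perm_single:
 assumes i: "i < length ks" and \<sigma>: "\<sigma> permutes {..<ks ! i}"
 shows "sum_perm ks ((replicate (length ks) id)[i := \<sigma>]) = shift_perm (sum_list (take i ks)) (ks ! i) \<sigma>"
proof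
 fix x
 let ?n = "length ks" and ?a = "sum_list (take i ks)" and ?\<tau>s = "(replicate (length ks) id)[i := \<sigma>]"
 let ?\<rho> = "shift_perm ?a (ks ! i) \<sigma>"
 let ?b = "%j. [sum_list (take j ks)..<sum_list (take (Suc j) ks)]"
 have mono: "sum_list (take j ks) \<le> sum_list (take l ks)" if "j \<le> l" for j l
  using that by (metis append_take_drop_id le_add1 min.absorb1 sum_list_append take_take)
 have Suc: "sum_list (take (Suc j) ks) = sum_list (take j ks) + ks ! j" if "j < ?n" for j
  using that by (simp add: take_Suc_conv_app_nth)
 have "map2 permute_list ?\<tau>s (blocks ks) = map (map ?\<rho>) (blocks ks)"
 proof (rule nth_equalityI)
  fix j assume "j < length (map2 permute_list ?\<tau>s (blocks ks))"
  then have j: "j < ?n" by (simp add: blocks_def)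
  have *: "map2 permute_list ?\<tau>s (blocks ks) ! j = permute_list (?\<tau>s ! j) (?b j)"
   using j by (simp add: blocks_def del: upt_Suc)
  show "map2 permute_list ?\<tau>s (blocks ks) ! j = map (map ?\<rho>) (blocks ks) ! j"
  proof (cases "j = i")
   case True
   have "permute_list \<sigma> (?b i) = map ?\<rho> (?b i)"
   proof (rule nth_equalityI)
    fix l assume "l < length (permute_list \<sigma> (?b i))"
    then have l: "l < ks ! i" using Suc[OF i] by simp
    then have "\<sigma> l < ks ! i" using permutes_in_image[OF \<sigma>] by auto
    then show "permute_list \<sigma> (?b i) ! l = map ?\<rho> (?b i) ! l"
     using l by (simp add: permute_list_def Suc[OF i] shift_perm_def)
   qed simp
   then show ?thesis unfolding * using True i by (simp add: blocks_def)
  next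
   case False
   have "?\<rho> y = y" if "y \<in> set (?b j)" for y
   proof (cases "j < i")
    case True
    then show ?thesis using that mono[of "Suc j" i] by (auto simp: shift_perm_def)
   next
    case False
    then have "Suc i \<le> j" using \<open>j \<noteq> i\<close> by simp
    then show ?thesis using that mono[of "Suc i" j] Suc[OF i] by (auto simp: shift_perm_def)
   qed
   then have "map ?\<rho> (?b j) = ?b j" by (intro map_idI)
   then show ?thesis unfolding * using False j by (simp add: blocks_def)
  qed
 qed (simp add: blocks_def)
 moreover have "concat (blocks ks) = [0..<sum_list ks]"
  using concat_blocks[of "length ks" ks] by (simp add: blocks_def)
 ultimately have "concat (map2 permute_list ?\<tau>s (blocks ks)) = map ?\<rho> [0..<sum_list ks]"
  by (metis map_concat)
 moreover have "?\<rho> x = x" if "\<not> x < sum_list ks"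
  using that mono[of "Suc i" ?n] Suc[OF i] i by (auto simp: shift_perm_def)
 ultimately show "sum_perm ks ?\<tau>s x = ?\<rho> x" by (simp add: sum_perm_def)
qed

lemma finite_mset_fibre: "finite {js. mset js = \<alpha>}"
proof -
 have "{js. mset js = \<alpha>} \<subseteq> {js. set js \<subseteq> set_mset \<alpha> \<and> length js = size \<alpha>}"
  by auto
 then show ?thesis by (rule finite_subset) (rule finite_lists_length_eq, simp)
qed

section \<open>Complexes, operads and their algebras\<close>

lemma elements_replicate: "elements (replicate n A) as \<longleftrightarrow> length as = n \<and> set as \<subseteq> carrier A"
 by (auto simp: elements_def list_all2_conv_all_nth set_conv_nth)

lemma homs_iff:
 "homs n A as ds \<longleftrightarrow> length as = n \<and> length ds = n \<and> (\<forall>i<n. as ! i \<in> grade A (ds ! i))"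
 by (auto simp: homogeneous_def)

lemma elements_map_op_space:
 "elements (map (op_space P) ks) qs \<longleftrightarrow> length qs = length ks \<and> (\<forall>i<length ks. qs ! i \<in> opc P (ks ! i))"
 by (auto simp: elements_def list_all2_conv_all_nth)

lemma homogeneous_ops:
 "homogeneous (map (op_space P) ks) qs ds \<longleftrightarrow> length qs = length ks \<and> length ds = length ks \<and>
  (\<forall>i<length ks. qs ! i \<in> opg P (ks ! i) (ds ! i))"
 by (auto simp: homogeneous_def)

sublocale graded_space \<subseteq> direct_sum R X "grade X"
 by unfold_locales (rule grading)

context graded_space
begin

lemma grade_closed: "x \<in> grade X i ==> x \<in> carrier X"
 using summandD(1) by blast

lemma grade_unique: "[|x \<in> grade X i; x \<in> grade X j; i \<noteq> j|] ==> x = \<zero>\<^sub>X"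
 using component_of[of x i j] component_of[of x j j] by auto

lemma hpart_of: "x \<in> grade X j ==> hpart X x i = (if i = j then x else \<zero>\<^sub>X)"
 unfolding hpart_component by (rule component_of)

lemma deg_of: "[|x \<in> grade X j; x \<noteq> \<zero>\<^sub>X |] ==> deg X x = j"
 unfolding deg_def by (rule some_equality) (use grade_unique in blast)+

end

lemma cochain_complexD:
 assumes "cochain_complex R X"
 shows complex_graded: "graded_space R X" and complex_module: "module R X"
  and complex_diff_linear: "linear_map R X X (diff X)"
  and complex_diff_grade: "x \<in> grade X i ==> diff X x \<in> grade X (i + 1)"
  and complex_diff_diff: "x \<in> carrier X ==> diff X (diff X x) = \<zero>\<^sub>X"
proof -
 interpret cochain_complex R X by fact
 show "graded_space R X" by unfold_locales
 show "module R X" by unfold_locales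
qed (use assms in \<open>auto simp: cochain_complex_def cochain_complex_axioms_def\<close>)

lemma graded_spaceD:
 assumes "graded_space R X"
 shows graded_module: "module R X" and graded_field: "field R"
  and graded_grade_closed: "x \<in> grade X i ==> x \<in> carrier X"
  and graded_submodule: "submodule (grade X i) R X"
  and graded_direct_sum: "direct_sum R X (grade X)"
proof -
 interpret graded_space R X by fact
 show "module R X" by (rule module_axioms)
 show "field R" by (rule field_axioms)
 show "x \<in> carrier X" if "x \<in> grade X i" using that by (rule grade_closed)
 show "submodule (grade X i) R X" by (rule summand_submodule)
 show "direct_sum R X (grade X)" by (rule direct_sum_axioms)
qed

lemma chain_mapD:
 assumes "chain_map R X Y f"
 shows chain_map_linear: "linear_map R X Y f"
  and chain_map_source: "cochain_complex R X" and chain_map_target: "cochain_complex R Y"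
  and chain_map_grade: "x \<in> grade X i ==> f x \<in> grade Y i"
  and chain_map_diff: "x \<in> carrier X ==> f (diff X x) = diff Y (f x)"
 using assms by (auto simp: chain_map_def)

lemma hpart_commute:
 assumes "graded_space R X" "graded_space R Y" "linear_map R X Y f"
  and "!!i x. x \<in> grade X i ==> f x \<in> grade Y (i + k)" "x \<in> carrier X"
 shows "hpart Y (f x) (i + k) = f (hpart X x i)"
 unfolding hpart_component
 by (rule linear_map_component[OF graded_direct_sum[OF assms(1)] graded_direct_sum[OF assms(2)] assms(3),
    where s="%i. i + k"]) (auto simp: assms inj_on_def)

subsection \<open>Multilinear maps\<close>

text \<open>Induction on the number of arguments that need not be generators.\<close>

lemma multilinear_eqI:
 assumes M: "module R M" and Z: "module R Z"
  and S: "!!i. i < n ==> S i \<subseteq> carrier M"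
  and f: "!!i as. [|i < n; length as = n; !!j. j < n ==> as ! j \<in> generated_submodule R M (S j)|] ==>
   linear_map R (M\<lparr>carrier := generated_submodule R M (S i)\<rparr>) Z (%a. f (as[i := a]))"
  and g: "!!i as. [|i < n; length as = n; !!j. j < n ==> as ! j \<in> generated_submodule R M (S j)|] ==>
   linear_map R (M\<lparr>carrier := generated_submodule R M (S i)\<rparr>) Z (%a. g (as[i := a]))"
  and eq: "!!as. [|length as = n; !!j. j < n ==> as ! j \<in> S j|] ==> f as = g as"
  and as: "length as = n" "!!j. j < n ==> as ! j \<in> generated_submodule R M (S j)"
 shows "f as = g as"
proof -
 interpret M: module R M by fact
 interpret Z: module R Z by fact
 have "f as = g as" if "k \<le> n" "length as = n" "!!j. j < n ==> as ! j \<in> generated_submodule R M (S j)"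
  "!!j. [|k \<le> j; j < n|] ==> as ! j \<in> S j" for k as
  using that
 proof (induction k arbitrary: as)
  case 0
  then show ?case using eq by blast
 next
  case (Suc k)
  then have k: "k < n" by simp
  let ?H = "generated_submodule R M (S k)"
  have H: "submodule ?H R M" by (rule M.generated_sub[OF S[OF k]])
  note D = submoduleD[OF M H]
  have mH: "module R (M\<lparr>carrier := ?H\<rparr>)" by (rule submodule_restrict_module[OF M H])
  note lf = f[OF k Suc.prems(2,3)] and lg = g[OF k Suc.prems(2,3)]
  have step: "f (as[k := a]) = g (as[k := a])" if "a \<in> S k" for a
  proof (rule Suc.IH)
   show "as[k := a] ! j \<in> generated_submodule R M (S j)" if "j < n" for j
    using that \<open>a \<in> S k\<close> M.generated_incl Suc.prems(2,3)[of ] by (cases "j = k") auto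
   show "as[k := a] ! j \<in> S j" if "k \<le> j" "j < n" for j
    using that \<open>a \<in> S k\<close> Suc.prems(2,4) by (cases "j = k") auto
  qed (use k Suc.prems in auto)
  have "a \<in> ?H \<and> f (as[k := a]) = g (as[k := a])" if "a \<in> ?H" for a
   using that S[OF k]
  proof (induction rule: M.generated_induct)
   case (gen x)
   then show ?case using step M.generated_incl by blast
  next
   case zero
   show ?case using lin_zero[OF mH Z lf] lin_zero[OF mH Z lg] D(2) by simp
  next
   case (add x y)
   then show ?case using lin_add[OF lf, of x y] lin_add[OF lg, of x y] D(3) by simp
  next
   case (smult r x)
   then show ?case using lin_smult[OF lf, of r x] lin_smult[OF lg, of r x] D(4) by simp
  qed
  from this[of "as ! k"] show ?case using Suc.prems(3)[OF k] by simp
 qed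
 from this[of n] show ?thesis using as by simp
qed

context dg_operad
begin

lemma op_module: "module R (op_space P n)" and op_graded: "graded_space R (op_space P n)"
 and op_diff_linear: "linear_map R (op_space P n) (op_space P n) (diff (op_space P n))"
 and op_diff_grade: "p \<in> opg P n e ==> diff (op_space P n) p \<in> opg P n (e + 1)"
 and op_diff_diff: "p \<in> opc P n ==> diff (op_space P n) (diff (op_space P n) p) = \<zero>\<^bsub>op_space P n\<^esub>"
 by (rule complex_module complex_graded complex_diff_linear complex_diff_grade complex_diff_diff;
   (rule op_complex | assumption))+

lemmas opg_closed = graded_grade_closed[OF op_graded]

lemma op_sym_linear: "\<sigma> permutes {..<n} ==> linear_map R (op_space P n) (op_space P n) (%p. op_sym P n p \<sigma>)"
 and op_sym_grade: "[|\<sigma> permutes {..<n}; p \<in> opg P n e|] ==> op_sym P n p \<sigma> \<in> opg P n e"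
 and op_sym_diff: "[|\<sigma> permutes {..<n}; p \<in> opc P n|] ==>
  op_sym P n (diff (op_space P n) p) \<sigma> = diff (op_space P n) (op_sym P n p \<sigma>)"
 using chain_mapD[OF sym_chain_map] by blast+

lemma unit_grade: "op_unit P \<in> opg P 1 0"
 and unit_diff: "diff (op_space P 1) (op_unit P) = \<zero>\<^bsub>op_space P 1\<^esub>"
 using unit_cocycle by (auto simp: cocycles_def)

lemma comp_linear_op:
 "[|length qs = length ks; !!i. i < length ks ==> qs ! i \<in> opc P (ks ! i)|] ==>
  linear_map R (op_space P (length ks)) (op_space P (sum_list ks)) (%p. op_comp P ks p qs)"
 using comp_multilinear[of ks] by (simp add: dg_multilinear_def elements_map_op_space)

lemma comp_linear_arg:
 "[|p \<in> opc P (length ks); length qs = length ks;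
  !!i. i < length ks ==> qs ! i \<in> opc P (ks ! i); i < length ks|] ==>
  linear_map R (op_space P (ks ! i)) (op_space P (sum_list ks)) (%q. op_comp P ks p (qs[i := q]))"
 using comp_multilinear[of ks] by (simp add: dg_multilinear_def elements_map_op_space)

lemma comp_closed:
 "[|p \<in> opc P (length ks); length qs = length ks;
  !!i. i < length ks ==> qs ! i \<in> opc P (ks ! i)|] ==>
  op_comp P ks p qs \<in> opc P (sum_list ks)"
 using lin_closed[OF comp_linear_op] by blast

lemma comp_grade:
 "[|p \<in> opg P (length ks) e; homogeneous (map (op_space P) ks) qs ds|] ==>
  op_comp P ks p qs \<in> opg P (sum_list ks) (e + sum_list ds)"
 using comp_multilinear[of ks] by (auto simp: dg_multilinear_def)

lemma comp_diff:
 "[|p \<in> opg P (length ks) e; homogeneous (map (op_space P) ks) qs ds|] ==>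
  diff (op_space P (sum_list ks)) (op_comp P ks p qs) =
  leibniz (op_space P (length ks)) (map (op_space P) ks) (op_space P (sum_list ks)) (op_comp P ks) e ds p qs"
 using comp_multilinear[of ks] by (auto simp: dg_multilinear_def)

end

context p_algebra
begin

lemma alg_module: "module R A" by (rule module_axioms)

lemma alg_graded: "graded_space R A" by unfold_locales

lemma act_linear_op:
 "[|length as = n; set as \<subseteq> carrier A|] ==> linear_map R (op_space P n) A (%p. act A p as)"
 using act_multilinear[of n] by (auto simp: dg_multilinear_def elements_replicate)

lemma act_linear_arg:
 "[|p \<in> opc P n; length as = n; set as \<subseteq> carrier A; i < n|] ==>
  linear_map R A A (%a. act A p (as[i := a]))"
 using act_multilinear[of n] by (auto simp: dg_multilinear_def elements_replicate)

lemma act_closed: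
 "[|p \<in> opc P n; length as = n; set as \<subseteq> carrier A|] ==> act A p as \<in> carrier A"
 using lin_closed[OF act_linear_op] by blast

lemma act_grade:
 "[|p \<in> opg P n e; homs n A as ds|] ==> act A p as \<in> grade A (e + sum_list ds)"
 using act_multilinear[of n] by (auto simp: dg_multilinear_def)

lemma act_diff:
 "[|p \<in> opg P n e; homs n A as ds|] ==>
  diff A (act A p as) = leibniz (op_space P n) (replicate n A) A (act A) e ds p as"
 using act_multilinear[of n] by (auto simp: dg_multilinear_def)

lemma act_zero_op:
 "[|length as = n; set as \<subseteq> carrier A|] ==> act A \<zero>\<^bsub>op_space P n\<^esub> as = \<zero>\<^sub>A"
 using lin_zero[OF op_module alg_module act_linear_op] by blast

lemma act_zero_arg:
 assumes "p \<in> opc P n" "length as = n" "set as \<subseteq> carrier A" "i < n" "as ! i = \<zero>\<^sub>A"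
 shows "act A p as = \<zero>\<^sub>A"
 using lin_zero[OF alg_module alg_module act_linear_arg[OF assms(1-4)]] assms(5)
 by (metis list_update_id)

end

subsection \<open>Derivations\<close>

text \<open>
 A derivation here covers the differential of the operad, so that the differential of an algebra is
 a derivation that squares to zero.
\<close>

definition p_derivation ::
 "('k, 'c) ring_scheme => ('k, 'p) operad => ('k, 'p, 'a) dg_algebra => ('a => 'a) => bool"
 where "p_derivation R P A D \<longleftrightarrow> linear_map R A A D \<and> (\<forall>i. \<forall>x\<in>grade A i. D x \<in> grade A (i + 1)) \<and>
  (\<forall>n p e as ds. p \<in> opg P n e --> homs n A as ds -->
   D (act A p as) = act A (diff (op_space P n) p) as \<oplus>\<^sub>A
    (\<Oplus>\<^sub>A i\<in>{..<n}. ksign A (e + sum_list (take i ds)) (act A p (as[i := D (as ! i)]))))"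

lemma p_derivationD:
 assumes "p_derivation R P A D"
 shows derivation_linear: "linear_map R A A D"
  and derivation_grade: "x \<in> grade A i ==> D x \<in> grade A (i + 1)"
  and derivation_act: "[|p \<in> opg P n e; homs n A as ds|] ==>
   D (act A p as) = act A (diff (op_space P n) p) as \<oplus>\<^sub>A
    (\<Oplus>\<^sub>A i\<in>{..<n}. ksign A (e + sum_list (take i ds)) (act A p (as[i := D (as ! i)])))"
 using assms by (auto simp: p_derivation_def)

context p_algebra
begin

lemma leibniz_replicate:
 assumes "p \<in> opc P n" "length as = n" "set as \<subseteq> carrier A"
  and "!!i. i < n ==> D (as ! i) \<in> carrier A" "diff A' = D"
 shows "leibniz (op_space P n) (replicate n A') A (act A) e ds p as =
  act A (diff (op_space P n) p) as \<oplus>\<^sub>A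
   (\<Oplus>\<^sub>A i\<in>{..<n}. ksign A (e + sum_list (take i ds)) (act A p (as[i := D (as ! i)])))"
proof -
 have "(\<Oplus>\<^sub>A i\<in>{..<n}. ksign A (e + sum_list (take i ds)) (act A p (as[i := diff (replicate n A' ! i) (as ! i)]))) =
   (\<Oplus>\<^sub>A i\<in>{..<n}. ksign A (e + sum_list (take i ds)) (act A p (as[i := D (as ! i)])))"
  by (rule finsum_cong')
   (use assms lin_closed[OF act_linear_arg[OF assms(1-3)]] in auto)
 then show ?thesis by (simp add: leibniz_def)
qed

lemma homogeneous_closed: "homs n A as ds ==> set as \<subseteq> carrier A"
 unfolding homs_iff by (metis grade_closed in_set_conv_nth subsetI)

lemma diff_derivation: "p_derivation R P A (diff A)"
 unfolding p_derivation_def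
proof (intro conjI allI ballI impI)
 show "linear_map R A A (diff A)" by (rule diff_linear)
 show "diff A x \<in> grade A (i + 1)" if "x \<in> grade A i" for i x using that by (rule diff_grade)
 fix n p e as ds assume p: "p \<in> opg P n e" and as: "homs n A as ds"
 have "length as = n" using as by (simp add: homs_iff)
 then have cl: "diff A (as ! i) \<in> carrier A" if "i < n" for i
  using that homogeneous_closed[OF as] lin_closed[OF diff_linear] by (metis nth_mem subsetD)
 show "diff A (act A p as) = act A (diff (op_space P n) p) as \<oplus>\<^sub>A
   (\<Oplus>\<^sub>A i\<in>{..<n}. ksign A (e + sum_list (take i ds)) (act A p (as[i := diff A (as ! i)])))"
  unfolding act_diff[OF p as]
  by (rule leibniz_replicate) (use \<open>length as = n\<close> homogeneous_closed[OF as] cl opg_closed[OF p] in auto)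
qed

end

subsection \<open>Changing the differential and restricting to a subalgebra\<close>

definition same_structure :: "('k, 'v, 'd) module_scheme => ('k, 'v, 'e) module_scheme => bool"
 where "same_structure N M \<longleftrightarrow> carrier N = carrier M \<and> zero N = zero M \<and> add N = add M \<and> smult N = smult M"

lemma same_structureD:
 assumes "same_structure N M"
 shows same_finsum: "finsum N = finsum M" and same_neg: "a_inv N = a_inv M" and same_ksign: "ksign N = ksign M"
proof -
 show "finsum N = finsum M"
  using assms by (intro ext) (simp add: same_structure_def finsum_def finprod_def)
 show "a_inv N = a_inv M"
  using assms by (intro ext) (simp add: same_structure_def a_inv_def m_inv_def)
 then show "ksign N = ksign M"
  by (simp add: ksign_def fun_eq_iff)
qed

lemma same_structure_simps:
 assumes "same_structure N M"
 shows "carrier N = carrier M" "zero N = zero M" "add N = add M" "smult N = smult M"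
 using assms by (simp_all add: same_structure_def)

lemma same_structure_module:
 assumes "module R M" "same_structure N M"
 shows "module R N"
proof -
 interpret M: module R M by fact
 note s = same_structure_simps[OF assms(2)]
 show ?thesis
 proof (rule moduleI)
  show "abelian_group N"
   by (rule abelian_groupI)
    (use M.M.a_assoc M.M.a_comm M.M.add.l_inv_ex in \<open>auto simp: s\<close>)
 qed (use s M.smult_l_distr M.smult_r_distr M.smult_assoc1 M.smult_closed in \<open>auto intro: M.is_cring\<close>)
qed

lemma same_structure_linear:
 "same_structure M' M ==> linear_map R M' N = linear_map R M N"
 "same_structure N' N ==> linear_map R M N' = linear_map R M N"
 by (simp_all add: linear_map_def same_structure_def fun_eq_iff)

lemma cochain_complexI:
 assumes "graded_space R X" "linear_map R X X (diff X)"
  and "!!x i. x \<in> grade X i ==> diff X x \<in> grade X (i + 1)"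
  and "!!x. x \<in> carrier X ==> diff X (diff X x) = \<zero>\<^sub>X"
 shows "cochain_complex R X"
 using assms by (simp add: cochain_complex_def cochain_complex_axioms_def)

section \<open>Free algebras\<close>

subsection \<open>Quotient modules\<close>

lemma (in module) minus_zero_iff:
 assumes "x \<in> carrier M" "y \<in> carrier M"
 shows "x \<ominus>\<^sub>M y = \<zero>\<^sub>M \<longleftrightarrow> x = y"
 using assms unfolding a_minus_def by (metis add.inv_closed M.minus_equality M.minus_minus M.r_neg)

lemma submodule_abelian_subgroup:
 assumes "module R M" "submodule N R M"
 shows "abelian_subgroup N M"
proof -
 interpret M: module R M by fact
 show ?thesis
  by (rule abelian_subgroupI3)
   (use submodule.axioms(1)[OF assms(2)] M.abelian_group_axioms in \<open>simp_all add: additive_subgroup_def\<close>)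
qed

lemma quotient_module_facts:
 assumes "module R M" "submodule N R M"
 shows quotient_is_module: "module R (quotient_module M N)"
  and coset_linear: "linear_map R M (quotient_module M N) (%x. N +>\<^sub>M x)"
  and quotient_carrier: "carrier (quotient_module M N) = (%x. N +>\<^sub>M x) ` carrier M"
  and coset_eq_iff: "[|x \<in> carrier M; y \<in> carrier M|] ==> N +>\<^sub>M x = N +>\<^sub>M y \<longleftrightarrow> x \<ominus>\<^sub>M y \<in> N"
  and coset_mem_iff: "x \<in> carrier M ==> y \<in> N +>\<^sub>M x \<longleftrightarrow> y \<in> carrier M \<and> y \<ominus>\<^sub>M x \<in> N"
proof -
 interpret M: module R M by fact
 interpret S: abelian_subgroup N M by (rule submodule_abelian_subgroup[OF assms])
 note D = submoduleD[OF assms]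
 let ?Q = "quotient_module M N"
 show car: "carrier ?Q = (%x. N +>\<^sub>M x) ` carrier M"
  by (auto simp: quotient_module_def A_RCOSETS_def RCOSETS_def a_r_coset_def)
 show mem: "y \<in> N +>\<^sub>M x \<longleftrightarrow> y \<in> carrier M \<and> y \<ominus>\<^sub>M x \<in> N" if x: "x \<in> carrier M" for x y
 proof (cases "y \<in> carrier M")
  case True
  then show ?thesis using S.a_rcos_module[OF x True] by (simp add: a_minus_def)
 next
  case False
  then show ?thesis using S.a_elemrcos_carrier[OF x] by blast
 qed
 show eqi: "N +>\<^sub>M x = N +>\<^sub>M y \<longleftrightarrow> x \<ominus>\<^sub>M y \<in> N" if x: "x \<in> carrier M" and y: "y \<in> carrier M" for x y
 proof
  assume "N +>\<^sub>M x = N +>\<^sub>M y"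
  then show "x \<ominus>\<^sub>M y \<in> N" using mem[OF y, of x] S.a_rcos_self[OF x] by simp
 next
  assume "x \<ominus>\<^sub>M y \<in> N"
  then have "x \<in> N +>\<^sub>M y" using mem[OF y] x by simp
  then show "N +>\<^sub>M x = N +>\<^sub>M y" using S.a_repr_independence'[OF _ y] by blast
 qed
 have add: "(N +>\<^sub>M x) \<oplus>\<^sub>?Q (N +>\<^sub>M y) = N +>\<^sub>M (x \<oplus>\<^sub>M y)" if "x \<in> carrier M" "y \<in> carrier M" for x y
  using S.a_rcos_sum[OF that] by (simp add: quotient_module_def)
 have sm: "r \<odot>\<^sub>?Q (N +>\<^sub>M x) = N +>\<^sub>M (r \<odot>\<^sub>M x)" if r: "r \<in> carrier R" and x: "x \<in> carrier M" for r x
 proof -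
  have const: "N +>\<^sub>M (r \<odot>\<^sub>M c) = N +>\<^sub>M (r \<odot>\<^sub>M x)" if "c \<in> N +>\<^sub>M x" for c
  proof -
   have c: "c \<in> carrier M" "c \<ominus>\<^sub>M x \<in> N" using that mem[OF x] by auto
   have "r \<odot>\<^sub>M c \<ominus>\<^sub>M r \<odot>\<^sub>M x = r \<odot>\<^sub>M (c \<ominus>\<^sub>M x)"
    using r x c by (simp add: a_minus_def M.smult_r_distr M.smult_r_minus)
   then show ?thesis using eqi[of "r \<odot>\<^sub>M c" "r \<odot>\<^sub>M x"] r x c D(4)[OF r c(2)] by simp
  qed
  have "(\<Union>c\<in>N +>\<^sub>M x. N +>\<^sub>M (r \<odot>\<^sub>M c)) = N +>\<^sub>M (r \<odot>\<^sub>M x)"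
   using S.a_rcos_self[OF x] const by (intro UN_constant_eq ballI)
  then show ?thesis by (simp add: quotient_module_def)
 qed
 have z: "\<zero>\<^sub>?Q = N +>\<^sub>M \<zero>\<^sub>M"
  using D(1) by (simp add: quotient_module_def M.a_coset_add_zero)
 show "module R ?Q"
 proof (rule moduleI)
  show "cring R" by (rule M.is_cring)
  show "abelian_group ?Q"
  proof (rule abelian_groupI)
   fix C assume "C \<in> carrier ?Q"
   then obtain x where x: "x \<in> carrier M" "C = N +>\<^sub>M x" using car by auto
   then have "(N +>\<^sub>M (\<ominus>\<^sub>M x)) \<oplus>\<^sub>?Q C = \<zero>\<^sub>?Q" by (simp add: add z M.l_neg)
   then show "\<exists>C'\<in>carrier ?Q. C' \<oplus>\<^sub>?Q C = \<zero>\<^sub>?Q" using x car by blast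
  qed (auto simp: car add z M.add.m_ac)
 qed (auto simp: car add sm M.smult_l_distr M.smult_r_distr M.smult_assoc1)
 show "linear_map R M ?Q (%x. N +>\<^sub>M x)"
  by (rule linear_mapI) (auto simp: car add sm)
qed

subsection \<open>The space spanned by the words\<close>

text \<open>
 The conditions under which values on words extend to the free algebra: multilinearity and
 equivariance on homogeneous arguments.
\<close>

definition respects_relations ::
 "('k, 'c) ring_scheme => ('k, 'p) operad => ('k, 'v, 'd) dgvs_scheme => ('k, 'z, 'f) module_scheme =>
  ('p => 'v list => 'z) => bool"
 where "respects_relations R P X Z \<phi> \<longleftrightarrow>
  (\<forall>n p e vs ds. p \<in> opg P n e --> homs n X vs ds -->
   \<phi> p vs \<in> carrier Z \<and>
   (\<forall>p'\<in>opg P n e. \<phi> (p \<oplus>\<^bsub>op_space P n\<^esub> p') vs = \<phi> p vs \<oplus>\<^sub>Z \<phi> p' vs) \<and>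
   (\<forall>r\<in>carrier R. \<phi> (r \<odot>\<^bsub>op_space P n\<^esub> p) vs = r \<odot>\<^sub>Z \<phi> p vs) \<and>
   (\<forall>i<n. \<forall>v\<in>grade X (ds ! i). \<phi> p (vs[i := vs ! i \<oplus>\<^sub>X v]) = \<phi> p vs \<oplus>\<^sub>Z \<phi> p (vs[i := v])) \<and>
   (\<forall>i<n. \<forall>r\<in>carrier R. \<phi> p (vs[i := r \<odot>\<^sub>X vs ! i]) = r \<odot>\<^sub>Z \<phi> p vs) \<and>
   (\<forall>\<sigma>. \<sigma> permutes {..<n} --> \<phi> (op_sym P n p \<sigma>) (permute_list \<sigma> vs) = ksign Z (perm_exp \<sigma> ds) (\<phi> p vs)))"

lemma respects_relationsD:
 assumes "respects_relations R P X Z \<phi>" "p \<in> opg P n e" "homs n X vs ds"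
 shows respects_closed: "\<phi> p vs \<in> carrier Z"
  and respects_op_add: "p' \<in> opg P n e ==> \<phi> (p \<oplus>\<^bsub>op_space P n\<^esub> p') vs = \<phi> p vs \<oplus>\<^sub>Z \<phi> p' vs"
  and respects_op_smult: "r \<in> carrier R ==> \<phi> (r \<odot>\<^bsub>op_space P n\<^esub> p) vs = r \<odot>\<^sub>Z \<phi> p vs"
  and respects_arg_add: "[|i < n; v \<in> grade X (ds ! i)|] ==>
   \<phi> p (vs[i := vs ! i \<oplus>\<^sub>X v]) = \<phi> p vs \<oplus>\<^sub>Z \<phi> p (vs[i := v])"
  and respects_arg_smult: "[|i < n; r \<in> carrier R|] ==> \<phi> p (vs[i := r \<odot>\<^sub>X vs ! i]) = r \<odot>\<^sub>Z \<phi> p vs"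
  and respects_sym: "\<sigma> permutes {..<n} ==>
   \<phi> (op_sym P n p \<sigma>) (permute_list \<sigma> vs) = ksign Z (perm_exp \<sigma> ds) (\<phi> p vs)"
 using assms(1)[unfolded respects_relations_def, rule_format, OF assms(2,3)] by blast+

definition lincomb :: "('k, 'c) ring_scheme => ('k, 'z, 'f) module_scheme => ('w => 'z) => ('w => 'k) => 'z"
 where "lincomb R Z g c = (\<Oplus>\<^sub>Z w\<in>support R c. c w \<odot>\<^sub>Z g w)"

lemma extend_lincomb: "extend R Z \<phi> C = lincomb R Z (%w. \<phi> (fst w) (snd w)) (representative C)"
 by (simp add: extend_def lincomb_def)

locale free_gens = dg_operad R P + X: graded_space R X
 for R :: "('k, 'c) ring_scheme" and P :: "('k, 'p) operad" and X :: "('k, 'v) dgvs"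
begin

abbreviation "Fm \<equiv> formal R P X"
abbreviation "Rel \<equiv> relations R P X"
abbreviation "M \<equiv> free_module R P X"
abbreviation "T \<equiv> tens R P X"

lemma wordI: "[|p \<in> opg P n e; homs n X vs ds|] ==> (p, vs) \<in> words P X"
 by (auto simp: words_def homs_iff)

lemma wordE:
 assumes "(p, vs) \<in> words P X"
 obtains e ds where "p \<in> opg P (length vs) e" "homs (length vs) X vs ds"
 using assms by (auto simp: words_def)

lemma homogeneous_update:
 "[|homs n X vs ds; v \<in> grade X e|] ==> homs n X (vs[i := v]) (ds[i := e])"
 unfolding homs_iff by (metis length_list_update nth_list_update_eq nth_list_update_neq)

lemma homs_update_same:
 "[|homs n X vs ds; v \<in> grade X (ds ! i)|] ==> homs n X (vs[i := v]) ds"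
 using homogeneous_update[of n vs ds v "ds ! i" i] by simp

lemma homogeneous_permute:
 "[|homs n X vs ds; \<sigma> permutes {..<n}|] ==>
  homs n X (permute_list \<sigma> vs) (permute_list \<sigma> ds)"
 using permutes_in_image[of \<sigma> "{..<n}"] by (auto simp: homs_iff permute_list_nth)

declare split_paired_All [simp del] split_paired_Ex [simp del]

lemma formal_simps:
 "zero Fm = (%w. \<zero>\<^sub>R)" "add Fm = (%c c' w. c w \<oplus>\<^sub>R c' w)" "smult Fm = (%r c w. r \<otimes>\<^sub>R c w)"
 by (simp_all add: formal_def)

lemma mem_formal: "c \<in> carrier Fm \<longleftrightarrow> (\<forall>w. c w \<in> carrier R) \<and> finite (support R c) \<and> support R c \<subseteq> words P X"
 by (auto simp: formal_def support_def)

lemma formal_module: "module R Fm"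
proof (rule moduleI)
 show "cring R" by (rule is_cring)
 have add: "c \<oplus>\<^sub>Fm c' \<in> carrier Fm" if "c \<in> carrier Fm" "c' \<in> carrier Fm" for c c'
 proof -
  have "support R (c \<oplus>\<^sub>Fm c') \<subseteq> support R c \<union> support R c'"
   using that by (auto simp: support_def formal_simps)
  moreover have "finite (support R c \<union> support R c')" "support R c \<union> support R c' \<subseteq> words P X"
   using that by (simp_all add: mem_formal)
  moreover have "(c \<oplus>\<^sub>Fm c') w \<in> carrier R" for w
   using that by (simp add: mem_formal formal_simps)
  ultimately show ?thesis unfolding mem_formal by (meson finite_subset order_trans)
 qed
 have sm: "r \<odot>\<^sub>Fm c \<in> carrier Fm" if "c \<in> carrier Fm" "r \<in> carrier R" for c r
 proof -
  have "support R (r \<odot>\<^sub>Fm c) \<subseteq> support R c"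
   using that by (auto simp: support_def formal_simps)
  moreover have "finite (support R c)" "support R c \<subseteq> words P X"
   using that by (simp_all add: mem_formal)
  moreover have "(r \<odot>\<^sub>Fm c) w \<in> carrier R" for w
   using that by (simp add: mem_formal formal_simps)
  ultimately show ?thesis unfolding mem_formal by (meson finite_subset order_trans)
 qed
 show "abelian_group Fm"
 proof (rule abelian_groupI)
  fix c assume c: "c \<in> carrier Fm"
  then have "(\<ominus>\<^sub>R \<one>\<^sub>R) \<odot>\<^sub>Fm c \<in> carrier Fm" using sm by simp
  moreover have "((\<ominus>\<^sub>R \<one>\<^sub>R) \<odot>\<^sub>Fm c) \<oplus>\<^sub>Fm c = \<zero>\<^sub>Fm"
   using c by (simp add: formal_simps mem_formal l_minus l_neg)
  ultimately show "\<exists>c'\<in>carrier Fm. c' \<oplus>\<^sub>Fm c = \<zero>\<^sub>Fm" by blast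
 next
  show "\<zero>\<^sub>Fm \<in> carrier Fm" by (simp add: mem_formal formal_simps support_def)
 qed (use add in \<open>simp_all add: mem_formal formal_simps add.m_ac\<close>)
 show "r \<odot>\<^sub>Fm c \<in> carrier Fm" if "r \<in> carrier R" "c \<in> carrier Fm" for r c
  by (rule sm[OF that(2,1)])
qed (simp_all add: mem_formal formal_simps l_distr r_distr m_assoc)

sublocale F: module R Fm by (rule formal_module)

lemma single_closed: "w \<in> words P X ==> single R w \<in> carrier Fm"
 by (auto simp: mem_formal single_def support_def)

lemma formal_generated: "carrier Fm = generated_submodule R Fm (single R ` words P X)"
proof
 have S: "single R ` words P X \<subseteq> carrier Fm" using single_closed by blast
 note D = submoduleD[OF formal_module F.generated_sub[OF S]]
 show "generated_submodule R Fm (single R ` words P X) \<subseteq> carrier Fm" by (rule D(1))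
 have "c \<in> generated_submodule R Fm (single R ` words P X)"
  if "card (support R c) = k" "c \<in> carrier Fm" for k c
  using that
 proof (induction k arbitrary: c)
  case 0
  then have "c = \<zero>\<^sub>Fm" by (auto simp: mem_formal support_def formal_simps fun_eq_iff)
  then show ?case using D(2) by simp
 next
  case (Suc k)
  then obtain w where w: "w \<in> support R c" by fastforce
  let ?c = "c(w := \<zero>\<^sub>R)"
  have s: "support R ?c = support R c - {w}" by (auto simp: support_def)
  have "?c \<in> carrier Fm" using Suc.prems(2) unfolding mem_formal s by auto
  moreover have "card (support R ?c) = k" unfolding s using w Suc.prems by (simp add: mem_formal)
  ultimately have 1: "?c \<in> generated_submodule R Fm (single R ` words P X)" by (rule Suc.IH[rotated])
  have "w \<in> words P X" using w Suc.prems by (auto simp: mem_formal)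
  then have "c w \<odot>\<^sub>Fm single R w \<in> generated_submodule R Fm (single R ` words P X)"
   using Suc.prems(2) by (intro D(4) subsetD[OF F.generated_incl]) (auto simp: mem_formal)
  then have "?c \<oplus>\<^sub>Fm c w \<odot>\<^sub>Fm single R w \<in> generated_submodule R Fm (single R ` words P X)"
   by (rule D(3)[OF 1])
  moreover have "?c \<oplus>\<^sub>Fm c w \<odot>\<^sub>Fm single R w = c"
   using Suc.prems(2) by (auto simp: formal_simps single_def mem_formal fun_eq_iff)
  ultimately show ?case by simp
 qed
 then show "carrier Fm \<subseteq> generated_submodule R Fm (single R ` words P X)" by blast
qed

lemma lincomb_superset:
 assumes "module R Z" "c \<in> carrier Fm" "!!w. w \<in> words P X ==> g w \<in> carrier Z"
  "finite S" "support R c \<subseteq> S" "S \<subseteq> words P X"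
 shows "lincomb R Z g c = (\<Oplus>\<^sub>Z w\<in>S. c w \<odot>\<^sub>Z g w)"
proof -
 interpret Z: module R Z by fact
 show ?thesis unfolding lincomb_def
  by (rule Z.add.finprod_mono_neutral_cong_left)
   (use assms in \<open>auto simp: support_def mem_formal subset_iff\<close>)
qed

lemma lincomb_linear:
 assumes Z: "module R Z" and g: "!!w. w \<in> words P X ==> g w \<in> carrier Z"
 shows "linear_map R Fm Z (lincomb R Z g)"
proof -
 interpret Z: module R Z by fact
 have fin: "finite (support R c)" "support R c \<subseteq> words P X" "c w \<in> carrier R" if "c \<in> carrier Fm" for c w
  using that by (auto simp: mem_formal)
 have cl: "(%w. c w \<odot>\<^sub>Z g w) \<in> S \<rightarrow> carrier Z" if "c \<in> carrier Fm" "S \<subseteq> words P X" for c S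
  using fin[OF that(1)] that(2) g by auto
 show ?thesis
 proof (rule linear_mapI)
  fix c assume c: "c \<in> carrier Fm"
  show "lincomb R Z g c \<in> carrier Z"
   unfolding lincomb_def by (rule Z.finsum_closed) (rule cl[OF c fin(2)[OF c]])
  fix c' assume c': "c' \<in> carrier Fm"
  let ?S = "support R c \<union> support R c'"
  have S: "finite ?S" "?S \<subseteq> words P X" using fin c c' by auto
  have "support R (c \<oplus>\<^sub>Fm c') \<subseteq> ?S" using fin c c' by (auto simp: support_def formal_simps)
  then have "lincomb R Z g (c \<oplus>\<^sub>Fm c') = (\<Oplus>\<^sub>Z w\<in>?S. (c \<oplus>\<^sub>Fm c') w \<odot>\<^sub>Z g w)"
   by (intro lincomb_superset[OF Z F.a_closed[OF c c']]) (use g S in auto)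
  also have "... = (\<Oplus>\<^sub>Z w\<in>?S. c w \<odot>\<^sub>Z g w \<oplus>\<^sub>Z c' w \<odot>\<^sub>Z g w)"
  proof (rule Z.finsum_cong'[OF refl])
   show "(%w. c w \<odot>\<^sub>Z g w \<oplus>\<^sub>Z c' w \<odot>\<^sub>Z g w) \<in> ?S \<rightarrow> carrier Z"
    by (intro Pi_I Z.a_closed Z.smult_closed fin(3) c c' g subsetD[OF S(2)])
   show "(c \<oplus>\<^sub>Fm c') w \<odot>\<^sub>Z g w = c w \<odot>\<^sub>Z g w \<oplus>\<^sub>Z c' w \<odot>\<^sub>Z g w" if "w \<in> ?S" for w
    unfolding formal_simps by (intro Z.smult_l_distr fin(3) c c' g subsetD[OF S(2) that])
  qed
  also have "... = (\<Oplus>\<^sub>Z w\<in>?S. c w \<odot>\<^sub>Z g w) \<oplus>\<^sub>Z (\<Oplus>\<^sub>Z w\<in>?S. c' w \<odot>\<^sub>Z g w)"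
   by (rule Z.finsum_addf) (use cl c c' S in auto)
  also have "... = lincomb R Z g c \<oplus>\<^sub>Z lincomb R Z g c'"
   using S by (intro arg_cong2[where f="add Z"]; intro lincomb_superset[OF Z, symmetric]) (use g c c' in auto)
  finally show "lincomb R Z g (c \<oplus>\<^sub>Fm c') = lincomb R Z g c \<oplus>\<^sub>Z lincomb R Z g c'" .
 next
  fix r c assume r: "r \<in> carrier R" and c: "c \<in> carrier Fm"
  have "support R (r \<odot>\<^sub>Fm c) \<subseteq> support R c" using r by (auto simp: support_def formal_simps)
  then have "lincomb R Z g (r \<odot>\<^sub>Fm c) = (\<Oplus>\<^sub>Z w\<in>support R c. (r \<odot>\<^sub>Fm c) w \<odot>\<^sub>Z g w)"
   by (intro lincomb_superset[OF Z F.smult_closed[OF r c]]) (use g fin[OF c] in auto)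
  also have "... = (\<Oplus>\<^sub>Z w\<in>support R c. r \<odot>\<^sub>Z (c w \<odot>\<^sub>Z g w))"
  proof (rule Z.finsum_cong'[OF refl])
   show "(%w. r \<odot>\<^sub>Z (c w \<odot>\<^sub>Z g w)) \<in> support R c \<rightarrow> carrier Z"
    by (intro Pi_I Z.smult_closed fin(3) r c g subsetD[OF fin(2)[OF c]])
   show "(r \<odot>\<^sub>Fm c) w \<odot>\<^sub>Z g w = r \<odot>\<^sub>Z (c w \<odot>\<^sub>Z g w)" if "w \<in> support R c" for w
    unfolding formal_simps by (intro Z.smult_assoc1 fin(3) r c g subsetD[OF fin(2)[OF c] that])
  qed
  also have "... = r \<odot>\<^sub>Z lincomb R Z g c" unfolding lincomb_def
   by (rule Z.finsum_smult_ldistr[symmetric]) (use fin[OF c] cl[OF c] r in auto)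
  finally show "lincomb R Z g (r \<odot>\<^sub>Fm c) = r \<odot>\<^sub>Z lincomb R Z g c" .
 qed
qed

lemma lincomb_single:
 assumes "module R Z" "g w \<in> carrier Z"
 shows "lincomb R Z g (single R w) = g w"
proof -
 interpret Z: module R Z by fact
 have "support R (single R w) = {w}" by (auto simp: support_def single_def)
 then show ?thesis using assms(2) by (simp add: lincomb_def single_def)
qed

lemma op_gradeD: 
 shows op_grade_add: "[|p \<in> opg P n e; p' \<in> opg P n e|] ==> p \<oplus>\<^bsub>op_space P n\<^esub> p' \<in> opg P n e"
  and op_grade_smult: "[|r \<in> carrier R; p \<in> opg P n e|] ==> r \<odot>\<^bsub>op_space P n\<^esub> p \<in> opg P n e"
  and op_grade_zero: "\<zero>\<^bsub>op_space P n\<^esub> \<in> opg P n e"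
 using submoduleD[OF op_module graded_submodule[OF op_graded]] by blast+

lemmas X_gradeD = submoduleD[OF X.module_axioms X.summand_submodule]

text \<open>By this a map given on words descends to the quotient by the relations.\<close>

lemma linear_kills_relators:
 assumes Z: "module R Z" and L: "linear_map R Fm Z L" "!!w. w \<in> words P X ==> L (single R w) = \<phi> (fst w) (snd w)"
  and \<phi>: "respects_relations R P X Z \<phi>" and \<rho>: "\<rho> \<in> relators R P X"
 shows "\<rho> \<in> carrier Fm \<and> L \<rho> = \<zero>\<^sub>Z"
proof -
 interpret Z: module R Z by fact
 have Ls: "L (single R (p, vs)) = \<phi> p vs" "single R (p, vs) \<in> carrier Fm" "\<phi> p vs \<in> carrier Z"
  if "p \<in> opg P n e" "homs n X vs ds" for p n e vs ds
  using L(2)[OF wordI[OF that]] single_closed[OF wordI[OF that]] respects_closed[OF \<phi> that] by simp_all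
 note lin = linear_mapD[OF L(1)] lin_neg[OF formal_module Z L(1)] lin_ksign[OF formal_module Z L(1)]
 show ?thesis using \<rho>
 proof (cases rule: relators.cases)
  case (op_add p n e p' vs ds)
  note * = Ls[OF op_add(2,4)] Ls[OF op_add(3,4)] Ls[OF op_grade_add[OF op_add(2,3)] op_add(4)] respects_op_add[OF \<phi> op_add(2,4,3)]
  show ?thesis using * by (simp add: op_add(1) lin Z.r_neg a_minus_def)
 next
  case (op_smult r p n e vs ds)
  note * = Ls[OF op_smult(3,4)] Ls[OF op_grade_smult[OF op_smult(2,3)] op_smult(4)] respects_op_smult[OF \<phi> op_smult(3,4,2)]
  show ?thesis using * op_smult(2) by (simp add: op_smult(1) lin Z.r_neg a_minus_def)
 next
  case (arg_add p n e vs ds i v)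
  have vi: "vs ! i \<in> grade X (ds ! i)" using arg_add(3,4) by (simp add: homs_iff)
  note * = Ls[OF arg_add(2,3)] Ls[OF arg_add(2) homs_update_same[OF arg_add(3,5)]]
   Ls[OF arg_add(2) homs_update_same[OF arg_add(3) X_gradeD(3)[OF vi arg_add(5)]]]
   respects_arg_add[OF \<phi> arg_add(2-5)]
  show ?thesis using * by (simp add: arg_add(1) lin Z.r_neg a_minus_def)
 next
  case (arg_smult r p n e vs ds i)
  have vi: "vs ! i \<in> grade X (ds ! i)" using arg_smult(4,5) by (simp add: homs_iff)
  note * = Ls[OF arg_smult(3,4)] Ls[OF arg_smult(3) homs_update_same[OF arg_smult(4) X_gradeD(4)[OF arg_smult(2) vi]]]
   respects_arg_smult[OF \<phi> arg_smult(3-5,2)]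
  show ?thesis using * arg_smult(2) by (simp add: arg_smult(1) lin Z.r_neg a_minus_def)
 next
  case (coinvariance p n e vs ds \<sigma>)
  note * = Ls[OF coinvariance(2,3)] Ls[OF op_sym_grade[OF coinvariance(4,2)] homogeneous_permute[OF coinvariance(3,4)]]
   respects_sym[OF \<phi> coinvariance(2-4)]
  show ?thesis using * by (simp add: coinvariance(1) lin Z.r_neg a_minus_def)
 qed
qed

lemma relators_closed: "relators R P X \<subseteq> carrier Fm"
proof
 fix \<rho> assume "\<rho> \<in> relators R P X"
 have "respects_relations R P X Fm (%p vs. \<zero>\<^sub>Fm)"
  by (simp add: respects_relations_def)
 from linear_kills_relators[OF formal_module lin_const_zero[OF formal_module] _ this \<open>\<rho> \<in> _\<close>]
 show "\<rho> \<in> carrier Fm" by simp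
qed

lemma relations_submodule: "submodule Rel R Fm"
 by (rule F.generated_sub[OF relators_closed])

lemma lincomb_kills_relations:
 assumes Z: "module R Z" and \<phi>: "respects_relations R P X Z \<phi>" and "\<rho> \<in> Rel"
 shows "lincomb R Z (%w. \<phi> (fst w) (snd w)) \<rho> = \<zero>\<^sub>Z"
proof -
 have g: "\<phi> (fst w) (snd w) \<in> carrier Z" if "w \<in> words P X" for w
  using that respects_closed[OF \<phi>] by (cases w) (auto elim!: wordE)
 have L: "linear_map R Fm Z (lincomb R Z (%w. \<phi> (fst w) (snd w)))"
  by (rule lincomb_linear[OF Z g])
 show ?thesis
 proof (rule linear_maps_eq_on_generated[OF formal_module Z L lin_const_zero[OF Z] relators_closed _ assms(3)])
  fix \<rho>' assume \<rho>': "\<rho>' \<in> relators R P X"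
  have Ls: "lincomb R Z (%w. \<phi> (fst w) (snd w)) (single R w) = \<phi> (fst w) (snd w)" if "w \<in> words P X" for w
   using lincomb_single[OF Z, where g="%w. \<phi> (fst w) (snd w)", OF g[OF that]] by simp
  show "lincomb R Z (%w. \<phi> (fst w) (snd w)) \<rho>' = \<zero>\<^sub>Z"
   using linear_kills_relators[OF Z L Ls \<phi> \<rho>'] by blast
 qed
qed

subsection \<open>The free algebra as a vector space\<close>

lemma free_module_module: "module R M" and tens_linear: "linear_map R Fm M (%c. Rel +>\<^sub>Fm c)"
 and free_carrier: "carrier M = (%c. Rel +>\<^sub>Fm c) ` carrier Fm"
 unfolding free_module_def
 by (rule quotient_is_module coset_linear quotient_carrier, rule formal_module, rule relations_submodule)+

sublocale M: module R M by (rule free_module_module)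

lemmas modM = M.module_axioms and modX = X.module_axioms

lemma tens_closed: "(p, vs) \<in> words P X ==> T p vs \<in> carrier M"
 unfolding tens_def by (rule lin_closed[OF tens_linear]) (rule single_closed)

definition word_tens :: "('k,'p,'v) tensors set"
 where "word_tens = {T p vs | p vs. (p, vs) \<in> words P X}"

lemma word_tens_closed: "word_tens \<subseteq> carrier M"
 using tens_closed by (auto simp: word_tens_def)

lemma free_generated: "carrier M = generated_submodule R M word_tens"
proof
 note D = submoduleD[OF free_module_module M.generated_sub[OF word_tens_closed]]
 show "generated_submodule R M word_tens \<subseteq> carrier M" by (rule D(1))
 have "Rel +>\<^sub>Fm c \<in> generated_submodule R M word_tens" if "c \<in> carrier Fm" for c
 proof (rule lin_generated_into[OF formal_module free_module_module tens_linear
    M.generated_sub[OF word_tens_closed]])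
  show "single R ` words P X \<subseteq> carrier Fm" using single_closed by blast
  show "Rel +>\<^sub>Fm x \<in> generated_submodule R M word_tens" if "x \<in> single R ` words P X" for x
   using that M.generated_incl by (fastforce simp: word_tens_def tens_def)
  show "c \<in> generated_submodule R Fm (single R ` words P X)" using that formal_generated by simp
 qed
 then show "carrier M \<subseteq> generated_submodule R M word_tens" by (auto simp: free_carrier)
qed

lemma representative_facts:
 assumes "C \<in> carrier M"
 shows representative_closed: "representative C \<in> carrier Fm" and representative_coset: "Rel +>\<^sub>Fm representative C = C"
proof -
 obtain c where c: "c \<in> carrier Fm" "C = Rel +>\<^sub>Fm c" using assms by (auto simp: free_carrier)
 note m = coset_mem_iff[OF formal_module relations_submodule c(1)] coset_eq_iff[OF formal_module relations_submodule _ c(1)]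
 have "c \<in> C" unfolding c(2) m(1) using c(1) submodule_zero[OF formal_module relations_submodule] by (simp add: F.r_neg a_minus_def)
 then have "representative C \<in> C" unfolding representative_def by (rule someI[of "%c. c \<in> C"])
 then show "representative C \<in> carrier Fm" "Rel +>\<^sub>Fm representative C = C"
  unfolding c(2) m(1) using m(2) by auto
qed

text \<open>The universal property of the vector space underlying the free algebra.\<close>

lemma extend_facts:
 assumes Z: "module R Z" and \<phi>: "respects_relations R P X Z \<phi>"
 shows extend_linear: "linear_map R M Z (extend R Z \<phi>)"
  and extend_tens: "(p, vs) \<in> words P X ==> extend R Z \<phi> (T p vs) = \<phi> p vs"
proof -
 interpret Z: module R Z by fact
 let ?g = "%w. \<phi> (fst w) (snd w)"
 have g: "?g w \<in> carrier Z" if "w \<in> words P X" for w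
  using that respects_closed[OF \<phi>] by (cases w) (auto elim!: wordE)
 have L: "linear_map R Fm Z (lincomb R Z (%w. \<phi> (fst w) (snd w)))"
  by (rule lincomb_linear[OF Z g])
 have ext: "extend R Z \<phi> (Rel +>\<^sub>Fm c) = lincomb R Z ?g c" if c: "c \<in> carrier Fm" for c
 proof -
  let ?r = "representative (Rel +>\<^sub>Fm c)"
  have C: "Rel +>\<^sub>Fm c \<in> carrier M" using c by (simp add: free_carrier)
  note r = representative_facts[OF C]
  have "?r \<ominus>\<^sub>Fm c \<in> Rel" using r(2) coset_eq_iff[OF formal_module relations_submodule r(1) c] by simp
  then have "lincomb R Z ?g (?r \<ominus>\<^sub>Fm c) = \<zero>\<^sub>Z" by (rule lincomb_kills_relations[OF Z \<phi>])
  then have "lincomb R Z ?g ?r \<ominus>\<^sub>Z lincomb R Z ?g c = \<zero>\<^sub>Z"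
   using lin_diff[OF formal_module Z L r(1) c] by simp
  then show ?thesis
   unfolding extend_lincomb using Z.minus_zero_iff lin_closed[OF L r(1)] lin_closed[OF L c] by blast
 qed
 show "linear_map R M Z (extend R Z \<phi>)"
 proof (rule linear_mapI)
  fix C assume "C \<in> carrier M"
  then obtain c where c: "c \<in> carrier Fm" "C = Rel +>\<^sub>Fm c" by (auto simp: free_carrier)
  show "extend R Z \<phi> C \<in> carrier Z" using c ext lin_closed[OF L] by simp
  show "extend R Z \<phi> (r \<odot>\<^sub>M C) = r \<odot>\<^sub>Z extend R Z \<phi> C" if r: "r \<in> carrier R" for r
   using c r ext ext[OF F.smult_closed[OF r c(1)]] lin_smult[OF L r c(1)] lin_smult[OF tens_linear r c(1)]
   by simp
  fix C' assume "C' \<in> carrier M"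
  then obtain c' where c': "c' \<in> carrier Fm" "C' = Rel +>\<^sub>Fm c'" by (auto simp: free_carrier)
  show "extend R Z \<phi> (C \<oplus>\<^sub>M C') = extend R Z \<phi> C \<oplus>\<^sub>Z extend R Z \<phi> C'"
   using c c' ext ext[OF F.a_closed[OF c(1) c'(1)]] lin_add[OF L c(1) c'(1)] lin_add[OF tens_linear c(1) c'(1)]
   by simp
 qed
 show "extend R Z \<phi> (T p vs) = \<phi> p vs" if "(p, vs) \<in> words P X"
  using ext[OF single_closed[OF that]] lincomb_single[OF Z, where g="%w. \<phi> (fst w) (snd w)", OF g[OF that]] by (simp add: tens_def)
qed

lemma tens_respects: "respects_relations R P X M T"
 unfolding respects_relations_def
proof (intro allI impI)
 fix n p e vs ds assume p: "p \<in> opg P n e" and vs: "homs n X vs ds"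
 have eq: "Rel +>\<^sub>Fm a = Rel +>\<^sub>Fm b" if "a \<ominus>\<^sub>Fm b \<in> relators R P X" "a \<in> carrier Fm" "b \<in> carrier Fm" for a b
  using coset_eq_iff[OF formal_module relations_submodule that(2,3)] that(1) F.generated_incl by blast
 have s: "single R (p, vs) \<in> carrier Fm"
  if "p \<in> opg P n e" "homs n X vs ds" for p e vs ds
  by (rule single_closed[OF wordI[OF that]])
 note lin = linear_mapD[OF tens_linear] lin_ksign[OF formal_module free_module_module tens_linear]
 show "T p vs \<in> carrier M \<and>
   (\<forall>p'\<in>opg P n e. T (p \<oplus>\<^bsub>op_space P n\<^esub> p') vs = T p vs \<oplus>\<^sub>M T p' vs) \<and>
   (\<forall>r\<in>carrier R. T (r \<odot>\<^bsub>op_space P n\<^esub> p) vs = r \<odot>\<^sub>M T p vs) \<and>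
   (\<forall>i<n. \<forall>v\<in>grade X (ds ! i). T p (vs[i := vs ! i \<oplus>\<^sub>X v]) = T p vs \<oplus>\<^sub>M T p (vs[i := v])) \<and>
   (\<forall>i<n. \<forall>r\<in>carrier R. T p (vs[i := r \<odot>\<^sub>X vs ! i]) = r \<odot>\<^sub>M T p vs) \<and>
   (\<forall>\<sigma>. \<sigma> permutes {..<n} --> T (op_sym P n p \<sigma>) (permute_list \<sigma> vs) = ksign M (perm_exp \<sigma> ds) (T p vs))"
 proof (intro conjI ballI allI impI)
  show "T p vs \<in> carrier M" by (rule tens_closed[OF wordI[OF p vs]])
  show "T (p \<oplus>\<^bsub>op_space P n\<^esub> p') vs = T p vs \<oplus>\<^sub>M T p' vs" if p': "p' \<in> opg P n e" for p'
   unfolding tens_def lin(2)[OF s[OF p vs] s[OF p' vs], symmetric]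
   by (rule eq[OF relators.op_add[OF p p' vs]]) (use s p p' vs op_grade_add[OF p p'] in auto)
  show "T (r \<odot>\<^bsub>op_space P n\<^esub> p) vs = r \<odot>\<^sub>M T p vs" if r: "r \<in> carrier R" for r
   unfolding tens_def lin(3)[OF r s[OF p vs], symmetric]
   by (rule eq[OF relators.op_smult[OF r p vs]]) (use s p r vs op_grade_smult[OF r p] in auto)
  show "T p (vs[i := vs ! i \<oplus>\<^sub>X v]) = T p vs \<oplus>\<^sub>M T p (vs[i := v])" if i: "i < n" "v \<in> grade X (ds ! i)" for i v
  proof -
   have vi: "vs ! i \<in> grade X (ds ! i)" using vs i by (simp add: homs_iff)
   note h = homs_update_same[OF vs i(2)] homs_update_same[OF vs X_gradeD(3)[OF vi i(2)]]
   show ?thesis unfolding tens_def lin(2)[OF s[OF p vs] s[OF p h(1)], symmetric]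
    by (rule eq[OF relators.arg_add[OF p vs i]]) (use s p vs h in auto)
  qed
  show "T p (vs[i := r \<odot>\<^sub>X vs ! i]) = r \<odot>\<^sub>M T p vs" if i: "i < n" "r \<in> carrier R" for i r
  proof -
   have vi: "vs ! i \<in> grade X (ds ! i)" using vs i by (simp add: homs_iff)
   note h = homs_update_same[OF vs X_gradeD(4)[OF i(2) vi]]
   show ?thesis unfolding tens_def lin(3)[OF i(2) s[OF p vs], symmetric]
    by (rule eq[OF relators.arg_smult[OF i(2) p vs i(1)]]) (use s p vs h i in auto)
  qed
  show "T (op_sym P n p \<sigma>) (permute_list \<sigma> vs) = ksign M (perm_exp \<sigma> ds) (T p vs)" if \<sigma>: "\<sigma> permutes {..<n}" for \<sigma>
   unfolding tens_def lin(4)[OF s[OF p vs], symmetric]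
   by (rule eq[OF relators.coinvariance[OF p vs \<sigma>]])
    (use s[OF p vs] s[OF op_sym_grade[OF \<sigma> p] homogeneous_permute[OF vs \<sigma>]] in auto)
 qed
qed

lemmas tensD = respects_relationsD[OF tens_respects]

lemma tens_zero_op:
 assumes "homs n X vs ds"
 shows "T \<zero>\<^bsub>op_space P n\<^esub> vs = \<zero>\<^sub>M"
proof -
 interpret O: module R "op_space P n" by (rule op_module)
 have z: "\<zero>\<^bsub>op_space P n\<^esub> \<in> opg P n 0" by (rule op_grade_zero)
 have "T (\<zero>\<^sub>R \<odot>\<^bsub>op_space P n\<^esub> \<zero>\<^bsub>op_space P n\<^esub>) vs = \<zero>\<^sub>R \<odot>\<^sub>M T \<zero>\<^bsub>op_space P n\<^esub> vs"
  by (rule tensD(3)[OF z assms]) simp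
 then show ?thesis using tensD(1)[OF z assms] by simp
qed

lemma tens_zero_arg:
 assumes "p \<in> opg P n e" "homs n X vs ds" "i < n" "vs ! i = \<zero>\<^sub>X"
 shows "T p vs = \<zero>\<^sub>M"
proof -
 have "T p (vs[i := \<zero>\<^sub>R \<odot>\<^sub>X vs ! i]) = \<zero>\<^sub>R \<odot>\<^sub>M T p vs"
  by (rule tensD(5)[OF assms(1-3)]) simp
 then show ?thesis using tensD(1)[OF assms(1,2)] assms(3,4)
  by (metis M.smult_l_null zero_closed X.smult_r_null list_update_id)
qed

end

subsection \<open>The operations on words\<close>

lemma finite_listset: "(!!A. A \<in> set As ==> finite A) ==> finite (listset As)"
proof (induction As)
 case (Cons A As)
 have "listset (A # As) = (%(x, xs). x # xs) ` (A \<times> listset As)" by (auto simp: set_Cons_def)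
 then show ?case using Cons by simp
qed simp

lemma homogeneous_list_all2:
 "homs n X vs ds \<longleftrightarrow> length vs = n \<and> list_all2 (%v d. v \<in> grade X d) vs ds"
 by (auto simp: homs_iff list_all2_conv_all_nth)

lemma list_all2_concat:
 "list_all2 (list_all2 Q) xss yss ==> list_all2 Q (concat xss) (concat yss)"
 by (induction rule: list_all2_induct) (auto intro: list_all2_appendI)

lemma homogeneous_concat:
 assumes "length dss = length vss"
  and "!!i. i < length vss ==> homogeneous (replicate (length (vss ! i)) X) (vss ! i) (dss ! i)"
 shows "homogeneous (replicate (sum_list (map length vss)) X) (concat vss) (concat dss)"
 using assms list_all2_concat[of "%v d. v \<in> grade X d" vss dss]
 by (simp add: homogeneous_list_all2 length_concat list_all2_conv_all_nth[of "list_all2 _"])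

lemma homogeneous_single [simp]: "homogeneous [X] [v] [i] \<longleftrightarrow> v \<in> grade X i"
 by (simp add: homogeneous_def)

lemma shuffle_exp_zeros: "shuffle_exp (replicate n 0) es = 0"
 by (simp add: shuffle_exp_def)

context free_gens
begin

text \<open>What the operations of the free algebra should be on words, without a choice of representatives.\<close>

definition word_act :: "'p => ('p \<times> 'v list) list => ('k,'p,'v) tensors"
 where "word_act p ws = ksign M
  (shuffle_exp (map (%(q, vs). deg (op_space P (length vs)) q) ws) (map (%(q, vs). sum_list (map (deg X) vs)) ws))
  (T (op_comp P (map (length \<circ> snd) ws) p (map fst ws)) (concat (map snd ws)))"

definition word_degs :: "('p \<times> 'v list) list => int list => int list list => bool"
 where "word_degs ws es dss \<longleftrightarrow> length es = length ws \<and> length dss = length ws \<and>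
  (\<forall>i<length ws. fst (ws ! i) \<in> grade (op_space P (length (snd (ws ! i)))) (es ! i) \<and>
   homogeneous (replicate (length (snd (ws ! i))) X) (snd (ws ! i)) (dss ! i))"

lemma words_degs:
 assumes "set ws \<subseteq> words P X"
 obtains es dss where "word_degs ws es dss"
proof -
 have "\<exists>e ds. fst w \<in> opg P (length (snd w)) e \<and> homs (length (snd w)) X (snd w) ds"
  if "w \<in> set ws" for w
  using subsetD[OF assms that] by (cases w) (simp add: words_def)
 then obtain e ds where "!!w. w \<in> set ws ==> fst w \<in> opg P (length (snd w)) (e w) \<and>
   homs (length (snd w)) X (snd w) (ds w)" by metis
 then have "word_degs ws (map e ws) (map ds ws)" by (simp add: word_degs_def)
 then show ?thesis by (rule that)
qed

lemma word_degs_update: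
 assumes "word_degs ws es dss" "q \<in> opg P (length vs) e" "homs (length vs) X vs ds"
 shows "word_degs (ws[i := (q, vs)]) (es[i := e]) (dss[i := ds])"
 unfolding word_degs_def
proof (intro conjI allI impI)
 fix j assume "j < length (ws[i := (q, vs)])"
 then show "fst (ws[i := (q, vs)] ! j) \<in> grade (op_space P (length (snd (ws[i := (q, vs)] ! j)))) (es[i := e] ! j)"
  "homogeneous (replicate (length (snd (ws[i := (q, vs)] ! j))) X) (snd (ws[i := (q, vs)] ! j)) (dss[i := ds] ! j)"
  using assms by (cases "j = i"; simp add: word_degs_def)+
qed (use assms in \<open>simp_all add: word_degs_def\<close>)

lemma word_degs_facts:
 assumes "word_degs ws es dss"
 shows word_degs_comp: "p \<in> opg P (length ws) e ==>
   op_comp P (map (length \<circ> snd) ws) p (map fst ws) \<in> grade (op_space P (sum_list (map (length \<circ> snd) ws))) (e + sum_list es)"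
  and word_degs_concat: "homogeneous (replicate (sum_list (map (length \<circ> snd) ws)) X) (concat (map snd ws)) (concat dss)"
  and word_degs_op: "homogeneous (map (op_space P) (map (length \<circ> snd) ws)) (map fst ws) es"
proof -
 show 1: "homogeneous (map (op_space P) (map (length \<circ> snd) ws)) (map fst ws) es"
  using assms by (simp add: word_degs_def homogeneous_def)
 show "op_comp P (map (length \<circ> snd) ws) p (map fst ws) \<in> grade (op_space P (sum_list (map (length \<circ> snd) ws))) (e + sum_list es)"
  if "p \<in> opg P (length ws) e" using comp_grade[OF _ 1] that by simp
 show "homogeneous (replicate (sum_list (map (length \<circ> snd) ws)) X) (concat (map snd ws)) (concat dss)"
  using homogeneous_concat[of dss "map snd ws" X] assms by (simp add: word_degs_def)
qed

text \<open>
 The degrees of zero operations and letters are arbitrary, but then the word itself is zero: so the sign may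
 be computed from any degrees that fit.
\<close>

lemma word_act_eq:
 assumes "word_degs ws es dss" "p \<in> opg P (length ws) e"
 shows "word_act p ws = ksign M (shuffle_exp es (map sum_list dss))
  (T (op_comp P (map (length \<circ> snd) ws) p (map fst ws)) (concat (map snd ws)))" (is "_ = ksign M _ ?t")
proof (cases "?t = \<zero>\<^sub>M")
 case True
 then show ?thesis by (simp add: word_act_def)
next
 case False
 note wd = word_degs_facts[OF assms(1)]
 let ?ks = "map (length \<circ> snd) ws" and ?qs = "map fst ws"
 have q: "?qs ! i \<in> carrier (op_space P (?ks ! i))" if "i < length ws" for i
  using assms(1) that opg_closed by (auto simp: word_degs_def)
 have nz1: "fst (ws ! i) \<noteq> \<zero>\<^bsub>op_space P (length (snd (ws ! i)))\<^esub>" if i: "i < length ws" for i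
 proof
  assume z: "fst (ws ! i) = \<zero>\<^bsub>op_space P (length (snd (ws ! i)))\<^esub>"
  have "linear_map R (op_space P (?ks ! i)) (op_space P (sum_list ?ks)) (%x. op_comp P ?ks p (?qs[i := x]))"
   by (rule comp_linear_arg) (use opg_closed[OF assms(2)] q i in auto)
  from lin_zero[OF op_module op_module this]
  have "op_comp P ?ks p (?qs[i := ?qs ! i]) = \<zero>\<^bsub>op_space P (sum_list ?ks)\<^esub>" using z i by simp
  then show False using False tens_zero_op[OF wd(2)] by simp
 qed
 have nz2: "snd (ws ! i) ! l \<noteq> \<zero>\<^sub>X" if i: "i < length ws" "l < length (snd (ws ! i))" for i l
 proof
  assume z: "snd (ws ! i) ! l = \<zero>\<^sub>X"
  have "T (op_comp P ?ks p ?qs) (concat (map snd ws)) = \<zero>\<^sub>M"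
   by (rule tens_zero_arg[OF wd(1)[OF assms(2)] wd(2), of "offset (map snd ws) i + l"])
    (use i z concat_nth[of i "map snd ws" l] offset_bound[of i "map snd ws" l] in \<open>auto simp: length_concat\<close>)
  then show False using False by simp
 qed
 have "map (%(q, vs). deg (op_space P (length vs)) q) ws = es"
 proof (rule nth_equalityI)
  show "map (%(q, vs). deg (op_space P (length vs)) q) ws ! i = es ! i"
   if "i < length (map (%(q, vs). deg (op_space P (length vs)) q) ws)" for i
   using that nz1[of i] assms(1) graded_space.deg_of[OF op_graded, of "fst (ws ! i)" "length (snd (ws ! i))" "es ! i"]
   by (simp add: split_def word_degs_def)
 qed (use assms(1) in \<open>simp add: word_degs_def\<close>)
 moreover have "map (%(q, vs). sum_list (map (deg X) vs)) ws = map sum_list dss"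
 proof (rule nth_equalityI)
  show "map (%(q, vs). sum_list (map (deg X) vs)) ws ! i = map sum_list dss ! i"
   if "i < length (map (%(q, vs). sum_list (map (deg X) vs)) ws)" for i
  proof -
   have i: "i < length ws" "i < length dss" using that assms(1) by (auto simp: word_degs_def)
   have h: "homogeneous (replicate (length (snd (ws ! i))) X) (snd (ws ! i)) (dss ! i)"
    using assms(1) i by (simp add: word_degs_def)
   have "map (deg X) (snd (ws ! i)) = dss ! i"
    by (rule nth_equalityI) (use h nz2[OF i(1)] X.deg_of in \<open>auto simp: homs_iff\<close>)
   then show ?thesis using i by (simp add: split_def)
  qed
 qed (use assms(1) in \<open>simp add: word_degs_def\<close>)
 ultimately show ?thesis by (simp add: word_act_def)
qed

lemma word_act_closed:
 assumes "set ws \<subseteq> words P X" "p \<in> opg P (length ws) e"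
 shows "word_act p ws \<in> carrier M"
proof -
 obtain es dss where wd: "word_degs ws es dss" using words_degs[OF assms(1)] .
 show ?thesis unfolding word_act_eq[OF wd assms(2)]
  by (intro M.ksign_closed tensD(1)[OF word_degs_comp[OF wd assms(2)] word_degs_concat[OF wd]])
qed

text \<open>
 The operations respect the relations in each entry: a permutation of the letters of one word
 becomes a permutation of one block of the letters of the result.
\<close>

lemma word_act_respects:
 assumes ws: "set ws \<subseteq> words P X" and p: "p \<in> opg P (length ws) e" and i: "i < length ws"
 shows "respects_relations R P X M (%q vs. word_act p (ws[i := (q, vs)]))"
 unfolding respects_relations_def
proof (intro allI impI)
 fix n q d vs ds assume q: "q \<in> opg P n d" and vs: "homs n X vs ds"
 obtain es dss where wd: "word_degs ws es dss" using words_degs[OF ws] .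
 have n: "length vs = n" "length ds = n" using vs by (auto simp: homs_iff)
 define ks where "ks = (map (length \<circ> snd) ws)[i := n]"
 define qs where "qs = (map fst ws)[i := q]"
 define vss where "vss = (map snd ws)[i := vs]"
 define E where "E = shuffle_exp (es[i := d]) (map sum_list (dss[i := ds]))"
 have len: "length ks = length ws" "length qs = length ws" "length vss = length ws" "length es = length ws" "length dss = length ws"
  using wd by (simp_all add: ks_def qs_def vss_def word_degs_def)
 have lv: "length (vss ! j) = ks ! j" if "j < length ws" for j
  using that n by (cases "j = i") (auto simp: vss_def ks_def)
 have upd: "word_act p (ws[i := (q', vs')]) =
   ksign M (shuffle_exp (es[i := d]) (map sum_list (dss[i := ds'])))
    (T (op_comp P ks p (qs[i := q'])) (concat (vss[i := vs'])))"
  and updc: "op_comp P ks p (qs[i := q']) \<in> opg P (sum_list ks) (e + sum_list (es[i := d]))"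
  and updv: "homs (sum_list ks) X (concat (vss[i := vs'])) (concat (dss[i := ds']))"
  if q': "q' \<in> opg P n d" and vs': "homs n X vs' ds'" for q' vs' ds'
 proof -
  have n': "length vs' = n" using vs' by (simp add: homs_iff)
  have wd': "word_degs (ws[i := (q', vs')]) (es[i := d]) (dss[i := ds'])"
   by (rule word_degs_update[OF wd]) (use q' vs' n' in auto)
  have *: "map (length \<circ> snd) (ws[i := (q', vs')]) = ks" "map fst (ws[i := (q', vs')]) = qs[i := q']"
   "map snd (ws[i := (q', vs')]) = vss[i := vs']"
   using n' by (simp_all add: map_update ks_def qs_def vss_def)
  show "word_act p (ws[i := (q', vs')]) =
   ksign M (shuffle_exp (es[i := d]) (map sum_list (dss[i := ds'])))
    (T (op_comp P ks p (qs[i := q'])) (concat (vss[i := vs'])))"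
   using word_act_eq[OF wd', of p e] p unfolding * by simp
  show "op_comp P ks p (qs[i := q']) \<in> opg P (sum_list ks) (e + sum_list (es[i := d]))"
   using word_degs_comp[OF wd', of p e] p unfolding * by simp
  show "homs (sum_list ks) X (concat (vss[i := vs'])) (concat (dss[i := ds']))"
   using word_degs_concat[OF wd'] unfolding * .
 qed
 have qc: "qs ! j \<in> opc P (ks ! j)" if "j < length ws" for j
  using that wd q opg_closed by (cases "j = i") (auto simp: qs_def ks_def word_degs_def)
 have ksi: "ks ! i = n" using i by (simp add: ks_def)
 have lin: "linear_map R (op_space P n) (op_space P (sum_list ks)) (%x. op_comp P ks p (qs[i := x]))"
  using comp_linear_arg[of p ks qs i] opg_closed[OF p] qc i ksi by (simp add: len)
 have qs_i: "qs[i := q] = qs" and vss_i: "vss[i := vs] = vss" by (simp_all add: qs_def vss_def)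
 note base = updc[OF q vs] updv[OF q vs]
 have Ec: "T (op_comp P ks p (qs[i := q'])) (concat (vss[i := vs'])) \<in> carrier M"
  if "q' \<in> opg P n d" "homs n X vs' ds'" for q' vs' ds'
  by (rule tensD(1)[OF updc updv]) (rule that)+
 have pos: "concat (vss[i := vs[l := y]]) = (concat (vss[i := vs]))[offset vss i + l := y]"
  "offset vss i + l < sum_list ks" "concat (dss[i := ds]) ! (offset vss i + l) = ds ! l"
  "concat (vss[i := vs]) ! (offset vss i + l) = vs ! l" if "l < n" for l y
 proof -
  have vi: "vss ! i = vs" "(dss[i := ds]) ! i = ds" using i len by (simp_all add: vss_def)
  have "map length (take i (dss[i := ds])) = map length (take i vss)"
  proof (rule nth_equalityI)
   show "map length (take i (dss[i := ds])) ! j = map length (take i vss) ! j"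
    if "j < length (map length (take i (dss[i := ds])))" for j
    using that wd i len by (auto simp: vss_def word_degs_def homs_iff)
  qed (simp add: len)
  then have o: "offset (dss[i := ds]) i = offset vss i" by (simp add: length_concat)
  show "concat (vss[i := vs[l := y]]) = (concat (vss[i := vs]))[offset vss i + l := y]"
   using concat_update[of i vss l y] i len vi n that vss_i by simp
  have "offset vss i + l < length (concat vss)" by (rule offset_bound) (use i len vi n that in auto)
  moreover have "length (concat vss) = sum_list ks"
   using updv[OF q vs] vss_i by (simp add: homs_iff)
  ultimately show "offset vss i + l < sum_list ks" by simp
  show "concat (dss[i := ds]) ! (offset vss i + l) = ds ! l"
   using concat_nth[of i "dss[i := ds]" l] o i len vi n that by simp
  show "concat (vss[i := vs]) ! (offset vss i + l) = vs ! l"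
   using concat_nth[of i vss l] i len vi n that vss_i by simp
 qed
 show "word_act p (ws[i := (q, vs)]) \<in> carrier M \<and>
   (\<forall>q'\<in>opg P n d. word_act p (ws[i := (q \<oplus>\<^bsub>op_space P n\<^esub> q', vs)]) =
    word_act p (ws[i := (q, vs)]) \<oplus>\<^sub>M word_act p (ws[i := (q', vs)])) \<and>
   (\<forall>r\<in>carrier R. word_act p (ws[i := (r \<odot>\<^bsub>op_space P n\<^esub> q, vs)]) = r \<odot>\<^sub>M word_act p (ws[i := (q, vs)])) \<and>
   (\<forall>l<n. \<forall>v\<in>grade X (ds ! l). word_act p (ws[i := (q, vs[l := vs ! l \<oplus>\<^sub>X v])]) =
    word_act p (ws[i := (q, vs)]) \<oplus>\<^sub>M word_act p (ws[i := (q, vs[l := v])])) \<and>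
   (\<forall>l<n. \<forall>r\<in>carrier R. word_act p (ws[i := (q, vs[l := r \<odot>\<^sub>X vs ! l])]) = r \<odot>\<^sub>M word_act p (ws[i := (q, vs)])) \<and>
   (\<forall>\<sigma>. \<sigma> permutes {..<n} --> word_act p (ws[i := (op_sym P n q \<sigma>, permute_list \<sigma> vs)]) =
    ksign M (perm_exp \<sigma> ds) (word_act p (ws[i := (q, vs)])))"
 proof (intro conjI ballI allI impI)
  show "word_act p (ws[i := (q, vs)]) \<in> carrier M"
   unfolding upd[OF q vs] using Ec[OF q vs] by simp
  show "word_act p (ws[i := (q \<oplus>\<^bsub>op_space P n\<^esub> q', vs)]) =
    word_act p (ws[i := (q, vs)]) \<oplus>\<^sub>M word_act p (ws[i := (q', vs)])" if q': "q' \<in> opg P n d" for q'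
   unfolding upd[OF q vs] upd[OF q' vs] upd[OF op_grade_add[OF q q'] vs]
    lin_add[OF lin opg_closed[OF q] opg_closed[OF q']]
    tensD(2)[OF base updc[OF q' vs]]
   by (rule M.ksign_add) (use Ec q q' vs in auto)
  show "word_act p (ws[i := (r \<odot>\<^bsub>op_space P n\<^esub> q, vs)]) = r \<odot>\<^sub>M word_act p (ws[i := (q, vs)])" if r: "r \<in> carrier R" for r
   unfolding upd[OF q vs] upd[OF op_grade_smult[OF r q] vs]
    lin_smult[OF lin r opg_closed[OF q]] tensD(3)[OF base r]
   by (rule lin_smult[OF M.ksign_linear r]) (use Ec q vs in auto)
  show "word_act p (ws[i := (q, vs[l := vs ! l \<oplus>\<^sub>X v])]) =
    word_act p (ws[i := (q, vs)]) \<oplus>\<^sub>M word_act p (ws[i := (q, vs[l := v])])"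
   if l: "l < n" and v: "v \<in> grade X (ds ! l)" for l v
  proof -
   have vl: "vs ! l \<in> grade X (ds ! l)" using vs l by (simp add: homs_iff)
   note h = homs_update_same[OF vs v] homs_update_same[OF vs X_gradeD(3)[OF vl v]]
   have "T (op_comp P ks p (qs[i := q])) (concat (vss[i := vs[l := vs ! l \<oplus>\<^sub>X v]])) =
     T (op_comp P ks p (qs[i := q])) (concat (vss[i := vs])) \<oplus>\<^sub>M T (op_comp P ks p (qs[i := q])) (concat (vss[i := vs[l := v]]))"
    using tensD(4)[OF base pos(2)[OF l], of v] pos(3,4)[OF l] v unfolding pos(1)[OF l] by simp
   then show ?thesis
    unfolding upd[OF q vs] upd[OF q h(1)] upd[OF q h(2)]
    using M.ksign_add[OF Ec[OF q vs] Ec[OF q h(1)]] by simp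
  qed
  show "word_act p (ws[i := (q, vs[l := r \<odot>\<^sub>X vs ! l])]) = r \<odot>\<^sub>M word_act p (ws[i := (q, vs)])"
   if l: "l < n" and r: "r \<in> carrier R" for l r
  proof -
   have vl: "vs ! l \<in> grade X (ds ! l)" using vs l by (simp add: homs_iff)
   note h = homs_update_same[OF vs X_gradeD(4)[OF r vl]]
   have "T (op_comp P ks p (qs[i := q])) (concat (vss[i := vs[l := r \<odot>\<^sub>X vs ! l]])) =
     r \<odot>\<^sub>M T (op_comp P ks p (qs[i := q])) (concat (vss[i := vs]))"
    using tensD(5)[OF base pos(2)[OF l] r] pos(4)[OF l] unfolding pos(1)[OF l] by simp
   then show ?thesis
    unfolding upd[OF q vs] upd[OF q h(1)]
    using lin_smult[OF M.ksign_linear r Ec[OF q vs]] by simp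
  qed
  show "word_act p (ws[i := (op_sym P n q \<sigma>, permute_list \<sigma> vs)]) =
    ksign M (perm_exp \<sigma> ds) (word_act p (ws[i := (q, vs)]))" if \<sigma>: "\<sigma> permutes {..<n}" for \<sigma>
  proof -
   let ?\<tau>s = "(replicate (length ks) id)[i := \<sigma>]"
   let ?a = "sum_list (take i ks)"
   let ?\<rho> = "shift_perm ?a n \<sigma>"
   have a: "?a = offset vss i"
   proof -
    have "take i ks = map length (take i vss)"
     by (rule nth_equalityI) (use lv len i in auto)
    then show ?thesis by (simp add: length_concat)
   qed
   have ad: "?a = offset (dss[i := ds]) i"
   proof -
    have "take i ks = map length (take i (dss[i := ds]))"
     by (rule nth_equalityI) (use wd len i in \<open>auto simp: ks_def word_degs_def homs_iff\<close>)
    then show ?thesis by (simp add: length_concat)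
   qed
   have \<rho>: "sum_perm ks ?\<tau>s = ?\<rho>" using sum_perm_single[of i ks \<sigma>] i len ksi \<sigma> by simp
   have "?a + n \<le> sum_list ks"
    using ksi i len by (metis id_take_nth_drop add.assoc le_add1 sum_list.Cons sum_list_append)
   then have \<rho>p: "?\<rho> permutes {..<sum_list ks}" by (rule shift_perm_permutes[OF \<sigma>])
   have "map (%j. op_sym P (ks ! j) (qs ! j) (?\<tau>s ! j)) [0..<length ks] = qs[i := op_sym P n q \<sigma>]"
   proof (rule nth_equalityI)
    show "map (%j. op_sym P (ks ! j) (qs ! j) (?\<tau>s ! j)) [0..<length ks] ! j = qs[i := op_sym P n q \<sigma>] ! j"
     if "j < length (map (%j. op_sym P (ks ! j) (qs ! j) (?\<tau>s ! j)) [0..<length ks])" for j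
     using that len i ksi sym_id[OF qc, of j] by (cases "j = i") (auto simp: qs_def)
   qed (simp add: len)
   moreover have "op_comp P ks p (map (%j. op_sym P (ks ! j) (qs ! j) (?\<tau>s ! j)) [0..<length ks]) =
     op_sym P (sum_list ks) (op_comp P ks p qs) (sum_perm ks ?\<tau>s)"
   proof (rule comp_sym_inner)
    show "?\<tau>s ! j permutes {..<ks ! j}" if "j < length ks" for j
     using that \<sigma> ksi permutes_id by (cases "j = i") auto
   qed (use opg_closed[OF p] qc len in \<open>auto simp: elements_map_op_space\<close>)
   ultimately have c: "op_comp P ks p (qs[i := op_sym P n q \<sigma>]) = op_sym P (sum_list ks) (op_comp P ks p (qs[i := q])) ?\<rho>"
    unfolding \<rho> qs_i by simp
   have v: "concat (vss[i := permute_list \<sigma> vs]) = permute_list ?\<rho> (concat (vss[i := vs]))"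
    using permute_list_shift[of \<sigma> vs "concat (take i vss)" "concat (drop (Suc i) vss)"] \<sigma> n i len
    by (simp add: concat_update_split a)
   have x: "perm_exp ?\<rho> (concat (dss[i := ds])) = perm_exp \<sigma> ds"
    using perm_exp_shift[of \<sigma> ds "concat (take i dss)" "concat (drop (Suc i) dss)"] \<sigma> n i len
    unfolding ad by (simp add: concat_update_split)
   have "mset (permute_list \<sigma> ds) = mset ds" using \<sigma> n by (simp add: mset_permute_list)
   then have "sum_list (permute_list \<sigma> ds) = sum_list ds" by (metis sum_mset_sum_list)
   then have s: "map sum_list (dss[i := permute_list \<sigma> ds]) = map sum_list (dss[i := ds])"
    by (simp add: map_update)
   note h = homogeneous_permute[OF vs \<sigma>]
   have "T (op_comp P ks p (qs[i := op_sym P n q \<sigma>])) (concat (vss[i := permute_list \<sigma> vs])) =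
     ksign M (perm_exp \<sigma> ds) (T (op_comp P ks p (qs[i := q])) (concat (vss[i := vs])))"
    using tensD(6)[OF base \<rho>p] unfolding c v x .
   then show ?thesis
    unfolding upd[OF q vs] upd[OF op_sym_grade[OF \<sigma> q] h] s
    using Ec[OF q vs] by (simp add: M.ksign_ksign add.commute)
  qed
 qed
qed

subsection \<open>Independence of the representatives\<close>

definition lincombs :: "(('p \<times> 'v list) list => ('k,'p,'v) tensors) => ('p \<times> 'v list => 'k) list => ('k,'p,'v) tensors"
 where "lincombs g cs = (\<Oplus>\<^sub>M ws\<in>listset (map (support R) cs). (\<Otimes>\<^sub>R i\<in>{..<length cs}. (cs ! i) (ws ! i)) \<odot>\<^sub>M g ws)"

lemma listset_lengths: "ws \<in> listset As ==> length ws = length As \<and> (\<forall>i<length As. ws ! i \<in> As ! i)"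
proof (induction As arbitrary: ws)
 case (Cons A As)
 then obtain w ws' where "ws = w # ws'" "w \<in> A" "ws' \<in> listset As" by (auto simp: set_Cons_def)
 then show ?case using Cons.IH[of ws'] by (auto simp: nth_Cons split: nat.splits)
qed simp

lemma formalD: "c \<in> carrier Fm ==> c w \<in> carrier R" "c \<in> carrier Fm ==> finite (support R c)"
 "c \<in> carrier Fm ==> support R c \<subseteq> words P X"
 by (auto simp: mem_formal)

lemma listset_words:
 assumes "set cs \<subseteq> carrier Fm" "ws \<in> listset (map (support R) cs)"
 shows "length ws = length cs" "set ws \<subseteq> words P X"
proof -
 note l = listset_lengths[OF assms(2)]
 show "length ws = length cs" using l by simp
 show "set ws \<subseteq> words P X"
 proof
  fix w assume "w \<in> set ws"
  then obtain i where i: "i < length cs" "w = ws ! i" using l by (auto simp: in_set_conv_nth)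
  then have "cs ! i \<in> carrier Fm" using assms(1) by auto
  then show "w \<in> words P X" using l i formalD(3) by force
 qed
qed

lemma lincombs_Cons:
 assumes c: "c \<in> carrier Fm" and cs: "set cs \<subseteq> carrier Fm"
  and g: "!!ws. [|length ws = Suc (length cs); set ws \<subseteq> words P X|] ==> g ws \<in> carrier M"
 shows "lincombs g (c # cs) = lincomb R M (%w. lincombs (%ws. g (w # ws)) cs) c"
proof -
 let ?A = "support R c" and ?L = "listset (map (support R) cs)"
 have fin: "finite ?A" "finite ?L"
  using formalD(2)[OF c] finite_listset[of "map (support R) cs"] formalD(2) cs by auto
 have csR: "(cs ! i) w \<in> carrier R" if "i < length cs" for i w using that cs formalD(1) nth_mem by blast
 have pc: "(\<Otimes>\<^sub>R i\<in>{..<length cs}. (cs ! i) (ws ! i)) \<in> carrier R" for ws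
  by (rule finprod_closed) (intro Pi_I csR, simp)
 have gc: "g (w # ws) \<in> carrier M" if "w \<in> ?A" "ws \<in> ?L" for w ws
  using g[of "w # ws"] listset_words[OF cs that(2)] formalD(3)[OF c] that(1) by auto
 have prod: "(\<Otimes>\<^sub>R i\<in>{..<length (c # cs)}. ((c # cs) ! i) ((w # ws) ! i)) = c w \<otimes>\<^sub>R (\<Otimes>\<^sub>R i\<in>{..<length cs}. (cs ! i) (ws ! i))" for w ws
 proof -
  have "{..<length (c # cs)} = insert 0 (Suc ` {..<length cs})" by (simp add: lessThan_Suc_eq_insert_0)
  moreover have "(\<Otimes>\<^sub>R i\<in>Suc ` {..<length cs}. ((c # cs) ! i) ((w # ws) ! i)) = (\<Otimes>\<^sub>R i\<in>{..<length cs}. (cs ! i) (ws ! i))"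
   by (subst finprod_reindex) (auto intro!: csR)
  moreover have "(\<Otimes>\<^sub>R i\<in>insert 0 (Suc ` {..<length cs}). ((c # cs) ! i) ((w # ws) ! i)) =
    ((c # cs) ! 0) ((w # ws) ! 0) \<otimes>\<^sub>R (\<Otimes>\<^sub>R i\<in>Suc ` {..<length cs}. ((c # cs) ! i) ((w # ws) ! i))"
   by (rule finprod_insert) (auto intro!: csR formalD(1)[OF c])
  ultimately show ?thesis by simp
 qed
 define h where "h ws = (\<Otimes>\<^sub>R i\<in>{..<length (c # cs)}. ((c # cs) ! i) (ws ! i)) \<odot>\<^sub>M g ws" for ws
 have h: "h (w # ws) = c w \<odot>\<^sub>M ((\<Otimes>\<^sub>R i\<in>{..<length cs}. (cs ! i) (ws ! i)) \<odot>\<^sub>M g (w # ws))" if "w \<in> ?A" "ws \<in> ?L" for w ws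
  unfolding h_def prod by (rule M.smult_assoc1) (use formalD(1)[OF c] pc gc[OF that] in auto)
 have hc: "h (w # ws) \<in> carrier M" if "w \<in> ?A" "ws \<in> ?L" for w ws
  unfolding h[OF that] by (intro M.smult_closed formalD(1)[OF c] pc gc[OF that])
 have "listset (map (support R) (c # cs)) = (\<Union>w\<in>?A. (%ws. w # ws) ` ?L)" by (auto simp: set_Cons_def)
 then have "lincombs g (c # cs) = (\<Oplus>\<^sub>M ws\<in>(\<Union>w\<in>?A. (%ws. w # ws) ` ?L). h ws)"
  by (simp add: lincombs_def h_def)
 also have "... = (\<Oplus>\<^sub>M w\<in>?A. \<Oplus>\<^sub>M ws\<in>(%ws. w # ws) ` ?L. h ws)"
  by (rule M.add.finprod_UN_disjoint) (use fin hc in \<open>auto simp: pairwise_def disjnt_def\<close>)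
 also have "... = (\<Oplus>\<^sub>M w\<in>?A. c w \<odot>\<^sub>M lincombs (%ws. g (w # ws)) cs)"
 proof (rule M.finsum_cong'[OF refl])
  have lc: "lincombs (%ws. g (w # ws)) cs \<in> carrier M" if "w \<in> ?A" for w
   unfolding lincombs_def by (rule M.finsum_closed) (use pc gc that in auto)
  then show "(%w. c w \<odot>\<^sub>M lincombs (%ws. g (w # ws)) cs) \<in> ?A \<rightarrow> carrier M"
   using formalD(1)[OF c] by (intro Pi_I M.smult_closed)
  fix w assume w: "w \<in> ?A"
  have "(\<Oplus>\<^sub>M ws\<in>(%ws. w # ws) ` ?L. h ws) = (\<Oplus>\<^sub>M ws\<in>?L. h (w # ws))"
   by (rule M.finsum_reindex) (use hc[OF w] in auto)
  also have "... = (\<Oplus>\<^sub>M ws\<in>?L. c w \<odot>\<^sub>M ((\<Otimes>\<^sub>R i\<in>{..<length cs}. (cs ! i) (ws ! i)) \<odot>\<^sub>M g (w # ws)))"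
   by (rule M.finsum_cong'[OF refl]) (use h[OF w] hc[OF w] in auto)
  also have "... = c w \<odot>\<^sub>M lincombs (%ws. g (w # ws)) cs"
   unfolding lincombs_def
   by (rule M.finsum_smult_ldistr[symmetric]) (use fin formalD(1)[OF c] pc gc[OF w] in auto)
  finally show "(\<Oplus>\<^sub>M ws\<in>(%ws. w # ws) ` ?L. h ws) = c w \<odot>\<^sub>M lincombs (%ws. g (w # ws)) cs" .
 qed
 finally show ?thesis by (simp add: lincomb_def)
qed

text \<open>
 One argument at a time, a representative is replaced by the word that it represents: a map that respects
 the relations does not distinguish them.
\<close>

lemma lincombs_representatives:
 assumes "length cs = length ws" "set ws \<subseteq> words P X" "set cs \<subseteq> carrier Fm"
  and "!!i. i < length ws ==> Rel +>\<^sub>Fm cs ! i = T (fst (ws ! i)) (snd (ws ! i))"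
  and "!!us. [|length us = length ws; set us \<subseteq> words P X|] ==> g us \<in> carrier M"
  and "!!us i. [|length us = length ws; set us \<subseteq> words P X; i < length ws|] ==>
   respects_relations R P X M (%q vs. g (us[i := (q, vs)]))"
 shows "lincombs g cs = g ws"
 using assms
proof (induction cs arbitrary: ws g)
 case Nil
 then have "g [] \<in> carrier M" by simp
 then show ?case using Nil by (simp add: lincombs_def)
next
 case (Cons c cs)
 then obtain w us where ws: "ws = w # us" by (cases ws) auto
 have c: "c \<in> carrier Fm" "set cs \<subseteq> carrier Fm" and w: "w \<in> words P X" "set us \<subseteq> words P X"
  using Cons.prems(2,3) by (auto simp: ws)
 have len: "length cs = length us" using Cons.prems(1) by (simp add: ws)
 have IH: "lincombs (%us. g (w' # us)) cs = g (w' # us)" if w': "w' \<in> words P X" for w'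
 proof (rule Cons.IH[OF len w(2) c(2)])
  show "Rel +>\<^sub>Fm cs ! i = T (fst (us ! i)) (snd (us ! i))" if "i < length us" for i
   using Cons.prems(4)[of "Suc i"] that by (simp add: ws)
  show "g (w' # us') \<in> carrier M" if "length us' = length us" "set us' \<subseteq> words P X" for us'
   using Cons.prems(5)[of "w' # us'"] that w' by (simp add: ws)
  show "respects_relations R P X M (%q vs. g (w' # us'[i := (q, vs)]))"
   if "length us' = length us" "set us' \<subseteq> words P X" "i < length us" for us' i
   using Cons.prems(6)[of "w' # us'" "Suc i"] that w' by (simp add: ws)
 qed
 have gw: "g (w' # us) \<in> carrier M" if "w' \<in> words P X" for w'
  using Cons.prems(5)[of "w' # us"] that w by (simp add: ws)
 have "lincombs g (c # cs) = lincomb R M (%w. lincombs (%ws. g (w # ws)) cs) c"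
  by (rule lincombs_Cons[OF c]) (use Cons.prems(5) len in \<open>auto simp: ws\<close>)
 also have "... = lincomb R M (%w. g (w # us)) c"
  unfolding lincomb_def
 proof (rule M.finsum_cong'[OF refl])
  show "(%w. c w \<odot>\<^sub>M g (w # us)) \<in> support R c \<rightarrow> carrier M"
   by (intro Pi_I M.smult_closed formalD(1)[OF c(1)] gw subsetD[OF formalD(3)[OF c(1)]])
  show "c w' \<odot>\<^sub>M lincombs (%ws. g (w' # ws)) cs = c w' \<odot>\<^sub>M g (w' # us)" if "w' \<in> support R c" for w'
   using IH[OF subsetD[OF formalD(3)[OF c(1)] that]] by simp
 qed
 also have "... = g (w # us)"
 proof -
  have L: "linear_map R Fm M (lincomb R M (%w. g (w # us)))" by (rule lincomb_linear[OF modM gw])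
  have "respects_relations R P X M (%q vs. g ((q, vs) # us))"
   using Cons.prems(6)[of "w # us" 0] w by (simp add: ws)
  note kill = lincomb_kills_relations[OF modM this]
  have "c \<ominus>\<^sub>Fm single R w \<in> Rel"
   using Cons.prems(4)[of 0] coset_eq_iff[OF formal_module relations_submodule c(1) single_closed[OF w(1)]]
   by (simp add: ws tens_def)
  from kill[OF this]
  have "lincomb R M (%w. g (w # us)) c \<ominus>\<^sub>M lincomb R M (%w. g (w # us)) (single R w) = \<zero>\<^sub>M"
   using lin_diff[OF formal_module modM L c(1) single_closed[OF w(1)]] by simp
  moreover have "lincomb R M (%w. g (w # us)) (single R w) = g (w # us)"
   by (rule lincomb_single[OF modM]) (rule gw[OF w(1)])
  ultimately show ?thesis
   using M.minus_zero_iff lin_closed[OF L c(1)] gw[OF w(1)] by metis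
 qed
 finally show ?case by (simp add: ws)
qed

lemma free_act_words:
 assumes p: "p \<in> opg P (length ws) e" and ws: "set ws \<subseteq> words P X"
 shows "free_act R P X p (map (%w. T (fst w) (snd w)) ws) = word_act p ws"
proof -
 interpret O: graded_space R "op_space P (length ws)" by (rule op_graded)
 let ?Cs = "map (%w. T (fst w) (snd w)) ws" and ?p = "%e. hpart (op_space P (length ws)) p e"
 let ?cs = "map representative ?Cs"
 have Cs: "T (fst w) (snd w) \<in> carrier M" if "w \<in> set ws" for w
  using tens_closed[of "fst w" "snd w"] that ws by auto
 have free: "free_act R P X p ?Cs = (\<Oplus>\<^sub>M e\<in>{e. ?p e \<noteq> \<zero>\<^bsub>op_space P (length ws)\<^esub>}. lincombs (word_act (?p e)) ?cs)"
  by (simp add: free_act_def Let_def lincombs_def word_act_def del: map_map)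
 have lc: "lincombs (word_act p) ?cs = word_act p ws"
 proof (rule lincombs_representatives)
  show "set ?cs \<subseteq> carrier Fm" using representative_closed[OF Cs] by auto
  show "Rel +>\<^sub>Fm ?cs ! i = T (fst (ws ! i)) (snd (ws ! i))" if "i < length ws" for i
   using representative_coset[OF Cs] that by simp
  show "word_act p us \<in> carrier M" if "length us = length ws" "set us \<subseteq> words P X" for us
   by (rule word_act_closed) (use that p in auto)
  show "respects_relations R P X M (%q vs. word_act p (us[i := (q, vs)]))"
   if "length us = length ws" "set us \<subseteq> words P X" "i < length ws" for us i
   by (rule word_act_respects) (use that p in auto)
 qed (use ws in auto)
 show ?thesis
 proof (cases "p = \<zero>\<^bsub>op_space P (length ws)\<^esub>")
  case True
  have "{e. ?p e \<noteq> \<zero>\<^bsub>op_space P (length ws)\<^esub>} = {}" using O.hpart_of[OF p] True by auto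
  then have "free_act R P X p ?Cs = \<zero>\<^sub>M" unfolding free by simp
  moreover have "word_act p ws = \<zero>\<^sub>M"
  proof -
   obtain es dss where wd: "word_degs ws es dss" using words_degs[OF ws] .
   have q: "map fst ws ! i \<in> carrier (op_space P (map (length \<circ> snd) ws ! i))" if "i < length ws" for i
    using wd that opg_closed by (auto simp: word_degs_def)
   have "linear_map R (op_space P (length (map (length \<circ> snd) ws))) (op_space P (sum_list (map (length \<circ> snd) ws)))
     (%p. op_comp P (map (length \<circ> snd) ws) p (map fst ws))"
    by (rule comp_linear_op) (use q in auto)
   from lin_zero[OF op_module op_module this]
   show ?thesis unfolding word_act_eq[OF wd p] using True tens_zero_op[OF word_degs_concat[OF wd]] by simp
  qed
  ultimately show ?thesis by simp
 next
  case False
  then have "{e. ?p e \<noteq> \<zero>\<^bsub>op_space P (length ws)\<^esub>} = {e}" using O.hpart_of[OF p] by auto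
  then show ?thesis unfolding free using lc O.hpart_of[OF p] word_act_closed[OF ws p] by simp
 qed
qed

subsection \<open>Generators\<close>

abbreviation "gen \<equiv> generator R P X"

lemma gen_homogeneous:
 assumes "v \<in> grade X i"
 shows "gen v = T (op_unit P) [v]" and "homs 1 X [v] [i]"
proof -
 show h: "homs 1 X [v] [i]" using assms by simp
 note t = tensD(1)[OF unit_grade h] tens_zero_arg[OF unit_grade h, of 0]
 show "gen v = T (op_unit P) [v]"
 proof (cases "v = \<zero>\<^sub>X")
  case True
  then have "{j. hpart X v j \<noteq> \<zero>\<^sub>X} = {}" using X.hpart_of[OF assms] by auto
  then show ?thesis using t True by (simp add: generator_def)
 next
  case False
  then have "{j. hpart X v j \<noteq> \<zero>\<^sub>X} = {i}" using X.hpart_of[OF assms] by auto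
  then show ?thesis using t X.hpart_of[OF assms] by (simp add: generator_def)
 qed
qed

lemma gen_linear: "linear_map R X M gen"
proof -
 let ?s = "%v. T (op_unit P) [v]"
 have h: "homs 1 X [v] [i]" if "v \<in> grade X i" for v i using that by simp
 have "linear_map R (X\<lparr>carrier := grade X i\<rparr>) M ?s" for i
 proof (rule linear_mapI; simp)
  show "T (op_unit P) [v] \<in> carrier M" if "v \<in> grade X i" for v by (rule tensD(1)[OF unit_grade h[OF that]])
  show "T (op_unit P) [v \<oplus>\<^sub>X v'] = T (op_unit P) [v] \<oplus>\<^sub>M T (op_unit P) [v']" if "v \<in> grade X i" "v' \<in> grade X i" for v v'
   using tensD(4)[OF unit_grade h[OF that(1)], of 0 v'] that by simp
  show "T (op_unit P) [r \<odot>\<^sub>X v] = r \<odot>\<^sub>M T (op_unit P) [v]" if "r \<in> carrier R" "v \<in> grade X i" for r v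
   using tensD(5)[OF unit_grade h[OF that(2)], of 0 r] that by simp
 qed
 from X.assemble_linear_map[OF modM this]
 obtain f where f: "linear_map R X M f" "!!i x. x \<in> grade X i ==> f x = ?s x" by blast
 have "gen v = f v" if v: "v \<in> carrier X" for v
 proof -
  let ?I = "{i. hpart X v i \<noteq> \<zero>\<^sub>X}"
  have "f (\<Oplus>\<^sub>X i\<in>?I. hpart X v i) = (\<Oplus>\<^sub>M i\<in>?I. f (hpart X v i))"
   by (rule lin_finsum[OF modX modM f(1)]) (use v in \<open>simp add: hpart_component\<close>)
  also have "... = gen v" unfolding generator_def
   by (rule M.finsum_cong')
    (use f(2)[OF X.component_in[OF v]] tensD(1)[OF unit_grade h[OF X.component_in[OF v]]] in \<open>auto simp: hpart_component\<close>)
  finally show ?thesis using X.component_sum[OF v] by (simp add: hpart_component)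
 qed
 then show ?thesis using f(1) by (auto intro: linear_map_cong[OF modX f(1)])
qed

lemmas gen_closed = lin_closed[OF gen_linear]

text \<open>Composing with units changes nothing.\<close>

lemma free_act_generators:
 assumes p: "p \<in> opg P n e" and vs: "homs n X vs ds"
 shows "free_act R P X p (map gen vs) = T p vs"
proof -
 let ?ws = "map (%v. (op_unit P, [v])) vs"
 have n: "length vs = n" "length ds = n" using vs by (auto simp: homs_iff)
 have wd: "word_degs ?ws (replicate n 0) (map (%d. [d]) ds)"
  using vs n unit_grade by (simp add: word_degs_def homs_iff)
 have ws: "set ?ws \<subseteq> words P X"
 proof
  fix w assume "w \<in> set ?ws"
  then obtain i where i: "i < n" "w = (op_unit P, [vs ! i])" using n by (auto simp: in_set_conv_nth)
  show "w \<in> words P X" unfolding i(2)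
   by (rule wordI[OF unit_grade gen_homogeneous(2)]) (use vs i in \<open>auto simp: homs_iff\<close>)
 qed
 have "map gen vs = map (%w. T (fst w) (snd w)) ?ws"
 proof (rule nth_equalityI)
  fix i assume "i < length (map gen vs)"
  then have i: "i < n" using n by simp
  then have "vs ! i \<in> grade X (ds ! i)" using vs by (simp add: homs_iff)
  from gen_homogeneous(1)[OF this] show "map gen vs ! i = map (%w. T (fst w) (snd w)) ?ws ! i"
   using i n by simp
 qed simp
 moreover have "free_act R P X p (map (%w. T (fst w) (snd w)) ?ws) = word_act p ?ws"
  by (rule free_act_words) (use p n ws in auto)
 moreover have "word_act p ?ws = T p vs"
 proof -
  have p': "p \<in> grade (op_space P (length ?ws)) e" using p n by simp
  have "map (length \<circ> snd) ?ws = replicate n 1" "map fst ?ws = replicate n (op_unit P)" "concat (map snd ?ws) = vs"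
   using n by (simp_all add: comp_def map_replicate_const concat_map_singleton flip: n(1))
  then show ?thesis
   unfolding word_act_eq[OF wd p'] shuffle_exp_zeros
   using comp_unit_right[OF opg_closed[OF p]] by (simp add: ksign_def)
 qed
 ultimately show ?thesis by (simp only:)
qed

end

section \<open>Maps and derivations out of quasi-free algebras\<close>

lemma linear_maps_eq_on_span:
 assumes "module R M" "module R N" "S \<subseteq> carrier M"
  and "linear_map R (M\<lparr>carrier := generated_submodule R M S\<rparr>) N f"
  and "linear_map R (M\<lparr>carrier := generated_submodule R M S\<rparr>) N g"
  and "!!x. x \<in> S ==> f x = g x" "x \<in> generated_submodule R M S"
 shows "f x = g x"
proof -
 interpret M: module R M by fact
 let ?H = "generated_submodule R M S"
 have H: "submodule ?H R M" by (rule M.generated_sub[OF assms(3)])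
 note D = submoduleD[OF assms(1) H]
 have mH: "module R (M\<lparr>carrier := ?H\<rparr>)" by (rule submodule_restrict_module[OF assms(1) H])
 have "x \<in> ?H \<and> f x = g x" using assms(7,3)
 proof (induction rule: M.generated_induct)
  case (gen x)
  then show ?case using assms(6) M.generated_incl by blast
 next
  case zero
  show ?case using lin_zero[OF mH assms(2,4)] lin_zero[OF mH assms(2,5)] D(2) by simp
 next
  case (add x y)
  then show ?case using lin_add[OF assms(4), of x y] lin_add[OF assms(5), of x y] D(3) by simp
 next
  case (smult r x)
  then show ?case using lin_smult[OF assms(4), of r x] lin_smult[OF assms(5), of r x] D(4) by simp
 qed
 then show ?thesis by blast
qed

lemma sum_list_raise: "k < length ds ==> sum_list (ds[k := ds ! k + 1]) = sum_list ds + (1 :: int)"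
 by (induction ds arbitrary: k) (auto split: nat.splits)

lemma (in abelian_group) finsum_antisymmetric:
 assumes "!!i j. [|i < n; j < n|] ==> u i j \<in> carrier G" "!!i. i < n ==> u i i = \<zero>"
  and "!!i j. [|i < n; j < n; i \<noteq> j|] ==> u i j \<oplus> u j i = \<zero>"
 shows "(\<Oplus>i\<in>{..<n::nat}. \<Oplus>j\<in>{..<n}. u i j) = \<zero>"
 using assms
proof (induction n)
 case (Suc n)
 have c: "u i j \<in> carrier G" if "i \<le> n" "j \<le> n" for i j using Suc.prems(1) that by simp
 have row: "(\<Oplus>j\<in>{..<Suc n}. u i j) = u i n \<oplus> (\<Oplus>j\<in>{..<n}. u i j)" if "i \<le> n" for i
  unfolding lessThan_Suc by (rule finsum_insert) (use c that in auto)
 have cr: "(\<Oplus>j\<in>{..<n}. u i j) \<in> carrier G" if "i \<le> n" for i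
  by (rule finsum_closed) (use c that in auto)
 have "(\<Oplus>i\<in>{..<Suc n}. \<Oplus>j\<in>{..<Suc n}. u i j) =
   (\<Oplus>j\<in>{..<Suc n}. u n j) \<oplus> (\<Oplus>i\<in>{..<n}. \<Oplus>j\<in>{..<Suc n}. u i j)"
  unfolding lessThan_Suc[of n] by (rule finsum_insert) (use c in \<open>auto intro!: finsum_closed\<close>)
 also have "(\<Oplus>i\<in>{..<n}. \<Oplus>j\<in>{..<Suc n}. u i j) = (\<Oplus>i\<in>{..<n}. u i n \<oplus> (\<Oplus>j\<in>{..<n}. u i j))"
  by (rule finsum_cong') (use row c cr in auto)
 also have "... = (\<Oplus>i\<in>{..<n}. u i n) \<oplus> (\<Oplus>i\<in>{..<n}. \<Oplus>j\<in>{..<n}. u i j)"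
  by (rule finsum_addf) (use c cr in auto)
 also have "(\<Oplus>i\<in>{..<n}. \<Oplus>j\<in>{..<n}. u i j) = \<zero>" by (rule Suc.IH) (use Suc.prems in auto)
 also have "(\<Oplus>j\<in>{..<Suc n}. u n j) = (\<Oplus>j\<in>{..<n}. u n j)"
  using row[of n] Suc.prems(2)[of n] cr by simp
 also have "(\<Oplus>j\<in>{..<n}. u n j) \<oplus> ((\<Oplus>i\<in>{..<n}. u i n) \<oplus> \<zero>) = (\<Oplus>i\<in>{..<n}. u n i \<oplus> u i n)"
  using c by (subst finsum_addf) (auto intro!: finsum_closed)
 also have "... = (\<Oplus>i\<in>{..<n}. \<zero>)"
  by (rule finsum_cong') (use Suc.prems(3) in auto)
 finally show ?case by simp
qed simp

text \<open>
 The right-hand side of the Leibniz rule, for the images of the arguments under a linear map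
 \<open>\<alpha>\<close> and the images of their derivatives under \<open>\<beta>\<close>.
\<close>

definition leib ::
 "('k, 'p) operad => ('k, 'p, 'a) dg_algebra => ('y => 'a) => ('y => 'a) => int => int list => 'p => 'y list => 'a"
 where "leib P A \<alpha> \<beta> e ds p ys = act A (diff (op_space P (length ys)) p) (map \<alpha> ys) \<oplus>\<^sub>A
  (\<Oplus>\<^sub>A i\<in>{..<length ys}. ksign A (e + sum_list (take i ds)) (act A p ((map \<alpha> ys)[i := \<beta> (ys ! i)])))"

context p_algebra
begin

lemma leib_closed:
 assumes "p \<in> opc P (length ys)" "!!y. y \<in> set ys ==> \<alpha> y \<in> carrier A" "!!y. y \<in> set ys ==> \<beta> y \<in> carrier A"
 shows "(%i. ksign A (e + sum_list (take i ds)) (act A p ((map \<alpha> ys)[i := \<beta> (ys ! i)]))) \<in> {..<length ys} \<rightarrow> carrier A"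
  and "leib P A \<alpha> \<beta> e ds p ys \<in> carrier A"
proof -
 have "set ((map \<alpha> ys)[i := \<beta> (ys ! i)]) \<subseteq> carrier A" if "i < length ys" for i
  using assms that by (auto dest!: subsetD[OF set_update_subset_insert])
 then show 1: "(%i. ksign A (e + sum_list (take i ds)) (act A p ((map \<alpha> ys)[i := \<beta> (ys ! i)]))) \<in> {..<length ys} \<rightarrow> carrier A"
  using assms(1) by (intro Pi_I ksign_closed act_closed) auto
 have "act A (diff (op_space P (length ys)) p) (map \<alpha> ys) \<in> carrier A"
  by (rule act_closed) (use assms lin_closed[OF op_diff_linear] in auto)
 then show "leib P A \<alpha> \<beta> e ds p ys \<in> carrier A"
  unfolding leib_def using 1 by (intro a_closed finsum_closed)
qed

lemma leib_linear_op:
 assumes "!!y. y \<in> set ys ==> \<alpha> y \<in> carrier A" "!!y. y \<in> set ys ==> \<beta> y \<in> carrier A"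
 shows "linear_map R (op_space P (length ys)) A (%p. leib P A \<alpha> \<beta> e ds p ys)"
 unfolding leib_def
proof (rule lin_sum[OF alg_module])
 show "linear_map R (op_space P (length ys)) A (%p. act A (diff (op_space P (length ys)) p) (map \<alpha> ys))"
  by (rule lin_comp[OF op_diff_linear act_linear_op]) (use assms in auto)
 show "linear_map R (op_space P (length ys)) A (%p. \<Oplus>\<^sub>A i\<in>{..<length ys}. ksign A (e + sum_list (take i ds)) (act A p ((map \<alpha> ys)[i := \<beta> (ys ! i)])))"
 proof (rule linear_map_finsum_left[OF op_module alg_module])
  fix i assume "i \<in> {..<length ys}"
  then have "set ((map \<alpha> ys)[i := \<beta> (ys ! i)]) \<subseteq> carrier A"
   using assms by (auto dest!: subsetD[OF set_update_subset_insert])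
  then show "linear_map R (op_space P (length ys)) A (%p. ksign A (e + sum_list (take i ds)) (act A p ((map \<alpha> ys)[i := \<beta> (ys ! i)])))"
   by (intro linear_map_ksign_left[OF alg_module] act_linear_op) auto
 qed
qed

lemma leib_linear_arg:
 assumes Y: "module R Y" and lin: "linear_map R Y A \<alpha>" "linear_map R Y A \<beta>"
  and p: "p \<in> opc P (length ys)" and ys: "set ys \<subseteq> carrier Y" and l: "l < length ys"
 shows "linear_map R Y A (%y. leib P A \<alpha> \<beta> e ds p (ys[l := y]))"
proof -
 have \<alpha>: "\<alpha> y \<in> carrier A" and \<beta>: "\<beta> y \<in> carrier A" if "y \<in> set ys" for y
  using that ys lin_closed[OF lin(1)] lin_closed[OF lin(2)] by auto
 have "linear_map R Y A (%y. act A (diff (op_space P (length ys)) p) ((map \<alpha> ys)[l := \<alpha> y]) \<oplus>\<^sub>A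
  (\<Oplus>\<^sub>A i\<in>{..<length ys}. ksign A (e + sum_list (take i ds))
   (act A p (if i = l then (map \<alpha> ys)[l := \<beta> y] else ((map \<alpha> ys)[i := \<beta> (ys ! i)])[l := \<alpha> y]))))"
 proof (rule lin_sum[OF alg_module])
  show "linear_map R Y A (%y. act A (diff (op_space P (length ys)) p) ((map \<alpha> ys)[l := \<alpha> y]))"
   by (rule lin_comp[OF lin(1) act_linear_arg]) (use l p \<alpha> lin_closed[OF op_diff_linear] in auto)
  show "linear_map R Y A (%y. \<Oplus>\<^sub>A i\<in>{..<length ys}. ksign A (e + sum_list (take i ds))
   (act A p (if i = l then (map \<alpha> ys)[l := \<beta> y] else ((map \<alpha> ys)[i := \<beta> (ys ! i)])[l := \<alpha> y])))"
  proof (rule linear_map_finsum_left[OF Y alg_module])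
   fix i assume i: "i \<in> {..<length ys}"
   have "linear_map R Y A (%y. act A p (if i = l then (map \<alpha> ys)[l := \<beta> y] else ((map \<alpha> ys)[i := \<beta> (ys ! i)])[l := \<alpha> y]))"
   proof (cases "i = l")
    case True
    have "linear_map R Y A (%y. act A p ((map \<alpha> ys)[l := \<beta> y]))"
     by (rule lin_comp[OF lin(2) act_linear_arg]) (use l p \<alpha> in auto)
    then show ?thesis using True by simp
   next
    case False
    have "set ((map \<alpha> ys)[i := \<beta> (ys ! i)]) \<subseteq> carrier A"
     using \<alpha> \<beta> i by (auto dest!: subsetD[OF set_update_subset_insert])
    then have "linear_map R Y A (%y. act A p (((map \<alpha> ys)[i := \<beta> (ys ! i)])[l := \<alpha> y]))"
     by (intro lin_comp[OF lin(1) act_linear_arg]) (use l p in auto)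
    then show ?thesis using False by simp
   qed
   then show "linear_map R Y A (%y. ksign A (e + sum_list (take i ds))
    (act A p (if i = l then (map \<alpha> ys)[l := \<beta> y] else ((map \<alpha> ys)[i := \<beta> (ys ! i)])[l := \<alpha> y])))"
    by (rule linear_map_ksign_left[OF alg_module])
  qed
 qed
 moreover have "(map \<alpha> (ys[l := y]))[i := \<beta> (ys[l := y] ! i)] =
   (if i = l then (map \<alpha> ys)[l := \<beta> y] else ((map \<alpha> ys)[i := \<beta> (ys ! i)])[l := \<alpha> y])" for i y
  using l by (simp add: map_update list_update_swap)
 ultimately show ?thesis by (simp add: leib_def map_update)
qed

end

locale free_p_alg = free_gens R P X + Q: p_algebra R P "quasi_free R P X d"
 for R :: "('k, 'c) ring_scheme" and P :: "('k, 'p) operad" and X :: "('k, 'v) dgvs"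
  and d :: "('k,'p,'v) tensors => ('k,'p,'v) tensors"
begin

abbreviation "Q \<equiv> quasi_free R P X d"
abbreviation "pact \<equiv> free_act R P X"
abbreviation "G \<equiv> free_grade R P X"

lemma quasi_free_simps [simp]:
 "carrier Q = carrier M" "zero Q = zero M" "add Q = add M" "smult Q = smult M"
 "grade Q = G" "diff Q = d" "act Q = pact"
 by (simp_all add: quasi_free_def free_algebra_def)

lemma same: "same_structure Q M" by (simp add: same_structure_def)

lemmas same_simps [simp] = same_finsum[OF same] same_neg[OF same] same_ksign[OF same]
 same_structure_linear(1)[OF same] same_structure_linear(2)[OF same]

lemma Q_graded: "graded_space R Q" by (rule Q.alg_graded)

lemma Q_d_linear: "linear_map R M M d" using complex_diff_linear[OF Q.cochain_complex_axioms] by simp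

lemma word_gen: "[|p \<in> opg P n e; homs n X vs ds|] ==> T p vs = pact p (map gen vs)"
 by (rule free_act_generators[symmetric])

lemma homs_closed: "homs n X vs ds ==> set vs \<subseteq> carrier X"
 unfolding homs_iff by (metis X.grade_closed in_set_conv_nth subsetI)

lemma homogeneous_Q: "homs n Q as ds \<longleftrightarrow> length as = n \<and> length ds = n \<and> (\<forall>i<n. as ! i \<in> G (ds ! i))"
 by (simp add: homs_iff)

lemma G_closed: "x \<in> G i ==> x \<in> carrier M"
 using Q.grade_closed by simp

definition word_grade :: "int => ('k,'p,'v) tensors set"
 where "word_grade i = {T p vs | p vs e ds. p \<in> opg P (length vs) e \<and>
   homs (length vs) X vs ds \<and> e + sum_list ds = i}"

lemma G_generated: "G i = generated_submodule R M (word_grade i)"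
 by (simp add: free_grade_def word_grade_def)

lemma word_grade_closed: "word_grade i \<subseteq> carrier M"
 using tensD(1) by (auto simp: word_grade_def)

lemma tens_grade: "[|p \<in> opg P n e; homs n X vs ds|] ==> T p vs \<in> G (e + sum_list ds)"
 unfolding G_generated by (rule subsetD[OF M.generated_incl]) (auto simp: word_grade_def homs_iff)

lemma gen_grade: "v \<in> grade X i ==> gen v \<in> G i"
 using tens_grade[OF unit_grade gen_homogeneous(2)] gen_homogeneous(1) by fastforce

lemma gens_homogeneous: "homs n X vs ds ==> homs n Q (map gen vs) ds"
 unfolding homogeneous_Q unfolding homs_iff using gen_grade by auto

lemma gens_closed: "homs n X vs ds ==> set (map gen vs) \<subseteq> carrier M"
 by (drule homs_closed) (auto intro: gen_closed)

text \<open>The span of the words with letters in \<open>W\<close>.\<close>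

definition letter_span :: "'v set => ('k,'p,'v) tensors set"
 where "letter_span W = generated_submodule R M {T p vs | p vs. (p, vs) \<in> words P X \<and> set vs \<subseteq> W}"

lemma letter_words_closed: "{T p vs | p vs. (p, vs) \<in> words P X \<and> set vs \<subseteq> W} \<subseteq> carrier M"
 using tens_closed by auto

lemma letter_span_sub: "submodule (letter_span W) R M"
 unfolding letter_span_def by (rule M.generated_sub[OF letter_words_closed])

lemma letter_span_mono: "W \<subseteq> W' ==> letter_span W \<subseteq> letter_span W'"
 unfolding letter_span_def by (rule M.generated_mono[OF _ letter_words_closed]) blast

lemma letter_span_UNIV: "letter_span UNIV = carrier M"
 unfolding letter_span_def free_generated by (simp add: word_tens_def)

lemma letter_span_eqI:
 assumes "module R Z" "linear_map R (M\<lparr>carrier := letter_span W\<rparr>) Z f" "linear_map R (M\<lparr>carrier := letter_span W\<rparr>) Z g"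
  and "!!n p e vs ds. [|p \<in> opg P n e; homs n X vs ds; set vs \<subseteq> W|] ==> f (T p vs) = g (T p vs)"
  and "x \<in> letter_span W"
 shows "f x = g x"
 by (rule linear_maps_eq_on_span[OF modM assms(1) letter_words_closed
    assms(2,3)[unfolded letter_span_def] _ assms(5)[unfolded letter_span_def]])
  (use assms(4) in \<open>auto elim!: wordE\<close>)

lemma linear_eq_on_words:
 assumes "module R Z" "linear_map R M Z f" "linear_map R M Z g"
  and "!!n p e vs ds. [|p \<in> opg P n e; homs n X vs ds|] ==> f (T p vs) = g (T p vs)"
  and "x \<in> carrier M"
 shows "f x = g x"
 by (rule linear_maps_eq_on_generated[OF modM assms(1-3) word_tens_closed])
  (use assms(4,5) free_generated in \<open>auto simp: word_tens_def elim!: wordE\<close>)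

subsection \<open>Algebra maps\<close>

definition alg_ext :: "('k, 'p, 'b) dg_algebra => ('v => 'b) => ('k,'p,'v) tensors => 'b"
 where "alg_ext E \<phi> = extend R E (%p vs. act E p (map \<phi> vs))"

text \<open>
 Compatibility with the operations is a multilinear condition, so it can be checked on words; there it is
 the associativity of both actions, with the same signs.
\<close>

lemma alg_ext_facts:
 assumes E: "p_algebra R P E" and lin: "linear_map R X E \<phi>" and deg': "\<forall>i. \<forall>v\<in>grade X i. \<phi> v \<in> grade E i"
 shows alg_ext_linear: "linear_map R M E (alg_ext E \<phi>)"
  and alg_ext_word: "[|p \<in> opg P n e; homs n X vs ds|] ==> alg_ext E \<phi> (T p vs) = act E p (map \<phi> vs)"
  and alg_ext_gen: "v \<in> carrier X ==> alg_ext E \<phi> (gen v) = \<phi> v"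
  and alg_ext_grade: "x \<in> G i ==> alg_ext E \<phi> x \<in> grade E i"
  and alg_ext_act: "[|p \<in> opc P n; length as = n; set as \<subseteq> carrier M|] ==>
   alg_ext E \<phi> (pact p as) = act E p (map (alg_ext E \<phi>) as)"
  and alg_ext_respects: "respects_relations R P X E (%p vs. act E p (map \<phi> vs))"
proof -
 interpret E: p_algebra R P E by fact
 have deg: "\<phi> v \<in> grade E i" if "v \<in> grade X i" for v i using deg' that by blast
 let ?f = "alg_ext E \<phi>"
 have hom: "homs n E (map \<phi> vs) ds" if "homs n X vs ds" for n vs ds
  using that deg by (auto simp: homs_iff)
 have cl: "set (map \<phi> vs) \<subseteq> carrier E" if "homs n X vs ds" for n vs ds
  by (rule E.homogeneous_closed[OF hom[OF that]])
 show resp: "respects_relations R P X E (%p vs. act E p (map \<phi> vs))"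
  unfolding respects_relations_def
 proof (intro allI impI conjI ballI)
  fix n p e vs ds assume p: "p \<in> opg P n e" and vs: "homs n X vs ds"
  have n: "length (map \<phi> vs) = n" using vs by (simp add: homs_iff)
  note pc = opg_closed[OF p]
  show "act E p (map \<phi> vs) \<in> carrier E" by (rule E.act_closed[OF pc n cl[OF vs]])
  show "act E (p \<oplus>\<^bsub>op_space P n\<^esub> p') (map \<phi> vs) = act E p (map \<phi> vs) \<oplus>\<^sub>E act E p' (map \<phi> vs)"
   if "p' \<in> opg P n e" for p'
   by (rule lin_add[OF E.act_linear_op[OF n cl[OF vs]] pc opg_closed[OF that]])
  show "act E (r \<odot>\<^bsub>op_space P n\<^esub> p) (map \<phi> vs) = r \<odot>\<^sub>E act E p (map \<phi> vs)" if "r \<in> carrier R" for r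
   by (rule lin_smult[OF E.act_linear_op[OF n cl[OF vs]] that pc])
  fix i
  have vi: "vs ! i \<in> carrier X" if "i < n" using vs that X.grade_closed by (auto simp: homs_iff)
  have self: "(map \<phi> vs)[i := \<phi> (vs ! i)] = map \<phi> vs" by (metis list_update_id map_update)
  show "act E p (map \<phi> (vs[i := vs ! i \<oplus>\<^sub>X v])) = act E p (map \<phi> vs) \<oplus>\<^sub>E act E p (map \<phi> (vs[i := v]))"
   if i: "i < n" and v: "v \<in> grade X (ds ! i)" for v
   using lin_add[OF E.act_linear_arg[OF pc n cl[OF vs] i], of "\<phi> (vs ! i)" "\<phi> v"]
    lin_add[OF lin vi[OF i] X.grade_closed[OF v]] lin_closed[OF lin] vi[OF i] X.grade_closed[OF v]
   by (simp add: map_update self)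
  show "act E p (map \<phi> (vs[i := r \<odot>\<^sub>X vs ! i])) = r \<odot>\<^sub>E act E p (map \<phi> vs)"
   if i: "i < n" and r: "r \<in> carrier R" for r
   using lin_smult[OF E.act_linear_arg[OF pc n cl[OF vs] i] r, of "\<phi> (vs ! i)"]
    lin_smult[OF lin r vi[OF i]] lin_closed[OF lin] vi[OF i]
   by (simp add: map_update self)
  fix \<sigma> assume \<sigma>: "\<sigma> permutes {..<n}"
  show "act E (op_sym P n p \<sigma>) (map \<phi> (permute_list \<sigma> vs)) = ksign E (perm_exp \<sigma> ds) (act E p (map \<phi> vs))"
   using E.act_sym[OF pc \<sigma> hom[OF vs]] \<sigma> n by (simp add: permute_list_map)
 qed
 show L: "linear_map R M E ?f" unfolding alg_ext_def by (rule extend_linear[OF E.alg_module resp])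
 show word: "?f (T p vs) = act E p (map \<phi> vs)"
  if "p \<in> opg P n e" "homs n X vs ds" for p n e vs ds
  unfolding alg_ext_def by (rule extend_tens[OF E.alg_module resp wordI[OF that]])
 show gen: "?f (gen v) = \<phi> v" if "v \<in> carrier X" for v
 proof (rule X.linear_maps_eq_on_summands[OF E.alg_module lin_comp[OF gen_linear L] lin _ that])
  fix i x assume x: "x \<in> grade X i"
  show "?f (gen x) = \<phi> x"
   unfolding gen_homogeneous(1)[OF x] word[OF unit_grade gen_homogeneous(2)[OF x]]
   using E.act_unit E.grade_closed[OF deg[OF x]] by simp
 qed
 show "?f x \<in> grade E i" if "x \<in> G i" for x i
 proof (rule lin_generated_into[OF modM E.alg_module L E.summand_submodule word_grade_closed])
  show "?f x \<in> grade E i" if x: "x \<in> word_grade i" for x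
  proof -
   obtain p vs e ds where *: "x = T p vs" "p \<in> opg P (length vs) e"
    "homs (length vs) X vs ds" "e + sum_list ds = i" using x by (auto simp: word_grade_def)
   show ?thesis using E.act_grade[OF *(2) hom[OF *(3)]] word[OF *(2,3)] *(1,4) by simp
  qed
 qed (use that G_generated in simp)
 have act_gens: "?f (pact p (map gen vs)) = act E p (map \<phi> vs)"
  if p: "p \<in> opc P n" and vs: "homs n X vs ds" for p n vs ds
 proof -
  interpret O: graded_space R "op_space P n" by (rule op_graded)
  have n: "length (map gen vs) = n" "length (map \<phi> vs) = n" using vs by (simp_all add: homs_iff)
  show ?thesis
  proof (rule O.linear_maps_eq_on_summands[OF E.alg_module _ _ _ p])
   show "linear_map R (op_space P n) E (%p. ?f (pact p (map gen vs)))"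
    using lin_comp[OF Q.act_linear_op[OF n(1)]] gens_closed[OF vs] L by simp
   show "linear_map R (op_space P n) E (%p. act E p (map \<phi> vs))"
    by (rule E.act_linear_op[OF n(2) cl[OF vs]])
   show "?f (pact x (map gen vs)) = act E x (map \<phi> vs)" if "x \<in> opg P n i" for i x
    using word[OF that vs] word_gen[OF that vs] by simp
  qed
 qed
 show "?f (pact p as) = act E p (map ?f as)"
  if p: "p \<in> opc P n" and as: "length as = n" "set as \<subseteq> carrier M" for p n as
 proof (rule multilinear_eqI[OF modM E.alg_module, where n=n and S="%_. word_tens" and
    f="%as. ?f (pact p as)" and g="%as. act E p (map ?f as)"])
  show "word_tens \<subseteq> carrier M" by (rule word_tens_closed)
  fix i and bs :: "('k,'p,'v) tensors list"
  assume i: "i < n" and len: "length bs = n" and bs: "!!j. j < n ==> bs ! j \<in> generated_submodule R M word_tens"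
  then have bc: "set bs \<subseteq> carrier M" unfolding free_generated by (auto simp: in_set_conv_nth)
  show "linear_map R (M\<lparr>carrier := generated_submodule R M word_tens\<rparr>) E (%a. ?f (pact p (bs[i := a])))"
   unfolding free_generated[symmetric]
   using lin_comp[OF _ L] Q.act_linear_arg[OF p len _ i] bc by simp
  have fc: "set (map ?f bs) \<subseteq> carrier E" using bc lin_closed[OF L] by auto
  show "linear_map R (M\<lparr>carrier := generated_submodule R M word_tens\<rparr>) E (%a. act E p (map ?f (bs[i := a])))"
   unfolding free_generated[symmetric]
   using lin_comp[OF L E.act_linear_arg[OF p _ fc i]] len by (simp add: map_update)
 next
  fix bs :: "('k,'p,'v) tensors list"
  assume len: "length bs = n" and "!!j. j < n ==> bs ! j \<in> word_tens"
  then have "\<exists>q vs e ds. bs ! j = T q vs \<and> q \<in> opg P (length vs) e \<and> homs (length vs) X vs ds"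
   if "j < n" for j using that by (fastforce simp: word_tens_def words_def)
  then obtain q vs e ds where *: "!!j. j < n ==> bs ! j = T (q j) (vs j)"
   "!!j. j < n ==> q j \<in> opg P (length (vs j)) (e j)"
   "!!j. j < n ==> homs (length (vs j)) X (vs j) (ds j)" by metis
  let ?ks = "map (%j. length (vs j)) [0..<n]" and ?qs = "map q [0..<n]" and ?es = "map e [0..<n]"
  let ?vss = "map vs [0..<n]" and ?dss = "map ds [0..<n]"
  let ?s = "shuffle_exp ?es (map sum_list ?dss)"
  have h1: "homogeneous (map (op_space P) ?ks) ?qs ?es" unfolding homogeneous_ops using *(2) by simp
  have p': "p \<in> carrier (op_space P (length ?ks))" using p by simp
  have c: "op_comp P ?ks p ?qs \<in> carrier (op_space P (sum_list ?ks))"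
   by (rule comp_closed[OF p']) (use *(2) opg_closed in auto)
  have ks: "sum_list ?ks = sum_list (map length ?vss)" by (simp add: comp_def)
  have vc: "homogeneous (replicate (sum_list ?ks) X) (concat ?vss) (concat ?dss)"
   unfolding ks by (rule homogeneous_concat) (use *(3) in auto)
  have "pact (op_comp P ?ks p ?qs) (concat (map (map gen) ?vss)) =
    ksign M ?s (pact p (map (%i. pact (?qs ! i) (map (map gen) ?vss ! i)) [0..<length ?ks]))"
   using Q.act_assoc[OF p' h1, of "map (map gen) ?vss" ?dss] gens_homogeneous *(3) by simp
  also have "map (%i. pact (?qs ! i) (map (map gen) ?vss ! i)) [0..<length ?ks] = bs"
   by (rule nth_equalityI) (use len * word_gen[OF *(2,3)] in auto)
  also have "concat (map (map gen) ?vss) = map gen (concat ?vss)" by (simp only: map_concat)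
  finally have 1: "pact (op_comp P ?ks p ?qs) (map gen (concat ?vss)) = ksign M ?s (pact p bs)" .
  have "act E (op_comp P ?ks p ?qs) (concat (map (map \<phi>) ?vss)) =
    ksign E ?s (act E p (map (%i. act E (?qs ! i) (map (map \<phi>) ?vss ! i)) [0..<length ?ks]))"
   using E.act_assoc[OF p' h1, of "map (map \<phi>) ?vss" ?dss] hom *(3) by simp
  also have "map (%i. act E (?qs ! i) (map (map \<phi>) ?vss ! i)) [0..<length ?ks] = map ?f bs"
   by (rule nth_equalityI) (use len * word[OF *(2,3)] in auto)
  also have "concat (map (map \<phi>) ?vss) = map \<phi> (concat ?vss)" by (simp only: map_concat)
  finally have 2: "act E (op_comp P ?ks p ?qs) (map \<phi> (concat ?vss)) = ksign E ?s (act E p (map ?f bs))" .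
  have bc: "set bs \<subseteq> carrier M"
   using * tensD(1)[OF *(2,3)] len by (auto simp: in_set_conv_nth)
  have pc: "pact p bs \<in> carrier M" using Q.act_closed[OF p len] bc by simp
  have ec: "act E p (map ?f bs) \<in> carrier E"
   by (rule E.act_closed[OF p]) (use len bc lin_closed[OF L] in auto)
  have "ksign E ?s (?f (pact p bs)) = ksign E ?s (act E p (map ?f bs))"
   using act_gens[OF c vc] unfolding 1 2 lin_ksign[OF modM E.alg_module L pc] .
  then have "ksign E ?s (ksign E ?s (?f (pact p bs))) = ksign E ?s (ksign E ?s (act E p (map ?f bs)))" by simp
  then show "?f (pact p bs) = act E p (map ?f bs)"
   using ec lin_closed[OF L pc] by (simp add: E.ksign_ksign) (simp add: ksign_def)
 next
  show "as ! j \<in> generated_submodule R M word_tens" if "j < n" for j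
   using that as unfolding free_generated[symmetric] by auto
 qed (rule as(1))
qed

text \<open>
 An algebra map commutes with derivations on the words in given letters if it does so on these
 letters.
\<close>

lemma alg_map_derivation:
 assumes E: "p_algebra R P E" and lin: "linear_map R X E \<phi>" and deg': "\<forall>i. \<forall>v\<in>grade X i. \<phi> v \<in> grade E i"
  and D: "p_derivation R P Q D" and D': "p_derivation R P E D'"
  and gens: "!!i v. [|v \<in> grade X i; v \<in> W|] ==> alg_ext E \<phi> (D (gen v)) = D' (\<phi> v)"
  and x: "x \<in> letter_span W"
 shows "alg_ext E \<phi> (D x) = D' (alg_ext E \<phi> x)"
proof -
 interpret E: p_algebra R P E by fact
 have deg: "\<phi> v \<in> grade E i" if "v \<in> grade X i" for v i using deg' that by blast
 note f = alg_ext_facts[OF E lin deg']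
 note D = p_derivationD[OF D] and D' = p_derivationD[OF D']
 have DL: "linear_map R M M D" using D(1) by simp
 show ?thesis
 proof (rule letter_span_eqI[OF E.alg_module _ _ _ x])
  show "linear_map R (M\<lparr>carrier := letter_span W\<rparr>) E (%x. alg_ext E \<phi> (D x))"
   by (rule submodule_linear_map[OF letter_span_sub modM lin_comp[OF DL f(1)]])
  show "linear_map R (M\<lparr>carrier := letter_span W\<rparr>) E (%x. D' (alg_ext E \<phi> x))"
   by (rule submodule_linear_map[OF letter_span_sub modM lin_comp[OF f(1) D'(1)]])
  fix n p e vs ds assume p: "p \<in> opg P n e" and vs: "homs n X vs ds" and W: "set vs \<subseteq> W"
  have n: "length vs = n" using vs by (simp add: homs_iff)
 let ?g = "%i. ((map gen vs)[i := D (gen (vs ! i))])"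
  have vg: "vs ! i \<in> grade X (ds ! i)" "vs ! i \<in> W" if "i < n" for i
   using vs that W n by (auto simp: homs_iff)
  have Dg: "D (gen (vs ! i)) \<in> carrier M" if "i < n" for i
   using D(2)[of "gen (vs ! i)" "ds ! i"] gen_grade[OF vg(1)[OF that]] G_closed by simp
  have set: "set (?g i) \<subseteq> carrier M" if "i < n" for i
   using gens_closed[OF vs] Dg[OF that] by (auto dest!: subsetD[OF set_update_subset_insert])
  have mapf: "map (alg_ext E \<phi>) (map gen vs) = map \<phi> vs"
   using homs_closed[OF vs] by (auto intro!: f(3))
  have pd: "diff (op_space P n) p \<in> opc P n" by (rule opg_closed[OF op_diff_grade[OF p]])
  have tm: "alg_ext E \<phi> (ksign M s (pact p (?g i))) = ksign E s (act E p ((map \<phi> vs)[i := D' (\<phi> (vs ! i))]))"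
   if i: "i < n" for i s
  proof -
   have c: "pact p (?g i) \<in> carrier M"
    using Q.act_closed[OF opg_closed[OF p], of "(map gen vs)[i := D (gen (vs ! i))]"] set[OF i] n by simp
   have "alg_ext E \<phi> (pact p (?g i)) = act E p (map (alg_ext E \<phi>) (?g i))"
    by (rule f(5)[OF opg_closed[OF p]]) (use n set[OF i] in auto)
   also have "map (alg_ext E \<phi>) (?g i) = (map \<phi> vs)[i := D' (\<phi> (vs ! i))]"
    unfolding map_update mapf gens[OF vg[OF i]] ..
   finally show ?thesis
    using lin_ksign[OF modM E.alg_module f(1) c] by simp
  qed
  have homE: "homs n E (map \<phi> vs) ds" using vs deg by (auto simp: homs_iff)
  have cl: "(%i. ksign M (e + sum_list (take i ds)) (pact p (?g i))) \<in> {..<n} \<rightarrow> carrier M"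
   using Q.act_closed[OF opg_closed[OF p]] set n by (intro Pi_I M.ksign_closed) auto
  have "D (T p vs) = pact (diff (op_space P n) p) (map gen vs) \<oplus>\<^sub>M
    (\<Oplus>\<^sub>M i\<in>{..<n}. ksign M (e + sum_list (take i ds)) (pact p ((map gen vs)[i := D (map gen vs ! i)])))"
   using D(3)[OF p gens_homogeneous[OF vs]] by (simp add: word_gen[OF p vs])
  also have "(\<Oplus>\<^sub>M i\<in>{..<n}. ksign M (e + sum_list (take i ds)) (pact p ((map gen vs)[i := D (map gen vs ! i)]))) =
    (\<Oplus>\<^sub>M i\<in>{..<n}. ksign M (e + sum_list (take i ds)) (pact p (?g i)))"
   by (rule M.finsum_cong') (use cl n in auto)
  finally have "alg_ext E \<phi> (D (T p vs)) = alg_ext E \<phi> (pact (diff (op_space P n) p) (map gen vs)) \<oplus>\<^sub>E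
    alg_ext E \<phi> (\<Oplus>\<^sub>M i\<in>{..<n}. ksign M (e + sum_list (take i ds)) (pact p (?g i)))"
   using lin_add[OF f(1)] Q.act_closed[OF pd, of "map gen vs"] gens_closed[OF vs] n M.finsum_closed[OF cl] by simp
  also have "alg_ext E \<phi> (\<Oplus>\<^sub>M i\<in>{..<n}. ksign M (e + sum_list (take i ds)) (pact p (?g i))) =
    (\<Oplus>\<^sub>E i\<in>{..<n}. ksign E (e + sum_list (take i ds)) (act E p ((map \<phi> vs)[i := D' (map \<phi> vs ! i)])))"
   unfolding lin_finsum[OF modM E.alg_module f(1) cl]
  proof (rule E.finsum_cong'[OF refl])
   show eq: "alg_ext E \<phi> (ksign M (e + sum_list (take i ds)) (pact p (?g i))) =
     ksign E (e + sum_list (take i ds)) (act E p ((map \<phi> vs)[i := D' (map \<phi> vs ! i)]))" if "i \<in> {..<n}" for i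
    using tm[of i] that n by simp
   show "(%i. ksign E (e + sum_list (take i ds)) (act E p ((map \<phi> vs)[i := D' (map \<phi> vs ! i)]))) \<in> {..<n} \<rightarrow> carrier E"
    using eq lin_closed[OF f(1)] cl by (metis (no_types, lifting) Pi_iff)
  qed
  also have "alg_ext E \<phi> (pact (diff (op_space P n) p) (map gen vs)) = act E (diff (op_space P n) p) (map \<phi> vs)"
   unfolding mapf[symmetric] by (rule f(5)[OF pd]) (use gens_closed[OF vs] n in simp_all)
  finally show "alg_ext E \<phi> (D (T p vs)) = D' (alg_ext E \<phi> (T p vs))"
   unfolding f(2)[OF p vs] D'(3)[OF p homE] .
 qed
qed

subsection \<open>Derivations\<close>

text \<open>The derivation with values \<open>\<theta>\<close> on the generators, given on words by the Leibniz rule.\<close>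

definition der :: "('v => ('k,'p,'v) tensors) => ('k,'p,'v) tensors => ('k,'p,'v) tensors"
 where "der \<theta> = extend R M (%p vs. leib P Q gen \<theta> (deg (op_space P (length vs)) p) (map (deg X) vs) p vs)"

lemma leib_degrees:
 assumes \<theta>: "linear_map R X M \<theta>" and p: "p \<in> opg P n e" and vs: "homs n X vs ds"
 shows "leib P Q gen \<theta> (deg (op_space P (length vs)) p) (map (deg X) vs) p vs = leib P Q gen \<theta> e ds p vs"
proof -
 interpret O: graded_space R "op_space P n" by (rule op_graded)
 have n: "length vs = n" using vs by (simp add: homs_iff)
 note pc = opg_closed[OF p] and vc = homs_closed[OF vs]
 have gc: "gen v \<in> carrier Q" "\<theta> v \<in> carrier Q" if "v \<in> set vs" for v
  using gen_closed lin_closed[OF \<theta>] that vc by auto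
 have z: "leib P Q gen \<theta> e' ds' p vs = \<zero>\<^sub>M" if "p = \<zero>\<^bsub>op_space P n\<^esub> \<or> (\<exists>l<n. vs ! l = \<zero>\<^sub>X)" for e' ds'
  using that
 proof (elim disjE exE conjE)
  assume "p = \<zero>\<^bsub>op_space P n\<^esub>"
  then show ?thesis
   using lin_zero[OF op_module Q.alg_module Q.leib_linear_op[of vs gen \<theta>]] gc n by simp
 next
  fix l assume l: "l < n" "vs ! l = \<zero>\<^sub>X"
  have "linear_map R X Q (%y. leib P Q gen \<theta> e' ds' p (vs[l := y]))"
   by (rule Q.leib_linear_arg[OF modX]) (use gen_linear \<theta> pc n vc l in auto)
  from lin_zero[OF modX Q.alg_module this] show ?thesis using l n by (metis list_update_id quasi_free_simps(2))
 qed
 show ?thesis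
 proof (cases "p = \<zero>\<^bsub>op_space P n\<^esub> \<or> (\<exists>l<n. vs ! l = \<zero>\<^sub>X)")
  case True
  then show ?thesis using z by simp
 next
  case False
  then have "deg (op_space P n) p = e" using O.deg_of[OF p] by blast
  moreover have "map (deg X) vs = ds"
   by (rule nth_equalityI) (use False vs X.deg_of in \<open>auto simp: homs_iff\<close>)
  ultimately show ?thesis using n by simp
 qed
qed

text \<open>
 The sum in the Leibniz rule is equivariant term by term: the term of the \<open>i\<close>-th letter of the permuted word
 is that of the letter \<open>\<sigma> i\<close>, the signs being compared by \<open>perm_exp_raise\<close>.
\<close>

lemma der_facts:
 assumes \<theta>: "linear_map R X M \<theta>" and deg\<theta>': "\<forall>i. \<forall>v\<in>grade X i. \<theta> v \<in> G (i + 1)"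
 shows der_respects: "respects_relations R P X M
   (%p vs. leib P Q gen \<theta> (deg (op_space P (length vs)) p) (map (deg X) vs) p vs)"
  and der_linear: "linear_map R M M (der \<theta>)"
  and der_word: "[|p \<in> opg P n e; homs n X vs ds|] ==> der \<theta> (T p vs) = leib P Q gen \<theta> e ds p vs"
  and der_gen: "v \<in> carrier X ==> der \<theta> (gen v) = \<theta> v"
  and der_grade: "x \<in> G i ==> der \<theta> x \<in> G (i + 1)"
proof -
 have deg\<theta>: "\<theta> v \<in> G (i + 1)" if "v \<in> grade X i" for v i using deg\<theta>' that by blast
 let ?\<phi> = "%p vs. leib P Q gen \<theta> (deg (op_space P (length vs)) p) (map (deg X) vs) p vs"
 have linQ: "linear_map R X Q gen" "linear_map R X Q \<theta>" using gen_linear \<theta> by simp_all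
 show resp: "respects_relations R P X M ?\<phi>"
  unfolding respects_relations_def
 proof (intro allI impI conjI ballI)
  fix n p e vs ds assume p: "p \<in> opg P n e" and vs: "homs n X vs ds"
  have n: "length vs = n" "length ds = n" using vs by (simp_all add: homs_iff)
  note pc = opg_closed[OF p] and vc = homs_closed[OF vs]
  have gc: "gen v \<in> carrier Q" "\<theta> v \<in> carrier Q" if "v \<in> set vs" for v
   using gen_closed lin_closed[OF \<theta>] that vc by auto
  note eq = leib_degrees[OF \<theta> p vs]
  show "?\<phi> p vs \<in> carrier M"
   unfolding eq using Q.leib_closed(2)[of p vs gen \<theta>] pc n gc by simp
  have lop: "linear_map R (op_space P n) M (%p. leib P Q gen \<theta> e ds p vs)"
   using Q.leib_linear_op[of vs gen \<theta>] gc n by simp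
  show "?\<phi> (p \<oplus>\<^bsub>op_space P n\<^esub> p') vs = ?\<phi> p vs \<oplus>\<^sub>M ?\<phi> p' vs" if p': "p' \<in> opg P n e" for p'
   unfolding eq leib_degrees[OF \<theta> op_grade_add[OF p p'] vs] leib_degrees[OF \<theta> p' vs]
   by (rule lin_add[OF lop pc opg_closed[OF p']])
  show "?\<phi> (r \<odot>\<^bsub>op_space P n\<^esub> p) vs = r \<odot>\<^sub>M ?\<phi> p vs" if r: "r \<in> carrier R" for r
   unfolding eq leib_degrees[OF \<theta> op_grade_smult[OF r p] vs] by (rule lin_smult[OF lop r pc])
  fix i
  have larg: "linear_map R X M (%y. leib P Q gen \<theta> e ds p (vs[i := y]))" if "i < n"
   using Q.leib_linear_arg[OF modX linQ, of p vs i] pc n vc that by simp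
  have vi: "vs ! i \<in> grade X (ds ! i)" if "i < n" using vs that by (simp add: homs_iff)
  show "?\<phi> p (vs[i := vs ! i \<oplus>\<^sub>X v]) = ?\<phi> p vs \<oplus>\<^sub>M ?\<phi> p (vs[i := v])" if i: "i < n" and v: "v \<in> grade X (ds ! i)" for v
   unfolding eq leib_degrees[OF \<theta> p homs_update_same[OF vs v]]
    leib_degrees[OF \<theta> p homs_update_same[OF vs X_gradeD(3)[OF vi[OF i] v]]]
   using lin_add[OF larg[OF i] X.grade_closed[OF vi[OF i]] X.grade_closed[OF v]] by simp
  show "?\<phi> p (vs[i := r \<odot>\<^sub>X vs ! i]) = r \<odot>\<^sub>M ?\<phi> p vs" if i: "i < n" and r: "r \<in> carrier R" for r
   unfolding eq leib_degrees[OF \<theta> p homs_update_same[OF vs X_gradeD(4)[OF r vi[OF i]]]]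
   using lin_smult[OF larg[OF i] r X.grade_closed[OF vi[OF i]]] by simp
  fix \<sigma> assume \<sigma>: "\<sigma> permutes {..<n}"
  have \<sigma>n: "\<sigma> i < n" if "i < n" for i using permutes_in_image[OF \<sigma>] that by auto
 let ?u = "%i. ((map gen (permute_list \<sigma> vs))[i := \<theta> (permute_list \<sigma> vs ! i)])"
  let ?g = "map gen vs"
  let ?t = "%i. ksign M (e + sum_list (take i ds)) (pact p (?g[i := \<theta> (vs ! i)]))"
  have tc: "?t \<in> {..<n} \<rightarrow> carrier M" using Q.leib_closed(1)[of p vs gen \<theta>] pc n gc by simp
  have t\<sigma>: "?t (\<sigma> i) \<in> carrier M" if "i < n" for i
   using funcset_mem[OF tc, of "\<sigma> i"] \<sigma>n[OF that] by simp
  have tm: "ksign M (e + sum_list (take i (permute_list \<sigma> ds))) (pact (op_sym P n p \<sigma>) (?u i)) =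
    ksign M (perm_exp \<sigma> ds) (?t (\<sigma> i))" if i: "i < n" for i
  proof -
   let ?h = "?g[\<sigma> i := \<theta> (vs ! \<sigma> i)]" and ?ds = "ds[\<sigma> i := ds ! \<sigma> i + 1]"
   have "(map gen (permute_list \<sigma> vs))[i := \<theta> (permute_list \<sigma> vs ! i)] = permute_list \<sigma> ?h"
   proof (rule nth_equalityI)
    fix j assume "j < length (?u i)"
    then have j: "j < n" using n by simp
    have "\<sigma> i = \<sigma> j \<longleftrightarrow> i = j" using permutes_inj[OF \<sigma>] by (auto dest: injD)
    then show "(map gen (permute_list \<sigma> vs))[i := \<theta> (permute_list \<sigma> vs ! i)] ! j = permute_list \<sigma> ?h ! j"
     using i j n \<sigma>n by (simp add: permute_list_def nth_list_update)
   qed (simp add: n)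
   moreover have "homs n Q ?h ?ds"
    unfolding homogeneous_Q
   proof (intro conjI allI impI)
    fix j assume "j < n"
    then show "?h ! j \<in> G (?ds ! j)"
     using gens_homogeneous[OF vs] deg\<theta>[of "vs ! \<sigma> i" "ds ! \<sigma> i"] vs \<sigma>n[OF i] n
     by (cases "j = \<sigma> i") (auto simp: homogeneous_Q homs_iff)
   qed (simp_all add: n)
   ultimately have "pact (op_sym P n p \<sigma>) (?u i) = ksign M (perm_exp \<sigma> ?ds) (pact p ?h)"
    using Q.act_sym[OF pc \<sigma>, of ?h ?ds] by simp
   moreover have hc: "pact p ?h \<in> carrier M"
   proof -
    have "set ?h \<subseteq> carrier M"
     using gens_closed[OF vs] lin_closed[OF \<theta>, of "vs ! \<sigma> i"] subsetD[OF vc nth_mem[of "\<sigma> i" vs]] \<sigma>n[OF i] n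
     by (auto dest!: subsetD[OF set_update_subset_insert])
    then show ?thesis using Q.act_closed[OF pc, of ?h] n by simp
   qed
   moreover have ev: "even ((e + sum_list (take i (permute_list \<sigma> ds)) + perm_exp \<sigma> ?ds) + (perm_exp \<sigma> ds + (e + sum_list (take (\<sigma> i) ds))))"
    using perm_exp_raise[OF \<sigma> n(2) i] by presburger
   ultimately show ?thesis
    by (simp only: M.ksign_ksign[OF hc] M.ksign_cong[OF ev])
  qed
  have bij: "inj_on \<sigma> {..<n}" "\<sigma> ` {..<n} = {..<n}" using permutes_inj_on[OF \<sigma>] permutes_image[OF \<sigma>] by auto
  have "leib P Q gen \<theta> e (permute_list \<sigma> ds) (op_sym P n p \<sigma>) (permute_list \<sigma> vs) =
   pact (diff (op_space P n) (op_sym P n p \<sigma>)) (map gen (permute_list \<sigma> vs)) \<oplus>\<^sub>M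
   (\<Oplus>\<^sub>M i\<in>{..<n}. ksign M (e + sum_list (take i (permute_list \<sigma> ds))) (pact (op_sym P n p \<sigma>) (?u i)))"
   using n by (simp add: leib_def)
  also have "(\<Oplus>\<^sub>M i\<in>{..<n}. ksign M (e + sum_list (take i (permute_list \<sigma> ds))) (pact (op_sym P n p \<sigma>) (?u i))) =
    (\<Oplus>\<^sub>M i\<in>{..<n}. ksign M (perm_exp \<sigma> ds) (?t (\<sigma> i)))"
   by (rule M.finsum_cong'[OF refl _ tm]) (intro Pi_I M.ksign_closed[OF t\<sigma>] | simp)+
  also have "... = ksign M (perm_exp \<sigma> ds) (\<Oplus>\<^sub>M i\<in>{..<n}. ?t (\<sigma> i))"
   by (rule M.ksign_finsum[symmetric]) (intro Pi_I t\<sigma>, simp)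
  also have "(\<Oplus>\<^sub>M i\<in>{..<n}. ?t (\<sigma> i)) = (\<Oplus>\<^sub>M i\<in>{..<n}. ?t i)"
   using M.finsum_reindex[of ?t \<sigma> "{..<n}"] tc bij by simp
  also have "pact (diff (op_space P n) (op_sym P n p \<sigma>)) (map gen (permute_list \<sigma> vs)) = ksign M (perm_exp \<sigma> ds) (pact (diff (op_space P n) p) ?g)"
   using Q.act_sym[OF opg_closed[OF op_diff_grade[OF p]] \<sigma> gens_homogeneous[OF vs]] \<sigma> n
   by (simp add: op_sym_diff[OF \<sigma> pc] permute_list_map)
  also have "ksign M (perm_exp \<sigma> ds) (pact (diff (op_space P n) p) ?g) \<oplus>\<^sub>M ksign M (perm_exp \<sigma> ds) (\<Oplus>\<^sub>M i\<in>{..<n}. ?t i) =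
    ksign M (perm_exp \<sigma> ds) (leib P Q gen \<theta> e ds p vs)"
   using M.ksign_add[OF _ M.finsum_closed[OF tc]] Q.act_closed[OF opg_closed[OF op_diff_grade[OF p]], of ?g] gens_closed[OF vs] n
   by (simp add: leib_def)
  finally show "?\<phi> (op_sym P n p \<sigma>) (permute_list \<sigma> vs) = ksign M (perm_exp \<sigma> ds) (?\<phi> p vs)"
   unfolding eq leib_degrees[OF \<theta> op_sym_grade[OF \<sigma> p] homogeneous_permute[OF vs \<sigma>]] .
 qed
 show L: "linear_map R M M (der \<theta>)" unfolding der_def by (rule extend_linear[OF modM resp])
 show word: "der \<theta> (T p vs) = leib P Q gen \<theta> e ds p vs"
  if "p \<in> opg P n e" "homs n X vs ds" for p n e vs ds
  unfolding der_def extend_tens[OF modM resp wordI[OF that]] by (rule leib_degrees[OF \<theta> that])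
 show "der \<theta> (gen v) = \<theta> v" if "v \<in> carrier X" for v
 proof (rule X.linear_maps_eq_on_summands[OF modM lin_comp[OF gen_linear L] \<theta> _ that])
  fix i x assume x: "x \<in> grade X i"
  have z: "pact \<zero>\<^bsub>op_space P 1\<^esub> [gen x] = \<zero>\<^sub>M"
   using Q.act_zero_op[of "[gen x]" 1] gen_closed[OF X.grade_closed[OF x]] by simp
  have c: "\<theta> x \<in> carrier M" "pact (op_unit P) [\<theta> x] = \<theta> x"
   using lin_closed[OF \<theta> X.grade_closed[OF x]] Q.act_unit by auto
  have "{..<length [x]} = {0}" by auto
  then have "leib P Q gen \<theta> 0 [i] (op_unit P) [x] = \<theta> x"
   using z c unit_diff by (simp add: leib_def ksign_def)
  then show "der \<theta> (gen x) = \<theta> x"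
   unfolding gen_homogeneous(1)[OF x] word[OF unit_grade gen_homogeneous(2)[OF x]] .
 qed
 show "der \<theta> x \<in> G (i + 1)" if "x \<in> G i" for x i
 proof (rule lin_generated_into[OF modM modM L _ word_grade_closed])
  have sub: "submodule (G k) R M" for k
   unfolding G_generated by (rule M.generated_sub[OF word_grade_closed])
  show "submodule (G (i + 1)) R M" by (rule sub)
  note Gd = submoduleD[OF modM sub]
  show "der \<theta> x \<in> G (i + 1)" if x: "x \<in> word_grade i" for x
  proof -
   obtain p vs e ds where *: "x = T p vs" "p \<in> opg P (length vs) e"
    "homs (length vs) X vs ds" "e + sum_list ds = i" using x by (auto simp: word_grade_def)
   have l: "length ds = length vs" using *(3) by (simp add: homs_iff)
   have 1: "pact (diff (op_space P (length vs)) p) (map gen vs) \<in> G (i + 1)"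
    using Q.act_grade[OF op_diff_grade[OF *(2)] gens_homogeneous[OF *(3)]] *(4) by (simp add: algebra_simps)
   have 2: "pact p ((map gen vs)[j := \<theta> (vs ! j)]) \<in> G (i + 1)" if j: "j < length vs" for j
   proof -
    have "homs (length vs) Q ((map gen vs)[j := \<theta> (vs ! j)]) (ds[j := ds ! j + 1])"
     unfolding homogeneous_Q
    proof (intro conjI allI impI)
     fix k assume "k < length vs"
     then show "(map gen vs)[j := \<theta> (vs ! j)] ! k \<in> G (ds[j := ds ! j + 1] ! k)"
      using gens_homogeneous[OF *(3)] deg\<theta>[of "vs ! j" "ds ! j"] *(3) j
      by (cases "k = j") (auto simp: homogeneous_Q homs_iff)
    qed (simp_all add: l)
    note g = Q.act_grade[OF *(2) this]
    have "e + sum_list (ds[j := ds ! j + 1]) = i + 1" using sum_list_raise[of j ds] *(4) j l by simp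
    then show ?thesis using g by simp
   qed
   show ?thesis unfolding *(1) word[OF *(2,3)] leib_def
    using 1 2 by (auto intro!: Gd(3,7,8))
  qed
 qed (use that G_generated in simp)
qed

end

lemma map_upt_update:
 "i < n ==> length bs = n ==> (!!j. j < n ==> j \<noteq> i ==> f j = bs ! j) ==> map f [0..<n] = bs[i := f i]"
 by (rule nth_equalityI) (auto simp: nth_list_update)

context free_p_alg
begin

text \<open>
 The Leibniz rule on a composite \<open>p(w\<^sub>1, \<dots>, w\<^sub>n)\<close> of words: the derivative of this word is the sum
 of the terms in which \<open>p\<close>, the operation of some \<open>w\<^sub>i\<close> or a letter of some \<open>w\<^sub>i\<close> is differentiated.
\<close>

lemma der_leibniz_words:
 assumes \<theta>: "linear_map R X M \<theta>" and deg\<theta>': "\<forall>i. \<forall>v\<in>grade X i. \<theta> v \<in> G (i + 1)"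
  and p: "p \<in> opg P n e" and bs: "length bs = n" "length ds = n" "!!j. j < n ==> bs ! j \<in> word_grade (ds ! j)"
 shows "der \<theta> (pact p bs) = leib P Q (%a. a) (der \<theta>) e ds p bs"
proof -
 have deg\<theta>: "\<theta> v \<in> G (i + 1)" if "v \<in> grade X i" for v i using deg\<theta>' that by blast
 let ?D = "der \<theta>"
 note D = der_facts(2-)[OF \<theta> deg\<theta>']
 have "\<exists>q vs e es. bs ! j = T q vs \<and> q \<in> opg P (length vs) e \<and> homs (length vs) X vs es \<and> e + sum_list es = ds ! j"
  if "j < n" for j using bs(3)[OF that] by (auto simp: word_grade_def)
 then obtain q vs e' es where *: "!!j. j < n ==> bs ! j = T (q j) (vs j)"
  "!!j. j < n ==> q j \<in> opg P (length (vs j)) (e' j)"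
  "!!j. j < n ==> homs (length (vs j)) X (vs j) (es j)"
  "!!j. j < n ==> e' j + sum_list (es j) = ds ! j" by metis
 define ks where "ks = map (%j. length (vs j)) [0..<n]"
 define qs where "qs = map q [0..<n]"
 define \<epsilon> where "\<epsilon> = map e' [0..<n]"
 define vss where "vss = map vs [0..<n]"
 define ess where "ess = map es [0..<n]"
 define gss where "gss = map (%j. map gen (vs j)) [0..<n]"
 define s where "s = shuffle_exp \<epsilon> (map sum_list ess)"
 define c where "c = op_comp P ks p qs"
 have len: "length ks = n" "length qs = n" "length \<epsilon> = n" "length vss = n" "length ess = n" "length gss = n"
  by (simp_all add: ks_def qs_def \<epsilon>_def vss_def ess_def gss_def)
 have nth: "ks ! j = length (vs j)" "qs ! j = q j" "\<epsilon> ! j = e' j" "vss ! j = vs j" "ess ! j = es j" "gss ! j = map gen (vs j)"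
  if "j < n" for j using that by (simp_all add: ks_def qs_def \<epsilon>_def vss_def ess_def gss_def)
 have lens: "length (es j) = length (vs j)" if "j < n" for j using *(3)[OF that] by (simp add: homs_iff)
 note pc = opg_closed[OF p]
 have pks: "p \<in> opg P (length ks) e" using p len by simp
 have hq: "homogeneous (map (op_space P) ks) qs \<epsilon>" using *(2) nth len by (simp add: homogeneous_ops)
 have hg: "homs (ks ! j) Q (gss ! j) (ess ! j)" if "j < n" for j
  using gens_homogeneous[OF *(3)[OF that]] nth[OF that] by simp
 have gss: "concat gss = map gen (concat vss)"
  by (simp add: gss_def vss_def map_concat comp_def)
 have vc: "homs (sum_list ks) X (concat vss) (concat ess)"
 proof -
  have "ks = map length vss" by (simp add: ks_def vss_def)
  then show ?thesis using homogeneous_concat[of ess vss X] *(3) nth len by simp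
 qed
 have lc: "length (concat vss) = sum_list ks" using vc by (simp add: homs_iff)
 have cg: "c \<in> opg P (sum_list ks) (e + sum_list \<epsilon>)" unfolding c_def by (rule comp_grade[OF pks hq])
 have word_bs: "pact (q j) (map gen (vs j)) = bs ! j" if "j < n" for j
  using word_gen[OF *(2,3)] *(1) that by simp
 have bsG: "bs ! j \<in> G (ds ! j)" if "j < n" for j
  using tens_grade[OF *(2,3)] *(1,4) that by simp
 have bsc: "set bs \<subseteq> carrier M" using bsG bs(1) by (metis G_closed in_set_conv_nth subsetI)
 have assoc: "pact (op_comp P ks p' qs') (concat hss) =
   ksign M (shuffle_exp \<epsilon>' (map sum_list ess')) (pact p' (map (%i. pact (qs' ! i) (hss ! i)) [0..<n]))"
  if "p' \<in> opc P n" "homogeneous (map (op_space P) ks) qs' \<epsilon>'" "length hss = n" "length ess' = n"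
   "!!j. j < n ==> homs (ks ! j) Q (hss ! j) (ess' ! j)" for p' qs' hss \<epsilon>' ess'
  using Q.act_assoc[of p' ks qs' \<epsilon>' hss ess'] that len by simp
 have mapbs: "map (%i. pact (qs ! i) (gss ! i)) [0..<n] = bs"
  by (rule nth_equalityI) (use nth word_bs bs(1) in auto)
 let ?A = "%i. pact (diff (op_space P (length (vs i))) (q i)) (map gen (vs i))"
 let ?B = "%i l. pact (q i) ((map gen (vs i))[l := \<theta> (vs i ! l)])"
 let ?U = "%i. pact p (bs[i := ?A i])" and ?W = "%i l. pact p (bs[i := ?B i l])"
 let ?SW = "%i. (\<Oplus>\<^sub>M l\<in>{..<length (vs i)}. ksign M (s + (e + sum_list (take i ds)) + (e' i + sum_list (take l (es i)))) (?W i l))"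
 let ?VW = "%i. (\<Oplus>\<^sub>M l\<in>{..<length (vs i)}. ksign M (e' i + sum_list (take l (es i))) (?W i l))"
 let ?k = "%i l. (s + (e + sum_list (take i ds)) + (e' i + sum_list (take l (es i))))"
 let ?kk = "%i l. (e' i + sum_list (take l (es i)))"
 let ?a = "%i. (s + (e + sum_list (take i ds)))"
 let ?z = "%i. (e + sum_list (take i \<epsilon>) + (s + (\<Sum>j<i. sum_list (es j))))"
 let ?t = "%k. ksign M (e + sum_list \<epsilon> + sum_list (take k (concat ess))) (pact c ((map gen (concat vss))[k := \<theta> (concat vss ! k)]))"
 let ?dq = "%i. qs[i := diff (op_space P (ks ! i)) (qs ! i)]"
 let ?O = "op_space P (sum_list ks)"
 let ?y = "%i. (ksign M (e + sum_list (take i ds)) (pact p (bs[i := ?D (bs ! i)])))"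
 have vsc: "set (vs i) \<subseteq> carrier X" if "i < n" for i using homs_closed[OF *(3)[OF that]] .
 have gvc: "gen v \<in> carrier M" "\<theta> v \<in> carrier M" if "i < n" "v \<in> set (vs i)" for i v
  using vsc[OF that(1)] that(2) gen_closed lin_closed[OF \<theta>] by auto
 have Ac: "?A i \<in> carrier M" if "i < n" for i
  using Q.act_closed[OF opg_closed[OF op_diff_grade[OF *(2)[OF that]]], of "map gen (vs i)"] gvc[OF that] by auto
 have hh: "homs (length (vs i)) Q ((map gen (vs i))[l := \<theta> (vs i ! l)]) ((es i)[l := es i ! l + 1])"
  if i: "i < n" and l: "l < length (vs i)" for i l
  unfolding homogeneous_Q
 proof (intro conjI allI impI)
  fix j assume "j < length (vs i)"
  then show "(map gen (vs i))[l := \<theta> (vs i ! l)] ! j \<in> G ((es i)[l := es i ! l + 1] ! j)"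
   using gens_homogeneous[OF *(3)[OF i]] deg\<theta>[of "vs i ! l" "es i ! l"] *(3)[OF i] l lens[OF i]
   by (cases "j = l") (auto simp: homogeneous_Q homs_iff)
 qed (simp_all add: lens[OF i])
 have Bc: "?B i l \<in> carrier M" if "i < n" "l < length (vs i)" for i l
  using Q.act_grade[OF *(2)[OF that(1)] hh[OF that]] G_closed by simp
 have updc: "pact p (bs[i := a]) \<in> carrier M" if "i < n" "a \<in> carrier M" for i a
  using Q.act_closed[OF pc, of "bs[i := a]"] bsc bs(1) that set_update_subset_insert[of bs i a] by auto
 note Uc = updc[OF _ Ac] and Wc = updc[OF _ Bc]
 have linp: "linear_map R M M (%a. pact p (bs[i := a]))" if "i < n" for i
  using Q.act_linear_arg[OF pc bs(1) _ that] bsc by simp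
 have Db: "?D (bs ! i) = ?A i \<oplus>\<^sub>M (\<Oplus>\<^sub>M l\<in>{..<length (vs i)}. ksign M (?kk i l) (?B i l))" if "i < n" for i
  using D(2)[OF *(2,3), OF that that] *(1)[OF that] by (simp add: leib_def)
 have sBc: "(%l. ksign M (k l) (?B i l)) \<in> {..<length (vs i)} \<rightarrow> carrier M" if "i < n" for i k
  using Bc[OF that] by (intro Pi_I M.ksign_closed) auto
 have sWc: "(%l. ksign M (k l) (?W i l)) \<in> {..<length (vs i)} \<rightarrow> carrier M" if "i < n" for i k
  using Wc[OF that that] by (intro Pi_I M.ksign_closed) auto
 have Dbc: "?D (bs ! i) \<in> carrier M" if "i < n" for i
  using lin_closed[OF D(1)] G_closed[OF bsG[OF that]] by simp
 have rhs_i: "pact p (bs[i := ?D (bs ! i)]) = ?U i \<oplus>\<^sub>M (?VW i)"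
  if i: "i < n" for i
 proof -
  have "pact p (bs[i := ?D (bs ! i)]) = ?U i \<oplus>\<^sub>M pact p (bs[i := (\<Oplus>\<^sub>M l\<in>{..<length (vs i)}. ksign M (?kk i l) (?B i l))])"
   unfolding Db[OF i] by (rule lin_add[OF linp[OF i] Ac[OF i] M.finsum_closed[OF sBc[OF i]]])
  also have "pact p (bs[i := (\<Oplus>\<^sub>M l\<in>{..<length (vs i)}. ksign M (?kk i l) (?B i l))]) =
    (\<Oplus>\<^sub>M l\<in>{..<length (vs i)}. pact p (bs[i := ksign M (?kk i l) (?B i l)]))"
   by (rule lin_finsum[OF modM modM linp[OF i] sBc[OF i]])
  also have "... = (?VW i)"
   by (rule M.finsum_cong'[OF refl sWc[OF i]])
    (use lin_ksign[OF modM modM linp[OF i] Bc[OF i]] in simp)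
  finally show ?thesis .
 qed
 \<comment> \<open>Associativity identifies the terms of three kinds: \<open>p\<close>, an operation or a letter of a word is differentiated.\<close>
 have T1: "pact (op_comp P ks (diff (op_space P n) p) qs) (concat gss) = ksign M s (pact (diff (op_space P n) p) bs)"
  using assoc[OF opg_closed[OF op_diff_grade[OF p]] hq len(6,5) hg] unfolding mapbs s_def .
 have T2: "pact (op_comp P ks p (?dq i)) (concat gss) =
   ksign M (s + (\<Sum>j<i. sum_list (es j))) (?U i)" if i: "i < n" for i
 proof -
  have h: "homogeneous (map (op_space P) ks) (?dq i) (\<epsilon>[i := \<epsilon> ! i + 1])"
   unfolding homogeneous_ops
  proof (intro conjI allI impI)
   fix j assume "j < length ks"
   then show "(?dq i) ! j \<in> opg P (ks ! j) (\<epsilon>[i := \<epsilon> ! i + 1] ! j)"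
    using i len nth *(2) op_diff_grade by (cases "j = i") auto
  qed (simp_all add: len)
  have m: "map (%j. pact ((?dq i) ! j) (gss ! j)) [0..<n] = bs[i := ?A i]"
   using map_upt_update[of i n bs "%j. pact ((?dq i) ! j) (gss ! j)"] i bs(1) nth word_bs len by simp
  have "(\<Sum>j<i. map sum_list ess ! j) = (\<Sum>j<i. sum_list (es j))" by (rule sum.cong) (use i nth len in auto)
  then show ?thesis
   using assoc[OF pc h len(6,5) hg] shuffle_exp_raise_left[of i \<epsilon> "map sum_list ess"] i len
   unfolding m by (simp add: s_def)
 qed
 have T3: "pact c ((map gen (concat vss))[offset vss i + l := \<theta> (concat vss ! (offset vss i + l))]) =
   ksign M (s + (\<Sum>j\<in>{i<..<n}. e' j)) (?W i l)" if i: "i < n" and l: "l < length (vs i)" for i l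
 proof -
  let ?h = "(map gen (vs i))[l := \<theta> (vs i ! l)]"
  have o: "offset gss i = offset vss i"
   by (simp add: length_concat gss_def vss_def take_map comp_def)
  have "(concat gss)[offset gss i + l := \<theta> (vs i ! l)] = concat (gss[i := ?h])"
   using concat_update[of i gss l] i l len nth by simp
  then have 1: "(map gen (concat vss))[offset vss i + l := \<theta> (concat vss ! (offset vss i + l))] = concat (gss[i := ?h])"
   using concat_nth[of i vss l] i l len nth o gss by simp
  have h: "homs (ks ! j) Q (gss[i := ?h] ! j) (ess[i := (es i)[l := es i ! l + 1]] ! j)" if "j < n" for j
   using that hg hh[OF i l] nth i len by (cases "j = i") auto
  have m: "map (%j. pact (qs ! j) (gss[i := ?h] ! j)) [0..<n] = bs[i := ?B i l]"
   using map_upt_update[of i n bs "%j. pact (qs ! j) (gss[i := ?h] ! j)"] i bs(1) nth word_bs len by simp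
  have E: "map sum_list (ess[i := (es i)[l := es i ! l + 1]]) = (map sum_list ess)[i := map sum_list ess ! i + 1]"
   using i l len nth lens[OF i] by (simp add: map_update sum_list_raise)
  have "(\<Sum>j\<in>{i<..<n}. \<epsilon> ! j) = (\<Sum>j\<in>{i<..<n}. e' j)" by (rule sum.cong) (use nth in auto)
  then show ?thesis
   unfolding 1 c_def
   using assoc[OF pc hq, of "gss[i := ?h]" "ess[i := (es i)[l := es i ! l + 1]]"] h len
    shuffle_exp_raise_right[of i "map sum_list ess" \<epsilon>] i
   unfolding m E by (simp add: s_def)
 qed
 have dc: "pact (diff ?O c) (concat gss) =
   ksign M s (pact (diff (op_space P n) p) bs) \<oplus>\<^sub>M
   (\<Oplus>\<^sub>M i\<in>{..<n}. ksign M (?z i) (?U i))"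
 proof -
  interpret O: module R "?O" by (rule op_module)
  let ?c = "%i. op_comp P ks p (?dq i)"
  have gl: "length (concat gss) = sum_list ks" using gss lc by simp
  have gc: "set (concat gss) \<subseteq> carrier Q" unfolding gss using gens_closed[OF vc] by simp
  have L: "linear_map R ?O M (%c. pact c (concat gss))"
   using Q.act_linear_op[OF gl gc] by simp
  have qc: "qs ! i \<in> opc P (ks ! i)" if "i < n" for i using opg_closed[OF *(2)[OF that]] nth that by simp
  have cc: "?c i \<in> carrier ?O" if "i < n" for i
  proof (rule comp_closed)
   show "(?dq i) ! j \<in> opc P (ks ! j)" if "j < length ks" for j
    using that qc len lin_closed[OF op_diff_linear] \<open>i < n\<close> by (cases "j = i") auto
  qed (use pc len in auto)
  have c1: "op_comp P ks (diff (op_space P n) p) qs \<in> carrier ?O"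
   by (rule comp_closed) (use len qc opg_closed[OF op_diff_grade[OF p]] in auto)
  have sc: "(%i. ksign ?O (e + sum_list (take i \<epsilon>)) (?c i)) \<in> {..<n} \<rightarrow> carrier ?O"
   using cc by (intro Pi_I O.ksign_closed) auto
  have "diff ?O c = op_comp P ks (diff (op_space P n) p) qs \<oplus>\<^sub>?O
    (\<Oplus>\<^sub>?O i\<in>{..<n}. ksign ?O (e + sum_list (take i \<epsilon>)) (op_comp P ks p (qs[i := diff (map (op_space P) ks ! i) (qs ! i)])))"
   unfolding c_def comp_diff[OF pks hq] by (simp add: leibniz_def len)
  also have "(\<Oplus>\<^sub>?O i\<in>{..<n}. ksign ?O (e + sum_list (take i \<epsilon>)) (op_comp P ks p (qs[i := diff (map (op_space P) ks ! i) (qs ! i)]))) =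
    (\<Oplus>\<^sub>?O i\<in>{..<n}. ksign ?O (e + sum_list (take i \<epsilon>)) (?c i))"
   by (rule O.finsum_cong'[OF refl sc]) (simp add: len)
  finally have "pact (diff ?O c) (concat gss) = pact (op_comp P ks (diff (op_space P n) p) qs) (concat gss) \<oplus>\<^sub>M
    pact (\<Oplus>\<^sub>?O i\<in>{..<n}. ksign ?O (e + sum_list (take i \<epsilon>)) (?c i)) (concat gss)"
   using lin_add[OF L c1 O.finsum_closed[OF sc]] by simp
  also have "pact (\<Oplus>\<^sub>?O i\<in>{..<n}. ksign ?O (e + sum_list (take i \<epsilon>)) (?c i)) (concat gss) =
    (\<Oplus>\<^sub>M i\<in>{..<n}. pact (ksign ?O (e + sum_list (take i \<epsilon>)) (?c i)) (concat gss))"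
   by (rule lin_finsum[OF op_module modM L sc])
  also have "... = (\<Oplus>\<^sub>M i\<in>{..<n}. ksign M (?z i) (?U i))"
  proof (rule M.finsum_cong'[OF refl])
   show "(%i. ksign M (?z i) (?U i)) \<in> {..<n} \<rightarrow> carrier M"
    using Uc by (intro Pi_I M.ksign_closed) auto
   show "pact (ksign ?O (e + sum_list (take i \<epsilon>)) (?c i)) (concat gss) =
     ksign M (?z i) (?U i)" if "i \<in> {..<n}" for i
   proof -
    have i: "i < n" using that by simp
    show ?thesis unfolding lin_ksign[OF op_module modM L cc[OF i]] T2[OF i] M.ksign_ksign[OF Uc[OF i i]] ..
   qed
  qed
  finally show ?thesis unfolding T1 .
 qed
 have letters: "(\<Oplus>\<^sub>M k\<in>{..<length (concat vss)}. (?t k)) =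
   (\<Oplus>\<^sub>M i\<in>{..<n}. \<Oplus>\<^sub>M l\<in>{..<length (vs i)}. ksign M (?k i l) (?W i l))"
 proof -
  have "(%k. (?t k)) \<in> {..<length (concat vss)} \<rightarrow> carrier M"
   using Q.leib_closed(1)[of c "concat vss" gen \<theta> "e + sum_list \<epsilon>" "concat ess"] opg_closed[OF cg] lc gen_closed lin_closed[OF \<theta>] homs_closed[OF vc]
   by (simp add: subset_iff)
  then have "(\<Oplus>\<^sub>M k\<in>{..<length (concat vss)}. (?t k)) =
   (\<Oplus>\<^sub>M i\<in>{..<length vss}. \<Oplus>\<^sub>M l\<in>{..<length (vss ! i)}. ksign M (e + sum_list \<epsilon> + sum_list (take (offset vss i + l) (concat ess)))
    (pact c ((map gen (concat vss))[offset vss i + l := \<theta> (concat vss ! (offset vss i + l))])))"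
   by (intro M.finsum_concat) auto
  also have "... = (\<Oplus>\<^sub>M i\<in>{..<n}. \<Oplus>\<^sub>M l\<in>{..<length (vs i)}. ksign M (?k i l) (?W i l))"
  proof (rule M.finsum_cong')
   show "(%i. \<Oplus>\<^sub>M l\<in>{..<length (vs i)}. ksign M (?k i l) (?W i l)) \<in> {..<n} \<rightarrow> carrier M"
    by (intro Pi_I M.finsum_closed sWc) simp
   fix i assume "i \<in> {..<n}"
   then have i: "i < n" by simp
   show "(\<Oplus>\<^sub>M l\<in>{..<length (vss ! i)}. ksign M (e + sum_list \<epsilon> + sum_list (take (offset vss i + l) (concat ess)))
    (pact c ((map gen (concat vss))[offset vss i + l := \<theta> (concat vss ! (offset vss i + l))]))) =
    (?SW i)"
   proof (rule M.finsum_cong'[OF _ sWc[OF i]])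
    fix l assume "l \<in> {..<length (vs i)}"
    then have l: "l < length (vs i)" by simp
    have o: "offset vss i = offset ess i"
    proof -
     have "map length (take i vss) = map length (take i ess)"
      by (rule nth_equalityI) (use i len nth lens in auto)
     then show ?thesis by (simp add: length_concat)
    qed
    have k: "sum_list (take (offset vss i + l) (concat ess)) = (\<Sum>j<i. sum_list (es j)) + sum_list (take l (es i))"
    proof -
     have "(\<Sum>j<i. sum_list (ess ! j)) = (\<Sum>j<i. sum_list (es j))" by (rule sum.cong) (use i nth in auto)
     then show ?thesis
      using sum_list_take_concat[of i ess l] i l len nth lens[OF i] unfolding o by simp
    qed
    have d: "sum_list (take i ds) = (\<Sum>j<i. e' j) + (\<Sum>j<i. sum_list (es j))"
    proof -
     have "sum_list (take i ds) = (\<Sum>j<i. ds ! j)" using i bs(2) by (simp add: sum_list_take)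
     also have "... = (\<Sum>j<i. e' j + sum_list (es j))" by (rule sum.cong) (use i *(4) in auto)
     finally show ?thesis by (simp add: sum.distrib)
    qed
    have \<epsilon>s: "sum_list \<epsilon> = (\<Sum>j<i. e' j) + e' i + (\<Sum>j\<in>{i<..<n}. e' j)"
    proof -
     have "sum_list \<epsilon> = (\<Sum>j<n. e' j)" by (simp add: \<epsilon>_def interv_sum_list_conv_sum_set_nat atLeast0LessThan)
     also have "{..<n} = insert i ({..<i} \<union> {i<..<n})" using i by auto
     also have "(\<Sum>j\<in>insert i ({..<i} \<union> {i<..<n}). e' j) = e' i + (\<Sum>j\<in>{..<i} \<union> {i<..<n}. e' j)" by simp
     also have "(\<Sum>j\<in>{..<i} \<union> {i<..<n}. e' j) = (\<Sum>j<i. e' j) + (\<Sum>j\<in>{i<..<n}. e' j)" by (rule sum.union_disjoint) auto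
     finally show ?thesis by simp
    qed
    have ev: "even ((e + sum_list \<epsilon> + sum_list (take (offset vss i + l) (concat ess)) + (s + (\<Sum>j\<in>{i<..<n}. e' j))) +
      (?k i l))"
     unfolding k d \<epsilon>s by presburger
    show "ksign M (e + sum_list \<epsilon> + sum_list (take (offset vss i + l) (concat ess)))
      (pact c ((map gen (concat vss))[offset vss i + l := \<theta> (concat vss ! (offset vss i + l))])) =
     ksign M (?k i l) (?W i l)"
     unfolding T3[OF i l] M.ksign_ksign[OF Wc[OF i i l]] by (rule M.ksign_cong[OF ev])
   qed (use nth i in simp)
  qed (simp add: len)
  finally show ?thesis .
 qed
 have ops: "(\<Oplus>\<^sub>M i\<in>{..<n}. ksign M (?z i) (?U i)) =
   (\<Oplus>\<^sub>M i\<in>{..<n}. ksign M (?a i) (?U i))"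
 proof (rule M.finsum_cong'[OF refl])
  show "(%i. ksign M (?a i) (?U i)) \<in> {..<n} \<rightarrow> carrier M"
   using Uc by (intro Pi_I M.ksign_closed) auto
  fix i assume "i \<in> {..<n}"
  then have i: "i < n" by simp
  have "sum_list (take i ds) = (\<Sum>j<i. ds ! j)" using i bs(2) by (simp add: sum_list_take)
  also have "... = (\<Sum>j<i. e' j + sum_list (es j))" by (rule sum.cong) (use i *(4) in auto)
  finally have d: "sum_list (take i ds) = (\<Sum>j<i. e' j) + (\<Sum>j<i. sum_list (es j))" by (simp add: sum.distrib)
  have "sum_list (take i \<epsilon>) = (\<Sum>j<i. \<epsilon> ! j)" using i len by (simp add: sum_list_take)
  also have "... = (\<Sum>j<i. e' j)" by (rule sum.cong) (use i nth in auto)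
  finally have ev: "even (e + sum_list (take i \<epsilon>) + (s + (\<Sum>j<i. sum_list (es j))) + (?a i))"
   unfolding d by presburger
  show "ksign M (?z i) (?U i) = ksign M (?a i) (?U i)"
   by (rule M.ksign_cong[OF ev])
 qed
 \<comment> \<open>Up to the common sign \<open>s\<close>, both sides are the sum of these terms.\<close>
 have pdc: "pact (diff (op_space P n) p) bs \<in> carrier M"
  using Q.act_closed[OF opg_closed[OF op_diff_grade[OF p]] bs(1)] bsc by simp
 have USc: "(%i. ksign M (k i) (?U i)) \<in> {..<n} \<rightarrow> carrier M" for k using Uc by (intro Pi_I M.ksign_closed) auto
 have WSc: "(%i. \<Oplus>\<^sub>M l\<in>{..<length (vs i)}. ksign M (k i l) (?W i l)) \<in> {..<n} \<rightarrow> carrier M" for k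
  by (intro Pi_I M.finsum_closed sWc) simp
 have Dw: "?D (T c (concat vss)) = ksign M s (leib P Q (%a. a) ?D e ds p bs)"
 proof -
  have "?D (T c (concat vss)) = pact (diff ?O c) (concat gss) \<oplus>\<^sub>M
   (\<Oplus>\<^sub>M k\<in>{..<length (concat vss)}. (?t k))"
   unfolding D(2)[OF cg vc] gss using lc by (simp add: leib_def)
  also have "... = ksign M s (pact (diff (op_space P n) p) bs) \<oplus>\<^sub>M
   ((\<Oplus>\<^sub>M i\<in>{..<n}. ksign M (?a i) (?U i)) \<oplus>\<^sub>M
    (\<Oplus>\<^sub>M i\<in>{..<n}. \<Oplus>\<^sub>M l\<in>{..<length (vs i)}. ksign M (?k i l) (?W i l)))"
   unfolding dc letters ops
   by (rule M.a_assoc) (intro M.ksign_closed pdc M.finsum_closed USc WSc)+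
  also have "(\<Oplus>\<^sub>M i\<in>{..<n}. ksign M (?a i) (?U i)) \<oplus>\<^sub>M
    (\<Oplus>\<^sub>M i\<in>{..<n}. \<Oplus>\<^sub>M l\<in>{..<length (vs i)}. ksign M (?k i l) (?W i l)) =
    (\<Oplus>\<^sub>M i\<in>{..<n}. ksign M (?a i) (?U i) \<oplus>\<^sub>M
     (?SW i))"
   by (rule M.finsum_addf[symmetric, OF USc WSc])
  also have "... = (\<Oplus>\<^sub>M i\<in>{..<n}. ksign M s (?y i))"
  proof (rule M.finsum_cong'[OF refl])
   show "(%i. ksign M s (?y i)) \<in> {..<n} \<rightarrow> carrier M"
    using updc Dbc by (intro Pi_I M.ksign_closed) auto
   fix i assume "i \<in> {..<n}"
   then have i: "i < n" by simp
   have "ksign M s (?y i) =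
     ksign M (?a i) (?U i \<oplus>\<^sub>M (?VW i))"
    by (subst M.ksign_ksign[OF updc[OF i Dbc[OF i]]]) (simp only: rhs_i[OF i])
   also have "... = ksign M (?a i) (?U i) \<oplus>\<^sub>M
     ksign M (?a i) (?VW i)"
    by (rule M.ksign_add[OF Uc[OF i i] M.finsum_closed[OF sWc[OF i]]])
   also have "ksign M (?a i) (?VW i) =
     (?SW i)"
    unfolding M.ksign_finsum[OF sWc[OF i]]
    by (rule M.finsum_cong'[OF refl sWc[OF i]]) (use M.ksign_ksign[OF Wc[OF i i]] in simp)
   finally show "ksign M (?a i) (?U i) \<oplus>\<^sub>M
     (?SW i) =
     ksign M s (?y i)" ..
  qed
  also have "... = ksign M s (\<Oplus>\<^sub>M i\<in>{..<n}. ksign M (e + sum_list (take i ds)) (pact p (bs[i := ?D (bs ! i)])))"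
   by (rule M.ksign_finsum[symmetric]) (use updc Dbc in \<open>intro Pi_I M.ksign_closed, auto\<close>)
  also have "ksign M s (pact (diff (op_space P n) p) bs) \<oplus>\<^sub>M \<dots> =
    ksign M s (pact (diff (op_space P n) p) bs \<oplus>\<^sub>M (\<Oplus>\<^sub>M i\<in>{..<n}. ksign M (e + sum_list (take i ds)) (pact p (bs[i := ?D (bs ! i)]))))"
   by (rule M.ksign_add[symmetric, OF pdc M.finsum_closed]) (use updc Dbc in \<open>intro Pi_I M.ksign_closed, auto\<close>)
  finally show ?thesis using bs(1) by (simp add: leib_def)
 qed
 have "T c (concat vss) = ksign M s (pact p bs)"
  using assoc[OF pc hq len(6,5) hg] word_gen[OF cg vc] unfolding mapbs gss c_def s_def by simp
 moreover have pb: "pact p bs \<in> carrier M" using Q.act_closed[OF pc bs(1)] bsc by simp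
 moreover have lcl: "leib P Q (%a. a) ?D e ds p bs \<in> carrier M"
  using Q.leib_closed(2)[of p bs "%a. a" ?D] pc bs(1) bsc lin_closed[OF D(1)] by auto
 ultimately have "ksign M s (?D (pact p bs)) = ksign M s (leib P Q (%a. a) ?D e ds p bs)"
  using Dw lin_ksign[OF modM modM D(1) pb] by simp
 then have "ksign M s (ksign M s (?D (pact p bs))) = ksign M s (ksign M s (leib P Q (%a. a) ?D e ds p bs))" by simp
 then show ?thesis
  using lcl lin_closed[OF D(1) pb] by (simp add: M.ksign_ksign) (simp add: ksign_def)
qed

text \<open>Both sides are multilinear in homogeneous arguments, and these are spanned by words of the same degree.\<close>

lemma der_derivation:
 assumes \<theta>: "linear_map R X M \<theta>" and deg\<theta>: "\<forall>i. \<forall>v\<in>grade X i. \<theta> v \<in> G (i + 1)"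
 shows "p_derivation R P Q (der \<theta>)"
 unfolding p_derivation_def
proof (intro conjI allI impI ballI)
 note D = der_facts(2-)[OF \<theta> deg\<theta>]
 show "linear_map R Q Q (der \<theta>)" using D(1) by simp
 show "der \<theta> x \<in> grade Q (i + 1)" if "x \<in> grade Q i" for x i using D(4) that by simp
 fix n p e as ds assume p: "p \<in> opg P n e" and as: "homs n Q as ds"
 have n: "length as = n" "length ds = n" using as by (auto simp: homogeneous_Q)
 note pc = opg_closed[OF p]
 have "der \<theta> (pact p as) = leib P Q (%a. a) (der \<theta>) e ds p as"
 proof (rule multilinear_eqI[OF modM modM, where n=n and S="%i. word_grade (ds ! i)" and
    f="%as. der \<theta> (pact p as)" and g="%as. leib P Q (%a. a) (der \<theta>) e ds p as"])
  show "word_grade (ds ! i) \<subseteq> carrier M" for i by (rule word_grade_closed)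
  fix i and bs :: "('k,'p,'v) tensors list"
  assume i: "i < n" and len: "length bs = n" and bs: "!!j. j < n ==> bs ! j \<in> generated_submodule R M (word_grade (ds ! j))"
  then have bc: "set bs \<subseteq> carrier M" unfolding G_generated[symmetric] by (metis G_closed in_set_conv_nth subsetI)
  have sub: "submodule (generated_submodule R M (word_grade (ds ! i))) R M"
   by (rule M.generated_sub[OF word_grade_closed])
  have "linear_map R M M (%a. pact p (bs[i := a]))" using Q.act_linear_arg[OF pc len _ i] bc by simp
  from submodule_linear_map[OF sub modM lin_comp[OF this D(1)]]
  show "linear_map R (M\<lparr>carrier := generated_submodule R M (word_grade (ds ! i))\<rparr>) M (%a. der \<theta> (pact p (bs[i := a])))" .
  have "linear_map R Q Q (%y. leib P Q (%a. a) (der \<theta>) e ds p (bs[i := y]))"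
   by (rule Q.leib_linear_arg[OF Q.alg_module]) (use D(1) lin_ident pc len bc i in auto)
  then have "linear_map R M M (%y. leib P Q (%a. a) (der \<theta>) e ds p (bs[i := y]))" by simp
  from submodule_linear_map[OF sub modM this]
  show "linear_map R (M\<lparr>carrier := generated_submodule R M (word_grade (ds ! i))\<rparr>) M (%a. leib P Q (%a. a) (der \<theta>) e ds p (bs[i := a]))" .
 next
  fix bs :: "('k,'p,'v) tensors list"
  assume "length bs = n" "!!j. j < n ==> bs ! j \<in> word_grade (ds ! j)"
  then show "der \<theta> (pact p bs) = leib P Q (%a. a) (der \<theta>) e ds p bs"
   by (intro der_leibniz_words[OF \<theta> deg\<theta> p _ n(2)])
 next
  show "as ! j \<in> generated_submodule R M (word_grade (ds ! j))" if "j < n" for j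
   using that as unfolding G_generated[symmetric] by (simp add: homogeneous_Q)
 qed (rule n(1))
 then show "der \<theta> (act Q p as) = act Q (diff (op_space P n) p) as \<oplus>\<^sub>Q
   (\<Oplus>\<^sub>Q i\<in>{..<n}. ksign Q (e + sum_list (take i ds)) (act Q p (as[i := der \<theta> (as ! i)])))"
  using n(1) by (simp add: leib_def)
qed

text \<open>
 The square of a derivation of degree one is a derivation, the mixed terms cancelling in pairs; so it
 vanishes if it vanishes on the generators.
\<close>

lemma derivation_square_zero:
 assumes D: "p_derivation R P Q D" and gens: "!!i v. v \<in> grade X i ==> D (D (gen v)) = \<zero>\<^sub>M" and x: "x \<in> carrier M"
 shows "D (D x) = \<zero>\<^sub>M"
proof -
 note D = p_derivationD[OF D]
 have DL: "linear_map R M M D" using D(1) by simp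
 show ?thesis
 proof (rule linear_eq_on_words[OF modM lin_comp[OF DL DL] lin_const_zero[OF modM] _ x])
  fix n p e vs ds assume p: "p \<in> opg P n e" and vs: "homs n X vs ds"
  have n: "length vs = n" "length ds = n" using vs by (auto simp: homs_iff)
  let ?g = "map gen vs" and ?d = "diff (op_space P n)"
  note dp = op_diff_grade[OF p]
  have hg: "homs n Q ?g ds" by (rule gens_homogeneous[OF vs])
  have DgG: "D (?g ! i) \<in> G (ds ! i + 1)" if "i < n" for i using D(2)[of "?g ! i" "ds ! i"] gen_grade[of "vs ! i" "ds ! i"] vs that n by (simp add: homs_iff)
  have Dc: "D (?g ! i) \<in> carrier M" if "i < n" for i using G_closed[OF DgG[OF that]] .
  let ?h = "%i. ?g[i := D (?g ! i)]" and ?ds = "%i. ds[i := ds ! i + 1]"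
  have hh: "homs n Q (?h i) (?ds i)" if "i < n" for i
   unfolding homogeneous_Q
  proof (intro conjI allI impI)
   fix j assume "j < n"
   then show "?h i ! j \<in> G (?ds i ! j)" using hg DgG[OF that] that n by (cases "j = i") (auto simp: homogeneous_Q)
  qed (simp_all add: n)
  have actc: "pact p' as \<in> carrier M" if "p' \<in> opg P n k" "homs n Q as ds'" for p' k as ds'
   using Q.act_grade[OF that] G_closed by simp
  have hc: "set (?h i) \<subseteq> carrier M" if "i < n" for i using Q.homogeneous_closed[OF hh[OF that]] by simp
  have hhc: "pact p ((?h i)[j := D (?h i ! j)]) \<in> carrier M" if "i < n" "j < n" for i j
  proof -
   have "?h i ! j \<in> carrier M" using hc[OF that(1)] that(2) n by (metis length_list_update length_map nth_mem subsetD)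
   then have "set ((?h i)[j := D (?h i ! j)]) \<subseteq> carrier M"
    using hc[OF that(1)] lin_closed[OF DL] set_update_subset_insert[of "?h i" j "D (?h i ! j)"] by auto
   then show ?thesis using Q.act_closed[OF opg_closed[OF p], of "(?h i)[j := D (?h i ! j)]"] n by simp
  qed
  let ?s = "%i. e + sum_list (take i ds)"
  let ?a = "%i. pact (?d p) (?h i)"
  let ?u = "%i j. ksign M (?s i + (e + sum_list (take j (?ds i)))) (pact p ((?h i)[j := D (?h i ! j)]))"
  have ac: "?a i \<in> carrier M" if "i < n" for i by (rule actc[OF dp hh[OF that]])
  have D1: "D (pact p ?g) = pact (?d p) ?g \<oplus>\<^sub>M (\<Oplus>\<^sub>M i\<in>{..<n}. ksign M (?s i) (pact p (?h i)))"
   using D(3)[OF p hg] by simp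
  have sc: "(%i. ksign M (k i) (pact p (?h i))) \<in> {..<n} \<rightarrow> carrier M" for k
   using actc[OF p hh] by (intro Pi_I M.ksign_closed) auto
  have D2: "D (pact (?d p) ?g) = (\<Oplus>\<^sub>M i\<in>{..<n}. ksign M (?s i + 1) (?a i))"
  proof -
   have "pact (?d (?d p)) ?g = \<zero>\<^sub>M"
    using Q.act_zero_op[of ?g n] gens_closed[OF vs] n op_diff_diff[OF opg_closed[OF p]] by simp
   moreover have "(\<Oplus>\<^sub>M i\<in>{..<n}. ksign M (e + 1 + sum_list (take i ds)) (?a i)) = (\<Oplus>\<^sub>M i\<in>{..<n}. ksign M (?s i + 1) (?a i))"
    by (rule M.finsum_cong') (use ac in \<open>auto simp: algebra_simps\<close>)
   moreover have "(%i. ksign M (?s i + 1) (?a i)) \<in> {..<n} \<rightarrow> carrier M" using ac by (intro Pi_I M.ksign_closed) auto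
   ultimately show ?thesis using D(3)[OF dp hg] M.finsum_closed by simp
  qed
  have D3: "D (ksign M (?s i) (pact p (?h i))) = ksign M (?s i) (?a i) \<oplus>\<^sub>M (\<Oplus>\<^sub>M j\<in>{..<n}. ?u i j)" if i: "i < n" for i
  proof -
   have tc: "(%j. ksign M (k j) (pact p ((?h i)[j := D (?h i ! j)]))) \<in> {..<n} \<rightarrow> carrier M" for k
    using hhc[OF i] by (intro Pi_I M.ksign_closed) auto
   have "D (ksign M (?s i) (pact p (?h i))) = ksign M (?s i) (D (pact p (?h i)))"
    by (rule lin_ksign[OF modM modM DL actc[OF p hh[OF i]]])
   also have "D (pact p (?h i)) = ?a i \<oplus>\<^sub>M (\<Oplus>\<^sub>M j\<in>{..<n}. ksign M (e + sum_list (take j (?ds i))) (pact p ((?h i)[j := D (?h i ! j)])))"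
    using D(3)[OF p hh[OF i]] by simp
   also have "ksign M (?s i) \<dots> = ksign M (?s i) (?a i) \<oplus>\<^sub>M
     ksign M (?s i) (\<Oplus>\<^sub>M j\<in>{..<n}. ksign M (e + sum_list (take j (?ds i))) (pact p ((?h i)[j := D (?h i ! j)])))"
    by (rule M.ksign_add[OF ac[OF i] M.finsum_closed[OF tc]])
   also have "ksign M (?s i) (\<Oplus>\<^sub>M j\<in>{..<n}. ksign M (e + sum_list (take j (?ds i))) (pact p ((?h i)[j := D (?h i ! j)]))) = (\<Oplus>\<^sub>M j\<in>{..<n}. ?u i j)"
    unfolding M.ksign_finsum[OF tc]
    by (rule M.finsum_cong'[OF refl tc]) (use M.ksign_ksign[OF hhc[OF i]] in simp)
   finally show ?thesis .
  qed
  have uc: "?u i j \<in> carrier M" if "i < n" "j < n" for i j using hhc[OF that] by simp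
  have anti: "(\<Oplus>\<^sub>M i\<in>{..<n}. \<Oplus>\<^sub>M j\<in>{..<n}. ?u i j) = \<zero>\<^sub>M"
  proof (rule M.finsum_antisymmetric[OF uc])
   fix i assume i: "i < n"
   then have "vs ! i \<in> grade X (ds ! i)" using vs by (simp add: homs_iff)
   then have z: "D (?h i ! i) = \<zero>\<^sub>M" using gens i n by simp
   have "set ((?h i)[i := \<zero>\<^sub>M]) \<subseteq> carrier M"
    using hc[OF i] set_update_subset_insert[of "?h i" i "\<zero>\<^sub>M"] by auto
   then have "pact p ((?h i)[i := \<zero>\<^sub>M]) = \<zero>\<^sub>M"
    using Q.act_zero_arg[OF opg_closed[OF p], of "(?h i)[i := \<zero>\<^sub>M]" i] i n by simp
   then show "?u i i = \<zero>\<^sub>M" unfolding z by simp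
  next
   have step: "?u i j \<oplus>\<^sub>M ?u j i = \<zero>\<^sub>M" if ij: "i < j" "j < n" for i j
   proof -
    have i: "i < n" using ij by simp
    have same: "(?h i)[j := D (?h i ! j)] = (?h j)[i := D (?h j ! i)]"
     using ij by (simp add: list_update_swap)
    have s1: "sum_list (take j (?ds i)) = sum_list (take j ds) + 1"
     using ij n by (simp add: take_update_swap sum_list_raise[of i "take j ds", simplified])
    have s2: "sum_list (take i (?ds j)) = sum_list (take i ds)" using ij by simp
    have "?u i j = ksign M ((?s j + (e + sum_list (take i (?ds j)))) + 1) (pact p ((?h j)[i := D (?h j ! i)]))"
     unfolding same s1 s2 by (rule M.ksign_cong) presburger
    then show ?thesis
     using M.ksign_cancel[OF hhc[OF ij(2) i]] uc[OF ij(2) i] uc[OF i ij(2)] by (simp add: M.a_comm)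
   qed
   fix i j assume "i < n" "j < n" "i \<noteq> j"
   then show "?u i j \<oplus>\<^sub>M ?u j i = \<zero>\<^sub>M"
    using step[of i j] step[of j i] uc[of i j] uc[of j i] M.a_comm by (cases "i < j") auto
  qed
  have kac: "(%i. ksign M (k i) (?a i)) \<in> {..<n} \<rightarrow> carrier M" for k using ac by (intro Pi_I M.ksign_closed) auto
  have usc: "(%i. \<Oplus>\<^sub>M j\<in>{..<n}. ?u i j) \<in> {..<n} \<rightarrow> carrier M" using uc by (intro Pi_I M.finsum_closed) auto
  have "D (D (T p vs)) = D (pact (?d p) ?g) \<oplus>\<^sub>M D (\<Oplus>\<^sub>M i\<in>{..<n}. ksign M (?s i) (pact p (?h i)))"
   unfolding word_gen[OF p vs] D1
   by (rule lin_add[OF DL actc[OF dp hg] M.finsum_closed[OF sc]])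
  also have "D (\<Oplus>\<^sub>M i\<in>{..<n}. ksign M (?s i) (pact p (?h i))) = (\<Oplus>\<^sub>M i\<in>{..<n}. ksign M (?s i) (?a i) \<oplus>\<^sub>M (\<Oplus>\<^sub>M j\<in>{..<n}. ?u i j))"
   unfolding lin_finsum[OF modM modM DL sc]
   by (rule M.finsum_cong'[OF refl _ D3]) (use ac usc in auto)
  also have "... = (\<Oplus>\<^sub>M i\<in>{..<n}. ksign M (?s i) (?a i)) \<oplus>\<^sub>M \<zero>\<^sub>M"
   unfolding M.finsum_addf[OF kac usc] anti ..
  also have "D (pact (?d p) ?g) \<oplus>\<^sub>M \<dots> = (\<Oplus>\<^sub>M i\<in>{..<n}. ksign M (?s i + 1) (?a i) \<oplus>\<^sub>M ksign M (?s i) (?a i))"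
   unfolding D2 M.finsum_addf[OF kac kac] using M.finsum_closed[OF kac] by simp
  also have "... = (\<Oplus>\<^sub>M i\<in>{..<n}. \<zero>\<^sub>M)"
   by (rule M.finsum_cong') (use M.ksign_cancel[OF ac] ac M.a_comm in auto)
  finally show "D (D (T p vs)) = \<zero>\<^sub>M" by simp
 qed
qed

end

section \<open>Weights\<close>

text \<open>
 Letters have levels, and the weight of a word is the multiset of the levels of its letters. A number would
 not do: the differential replaces a letter by arbitrarily many letters of lower level.
\<close>

locale weighted_free_alg = free_p_alg R P X d
 for R :: "('k, 'c) ring_scheme" and P :: "('k, 'p) operad" and X :: "('k, 'v) dgvs"
  and d :: "('k,'p,'v) tensors => ('k,'p,'v) tensors" +
 fixes L :: "nat => 'v set" and pr :: "nat => 'v => 'v"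
 assumes pr_linear: "linear_map R X X (pr j)"
  and pr_grade: "v \<in> grade X i ==> pr j v \<in> grade X i"
  and pr_mem: "v \<in> carrier X ==> pr j v \<in> L j"
  and pr_same: "v \<in> L j ==> pr j v = v"
  and pr_other: "[|v \<in> L l; l \<noteq> j|] ==> pr j v = \<zero>\<^sub>X"
  and letters_generate: "grade X i \<subseteq> generated_submodule R X (\<Union>j. L j \<inter> grade X i)"
begin

definition weight_words :: "nat multiset => ('k,'p,'v) tensors set"
 where "weight_words \<alpha> = {T p vs | p vs e ds js. p \<in> opg P (length vs) e \<and>
  homs (length vs) X vs ds \<and> length js = length vs \<and> (\<forall>i<length vs. vs ! i \<in> L (js ! i)) \<and> mset js = \<alpha>}"

lemma weight_wordsI:
 "[|p \<in> opg P n e; homs n X vs ds; length js = n; !!i. i < n ==> vs ! i \<in> L (js ! i)|] ==>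
  T p vs \<in> weight_words (mset js)"
 unfolding weight_words_def mem_Collect_eq
 by (intro exI[of _ p] exI[of _ vs] exI[of _ e] exI[of _ ds] exI[of _ js]) (simp add: homs_iff)

lemma weight_wordsE:
 assumes "x \<in> weight_words \<alpha>"
 obtains p n vs e ds js where "x = T p vs" "p \<in> opg P n e" "homs n X vs ds"
  "length js = n" "!!i. i < n ==> vs ! i \<in> L (js ! i)" "mset js = \<alpha>"
 using assms unfolding weight_words_def by blast

lemma weight_words_closed: "weight_words \<alpha> \<subseteq> carrier M"
 using tensD(1) by (auto elim!: weight_wordsE)

definition weight_span :: "(nat multiset => bool) => ('k,'p,'v) tensors set"
 where "weight_span Z = generated_submodule R M (\<Union>\<alpha>\<in>Collect Z. weight_words \<alpha>)"

lemma weight_gens_closed: "(\<Union>\<alpha>\<in>Collect Z. weight_words \<alpha>) \<subseteq> carrier M"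
 using weight_words_closed by blast

lemma weight_span_sub: "submodule (weight_span Z) R M"
 unfolding weight_span_def by (rule M.generated_sub[OF weight_gens_closed])

lemmas weight_spanD = submoduleD[OF modM weight_span_sub]

lemma weight_span_closed: "x \<in> weight_span Z ==> x \<in> carrier M"
 using weight_spanD(1) by blast

lemma weight_span_incl: "[|x \<in> weight_words \<alpha>; Z \<alpha>|] ==> x \<in> weight_span Z"
 unfolding weight_span_def by (rule subsetD[OF M.generated_incl]) auto

lemma weight_span_mono: "[|x \<in> weight_span Z; !!\<alpha>. Z \<alpha> ==> Z' \<alpha>|] ==> x \<in> weight_span Z'"
 unfolding weight_span_def by (erule subsetD[OF M.generated_mono[OF _ weight_gens_closed], rotated]) auto

lemma weight_span_induct [consumes 1, case_names words zero add smult]: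
 assumes "x \<in> weight_span Z"
  and "!!\<alpha> x. [|Z \<alpha>; x \<in> weight_words \<alpha>|] ==> Q' x" and "Q' \<zero>\<^sub>M"
  and "!!x y. [|x \<in> carrier M; y \<in> carrier M; Q' x; Q' y|] ==> Q' (x \<oplus>\<^sub>M y)"
  and "!!r x. [|r \<in> carrier R; x \<in> carrier M; Q' x|] ==> Q' (r \<odot>\<^sub>M x)"
 shows "Q' x"
 using assms(1)[unfolded weight_span_def] weight_gens_closed
 by (induction rule: M.generated_induct) (use assms in auto)

lemma linear_weight_span:
 assumes "linear_map R M M f" "!!\<alpha> x. [|Z \<alpha>; x \<in> weight_words \<alpha>|] ==> f x \<in> weight_span Z'" "x \<in> weight_span Z"
 shows "f x \<in> weight_span Z'"
 using assms(3) by (induction rule: weight_span_induct)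
  (use assms(2) weight_spanD linear_mapD[OF assms(1)] lin_zero[OF modM modM assms(1)] in auto)

text \<open>Expanding the letters of a word gives words whose letters have a weight.\<close>

lemma word_weight_span:
 assumes p: "p \<in> opg P n e" and vs: "homs n X vs ds"
  and letters: "!!i. i < n ==> vs ! i \<in> generated_submodule R X (\<Union>l\<in>I. L l \<inter> grade X (ds ! i))"
 shows "T p vs \<in> weight_span (%\<beta>. set_mset \<beta> \<subseteq> I)"
proof -
 have "T p vs \<in> weight_span (%\<beta>. set_mset \<beta> \<subseteq> I)"
  if "k \<le> n" and vs: "homs n X vs ds"
   and "!!i. i < n ==> vs ! i \<in> generated_submodule R X (\<Union>l\<in>I. L l \<inter> grade X (ds ! i))"
   and "!!j. [|k \<le> j; j < n|] ==> vs ! j \<in> (\<Union>l\<in>I. L l)" for vs k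
  using that
 proof (induction k arbitrary: vs)
  case 0
  then have "\<forall>j. \<exists>l. j < n --> l \<in> I \<and> vs ! j \<in> L l" by blast
  then obtain l where l: "!!j. j < n ==> l j \<in> I \<and> vs ! j \<in> L (l j)" by metis
  have "T p vs \<in> weight_words (mset (map l [0..<n]))"
   by (rule weight_wordsI[OF p 0(2)]) (use l in auto)
  then show ?case by (rule weight_span_incl) (use l in auto)
 next
  case (Suc k)
  then have k: "k < n" by simp
  have n: "length vs = n" and vk: "vs ! k \<in> grade X (ds ! k)" using Suc.prems(2) k by (auto simp: homs_iff)
  let ?f = "%v. pact p ((map gen vs)[k := gen v])"
  have lin: "linear_map R X M ?f"
   using lin_comp[OF gen_linear, of Q "%a. pact p ((map gen vs)[k := a])"] Q.act_linear_arg[OF opg_closed[OF p], of "map gen vs" k]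
    gens_closed[OF Suc.prems(2)] n k by simp
  have f: "?f v = T p (vs[k := v])" if "v \<in> grade X (ds ! k)" for v
   using word_gen[OF p homs_update_same[OF Suc.prems(2) that]] by (simp add: map_update)
  let ?S = "\<Union>l\<in>I. L l \<inter> grade X (ds ! k)"
  have "?f (vs ! k) \<in> weight_span (%\<beta>. set_mset \<beta> \<subseteq> I)"
  proof (rule lin_generated_into[OF modX modM lin weight_span_sub])
   show "?S \<subseteq> carrier X" using X.grade_closed by blast
   show "vs ! k \<in> generated_submodule R X ?S" by (rule Suc.prems(3)[OF k])
   show "?f v \<in> weight_span (%\<beta>. set_mset \<beta> \<subseteq> I)" if "v \<in> ?S" for v
   proof -
    have v: "v \<in> grade X (ds ! k)" "v \<in> (\<Union>l\<in>I. L l)" using that by auto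
    show ?thesis unfolding f[OF v(1)]
    proof (rule Suc.IH)
     show "homs n X (vs[k := v]) ds" by (rule homs_update_same[OF Suc.prems(2) v(1)])
     show "vs[k := v] ! j \<in> generated_submodule R X (\<Union>l\<in>I. L l \<inter> grade X (ds ! j))" if "j < n" for j
      using that Suc.prems(3)[OF that] \<open>v \<in> ?S\<close> n subsetD[OF X.generated_incl, of v ?S] by (cases "j = k") auto
     show "vs[k := v] ! j \<in> (\<Union>l\<in>I. L l)" if "k \<le> j" "j < n" for j
      using that Suc.prems(4)[of j] v(2) n by (cases "j = k") auto
    qed (use k in simp)
   qed
  qed
  then show ?case using f[OF vk] by simp
 qed
 from this[of n vs] show ?thesis using vs letters by simp
qed

lemma weight_span_all: "weight_span (%\<alpha>. True) = carrier M"
proof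
 show "weight_span (%\<alpha>. True) \<subseteq> carrier M" by (rule weight_spanD(1))
 have "T p vs \<in> weight_span (%\<alpha>. True)"
  if "p \<in> opg P n e" and vs: "homs n X vs ds" for p n e vs ds
  using word_weight_span[OF that, of UNIV] subsetD[OF letters_generate] vs by (simp add: homs_iff)
 then have "word_tens \<subseteq> weight_span (%\<alpha>. True)"
  by (auto simp: word_tens_def elim!: wordE)
 then show "carrier M \<subseteq> weight_span (%\<alpha>. True)"
  unfolding free_generated by (rule M.generated_subset[OF weight_span_sub])
qed

subsection \<open>The component of a given weight\<close>

definition weight_lists :: "nat multiset => nat => nat list set"
 where "weight_lists \<alpha> n = {js. mset js = \<alpha> \<and> length js = n}"

lemma finite_weight_lists: "finite (weight_lists \<alpha> n)"
 by (rule finite_subset[OF _ finite_mset_fibre[of \<alpha>]]) (auto simp: weight_lists_def)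

text \<open>The projection to the part of weight \<open>\<alpha>\<close> sums over the distributions of the levels in \<open>\<alpha>\<close> to the letters.\<close>

definition weight_part :: "nat multiset => ('k,'p,'v) tensors => ('k,'p,'v) tensors"
 where "weight_part \<alpha> = extend R M (%p vs. \<Oplus>\<^sub>M js\<in>weight_lists \<alpha> (length vs). T p (map2 pr js vs))"

lemma homogeneous_pr:
 "[|homs n X vs ds; length js = n|] ==> homs n X (map2 pr js vs) ds"
 by (auto simp: homs_iff pr_grade)

text \<open>Permuting the letters permutes the distributions of the levels.\<close>

lemma weight_part_respects:
 "respects_relations R P X M (%p vs. \<Oplus>\<^sub>M js\<in>weight_lists \<alpha> (length vs). T p (map2 pr js vs))"
 unfolding respects_relations_def
proof (intro allI impI conjI ballI)
 fix n p e vs ds assume p: "p \<in> opg P n e" and vs: "homs n X vs ds"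
 let ?tot = "%p vs. (\<Oplus>\<^sub>M js\<in>weight_lists \<alpha> (length vs). T p (map2 pr js vs))"
 have n: "length vs = n" "length ds = n" using vs by (auto simp: homs_iff)
 let ?J = "weight_lists \<alpha> n"
 have h: "homs n X (map2 pr js vs) ds" if "js \<in> ?J" "homs n X vs ds" for js vs
  using homogeneous_pr that by (simp add: weight_lists_def)
 have c: "(%js. T p' (map2 pr js vs')) \<in> ?J \<rightarrow> carrier M"
  if "p' \<in> opg P n e" "homs n X vs' ds" for p' vs'
  using tensD(1)[OF that(1) h[OF _ that(2)]] by auto
 show "(?tot p vs) \<in> carrier M"
  unfolding n by (rule M.finsum_closed[OF c[OF p vs]])
 show "(\<Oplus>\<^sub>M js\<in>weight_lists \<alpha> (length vs). T (p \<oplus>\<^bsub>op_space P n\<^esub> p') (map2 pr js vs)) =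
   (?tot p vs) \<oplus>\<^sub>M (\<Oplus>\<^sub>M js\<in>weight_lists \<alpha> (length vs). T p' (map2 pr js vs))"
  if p': "p' \<in> opg P n e" for p'
  unfolding n M.finsum_addf[OF c[OF p vs] c[OF p' vs], symmetric]
 proof (rule M.finsum_cong'[OF refl])
  show "(%js. T p (map2 pr js vs) \<oplus>\<^sub>M T p' (map2 pr js vs)) \<in> ?J \<rightarrow> carrier M"
   using c[OF p vs] c[OF p' vs] by auto
 qed (use tensD(2)[OF p h[OF _ vs] p'] in simp)
 show "(\<Oplus>\<^sub>M js\<in>weight_lists \<alpha> (length vs). T (r \<odot>\<^bsub>op_space P n\<^esub> p) (map2 pr js vs)) =
   r \<odot>\<^sub>M (?tot p vs)" if r: "r \<in> carrier R" for r
  unfolding n M.finsum_smult_ldistr[OF finite_weight_lists r c[OF p vs]]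
 proof (rule M.finsum_cong'[OF refl])
  show "(%js. r \<odot>\<^sub>M T p (map2 pr js vs)) \<in> ?J \<rightarrow> carrier M" using c[OF p vs] r by auto
 qed (use tensD(3)[OF p h[OF _ vs] r] in simp)
 fix i
 have upd: "map2 pr js (vs[i := v]) = (map2 pr js vs)[i := pr (js ! i) v]" if "js \<in> ?J" "i < n" for js v
  using that n by (intro nth_equalityI) (auto simp: weight_lists_def nth_list_update)
 have vi: "vs ! i \<in> grade X (ds ! i)" if "i < n" using vs that by (simp add: homs_iff)
 have nth: "map2 pr js vs ! i = pr (js ! i) (vs ! i)" if "js \<in> ?J" "i < n" for js
  using that n by (simp add: weight_lists_def)
 show "(\<Oplus>\<^sub>M js\<in>weight_lists \<alpha> (length (vs[i := vs ! i \<oplus>\<^sub>X v])). T p (map2 pr js (vs[i := vs ! i \<oplus>\<^sub>X v]))) =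
   (?tot p vs) \<oplus>\<^sub>M (\<Oplus>\<^sub>M js\<in>weight_lists \<alpha> (length (vs[i := v])). T p (map2 pr js (vs[i := v])))"
  if i: "i < n" and v: "v \<in> grade X (ds ! i)" for v
  unfolding length_list_update n M.finsum_addf[OF c[OF p vs] c[OF p homs_update_same[OF vs v]], symmetric]
 proof (rule M.finsum_cong'[OF refl])
  show "(%js. T p (map2 pr js vs) \<oplus>\<^sub>M T p (map2 pr js (vs[i := v]))) \<in> ?J \<rightarrow> carrier M"
   using c[OF p vs] c[OF p homs_update_same[OF vs v]] by auto
  show "T p (map2 pr js (vs[i := vs ! i \<oplus>\<^sub>X v])) = T p (map2 pr js vs) \<oplus>\<^sub>M T p (map2 pr js (vs[i := v]))" if js: "js \<in> ?J" for js
   using tensD(4)[OF p h[OF js vs] i pr_grade[OF v]] lin_add[OF pr_linear X.grade_closed[OF vi[OF i]] X.grade_closed[OF v]]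
   by (simp add: upd[OF js i] nth[OF js i])
 qed
 show "(\<Oplus>\<^sub>M js\<in>weight_lists \<alpha> (length (vs[i := r \<odot>\<^sub>X vs ! i])). T p (map2 pr js (vs[i := r \<odot>\<^sub>X vs ! i]))) =
   r \<odot>\<^sub>M (?tot p vs)" if i: "i < n" and r: "r \<in> carrier R" for r
  unfolding length_list_update n M.finsum_smult_ldistr[OF finite_weight_lists r c[OF p vs]]
 proof (rule M.finsum_cong'[OF refl])
  show "(%js. r \<odot>\<^sub>M T p (map2 pr js vs)) \<in> ?J \<rightarrow> carrier M" using c[OF p vs] r by auto
  show "T p (map2 pr js (vs[i := r \<odot>\<^sub>X vs ! i])) = r \<odot>\<^sub>M T p (map2 pr js vs)" if js: "js \<in> ?J" for js
   using tensD(5)[OF p h[OF js vs] i r] lin_smult[OF pr_linear r X.grade_closed[OF vi[OF i]]]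
   by (simp add: upd[OF js i] nth[OF js i])
 qed
 fix \<sigma> assume \<sigma>: "\<sigma> permutes {..<n}"
 have inj: "inj_on (permute_list \<sigma>) ?J"
 proof (rule inj_onI)
  fix js js' assume "js \<in> ?J" "js' \<in> ?J" and eq: "permute_list \<sigma> js = permute_list \<sigma> js'"
  then have l: "length js = n" "length js' = n" by (auto simp: weight_lists_def)
  show "js = js'"
  proof (rule nth_equalityI)
   fix j assume "j < length js"
   then obtain k where k: "k < n" "\<sigma> k = j" using permutes_image[OF \<sigma>] l by (metis imageE lessThan_iff)
   then show "js ! j = js' ! j" using arg_cong[OF eq, of "%l. l ! k"] l \<sigma> by (simp add: permute_list_nth)
  qed (simp add: l)
 qed
 have "permute_list \<sigma> ` ?J \<subseteq> ?J" using \<sigma> by (auto simp: weight_lists_def)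
 then have bij: "permute_list \<sigma> ` ?J = ?J" by (rule endo_inj_surj[OF finite_weight_lists _ inj])
 have m: "map2 pr (permute_list \<sigma> js) (permute_list \<sigma> vs) = permute_list \<sigma> (map2 pr js vs)" if "js \<in> ?J" for js
  by (rule nth_equalityI) (use that n \<sigma> permutes_in_image[OF \<sigma>] in \<open>auto simp: weight_lists_def permute_list_def\<close>)
 have cs: "(%js. T (op_sym P n p \<sigma>) (map2 pr js (permute_list \<sigma> vs))) \<in> ?J \<rightarrow> carrier M"
  using tensD(1)[OF op_sym_grade[OF \<sigma> p] homogeneous_pr[OF homogeneous_permute[OF vs \<sigma>]]] by (auto simp: weight_lists_def)
 have "(\<Oplus>\<^sub>M js\<in>?J. T (op_sym P n p \<sigma>) (map2 pr js (permute_list \<sigma> vs))) =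
   (\<Oplus>\<^sub>M js\<in>?J. T (op_sym P n p \<sigma>) (map2 pr (permute_list \<sigma> js) (permute_list \<sigma> vs)))"
  using M.finsum_reindex[of "%js. T (op_sym P n p \<sigma>) (map2 pr js (permute_list \<sigma> vs))" "permute_list \<sigma>" ?J] cs inj bij by simp
 also have "... = (\<Oplus>\<^sub>M js\<in>?J. ksign M (perm_exp \<sigma> ds) (T p (map2 pr js vs)))"
 proof (rule M.finsum_cong'[OF refl])
  show "(%js. ksign M (perm_exp \<sigma> ds) (T p (map2 pr js vs))) \<in> ?J \<rightarrow> carrier M"
   by (intro Pi_I M.ksign_closed funcset_mem[OF c[OF p vs]])
 qed (use tensD(6)[OF p h[OF _ vs] \<sigma>] m in simp)
 also have "... = ksign M (perm_exp \<sigma> ds) (\<Oplus>\<^sub>M js\<in>?J. T p (map2 pr js vs))"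
  by (rule M.ksign_finsum[OF c[OF p vs], symmetric])
 finally show "(\<Oplus>\<^sub>M js\<in>weight_lists \<alpha> (length (permute_list \<sigma> vs)). T (op_sym P n p \<sigma>) (map2 pr js (permute_list \<sigma> vs))) =
   ksign M (perm_exp \<sigma> ds) (?tot p vs)"
  using n by simp
qed

lemma weight_part_linear: "linear_map R M M (weight_part \<alpha>)"
 unfolding weight_part_def by (rule extend_linear[OF modM weight_part_respects])

lemma weight_part_word:
 assumes "p \<in> opg P n e" "homs n X vs ds"
 shows "weight_part \<alpha> (T p vs) = (\<Oplus>\<^sub>M js\<in>weight_lists \<alpha> n. T p (map2 pr js vs))"
proof -
 have "length vs = n" using assms(2) by (simp add: homs_iff)
 then show ?thesis
  unfolding weight_part_def extend_tens[OF modM weight_part_respects wordI[OF assms]] by simp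
qed

lemma weight_part_words:
 assumes "x \<in> weight_words \<beta>"
 shows "weight_part \<alpha> x = (if \<alpha> = \<beta> then x else \<zero>\<^sub>M)"
 using assms
proof (cases rule: weight_wordsE)
 case (1 p n vs e ds js)
 have n: "length vs = n" using 1(3) by (simp add: homs_iff)
 have tc: "T p vs \<in> carrier M" by (rule tensD(1)[OF 1(2,3)])
 have self: "map2 pr js vs = vs" by (rule nth_equalityI) (use n 1(4,5) pr_same in auto)
 have z: "T p (map2 pr js' vs) = \<zero>\<^sub>M" if l: "length js' = n" "js' \<noteq> js" for js'
 proof -
  obtain i where i: "i < n" "js' ! i \<noteq> js ! i" using l 1(4) by (metis nth_equalityI)
  have "pr (js' ! i) (vs ! i) = \<zero>\<^sub>X" by (rule pr_other[OF 1(5)[OF i(1)]]) (use i in simp)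
  then show ?thesis
   by (intro tens_zero_arg[OF 1(2) homogeneous_pr[OF 1(3) l(1)] i(1)]) (use i l n in simp)
 qed
 have "(\<Oplus>\<^sub>M js'\<in>weight_lists \<alpha> n. T p (map2 pr js' vs)) = (\<Oplus>\<^sub>M js'\<in>weight_lists \<alpha> n. if js = js' then T p vs else \<zero>\<^sub>M)"
  by (rule M.finsum_cong') (use tc z self in \<open>auto simp: weight_lists_def\<close>)
 also have "... = (if \<alpha> = \<beta> then T p vs else \<zero>\<^sub>M)"
 proof (cases "\<alpha> = \<beta>")
  case True
  then have "js \<in> weight_lists \<alpha> n" using 1 by (simp add: weight_lists_def)
  then show ?thesis using True M.add.finprod_singleton[OF _ finite_weight_lists, of js \<alpha> n "%_. T p vs"] tc by simp
 next
  case False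
  then have "js \<notin> weight_lists \<alpha> n" using 1 by (simp add: weight_lists_def)
  then have "(\<Oplus>\<^sub>M js'\<in>weight_lists \<alpha> n. if js = js' then T p vs else \<zero>\<^sub>M) = (\<Oplus>\<^sub>M js'\<in>weight_lists \<alpha> n. \<zero>\<^sub>M)"
   by (intro M.finsum_cong') auto
  then show ?thesis using False by simp
 qed
 finally show ?thesis using weight_part_word[OF 1(2,3)] 1(1) by simp
qed

lemma weight_part_span:
 assumes "x \<in> weight_span Z" "!!\<beta>. Z \<beta> ==> \<beta> = \<alpha>" shows "weight_part \<alpha> x = x"
 using assms(1)
proof (induction rule: weight_span_induct)
 case (words \<beta> x)
 then show ?case using weight_part_words[OF words(2), of \<alpha>] assms(2) by auto
qed (simp_all add: linear_mapD[OF weight_part_linear] lin_zero[OF modM modM weight_part_linear])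

lemma weight_part_other:
 assumes "x \<in> weight_span Z" "\<not> Z \<alpha>" shows "weight_part \<alpha> x = \<zero>\<^sub>M"
 using assms(1)
proof (induction rule: weight_span_induct)
 case (words \<beta> x)
 then show ?case using weight_part_words[OF words(2), of \<alpha>] assms(2) by auto
qed (simp_all add: linear_mapD[OF weight_part_linear] lin_zero[OF modM modM weight_part_linear])

lemma weight_part_mem: "x \<in> carrier M ==> weight_part \<alpha> x \<in> weight_span (%\<beta>. \<beta> = \<alpha>)"
 unfolding weight_span_all[symmetric]
 by (erule linear_weight_span[OF weight_part_linear, rotated])
  (use weight_part_words weight_span_incl[where Z="%\<beta>. \<beta> = \<alpha>"] weight_spanD(2) in auto)

subsection \<open>Perturbations that lower the weight\<close>

lemma der_preserves_weight:
 assumes dX: "linear_map R X X dX" "!!i v. v \<in> grade X i ==> dX v \<in> grade X (i + 1)" "!!j v. v \<in> L j ==> dX v \<in> L j"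
  and x: "x \<in> weight_words \<alpha>"
 shows "der (%v. gen (dX v)) x \<in> weight_span (%\<beta>. \<beta> = \<alpha>)"
 using x
proof (cases rule: weight_wordsE)
 case (1 p n vs e ds js)
 have n: "length vs = n" "length ds = n" using 1(3) by (simp_all add: homs_iff)
 have \<theta>: "linear_map R X M (%v. gen (dX v))" by (rule lin_comp[OF dX(1) gen_linear])
 have deg: "\<forall>i. \<forall>v\<in>grade X i. gen (dX v) \<in> G (i + 1)" using dX(2) gen_grade by blast
 have "pact (diff (op_space P n) p) (map gen vs) \<in> weight_span (%\<beta>. \<beta> = \<alpha>)"
  unfolding word_gen[OF op_diff_grade[OF 1(2)] 1(3), symmetric]
  by (rule weight_span_incl[OF weight_wordsI[OF op_diff_grade[OF 1(2)] 1(3,4,5)]]) (simp_all add: 1(6))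
 moreover have "pact p ((map gen vs)[i := gen (dX (vs ! i))]) \<in> weight_span (%\<beta>. \<beta> = \<alpha>)" if i: "i < n" for i
 proof -
  have "vs ! i \<in> grade X (ds ! i)" using 1(3) i by (simp add: homs_iff)
  note h = homogeneous_update[OF 1(3) dX(2)[OF this], of i]
  have "T p (vs[i := dX (vs ! i)]) \<in> weight_words (mset js)"
  proof (rule weight_wordsI[OF 1(2) h 1(4)])
   show "vs[i := dX (vs ! i)] ! j \<in> L (js ! j)" if "j < n" for j
    using that 1(5) dX(3) i n by (cases "j = i") auto
  qed
  then show ?thesis using word_gen[OF 1(2) h] weight_span_incl 1(6) by (simp add: map_update)
 qed
 ultimately show ?thesis
  unfolding 1(1) der_word[OF \<theta> deg 1(2,3)] leib_def
  using n by (auto intro!: weight_spanD(3,7,8))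
qed

text \<open>
 The new terms have a letter of level \<open>Suc j\<close> replaced by words with letters of levels strictly between
 \<open>0\<close> and \<open>Suc j\<close>. This lowers the weight, and letters of level \<open>0\<close> are never removed.
\<close>

lemma der_add_weight:
 assumes \<theta>0: "linear_map R X M \<theta>0" "\<forall>i. \<forall>v\<in>grade X i. \<theta>0 v \<in> G (i + 1)"
  and \<eta>: "linear_map R X M \<eta>" "\<forall>i. \<forall>v\<in>grade X i. \<eta> v \<in> G (i + 1)"
  and \<eta>0: "!!v. v \<in> L 0 ==> \<eta> v = \<zero>\<^sub>M"
  and \<eta>S: "!!j v. v \<in> L (Suc j) ==> \<eta> v \<in> weight_span (%\<beta>. \<forall>l\<in>#\<beta>. 0 < l \<and> l < Suc j)"
  and x: "x \<in> weight_words \<alpha>"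
 shows "\<exists>y\<in>weight_span (%\<beta>. \<beta> < \<alpha> \<and> (0 \<in># \<alpha> --> 0 \<in># \<beta>)). der (%v. \<theta>0 v \<oplus>\<^sub>M \<eta> v) x = der \<theta>0 x \<oplus>\<^sub>M y"
 using x
proof (cases rule: weight_wordsE)
 case (1 p n vs e ds js)
 let ?Z = "%\<beta>. \<beta> < \<alpha> \<and> (0 \<in># \<alpha> --> 0 \<in># \<beta>)"
 have n: "length vs = n" "length ds = n" using 1(3) by (simp_all add: homs_iff)
 note pc = opg_closed[OF 1(2)] and vc = homs_closed[OF 1(3)]
 have gc: "set (map gen vs) \<subseteq> carrier Q" using gens_closed[OF 1(3)] by simp
 have vi: "vs ! i \<in> grade X (ds ! i)" "vs ! i \<in> carrier X" if "i < n" for i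
  using 1(3) that X.grade_closed by (auto simp: homs_iff)
 have lin: "linear_map R M M (%a. pact p ((map gen vs)[i := a]))" if "i < n" for i
  using Q.act_linear_arg[OF pc, of "map gen vs" i] gc n that by simp
 have low: "pact p ((map gen vs)[i := \<eta> (vs ! i)]) \<in> weight_span ?Z" if i: "i < n" for i
 proof (cases "js ! i")
  case 0
  then have z: "\<eta> (vs ! i) = \<zero>\<^sub>M" using \<eta>0 1(5)[OF i] by simp
  show ?thesis
   unfolding z using lin_zero[OF modM modM lin[OF i]] weight_spanD(2) by simp
 next
  case (Suc j)
  then have "\<eta> (vs ! i) \<in> weight_span (%\<beta>. \<forall>l\<in>#\<beta>. 0 < l \<and> l < Suc j)" using \<eta>S 1(5)[OF i] by simp
  then show ?thesis
  proof (rule linear_weight_span[OF lin[OF i], rotated])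
   fix \<beta> y assume \<beta>: "\<forall>l\<in>#\<beta>. 0 < l \<and> l < Suc j" and y: "y \<in> weight_words \<beta>"
   from y show "pact p ((map gen vs)[i := y]) \<in> weight_span ?Z"
   proof (cases rule: weight_wordsE)
    case y: (1 q k us e' es ks)
    let ?ws = "(map (%v. (op_unit P, [v])) vs)[i := (q, us)]"
    have k: "length us = k" using y(3) by (simp add: homs_iff)
    have wd: "word_degs ?ws ((replicate n 0)[i := e']) ((map (%d. [d]) ds)[i := es])"
    proof (rule word_degs_update)
     show "word_degs (map (%v. (op_unit P, [v])) vs) (replicate n 0) (map (%d. [d]) ds)"
      using vi n unit_grade by (simp add: word_degs_def)
    qed (use y k in auto)
    have p': "p \<in> grade (op_space P (length ?ws)) e" using 1(2) n by simp
    have wsw: "set ?ws \<subseteq> words P X"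
    proof
     fix w assume "w \<in> set ?ws"
     then obtain l where l: "l < n" "w = ?ws ! l" using n by (auto simp: in_set_conv_nth)
     then have "fst w \<in> opg P (length (snd w)) ((replicate n 0)[i := e'] ! l)"
      "homs (length (snd w)) X (snd w) ((map (%d. [d]) ds)[i := es] ! l)"
      using wd n unfolding word_degs_def by auto
     from wordI[OF this] show "w \<in> words P X" by simp
    qed
    have "map (%w. T (fst w) (snd w)) ?ws = (map gen vs)[i := y]"
     by (rule nth_equalityI) (use n i y(1) gen_homogeneous(1)[OF vi(1)] in \<open>auto simp: nth_list_update\<close>)
    then have "pact p ((map gen vs)[i := y]) = word_act p ?ws" using free_act_words[OF p' wsw] by simp
    also have "... = ksign M (shuffle_exp ((replicate n 0)[i := e']) (map sum_list ((map (%d. [d]) ds)[i := es])))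
      (T (op_comp P (map (length \<circ> snd) ?ws) p (map fst ?ws)) (concat (map snd ?ws)))"
     by (rule word_act_eq[OF wd p'])
    also have "... \<in> weight_span ?Z"
    proof (rule weight_spanD(8), rule weight_span_incl)
     let ?jss = "(map (%l. [l]) js)[i := ks]"
     note c = word_degs_comp[OF wd p'] word_degs_concat[OF wd]
     have vss: "map snd ?ws = (map (%v. [v]) vs)[i := us]" by (simp add: map_update comp_def)
     have la: "list_all2 (%v l. v \<in> L l) (concat (map snd ?ws)) (concat ?jss)"
     proof (rule list_all2_concat)
      show "list_all2 (list_all2 (%v l. v \<in> L l)) (map snd ?ws) ?jss"
       unfolding vss list_all2_conv_all_nth[of "list_all2 _"]
      proof (intro conjI allI impI)
       fix l assume "l < length ((map (%v. [v]) vs)[i := us])"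
       then show "list_all2 (%v l. v \<in> L l) ((map (%v. [v]) vs)[i := us] ! l) (?jss ! l)"
        using n 1(4,5) y(4,5) k by (cases "l = i") (auto simp: list_all2_conv_all_nth)
      qed (use n 1(4) in simp)
     qed
     show "T (op_comp P (map (length \<circ> snd) ?ws) p (map fst ?ws)) (concat (map snd ?ws)) \<in> weight_words (mset (concat ?jss))"
      by (rule weight_wordsI[OF c]) (use la c(2) in \<open>auto simp: list_all2_conv_all_nth homs_iff\<close>)
     have cs: "concat ?jss = take i js @ ks @ drop (Suc i) js"
      using i 1(4) by (simp add: concat_update_split take_map drop_map)
     have js: "js = take i js @ js ! i # drop (Suc i) js" using i 1(4) by (simp add: id_take_nth_drop)
     let ?I = "mset (take i js) + mset (drop (Suc i) js)"
     have m: "mset (concat ?jss) = ?I + \<beta>" unfolding cs using y(6) by simp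
     have a: "\<alpha> = ?I + {#Suc j#}" using arg_cong[OF js, of mset] 1(6) Suc by simp
     have "\<forall>l\<in>#\<beta>. \<exists>l'\<in>#{#Suc j#}. l < l'" using \<beta> by simp
     then have "multp (<) (?I + \<beta>) (?I + {#Suc j#})" by (intro one_step_implies_multp) auto
     then have "mset (concat ?jss) < \<alpha>" unfolding m a less_multiset_def .
     moreover have "0 \<in># mset (concat ?jss)" if "0 \<in># \<alpha>" using that unfolding m a by auto
     ultimately show "?Z (mset (concat ?jss))" by blast
    qed
    finally show ?thesis .
   qed
  qed
 qed
 let ?\<theta> = "%v. \<theta>0 v \<oplus>\<^sub>M \<eta> v"
 have sub: "submodule (G k) R M" for k unfolding G_generated by (rule M.generated_sub[OF word_grade_closed])
 have \<theta>: "linear_map R X M ?\<theta>" by (rule lin_sum[OF modM \<theta>0(1) \<eta>(1)])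
 have deg: "\<forall>i. \<forall>v\<in>grade X i. ?\<theta> v \<in> G (i + 1)"
  using \<theta>0(2) \<eta>(2) submodule_add[OF modM sub] by blast
 let ?y = "\<Oplus>\<^sub>M i\<in>{..<n}. ksign M (e + sum_list (take i ds)) (pact p ((map gen vs)[i := \<eta> (vs ! i)]))"
 have cl: "(%i. ksign M (e + sum_list (take i ds)) (pact p ((map gen vs)[i := \<xi> (vs ! i)]))) \<in> {..<n} \<rightarrow> carrier M"
  if "linear_map R X M \<xi>" for \<xi>
  using Q.leib_closed(1)[of p vs gen \<xi> e ds] pc n vc gen_closed lin_closed[OF that] by (simp add: subset_iff)
 have dc: "pact (diff (op_space P n) p) (map gen vs) \<in> carrier M"
  using Q.act_closed[OF opg_closed[OF op_diff_grade[OF 1(2)]], of "map gen vs"] gc n by simp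
 have "(\<Oplus>\<^sub>M i\<in>{..<n}. ksign M (e + sum_list (take i ds)) (pact p ((map gen vs)[i := ?\<theta> (vs ! i)]))) =
   (\<Oplus>\<^sub>M i\<in>{..<n}. ksign M (e + sum_list (take i ds)) (pact p ((map gen vs)[i := \<theta>0 (vs ! i)])) \<oplus>\<^sub>M
    ksign M (e + sum_list (take i ds)) (pact p ((map gen vs)[i := \<eta> (vs ! i)])))"
 proof (rule M.finsum_cong'[OF refl])
  show "(%i. ksign M (e + sum_list (take i ds)) (pact p ((map gen vs)[i := \<theta>0 (vs ! i)])) \<oplus>\<^sub>M
    ksign M (e + sum_list (take i ds)) (pact p ((map gen vs)[i := \<eta> (vs ! i)]))) \<in> {..<n} \<rightarrow> carrier M"
   using cl[OF \<theta>0(1)] cl[OF \<eta>(1)] by (auto simp: Pi_iff)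
  fix i assume "i \<in> {..<n}"
  then have i: "i < n" by simp
  note c = lin_closed[OF \<theta>0(1) vi(2)[OF i]] lin_closed[OF \<eta>(1) vi(2)[OF i]]
  show "ksign M (e + sum_list (take i ds)) (pact p ((map gen vs)[i := ?\<theta> (vs ! i)])) =
    ksign M (e + sum_list (take i ds)) (pact p ((map gen vs)[i := \<theta>0 (vs ! i)])) \<oplus>\<^sub>M
    ksign M (e + sum_list (take i ds)) (pact p ((map gen vs)[i := \<eta> (vs ! i)]))"
   unfolding lin_add[OF lin[OF i] c]
   by (rule M.ksign_add[OF lin_closed[OF lin[OF i] c(1)] lin_closed[OF lin[OF i] c(2)]])
 qed
 also have "... = (\<Oplus>\<^sub>M i\<in>{..<n}. ksign M (e + sum_list (take i ds)) (pact p ((map gen vs)[i := \<theta>0 (vs ! i)]))) \<oplus>\<^sub>M ?y"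
  by (rule M.finsum_addf[OF cl[OF \<theta>0(1)] cl[OF \<eta>(1)]])
 finally have "der ?\<theta> x = der \<theta>0 x \<oplus>\<^sub>M ?y"
  unfolding 1(1) der_word[OF \<theta> deg 1(2,3)] der_word[OF \<theta>0 1(2,3)]
  using n M.a_assoc[OF dc M.finsum_closed[OF cl[OF \<theta>0(1)]] M.finsum_closed[OF cl[OF \<eta>(1)]]] by (simp add: leib_def)
 moreover have "?y \<in> weight_span ?Z" by (intro weight_spanD(7,8) low) simp
 ultimately show ?thesis by blast
qed

text \<open>Finitely many weights are involved, and the largest of them is a bound.\<close>

lemma weight_span_bounded:
 assumes "x \<in> weight_span Z"
 shows "x = \<zero>\<^sub>M \<or> (\<exists>\<alpha>. Z \<alpha> \<and> x \<in> weight_span (%\<gamma>. \<gamma> \<le> \<alpha> \<and> Z \<gamma>))"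
 using assms
proof (induction rule: weight_span_induct)
 case (words \<beta> x)
 then show ?case using weight_span_incl[OF words(2), of "%\<gamma>. \<gamma> \<le> \<beta> \<and> Z \<gamma>"] by blast
next
 case (add y z)
 show ?case
 proof (cases "y = \<zero>\<^sub>M \<or> z = \<zero>\<^sub>M")
  case True
  then show ?thesis using add by auto
 next
  case False
  then obtain \<beta> \<gamma> where *: "Z \<beta>" "y \<in> weight_span (%\<delta>. \<delta> \<le> \<beta> \<and> Z \<delta>)" "Z \<gamma>" "z \<in> weight_span (%\<delta>. \<delta> \<le> \<gamma> \<and> Z \<delta>)"
   using add.IH by blast
  have "y \<oplus>\<^sub>M z \<in> weight_span (%\<delta>. \<delta> \<le> max \<beta> \<gamma> \<and> Z \<delta>)"
   by (rule weight_spanD(3)[OF weight_span_mono[OF *(2)] weight_span_mono[OF *(4)]]) (auto simp: le_max_iff_disj)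
  moreover have "Z (max \<beta> \<gamma>)" using *(1,3) by (simp add: max_def)
  ultimately show ?thesis by blast
 qed
next
 case (smult r z)
 show ?case
 proof (cases "z = \<zero>\<^sub>M")
  case True
  then show ?thesis using smult(1) by simp
 next
  case False
  then obtain \<beta> where \<beta>: "Z \<beta>" "z \<in> weight_span (%\<delta>. \<delta> \<le> \<beta> \<and> Z \<delta>)" using smult.IH by blast
  show ?thesis using \<beta>(1) weight_spanD(4)[OF smult(1) \<beta>(2)] by blast
 qed
qed simp

text \<open>
 If the part of weight \<open>\<alpha>\<close> is acyclic for a differential \<open>D\<close> that preserves the weights, for all
 weights \<open>\<alpha>\<close> that contain \<open>0\<close>, then their sum is acyclic for every differential that differs from
 \<open>D\<close> by terms of lower weight: the leading part of a cocycle is a coboundary for \<open>D\<close>, and subtracting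
 the corresponding coboundary lowers the weight. The weights are well-ordered.
\<close>

lemma perturbed_acyclic:
 assumes D: "linear_map R M M D" and D': "linear_map R M M D'"
  and D'D': "!!x. x \<in> carrier M ==> D' (D' x) = \<zero>\<^sub>M"
  and pres: "!!\<alpha> x. x \<in> weight_words \<alpha> ==> D x \<in> weight_span (%\<beta>. \<beta> = \<alpha>)"
  and low: "!!\<alpha> x. x \<in> weight_words \<alpha> ==> \<exists>y\<in>weight_span (%\<beta>. \<beta> < \<alpha> \<and> (0 \<in># \<alpha> --> 0 \<in># \<beta>)). D' x = D x \<oplus>\<^sub>M y"
  and acyc: "!!\<alpha> x. [|0 \<in># \<alpha>; x \<in> weight_span (%\<beta>. \<beta> = \<alpha>); D x = \<zero>\<^sub>M |] ==> \<exists>y\<in>carrier M. D y = x"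
  and x: "x \<in> weight_span (%\<beta>. 0 \<in># \<beta>)" "D' x = \<zero>\<^sub>M"
 shows "\<exists>y\<in>carrier M. D' y = x"
proof -
 let ?lt = "%\<alpha>. weight_span (%\<beta>. \<beta> < \<alpha> \<and> 0 \<in># \<beta>)"
 let ?eq = "%\<alpha>. weight_span (%\<beta>. \<beta> = \<alpha> \<and> 0 \<in># \<beta>)"
 let ?low = "%\<alpha>. weight_span (%\<beta>. \<beta> < \<alpha> \<and> (0 \<in># \<alpha> --> 0 \<in># \<beta>))"
 let ?at = "%\<alpha>. weight_span (%\<beta>. \<beta> = \<alpha>)"
 note LD = linear_mapD[OF D] lin_zero[OF modM modM D]
  and LD' = linear_mapD[OF D'] lin_zero[OF modM modM D']
 have diff_low: "D' x \<ominus>\<^sub>M D x \<in> ?low \<alpha>" if "x \<in> ?at \<alpha>" for x \<alpha>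
 proof (rule linear_weight_span[OF linear_map_minus[OF modM D' D] _ that])
  fix \<beta> w assume "\<beta> = \<alpha>" and w: "w \<in> weight_words \<beta>"
  obtain y where y: "y \<in> weight_span (%\<gamma>. \<gamma> < \<alpha> \<and> (0 \<in># \<alpha> --> 0 \<in># \<gamma>))" "D' w = D w \<oplus>\<^sub>M y" using low[OF w] \<open>\<beta> = \<alpha>\<close> by blast
  have "w \<in> carrier M" using w weight_words_closed by blast
  then have "D' w \<ominus>\<^sub>M D w = y"
   using LD(1)[of w] weight_span_closed[OF y(1)] unfolding y(2) a_minus_def
   by (simp add: M.add.m_ac M.r_neg1 M.r_neg2 M.r_neg)
  then show "D' w \<ominus>\<^sub>M D w \<in> ?low \<alpha>" using y(1) by simp
 qed
 have D_span: "D x \<in> ?at \<alpha>" if "x \<in> ?at \<alpha>" for x \<alpha>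
  by (rule linear_weight_span[OF D _ that]) (use pres in blast)
 have D'_lt: "D' x \<in> weight_span (%\<beta>. \<beta> < \<alpha>)" if "x \<in> ?lt \<alpha>" for x \<alpha>
 proof (rule linear_weight_span[OF D' _ that])
  fix \<beta> w assume \<beta>: "\<beta> < \<alpha> \<and> 0 \<in># \<beta>" and w: "w \<in> weight_words \<beta>"
  obtain y where y: "y \<in> weight_span (%\<gamma>. \<gamma> < \<beta> \<and> (0 \<in># \<beta> --> 0 \<in># \<gamma>))" "D' w = D w \<oplus>\<^sub>M y" using low[OF w] by blast
  show "D' w \<in> weight_span (%\<beta>. \<beta> < \<alpha>)" unfolding y(2)
   by (rule weight_spanD(3)[OF weight_span_mono[OF pres[OF w]] weight_span_mono[OF y(1)]]) (use \<beta> in auto)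
 qed
 have commute: "weight_part \<alpha> (D y) = D (weight_part \<alpha> y)" if "y \<in> carrier M" for y \<alpha>
  using that unfolding weight_span_all[symmetric]
 proof (induction rule: weight_span_induct)
  case (words \<beta> w)
  then have "w \<in> carrier M" using weight_words_closed by blast
  then show ?case
   using weight_part_words[OF words(2), of \<alpha>] weight_part_span[OF pres[OF words(2)], of \<alpha>] weight_part_other[OF pres[OF words(2)], of \<alpha>] LD(4)
   by (cases "\<alpha> = \<beta>") auto
 qed (simp_all add: LD linear_mapD[OF weight_part_linear] lin_zero[OF modM modM weight_part_linear])
 have lt_le: "z = \<zero>\<^sub>M \<or> (\<exists>\<beta><\<alpha>. z \<in> weight_span (%\<gamma>. \<gamma> \<le> \<beta> \<and> 0 \<in># \<gamma>))" if "z \<in> ?lt \<alpha>" for z \<alpha>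
  using weight_span_bounded[OF that] weight_span_mono[where Z'="%\<gamma>. \<gamma> \<le> _ \<and> 0 \<in># \<gamma>"] by blast
 have split: "\<exists>a b. a \<in> ?eq \<alpha> \<and> b \<in> ?lt \<alpha> \<and> x = a \<oplus>\<^sub>M b"
  if "x \<in> weight_span (%\<beta>. \<beta> \<le> \<alpha> \<and> 0 \<in># \<beta>)" for x \<alpha>
  using that
 proof (induction rule: weight_span_induct)
  case (words \<beta> w)
  have wc: "w \<in> carrier M" using words weight_words_closed by blast
  show ?case
  proof (cases "\<beta> = \<alpha>")
   case True
   then have "w \<in> ?eq \<alpha>" using words(1) by (intro weight_span_incl[OF words(2)]) auto
   then show ?thesis using weight_spanD(2) wc
    by (intro exI[of _ w] exI[of _ "\<zero>\<^sub>M"]) simp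
  next
   case False
   then have "w \<in> ?lt \<alpha>" using words(1) by (intro weight_span_incl[OF words(2)]) auto
   then show ?thesis using weight_spanD(2) wc
    by (intro exI[of _ "\<zero>\<^sub>M"] exI[of _ w]) simp
  qed
 next
  case zero
  show ?case using weight_spanD(2) by (intro exI[of _ "\<zero>\<^sub>M"]) simp
 next
  case (add y z)
  then obtain a b a' b' where *: "a \<in> ?eq \<alpha>" "b \<in> ?lt \<alpha>" "y = a \<oplus>\<^sub>M b"
   "a' \<in> ?eq \<alpha>" "b' \<in> ?lt \<alpha>" "z = a' \<oplus>\<^sub>M b'" by blast
  have "y \<oplus>\<^sub>M z = (a \<oplus>\<^sub>M a') \<oplus>\<^sub>M (b \<oplus>\<^sub>M b')"
   unfolding *(3,6) using *(1,2,4,5)[THEN weight_span_closed] by (simp add: M.add.m_ac)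
  then show ?case using weight_spanD(3)[OF *(1,4)] weight_spanD(3)[OF *(2,5)] by blast
 next
  case (smult r z)
  then obtain a b where *: "a \<in> ?eq \<alpha>" "b \<in> ?lt \<alpha>" "z = a \<oplus>\<^sub>M b" by blast
  have "r \<odot>\<^sub>M z = r \<odot>\<^sub>M a \<oplus>\<^sub>M r \<odot>\<^sub>M b"
   unfolding *(3) using smult(1) *(1,2)[THEN weight_span_closed] by (simp add: M.smult_r_distr)
  then show ?case using weight_spanD(4)[OF smult(1) *(1)] weight_spanD(4)[OF smult(1) *(2)] by blast
 qed
 have main: "\<forall>x. x \<in> weight_span (%\<beta>. \<beta> \<le> \<alpha> \<and> 0 \<in># \<beta>) --> D' x = \<zero>\<^sub>M --> (\<exists>y\<in>carrier M. D' y = x)" for \<alpha>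
 proof (induction \<alpha> rule: less_induct)
  case (less \<alpha>)
  have lt: "\<exists>y\<in>carrier M. D' y = z" if z: "z \<in> ?lt \<alpha>" "D' z = \<zero>\<^sub>M" for z
   using lt_le[OF z(1)]
  proof
   assume "z = \<zero>\<^sub>M"
   then show ?thesis using LD'(4) by blast
  next
   assume "\<exists>\<beta><\<alpha>. z \<in> weight_span (%\<gamma>. \<gamma> \<le> \<beta> \<and> 0 \<in># \<gamma>)"
   then show ?thesis using less.IH z(2) by blast
  qed
  show ?case
  proof (intro allI impI)
   fix x assume x: "x \<in> weight_span (%\<beta>. \<beta> \<le> \<alpha> \<and> 0 \<in># \<beta>)" and D'x: "D' x = \<zero>\<^sub>M"
   obtain a b where ab: "a \<in> ?eq \<alpha>" "b \<in> ?lt \<alpha>" "x = a \<oplus>\<^sub>M b"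
    using split[OF x] by blast
   note c = ab(1,2)[THEN weight_span_closed]
   show "\<exists>y\<in>carrier M. D' y = x"
   proof (cases "0 \<in># \<alpha>")
    case False
    then have "a \<in> weight_span (%\<beta>. False)" using weight_span_mono[OF ab(1)] by blast
    then have "a = \<zero>\<^sub>M" by (induction rule: weight_span_induct) simp_all
    then show ?thesis using lt[of x] ab c D'x by simp
   next
    case True
    have a: "a \<in> ?at \<alpha>" by (rule weight_span_mono[OF ab(1)]) simp
    have "weight_part \<alpha> (D' b) = \<zero>\<^sub>M" by (rule weight_part_other[OF D'_lt[OF ab(2)]]) simp
    moreover have "weight_part \<alpha> (D' a) = D a"
    proof -
     have "weight_part \<alpha> (D' a \<ominus>\<^sub>M D a) = \<zero>\<^sub>M" by (rule weight_part_other[OF diff_low[OF a]]) simp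
     then have "weight_part \<alpha> (D' a) \<ominus>\<^sub>M weight_part \<alpha> (D a) = \<zero>\<^sub>M"
      using lin_diff[OF modM modM weight_part_linear] LD(1) LD'(1) c(1) by simp
     then have "weight_part \<alpha> (D' a) = weight_part \<alpha> (D a)"
      using M.minus_zero_iff[OF lin_closed[OF weight_part_linear LD'(1)[OF c(1)]]
        lin_closed[OF weight_part_linear LD(1)[OF c(1)]]] by blast
     then show ?thesis using weight_part_span[OF D_span[OF a]] by simp
    qed
    moreover have "weight_part \<alpha> (D' x) = weight_part \<alpha> (D' a) \<oplus>\<^sub>M weight_part \<alpha> (D' b)"
     unfolding ab(3) using LD'(1,2) c lin_add[OF weight_part_linear] by simp
    ultimately have "D a = \<zero>\<^sub>M"
     using D'x lin_zero[OF modM modM weight_part_linear] LD(1)[OF c(1)] by simp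
    then obtain y where y: "y \<in> carrier M" "D y = a" using acyc[OF True a] by blast
    define y' where "y' = weight_part \<alpha> y"
    have y': "y' \<in> ?at \<alpha>" "D y' = a"
     using weight_part_mem[OF y(1)] commute[OF y(1), of \<alpha>] y(2) weight_part_span[OF a] by (auto simp: y'_def)
    note y'c = weight_span_closed[OF y'(1)]
    let ?l = "D' y' \<ominus>\<^sub>M a"
    have l: "?l \<in> ?lt \<alpha>"
     using weight_span_mono[OF diff_low[OF y'(1)], of "%\<beta>. \<beta> < \<alpha> \<and> 0 \<in># \<beta>"] True unfolding y'(2) by blast
    have eq: "x \<ominus>\<^sub>M D' y' = b \<ominus>\<^sub>M ?l"
     unfolding ab(3) a_minus_def using c LD'(1)[OF y'c]
     by (simp add: M.minus_add M.add.m_ac)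
    have "D' (x \<ominus>\<^sub>M D' y') = \<zero>\<^sub>M"
     using lin_diff[OF modM modM D', of x "D' y'"] D'x D'D'[OF y'c] LD'(1)[OF y'c] ab(3) c
     by (simp add: a_minus_def)
    moreover have "x \<ominus>\<^sub>M D' y' \<in> ?lt \<alpha>"
     unfolding eq by (rule weight_spanD(6)[OF ab(2) l])
    ultimately obtain z where z: "z \<in> carrier M" "D' z = x \<ominus>\<^sub>M D' y'" using lt by blast
    have "D' (y' \<oplus>\<^sub>M z) = D' y' \<oplus>\<^sub>M (x \<ominus>\<^sub>M D' y')" using LD'(2)[OF y'c z(1)] z(2) by simp
    also have "... = x" using LD'(1)[OF y'c] ab(3) c by (simp add: a_minus_def M.add.m_ac M.r_neg1 M.r_neg2 M.r_neg)
    finally show ?thesis using y'c z(1) by blast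
   qed
  qed
 qed
 have "x = \<zero>\<^sub>M \<or> (\<exists>\<beta>. x \<in> weight_span (%\<gamma>. \<gamma> \<le> \<beta> \<and> 0 \<in># \<gamma>))"
  using weight_span_bounded[OF x(1)] by blast
 then show ?thesis using main x(2) LD'(4) by blast
qed

end

section \<open>Cohomology, subalgebras and selections\<close>

lemma image_submodule:
 assumes "module R M" "module R N" "linear_map R M N f"
 shows "submodule (f ` carrier M) R N"
proof -
 interpret M: module R M by fact
 interpret N: module R N by fact
 note D = linear_mapD[OF assms(3)] lin_zero[OF assms] lin_neg[OF assms]
 show ?thesis
 proof (rule N.submoduleI)
  show "f ` carrier M \<subseteq> carrier N" using D(1) by blast
  show "\<zero>\<^sub>N \<in> f ` carrier M" unfolding D(4)[symmetric] by (rule imageI[OF M.zero_closed])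
  show "\<ominus>\<^sub>N a \<in> f ` carrier M" if "a \<in> f ` carrier M" for a
   using that
  proof
   fix x assume x: "a = f x" "x \<in> carrier M"
   show ?thesis unfolding x(1) D(5)[OF x(2), symmetric] by (rule imageI[OF M.a_inv_closed[OF x(2)]])
  qed
  show "a \<oplus>\<^sub>N b \<in> f ` carrier M" if ab: "a \<in> f ` carrier M" "b \<in> f ` carrier M" for a b
  proof -
   obtain x y where x: "a = f x" "x \<in> carrier M" "b = f y" "y \<in> carrier M" using ab by blast
   show ?thesis unfolding x(1,3) D(2)[OF x(2,4), symmetric] by (rule imageI[OF M.a_closed[OF x(2,4)]])
  qed
  show "r \<odot>\<^sub>N a \<in> f ` carrier M" if r: "r \<in> carrier R" and a: "a \<in> f ` carrier M" for r a
   using a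
  proof
   fix x assume x: "a = f x" "x \<in> carrier M"
   show ?thesis unfolding x(1) D(3)[OF r x(2), symmetric] by (rule imageI[OF M.smult_closed[OF r x(2)]])
  qed
 qed
qed

lemma boundaries_submodule:
 "[|module R X; linear_map R X X (diff X)|] ==> submodule (diff X ` carrier X) R X"
 by (rule image_submodule)

lemma coh_class_eq_iff:
 assumes "module R X" "linear_map R X X (diff X)" "x \<in> carrier X" "y \<in> carrier X"
 shows "coh_class X x = coh_class X y \<longleftrightarrow> x \<ominus>\<^sub>X y \<in> diff X ` carrier X"
 unfolding coh_class_def by (rule coset_eq_iff[OF assms(1) boundaries_submodule[OF assms(1,2)] assms(3,4)])

lemma coh_map_class:
 assumes X: "module R X" "linear_map R X X (diff X)" and Y: "module R Y" "linear_map R Y Y (diff Y)"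
  and f: "linear_map R X Y f" "!!x. x \<in> carrier X ==> f (diff X x) = diff Y (f x)" and z: "z \<in> carrier X"
 shows "coh_map Y f (coh_class X z) = coh_class Y (f z)"
proof -
 interpret X: module R X by fact
 note B = boundaries_submodule[OF X]
 note mem = coset_mem_iff[OF X(1) B z, folded coh_class_def]
 have self: "z \<in> coh_class X z" using mem z submodule_zero[OF X(1) B] by (simp add: a_minus_def X.r_neg)
 have const: "coh_class Y (f y) = coh_class Y (f z)" if y: "y \<in> coh_class X z" for y
 proof -
  obtain w where w: "w \<in> carrier X" "y \<ominus>\<^sub>X z = diff X w" and yc: "y \<in> carrier X" using mem y by auto
  have "f y \<ominus>\<^sub>Y f z = diff Y (f w)" using lin_diff[OF X(1) Y(1) f(1) yc z] w f(2) by simp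
  then show ?thesis
   using coh_class_eq_iff[OF Y lin_closed[OF f(1) yc] lin_closed[OF f(1) z]] lin_closed[OF f(1) w(1)] by blast
 qed
 have "(\<Union>y\<in>coh_class X z. coh_class Y (f y)) = coh_class Y (f z)"
  using self const by (intro UN_constant_eq ballI)
 then show ?thesis by (simp add: coh_map_def)
qed

text \<open>Quasi-isomorphisms are used through cocycles rather than classes.\<close>

lemma quasi_isoD:
 assumes q: "quasi_iso R X Y f"
 shows quasi_iso_inj: "[|z \<in> carrier X; diff X z = \<zero>\<^sub>X; f z \<in> diff Y ` carrier Y|] ==> z \<in> diff X ` carrier X"
  and quasi_iso_surj: "[|y \<in> carrier Y; diff Y y = \<zero>\<^sub>Y |] ==>
   \<exists>z\<in>carrier X. \<exists>b\<in>carrier Y. diff X z = \<zero>\<^sub>X \<and> y = f z \<oplus>\<^sub>Y diff Y b"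
proof -
 have c: "chain_map R X Y f" and bij: "bij_betw (coh_map Y f) (cohomology X) (cohomology Y)" using q by (auto simp: quasi_iso_def)
 note C = chain_mapD[OF c]
 note X = complex_module[OF C(2)] complex_diff_linear[OF C(2)] and Y = complex_module[OF C(3)] complex_diff_linear[OF C(3)]
 interpret X: module R X by (rule X(1))
 interpret Y: module R Y by (rule Y(1))
 have cls: "coh_map Y f (coh_class X z) = coh_class Y (f z)" if "z \<in> carrier X" for z
  by (rule coh_map_class[OF X Y C(1) C(5) that])
 have f0: "f \<zero>\<^sub>X = \<zero>\<^sub>Y" by (rule lin_zero[OF X(1) Y(1) C(1)])
 show "z \<in> diff X ` carrier X" if z: "z \<in> carrier X" "diff X z = \<zero>\<^sub>X" "f z \<in> diff Y ` carrier Y"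
 proof -
  have "f z \<ominus>\<^sub>Y \<zero>\<^sub>Y = f z"
   using lin_closed[OF C(1) z(1)] by (simp add: a_minus_def)
  then have "coh_class Y (f z) = coh_class Y (f \<zero>\<^sub>X)"
   using coh_class_eq_iff[OF Y lin_closed[OF C(1) z(1)] Y.zero_closed] z(3) by (simp add: f0)
  then have "coh_map Y f (coh_class X z) = coh_map Y f (coh_class X \<zero>\<^sub>X)" using cls z(1) by simp
  moreover have "coh_class X z \<in> cohomology X" "coh_class X \<zero>\<^sub>X \<in> cohomology X"
   using z lin_zero[OF X(1,1,2)] by (auto simp: cohomology_def cocycles_def)
  ultimately have "coh_class X z = coh_class X \<zero>\<^sub>X" using bij by (auto simp: bij_betw_def inj_on_def)
  moreover have "\<ominus>\<^sub>X \<zero>\<^sub>X = \<zero>\<^sub>X"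
   using X.M.l_zero[OF X.M.a_inv_closed[OF X.M.zero_closed]] X.M.r_neg[OF X.M.zero_closed] by (rule trans[OF sym])
  then have "z \<ominus>\<^sub>X \<zero>\<^sub>X = z" unfolding a_minus_def using X.M.r_zero[OF z(1)] by (simp only:)
  ultimately show ?thesis using coh_class_eq_iff[OF X z(1) X.zero_closed] by simp
 qed
 show "\<exists>z\<in>carrier X. \<exists>b\<in>carrier Y. diff X z = \<zero>\<^sub>X \<and> y = f z \<oplus>\<^sub>Y diff Y b"
  if y: "y \<in> carrier Y" "diff Y y = \<zero>\<^sub>Y"
 proof -
  have "coh_class Y y \<in> coh_map Y f ` cohomology X"
   using bij y by (auto simp: bij_betw_def cohomology_def cocycles_def)
  then obtain z where z: "z \<in> carrier X" "diff X z = \<zero>\<^sub>X" "coh_class Y y = coh_map Y f (coh_class X z)"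
   by (auto simp: cohomology_def cocycles_def)
  then have "y \<ominus>\<^sub>Y f z \<in> diff Y ` carrier Y"
   using cls coh_class_eq_iff[OF Y y(1) lin_closed[OF C(1) z(1)]] by simp
  then obtain b where b: "b \<in> carrier Y" "y \<ominus>\<^sub>Y f z = diff Y b" by auto
  have "y = f z \<oplus>\<^sub>Y diff Y b"
   unfolding b(2)[symmetric] using y(1) lin_closed[OF C(1) z(1)] by (simp add: a_minus_def Y.add.m_ac Y.r_neg1 Y.r_neg2 Y.r_neg)
  then show ?thesis using z b by blast
 qed
qed

lemma finsum_restrict:
 assumes "module R M" "submodule H R M" "f \<in> A \<rightarrow> H"
 shows "finsum (M\<lparr>carrier := H\<rparr>) f A = finsum M f A"
proof -
 interpret M: module R M by fact
 interpret H: module R "M\<lparr>carrier := H\<rparr>" by (rule submodule_restrict_module[OF assms(1,2)])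
 note sub = submodule_subset[OF assms(1,2)]
 show ?thesis using assms(3)
 proof (induction A rule: infinite_finite_induct)
  case (insert x A)
  have "finsum (M\<lparr>carrier := H\<rparr>) f (insert x A) = f x \<oplus>\<^sub>M finsum (M\<lparr>carrier := H\<rparr>) f A"
   using H.finsum_insert[OF insert.hyps, of f] insert.prems by (simp add: Pi_iff)
  also have "... = f x \<oplus>\<^sub>M finsum M f A" using insert by (simp add: Pi_iff)
  also have "... = finsum M f (insert x A)"
   by (rule M.finsum_insert[OF insert.hyps, symmetric]) (use insert.prems sub in auto)
  finally show ?case .
 qed (use H.finsum_infinite H.finsum_empty in simp_all)
qed

lemma restrict_graded:
 assumes V: "graded_space R V" and W: "submodule W R V" "graded_subset V W"
 shows "graded_space R (restrict_to V W)"
proof -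
 interpret V: graded_space R V by fact
 let ?W = "V\<lparr>carrier := W\<rparr>" and ?g = "%i. grade V i \<inter> W"
 note D = submoduleD[OF V.module_axioms W(1)]
 have mW: "module R ?W" by (rule submodule_restrict_module[OF V.module_axioms W(1)])
 have same: "same_structure (restrict_to V W) ?W" by (simp add: same_structure_def restrict_to_def)
 interpret W: module R "restrict_to V W" by (rule same_structure_module[OF mW same])
 have simps: "carrier (restrict_to V W) = W" "zero (restrict_to V W) = zero V" "add (restrict_to V W) = add V"
  "smult (restrict_to V W) = smult V" "grade (restrict_to V W) = ?g" by (simp_all add: restrict_to_def)
 have fs: "finsum (restrict_to V W) c F = finsum V c F" if "c \<in> F \<rightarrow> W" for c :: "int => _" and F
  unfolding same_finsum[OF same] by (rule finsum_restrict[OF V.module_axioms W(1) that])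
 have neg: "a_inv (restrict_to V W) x = a_inv V x" if "x \<in> W" for x
 proof -
  have "\<ominus>\<^bsub>restrict_to V W\<^esub> x \<oplus>\<^sub>V x = \<zero>\<^sub>V" "\<ominus>\<^bsub>restrict_to V W\<^esub> x \<in> W"
   using W.l_neg[of x] W.a_inv_closed[of x] that unfolding simps by simp_all
  then show ?thesis
   by (intro V.M.minus_equality[symmetric] subsetD[OF D(1)] that)
 qed
 have sub: "submodule (?g i) R (restrict_to V W)" for i
 proof (rule W.submoduleI)
  note g = submoduleD[OF V.module_axioms V.summand_submodule]
  show "\<ominus>\<^bsub>restrict_to V W\<^esub> a \<in> ?g i" if "a \<in> ?g i" for a
   using that neg g(5)[of a i] D(5)[of a] by simp
  show "a \<oplus>\<^bsub>restrict_to V W\<^esub> b \<in> ?g i" if "a \<in> ?g i" "b \<in> ?g i" for a b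
   using that g(3)[of a i b] D(3)[of a b] by (simp add: simps)
  show "r \<odot>\<^bsub>restrict_to V W\<^esub> a \<in> ?g i" if "r \<in> carrier R" "a \<in> ?g i" for r a
   using that g(4)[of r a i] D(4)[of r a] by (simp add: simps)
  show "\<zero>\<^bsub>restrict_to V W\<^esub> \<in> ?g i" using g(2)[of i] D(2) by (simp add: simps)
 qed (simp add: simps)
 have "\<exists>!c. decomposes (restrict_to V W) ?g x c" if x: "x \<in> W" for x
 proof (rule ex1I)
  have xV: "x \<in> carrier V" using x D(1) by blast
  have c: "component V (grade V) i x \<in> ?g i" for i
   using V.component_in[OF xV] W(2) x by (auto simp: graded_subset_def hpart_component)
  then show "decomposes (restrict_to V W) ?g x (%i. component V (grade V) i x)"
   using V.component_decomposes[OF xV] fs by (simp add: decomposes_def simps)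
  fix c assume c: "decomposes (restrict_to V W) ?g x c"
  then have "decomposes V (grade V) x c" using fs[of c] by (auto simp: decomposes_def simps)
  then show "c = (%i. component V (grade V) i x)" using V.component_eqI by fastforce
 qed
 then have "internal_direct_sum R (restrict_to V W) (grade (restrict_to V W))"
  using sub by (simp add: internal_direct_sum_def simps)
 then show ?thesis using W.module_axioms V.field_axioms by (simp add: graded_space_def graded_space_axioms_def)
qed

text \<open>The selections in the single degrees are assembled.\<close>

lemma graded_linear_selection:
 assumes "graded_space R V" "module R N"
  and \<Gamma>: "!!i x y. \<Gamma> i x y ==> x \<in> grade V i \<and> y \<in> carrier N"
  and \<Gamma>add: "!!i x y x' y'. [|\<Gamma> i x y; \<Gamma> i x' y'|] ==> \<Gamma> i (x \<oplus>\<^sub>V x') (y \<oplus>\<^sub>N y')"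
  and \<Gamma>smult: "!!i r x y. [|r \<in> carrier R; \<Gamma> i x y|] ==> \<Gamma> i (r \<odot>\<^sub>V x) (r \<odot>\<^sub>N y)"
  and total: "!!i x. x \<in> grade V i ==> \<exists>y. \<Gamma> i x y"
 shows "\<exists>f. linear_map R V N f \<and> (\<forall>i. \<forall>x\<in>grade V i. \<Gamma> i x (f x))"
proof -
 interpret V: graded_space R V by fact
 have "\<exists>f. linear_map R (V\<lparr>carrier := grade V i\<rparr>) N f \<and> (\<forall>x\<in>carrier (V\<lparr>carrier := grade V i\<rparr>). \<Gamma> i x (f x))" for i
 proof (rule linear_selection[OF V.field_axioms submodule_restrict_module[OF V.module_axioms V.summand_submodule] assms(2)])
  show "x \<in> carrier (V\<lparr>carrier := grade V i\<rparr>) \<and> y \<in> carrier N" if "\<Gamma> i x y" for x y using \<Gamma>[OF that] by simp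
  show "\<exists>y. \<Gamma> i x y" if "x \<in> carrier (V\<lparr>carrier := grade V i\<rparr>)" for x using total that by simp
 qed (use \<Gamma>add \<Gamma>smult in auto)
 then obtain s where s: "!!i. linear_map R (V\<lparr>carrier := grade V i\<rparr>) N (s i)" "!!i x. x \<in> grade V i ==> \<Gamma> i x (s i x)"
  by (simp, metis)
 from V.assemble_linear_map[OF assms(2) s(1)] show ?thesis using s(2) by metis
qed

lemma (in direct_sum) sum_space_eqI:
 assumes "module R N" "linear_map R M N f" "linear_map R M N g"
  and "!!i x. [|i \<in> K; x \<in> X i|] ==> f x = g x" "x \<in> sum_space M X K"
 shows "f x = g x"
proof -
 interpret N: module R N by fact
 have x: "x \<in> carrier M" "!!i. i \<notin> K ==> component M X i x = \<zero>\<^sub>M" using assms(5) by (auto simp: mem_sum_space_iff)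
 let ?F = "{i. component M X i x \<noteq> \<zero>\<^sub>M}"
 have c: "(%i. component M X i x) \<in> ?F \<rightarrow> carrier M" using x(1) by simp
 have "f (\<Oplus>\<^sub>M i\<in>?F. component M X i x) = (\<Oplus>\<^sub>N i\<in>?F. f (component M X i x))"
  by (rule lin_finsum[OF module_axioms assms(1,2) c])
 also have "... = (\<Oplus>\<^sub>N i\<in>?F. g (component M X i x))"
 proof (rule N.finsum_cong'[OF refl])
  show "(%i. g (component M X i x)) \<in> ?F \<rightarrow> carrier N" using lin_closed[OF assms(3)] x(1) by simp
  show "f (component M X i x) = g (component M X i x)" if "i \<in> ?F" for i
   using assms(4)[OF _ component_in[OF x(1)]] x(2) that by blast
 qed
 also have "... = g (\<Oplus>\<^sub>M i\<in>?F. component M X i x)"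
  by (rule lin_finsum[OF module_axioms assms(1,3) c, symmetric])
 finally show ?thesis using component_sum[OF x(1)] by simp
qed

context free_gens
begin

lemma extend_cong:
 assumes "respects_relations R P X Z \<psi>" "module R Z"
  and "!!p vs. (p, vs) \<in> words P X ==> \<phi> p vs = \<psi> p vs" "C \<in> carrier M"
 shows "extend R Z \<phi> C = extend R Z \<psi> C"
proof -
 interpret Z: module R Z by fact
 note r = formalD[OF representative_closed[OF assms(4)]]
 have c: "\<psi> (fst w) (snd w) \<in> carrier Z" if "w \<in> words P X" for w
  using that respects_closed[OF assms(1)] by (cases w) (auto elim!: wordE)
 show ?thesis unfolding extend_def
 proof (rule Z.finsum_cong'[OF refl])
  show "(%w. representative C w \<odot>\<^sub>Z \<psi> (fst w) (snd w)) \<in> support R (representative C) \<rightarrow> carrier Z"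
   by (intro Pi_I Z.smult_closed r(1) c subsetD[OF r(3)])
  show "representative C w \<odot>\<^sub>Z \<phi> (fst w) (snd w) = representative C w \<odot>\<^sub>Z \<psi> (fst w) (snd w)" if "w \<in> support R (representative C)" for w
   using assms(3)[of "fst w" "snd w"] subsetD[OF r(3) that] by simp
 qed
qed

end

context free_p_alg
begin

text \<open>
 The map induced by the inclusion of \<open>W\<close> sends words to words, and words span \<open>P(W)\<close>.
\<close>

lemma free_on_letter_span:
 assumes W: "submodule W R X" "graded_subset X W"
 shows "free_on R P X W = letter_span W"
proof -
 let ?W = "restrict_to X W"
 have g: "graded_space R ?W" by (rule restrict_graded[OF X.graded_space_axioms W])
 interpret W: free_gens R P ?W
  by (rule free_gens.intro[OF dg_operad_axioms g])
 have simps: "add ?W = add X" "smult ?W = smult X" "grade ?W i = grade X i \<inter> W" "carrier ?W = W" for i by (simp_all add: restrict_to_def)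
 have hom: "homs n ?W vs ds \<longleftrightarrow> homs n X vs ds \<and> set vs \<subseteq> W" for n vs ds
  unfolding homs_iff simps by (auto simp: in_set_conv_nth subset_iff)
 have words: "(p, vs) \<in> words P ?W \<longleftrightarrow> (p, vs) \<in> words P X \<and> set vs \<subseteq> W" for p vs
  using hom by (auto simp: words_def)
 have resp: "respects_relations R P ?W M (%p vs. T p (map (%v. v) vs))"
  unfolding respects_relations_def map_ident
 proof (intro allI impI)
  fix n p e vs ds assume p: "p \<in> opg P n e" and "homs n ?W vs ds"
  then have vs: "homs n X vs ds" using hom by blast
  note t = tensD[OF p vs]
  show "T p vs \<in> carrier M \<and>
   (\<forall>p'\<in>opg P n e. T (p \<oplus>\<^bsub>op_space P n\<^esub> p') vs = T p vs \<oplus>\<^sub>M T p' vs) \<and>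
   (\<forall>r\<in>carrier R. T (r \<odot>\<^bsub>op_space P n\<^esub> p) vs = r \<odot>\<^sub>M T p vs) \<and>
   (\<forall>i<n. \<forall>v\<in>grade ?W (ds ! i). T p (vs[i := vs ! i \<oplus>\<^sub>?W v]) = T p vs \<oplus>\<^sub>M T p (vs[i := v])) \<and>
   (\<forall>i<n. \<forall>r\<in>carrier R. T p (vs[i := r \<odot>\<^sub>?W vs ! i]) = r \<odot>\<^sub>M T p vs) \<and>
   (\<forall>\<sigma>. \<sigma> permutes {..<n} --> T (op_sym P n p \<sigma>) (permute_list \<sigma> vs) = ksign M (perm_exp \<sigma> ds) (T p vs))"
   unfolding simps using t by simp
 qed
 have fm: "free_map R P X (%v. v) = extend R M (%p vs. T p (map (%v. v) vs))" by (simp add: free_map_def)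
 note L = W.extend_linear[OF modM resp]
 have word: "free_map R P X (%v. v) (tens R P ?W p vs) = T p vs" if "(p, vs) \<in> words P ?W" for p vs
  unfolding fm using W.extend_tens[OF modM resp that] by simp
 have car: "carrier (free_algebra R P ?W) = carrier W.M" by (simp add: free_algebra_def)
 show ?thesis
 proof
  show "free_on R P X W \<subseteq> letter_span W"
  proof
   fix x assume "x \<in> free_on R P X W"
   then obtain y where y: "y \<in> carrier W.M" "x = free_map R P X (%v. v) y" by (auto simp: free_on_def car)
   show "x \<in> letter_span W" unfolding y(2) fm
   proof (rule lin_generated_into[OF W.M.module_axioms modM L letter_span_sub W.word_tens_closed])
    show "y \<in> generated_submodule R W.M W.word_tens" using y(1) W.free_generated by simp
    fix z assume "z \<in> W.word_tens"
    then obtain p vs where z: "z = tens R P ?W p vs" "(p, vs) \<in> words P ?W" by (auto simp: W.word_tens_def)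
    then show "extend R M (%p vs. T p (map (%v. v) vs)) z \<in> letter_span W"
     using word[OF z(2)] words unfolding fm letter_span_def
     by (intro subsetD[OF M.generated_incl]) auto
   qed
  qed
  have im: "submodule (free_on R P X W) R M"
   unfolding free_on_def car fm by (rule image_submodule[OF W.M.module_axioms modM L])
  show "letter_span W \<subseteq> free_on R P X W" unfolding letter_span_def
  proof (rule M.generated_subset[OF im])
   show "{T p vs | p vs. (p, vs) \<in> words P X \<and> set vs \<subseteq> W} \<subseteq> free_on R P X W"
   proof
    fix x assume "x \<in> {T p vs | p vs. (p, vs) \<in> words P X \<and> set vs \<subseteq> W}"
    then obtain p vs where x: "x = T p vs" "(p, vs) \<in> words P ?W" using words by blast
    then show "x \<in> free_on R P X W"
     using word[OF x(2)] W.tens_closed[OF x(2)] unfolding free_on_def car by (metis imageI)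
   qed
  qed
 qed
qed

lemma der_free_diff:
 assumes dX: "linear_map R X X (diff X)" "!!i v. v \<in> grade X i ==> diff X v \<in> grade X (i + 1)" and x: "x \<in> carrier M"
 shows "free_diff R P X x = der (%v. gen (diff X v)) x"
proof -
 let ?\<theta> = "%v. gen (diff X v)"
 have \<theta>: "linear_map R X M ?\<theta>" by (rule lin_comp[OF dX(1) gen_linear])
 have deg: "\<forall>i. \<forall>v\<in>grade X i. ?\<theta> v \<in> G (i + 1)" using dX(2) gen_grade by blast
 show ?thesis
  unfolding free_diff_def der_def
 proof (rule extend_cong[OF der_respects[OF \<theta> deg] modM _ x])
  fix p vs assume "(p, vs) \<in> words P X"
  then obtain e ds where p: "p \<in> opg P (length vs) e" and vs: "homs (length vs) X vs ds" by (rule wordE)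
  have "T (diff (op_space P (length vs)) p) vs = pact (diff (op_space P (length vs)) p) (map gen vs)"
   by (rule word_gen[OF op_diff_grade[OF p] vs])
  moreover have t: "T p (vs[i := diff (replicate (length vs) X ! i) (vs ! i)]) = pact p ((map gen vs)[i := ?\<theta> (vs ! i)])" if "i < length vs" for i
  proof -
   have "vs ! i \<in> grade X (ds ! i)" using vs that by (simp add: homs_iff)
   from word_gen[OF p homogeneous_update[OF vs dX(2)[OF this], of i]] show ?thesis using that by (simp add: map_update)
  qed
  moreover have "(%i. ksign M (deg (op_space P (length vs)) p + sum_list (take i (map (deg X) vs))) (pact p ((map gen vs)[i := ?\<theta> (vs ! i)]))) \<in> {..<length vs} \<rightarrow> carrier M"
   using Q.leib_closed(1)[of p vs gen ?\<theta>] opg_closed[OF p] gen_closed lin_closed[OF \<theta>] subsetD[OF homs_closed[OF vs]] by simp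
  ultimately show "leibniz (op_space P (length vs)) (replicate (length vs) X) M T (deg (op_space P (length vs)) p) (map (deg X) vs) p vs =
    leib P Q gen ?\<theta> (deg (op_space P (length vs)) p) (map (deg X) vs) p vs"
   unfolding leibniz_def leib_def length_replicate quasi_free_simps same_simps by (intro arg_cong2[where f="add M"] M.finsum_cong'[OF refl]) simp_all
 qed
qed

end

section \<open>Maps of the underlying graded algebras\<close>

text \<open>Nothing is required of the differentials.\<close>

definition alg_map ::
 "('k, 'c) ring_scheme => ('k, 'p) operad => ('k, 'p, 'a) dg_algebra => ('k, 'p, 'b) dg_algebra => ('a => 'b) => bool"
 where "alg_map R P A B f \<longleftrightarrow> linear_map R A B f \<and> (\<forall>i. \<forall>x\<in>grade A i. f x \<in> grade B i) \<and>
  (\<forall>n. \<forall>p\<in>opc P n. \<forall>as. length as = n \<and> set as \<subseteq> carrier A --> f (act A p as) = act B p (map f as))"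

lemma alg_mapD:
 assumes "alg_map R P A B f"
 shows alg_map_linear: "linear_map R A B f" and alg_map_grade: "x \<in> grade A i ==> f x \<in> grade B i"
  and alg_map_act: "[|p \<in> opc P n; length as = n; set as \<subseteq> carrier A|] ==> f (act A p as) = act B p (map f as)"
 using assms by (auto simp: alg_map_def)

lemma alg_map_comp:
 assumes f: "alg_map R P A B f" and g: "alg_map R P B C g"
 shows "alg_map R P A C (%x. g (f x))"
 unfolding alg_map_def
proof (intro conjI allI ballI impI)
 show "linear_map R A C (%x. g (f x))" by (rule lin_comp[OF alg_map_linear[OF f] alg_map_linear[OF g]])
 show "g (f x) \<in> grade C i" if "x \<in> grade A i" for x i by (rule alg_map_grade[OF g alg_map_grade[OF f that]])
 fix n p as assume p: "p \<in> opc P n" and as: "length as = n \<and> set as \<subseteq> carrier A"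
 have "set (map f as) \<subseteq> carrier B" using as lin_closed[OF alg_map_linear[OF f]] by auto
 then have "g (act B p (map f as)) = act C p (map g (map f as))"
  by (intro alg_map_act[OF g p]) (use as in simp_all)
 then show "g (f (act A p as)) = act C p (map (%x. g (f x)) as)"
  using alg_map_act[OF f p] as by (simp add: comp_def)
qed

lemma p_morphism_alg_map: "p_morphism R P A B f ==> alg_map R P A B f"
 by (auto simp: p_morphism_def alg_map_def chain_map_def elements_replicate)

context free_p_alg
begin

lemma alg_ext_alg_map:
 assumes "p_algebra R P E" "linear_map R X E \<phi>" "\<forall>i. \<forall>v\<in>grade X i. \<phi> v \<in> grade E i"
 shows "alg_map R P Q E (alg_ext E \<phi>)"
 unfolding alg_map_def quasi_free_simps same_simps
 using alg_ext_linear[OF assms] alg_ext_grade[OF assms] alg_ext_act[OF assms] by auto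

lemma alg_map_word:
 assumes f: "alg_map R P Q E f" and p: "p \<in> opg P n e" and vs: "homs n X vs ds"
 shows "f (T p vs) = act E p (map (%v. f (gen v)) vs)"
proof -
 have "f (act Q p (map gen vs)) = act E p (map f (map gen vs))"
  by (rule alg_map_act[OF f opg_closed[OF p]]) (use gens_closed[OF vs] vs in \<open>simp_all add: homs_iff\<close>)
 then show ?thesis unfolding word_gen[OF p vs] by (simp add: comp_def)
qed

lemma alg_map_eqI:
 assumes E: "p_algebra R P E" and f: "alg_map R P Q E f" and g: "alg_map R P Q E g"
  and gens: "!!i v. [|v \<in> grade X i; v \<in> W|] ==> f (gen v) = g (gen v)" and x: "x \<in> letter_span W"
 shows "f x = g x"
proof (rule letter_span_eqI[OF p_algebra.alg_module[OF E] _ _ _ x])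
 show "linear_map R (M\<lparr>carrier := letter_span W\<rparr>) E f" "linear_map R (M\<lparr>carrier := letter_span W\<rparr>) E g"
  using submodule_linear_map[OF letter_span_sub modM] alg_map_linear[OF f] alg_map_linear[OF g] by simp_all
 fix n p e vs ds assume p: "p \<in> opg P n e" and vs: "homs n X vs ds" and W: "set vs \<subseteq> W"
 have "f (gen v) = g (gen v)" if "v \<in> set vs" for v
 proof -
  have "\<exists>i<length vs. vs ! i = v" using that by (simp add: in_set_conv_nth)
  then obtain i where i: "i < length vs" "vs ! i = v" by blast
  have "vs ! i \<in> grade X (ds ! i)" using vs i(1) by (simp add: homs_iff)
  then show ?thesis unfolding i(2) using gens W that by blast
 qed
 then show "f (T p vs) = g (T p vs)"
  unfolding alg_map_word[OF f p vs] alg_map_word[OF g p vs] by (intro arg_cong[where f="act E p"] map_cong refl)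
qed

lemma alg_map_eq_carrierI:
 assumes E: "p_algebra R P E" and f: "alg_map R P Q E f" and g: "alg_map R P Q E g"
  and gens: "!!v. v \<in> carrier X ==> f (gen v) = g (gen v)" and x: "x \<in> carrier M"
 shows "f x = g x"
 by (rule alg_map_eqI[OF E f g _ x[folded letter_span_UNIV]]) (use gens X.grade_closed in blast)

text \<open>Such a map is the extension of its values on the generators.\<close>

lemma alg_map_commutes:
 assumes E: "p_algebra R P E" and f: "alg_map R P Q E f"
  and D: "p_derivation R P Q D" and D': "p_derivation R P E D'"
  and gens: "!!i v. [|v \<in> grade X i; v \<in> W|] ==> f (D (gen v)) = D' (f (gen v))" and x: "x \<in> letter_span W"
 shows "f (D x) = D' (f x)"
proof -
 have lin: "linear_map R X E (%v. f (gen v))"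
  using lin_comp[OF gen_linear, of E f] alg_map_linear[OF f] by simp
 have deg: "\<forall>i. \<forall>v\<in>grade X i. f (gen v) \<in> grade E i"
  using alg_map_grade[OF f] gen_grade by simp
 let ?g = "alg_ext E (%v. f (gen v))"
 have eq: "?g x = f x" if "x \<in> carrier M" for x
  by (rule alg_map_eq_carrierI[OF E alg_ext_alg_map[OF E lin deg] f alg_ext_gen[OF E lin deg] that])
 have cl: "D x \<in> carrier M" if "x \<in> carrier M" for x
  using lin_closed[OF derivation_linear[OF D]] that by simp
 have xc: "x \<in> carrier M" using x submodule_subset[OF modM letter_span_sub] by blast
 have "?g (D x) = D' (?g x)"
 proof (rule alg_map_derivation[OF E lin deg D D' _ x])
  show "?g (D (gen v)) = D' (f (gen v))" if "v \<in> grade X i" "v \<in> W" for i v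
   unfolding eq[OF cl[OF gen_closed[OF X.grade_closed[OF that(1)]]]] by (rule gens[OF that])
 qed
 then show ?thesis unfolding eq[OF cl[OF xc]] eq[OF xc] .
qed

end

section \<open>Adding a cone\<close>

text \<open>
 The direct sum of \<open>V\<close> with zero differential and of the cone of its identity. A triple
 \<open>[v, u, w]\<close> has its entry \<open>u\<close> shifted by one degree.
\<close>

definition add_cone :: "('k, 'v) dgvs => ('k, 'v list) dgvs"
 where "add_cone V =
  \<lparr>carrier = {[v, u, w] | v u w. v \<in> carrier V \<and> u \<in> carrier V \<and> w \<in> carrier V},
   monoid.mult = undefined, one = undefined, zero = [\<zero>\<^sub>V, \<zero>\<^sub>V, \<zero>\<^sub>V],
   add = (%x y. [x ! 0 \<oplus>\<^sub>V y ! 0, x ! 1 \<oplus>\<^sub>V y ! 1, x ! 2 \<oplus>\<^sub>V y ! 2]),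
   smult = (%r x. [r \<odot>\<^sub>V x ! 0, r \<odot>\<^sub>V x ! 1, r \<odot>\<^sub>V x ! 2]),
   grade = (%i. {[v, u, w] | v u w. v \<in> grade V i \<and> u \<in> grade V (i + 1) \<and> w \<in> grade V i}),
   diff = (%x. [\<zero>\<^sub>V, \<zero>\<^sub>V, x ! 1])\<rparr>"

lemma add_cone_simps:
 "[v, u, w] \<in> carrier (add_cone V) \<longleftrightarrow> v \<in> carrier V \<and> u \<in> carrier V \<and> w \<in> carrier V"
 "zero (add_cone V) = [\<zero>\<^sub>V, \<zero>\<^sub>V, \<zero>\<^sub>V]"
 "[v, u, w] \<oplus>\<^bsub>add_cone V\<^esub> [v', u', w'] = [v \<oplus>\<^sub>V v', u \<oplus>\<^sub>V u', w \<oplus>\<^sub>V w']"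
 "r \<odot>\<^bsub>add_cone V\<^esub> [v, u, w] = [r \<odot>\<^sub>V v, r \<odot>\<^sub>V u, r \<odot>\<^sub>V w]"
 "[v, u, w] \<in> grade (add_cone V) i \<longleftrightarrow> v \<in> grade V i \<and> u \<in> grade V (i + 1) \<and> w \<in> grade V i"
 "diff (add_cone V) [v, u, w] = [\<zero>\<^sub>V, \<zero>\<^sub>V, u]"
 "diff (add_cone V) x = [\<zero>\<^sub>V, \<zero>\<^sub>V, x ! 1]"
 by (simp_all add: add_cone_def)

lemma add_coneE:
 assumes "x \<in> carrier (add_cone V)"
 obtains v u w where "x = [v, u, w]" "v \<in> carrier V" "u \<in> carrier V" "w \<in> carrier V"
 using assms by (auto simp: add_cone_def)

lemma add_cone_gradeE:
 assumes "x \<in> grade (add_cone V) i"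
 obtains v u w where "x = [v, u, w]" "v \<in> grade V i" "u \<in> grade V (i + 1)" "w \<in> grade V i"
 using assms by (auto simp: add_cone_def)

lemma add_cone_module:
 assumes "module R V" shows "module R (add_cone V)"
proof -
 interpret V: module R V by fact
 show ?thesis
 proof (rule moduleI)
  show "abelian_group (add_cone V)"
  proof (rule abelian_groupI)
   fix x assume "x \<in> carrier (add_cone V)"
   then obtain v u w where x: "x = [v, u, w]" "v \<in> carrier V" "u \<in> carrier V" "w \<in> carrier V" by (rule add_coneE)
   then show "\<exists>y\<in>carrier (add_cone V). y \<oplus>\<^bsub>add_cone V\<^esub> x = \<zero>\<^bsub>add_cone V\<^esub>"
    by (intro bexI[of _ "[\<ominus>\<^sub>V v, \<ominus>\<^sub>V u, \<ominus>\<^sub>V w]"]) (simp_all add: add_cone_simps V.l_neg)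
  qed (auto elim!: add_coneE simp: add_cone_simps V.M.add.m_ac)
 qed (auto elim!: add_coneE simp: add_cone_simps V.is_cring V.smult_l_distr V.smult_r_distr V.smult_assoc1)
qed

lemma triple_linear:
 assumes "linear_map R N V f" "linear_map R N V g" "linear_map R N V h"
 shows "linear_map R N (add_cone V) (%x. [f x, g x, h x])"
 by (rule linear_mapI) (simp_all add: add_cone_simps linear_mapD[OF assms(1)] linear_mapD[OF assms(2)] linear_mapD[OF assms(3)])

lemma entry_linear: "i < 3 ==> linear_map R (add_cone V) V (%x. x ! i)"
 by (rule linear_mapI) (auto elim!: add_coneE simp: add_cone_simps less_Suc_eq numeral_3_eq_3 numeral_2_eq_2)

lemma add_cone_eqI:
 "[|x \<in> carrier (add_cone V); y \<in> carrier (add_cone V); x ! 0 = y ! 0; x ! 1 = y ! 1; x ! 2 = y ! 2|] ==> x = y"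
 by (auto elim!: add_coneE)

lemma add_cone_eta: "x \<in> carrier (add_cone V) ==> x = [x ! 0, x ! 1, x ! 2]"
 by (auto elim!: add_coneE)

lemma add_cone_graded:
 assumes "graded_space R V" shows "graded_space R (add_cone V)"
proof -
 interpret V: graded_space R V by fact
 let ?C = "add_cone V"
 interpret C: module R ?C by (rule add_cone_module[OF V.module_axioms])
 note g = submoduleD[OF V.module_axioms V.summand_submodule]
 have sub: "submodule (grade ?C i) R ?C" for i
 proof (rule C.submoduleI)
  fix a assume a: "a \<in> grade ?C i"
  then have ac: "a \<in> carrier ?C" by (auto elim!: add_cone_gradeE simp: add_cone_simps V.grade_closed)
  show "\<ominus>\<^sub>?C a \<in> grade ?C i"
   unfolding C.smult_minus_one[OF ac, symmetric] using a g(4) by (auto elim!: add_cone_gradeE simp: add_cone_simps)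
 qed (use g in \<open>auto elim!: add_cone_gradeE simp: add_cone_simps V.grade_closed\<close>)
 have gc: "a \<in> carrier ?C" if "a \<in> grade ?C i" for a i using submodule_subset[OF C.module_axioms sub] that by blast
 have "\<exists>!c. decomposes ?C (grade ?C) x c" if xc: "x \<in> carrier ?C" for x
 proof -
  obtain v u w where x: "x = [v, u, w]" "v \<in> carrier V" "u \<in> carrier V" "w \<in> carrier V" using xc by (rule add_coneE)
  let ?s = "%v. {i. component V (grade V) i v \<noteq> \<zero>\<^sub>V}"
  let ?c = "%i. [component V (grade V) i v, component V (grade V) (i + 1) u, component V (grade V) i w]"
  show ?thesis
  proof (rule ex1I)
   have "\<exists>F. finite F \<and> (\<forall>i. i \<notin> F --> component V (grade V) i v = \<zero>\<^sub>V \<and>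
     component V (grade V) (i + 1) u = \<zero>\<^sub>V \<and> component V (grade V) i w = \<zero>\<^sub>V)"
   proof (intro exI conjI allI impI)
    show "finite (?s v \<union> (%i. i - 1) ` ?s u \<union> ?s w)" using V.component_finite x by simp
    fix i assume i: "i \<notin> ?s v \<union> (%i. i - 1) ` ?s u \<union> ?s w"
    show "component V (grade V) (i + 1) u = \<zero>\<^sub>V"
    proof (rule ccontr)
     assume "component V (grade V) (i + 1) u \<noteq> \<zero>\<^sub>V"
     then have "i + 1 - 1 \<in> (%i. i - 1) ` ?s u" by (intro imageI) simp
     then show False using i by simp
    qed
   qed simp_all
   then obtain F where F: "finite F" and v0: "!!i. i \<notin> F ==> component V (grade V) i v = \<zero>\<^sub>V"
    and u0: "!!i. i \<notin> F ==> component V (grade V) (i + 1) u = \<zero>\<^sub>V"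
    and w0: "!!i. i \<notin> F ==> component V (grade V) i w = \<zero>\<^sub>V" by (elim exE conjE) simp
   have cc: "?c \<in> F \<rightarrow> carrier ?C" using x by (simp add: add_cone_simps)
   have u1: "component V (grade V) i u = \<zero>\<^sub>V" if "i \<notin> (%i. i + 1) ` F" for i
   proof -
    have "i - 1 \<notin> F" using that image_eqI[of i "%i. i + 1" "i - 1" F] by auto
    from u0[OF this] show ?thesis by simp
   qed
   have e: "(\<Oplus>\<^sub>?C i\<in>F. ?c i) ! j = (\<Oplus>\<^sub>V i\<in>F. ?c i ! j)" if "j < 3" for j
    by (rule lin_finsum[OF C.module_axioms V.module_axioms entry_linear[OF that] cc])
   have "x = (\<Oplus>\<^sub>?C i\<in>F. ?c i)"
   proof (rule add_cone_eqI[OF xc C.finsum_closed[OF cc]])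
    show "x ! 0 = (\<Oplus>\<^sub>?C i\<in>F. ?c i) ! 0"
     using e[of 0] V.component_sum'[OF x(2) F v0] by (simp add: x(1))
    show "x ! 2 = (\<Oplus>\<^sub>?C i\<in>F. ?c i) ! 2"
     using e[of 2] V.component_sum'[OF x(4) F w0] by (simp add: x(1))
    have "u = (\<Oplus>\<^sub>V i\<in>(%i. i + 1) ` F. component V (grade V) i u)"
     by (rule V.component_sum'[OF x(3) _ u1]) (use F in simp)
    also have "... = (\<Oplus>\<^sub>V i\<in>F. component V (grade V) (i + 1) u)"
     by (rule V.finsum_reindex) (use x(3) in \<open>auto simp: inj_on_def\<close>)
    finally show "x ! 1 = (\<Oplus>\<^sub>?C i\<in>F. ?c i) ! 1"
     using e[of 1] by (simp add: x(1))
   qed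
   then show "decomposes ?C (grade ?C) x ?c"
    by (intro C.decomposesI[OF F]) (use v0 u0 w0 x V.component_in gc in \<open>auto simp: add_cone_simps\<close>)
  next
   fix c assume c: "decomposes ?C (grade ?C) x c"
   let ?F = "{i. c i \<noteq> \<zero>\<^sub>?C}"
   have F: "finite ?F" and cg: "!!i. c i \<in> grade ?C i" and sum: "x = (\<Oplus>\<^sub>?C i\<in>?F. c i)"
    using c by (auto simp: decomposes_def)
   have cc: "c \<in> ?F \<rightarrow> carrier ?C" using gc[OF cg] by simp
   have e: "x ! j = (\<Oplus>\<^sub>V i\<in>?F. c i ! j)" if "j < 3" for j
    unfolding arg_cong[OF sum, of "%x. x ! j"] by (rule lin_finsum[OF C.module_axioms V.module_axioms entry_linear[OF that] cc])
   have z: "c i ! j = \<zero>\<^sub>V" if "i \<notin> ?F" "j < 3" for i j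
    using that by (auto simp: add_cone_simps less_Suc_eq numeral_3_eq_3 numeral_2_eq_2)
   have cgr: "c i ! 0 \<in> grade V i" "c i ! 1 \<in> grade V (i + 1)" "c i ! 2 \<in> grade V i" for i
    using cg[of i] by (auto elim!: add_cone_gradeE)
   have ccl: "c i ! 1 \<in> carrier V" for i using cgr(2) by (rule V.grade_closed)
   have "decomposes V (grade V) v (%i. c i ! 0)"
    using e[of 0] by (intro V.decomposesI[OF F]) (use z cgr V.grade_closed in \<open>auto simp: x(1)\<close>)
   moreover have "decomposes V (grade V) w (%i. c i ! 2)"
    using e[of 2] by (intro V.decomposesI[OF F]) (use z cgr V.grade_closed in \<open>auto simp: x(1)\<close>)
   moreover have "decomposes V (grade V) u (%i. c (i - 1) ! 1)"
   proof (rule V.decomposesI[of "(%i. i + 1) ` ?F"])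
    have "(\<Oplus>\<^sub>V i\<in>(%i. i + 1) ` ?F. c (i - 1) ! 1) = (\<Oplus>\<^sub>V i\<in>?F. c (i + 1 - 1) ! 1)"
     by (rule V.finsum_reindex) (use ccl in \<open>auto simp: inj_on_def\<close>)
    then show "u = (\<Oplus>\<^sub>V i\<in>(%i. i + 1) ` ?F. c (i - 1) ! 1)" using e[of 1] by (simp add: x(1))
    show "c (i - 1) ! 1 = \<zero>\<^sub>V" if "i \<notin> (%i. i + 1) ` ?F" for i
    proof -
     have "i - 1 \<notin> ?F" using that image_eqI[of i "%i. i + 1" "i - 1" ?F] by auto
     from z[OF this, of 1] show ?thesis by simp
    qed
    show "c (i - 1) ! 1 \<in> grade V i" for i using cgr(2)[of "i - 1"] by simp
    show "grade V i \<subseteq> carrier V" for i using V.grade_closed by blast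
   qed (use F in simp)
   ultimately have "component V (grade V) i v = c i ! 0" "component V (grade V) (i + 1) u = c i ! 1" "component V (grade V) i w = c i ! 2" for i
    by (simp_all add: V.component_eqI)
   then show "c = ?c" using add_cone_eta[OF gc[OF cg]] by auto
  qed
 qed
 then have "internal_direct_sum R ?C (grade ?C)" using sub by (simp add: internal_direct_sum_def)
 then show ?thesis using C.module_axioms V.field_axioms by (simp add: graded_space_def graded_space_axioms_def)
qed

lemma add_cone_complex:
 assumes "graded_space R V" shows "cochain_complex R (add_cone V)"
proof -
 interpret V: graded_space R V by fact
 have z: "linear_map R (add_cone V) V (%x. \<zero>\<^sub>V)" by (rule lin_const_zero[OF V.module_axioms])
 show ?thesis
 proof (rule cochain_complexI[OF add_cone_graded[OF assms]])
  show "linear_map R (add_cone V) (add_cone V) (diff (add_cone V))"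
   unfolding add_cone_simps(7)[abs_def] by (rule triple_linear[OF z z entry_linear]) simp
  show "diff (add_cone V) x \<in> grade (add_cone V) (i + 1)" if "x \<in> grade (add_cone V) i" for x i
   using that submodule_zero[OF V.module_axioms V.summand_submodule] by (auto elim!: add_cone_gradeE simp: add_cone_simps(5,6))
 qed (simp add: add_cone_simps)
qed

text \<open>The cone is acyclic: \<open>[v, 0, w]\<close> differs from \<open>[v, 0, 0]\<close> by the boundary of \<open>[0, w, 0]\<close>.\<close>

lemma kill_cone_quasi_iso:
 assumes "graded_space R V"
 shows "quasi_iso R (add_cone V) (add_cone V) (%x. [x ! 0, \<zero>\<^sub>V, \<zero>\<^sub>V])"
proof -
 interpret V: graded_space R V by fact
 let ?C = "add_cone V" and ?e = "%x. [x ! 0, \<zero>\<^sub>V, \<zero>\<^sub>V]"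
 interpret C: cochain_complex R ?C by (rule add_cone_complex[OF assms])
 have z: "linear_map R ?C V (%x. \<zero>\<^sub>V)" by (rule lin_const_zero[OF V.module_axioms])
 have e: "linear_map R ?C ?C ?e" by (rule triple_linear[OF entry_linear z z]) simp
 have ed: "?e (diff ?C x) = diff ?C (?e x)" for x by (simp add: add_cone_simps)
 have "chain_map R ?C ?C ?e"
  unfolding chain_map_def using C.cochain_complex_axioms e ed submodule_zero[OF V.module_axioms V.summand_submodule]
  by (auto elim!: add_cone_gradeE simp: add_cone_simps(5))
 moreover have "coh_map ?C ?e c = c" if c: "c \<in> cohomology ?C" for c
 proof -
  obtain x where x: "x \<in> carrier ?C" "diff ?C x = \<zero>\<^sub>?C" "c = coh_class ?C x"
   using c by (auto simp: cohomology_def cocycles_def)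
  obtain v u w where vuw: "x = [v, u, w]" "v \<in> carrier V" "u \<in> carrier V" "w \<in> carrier V" using x(1) by (rule add_coneE)
  have u: "u = \<zero>\<^sub>V" using x(2) by (simp add: vuw(1) add_cone_simps)
  have "x = ?e x \<oplus>\<^sub>?C diff ?C [\<zero>\<^sub>V, w, \<zero>\<^sub>V]" using vuw u by (simp add: add_cone_simps)
  moreover have cl: "?e x \<in> carrier ?C" "[\<zero>\<^sub>V, w, \<zero>\<^sub>V] \<in> carrier ?C" using vuw by (simp_all add: add_cone_simps)
  moreover have dc: "diff ?C [\<zero>\<^sub>V, w, \<zero>\<^sub>V] \<in> carrier ?C" by (rule lin_closed[OF C.diff_linear cl(2)])
  ultimately have "x \<ominus>\<^sub>?C ?e x = diff ?C [\<zero>\<^sub>V, w, \<zero>\<^sub>V]"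
   using C.M.add.inv_solve_right[OF dc x(1) cl(1)] C.M.a_comm[OF dc cl(1)] by (simp add: a_minus_def)
  then have "coh_class ?C x = coh_class ?C (?e x)"
   unfolding coh_class_eq_iff[OF C.module_axioms C.diff_linear x(1) cl(1)] using cl(2) by (metis imageI)
  then show ?thesis
   unfolding x(3) coh_map_class[OF C.module_axioms C.diff_linear C.module_axioms C.diff_linear e ed x(1)] by simp
 qed
 then have "bij_betw (coh_map ?C ?e) (cohomology ?C) (cohomology ?C)"
  using bij_betw_cong[of "cohomology ?C" "coh_map ?C ?e" "%c. c"] bij_betw_id[of "cohomology ?C"] by (simp add: id_def)
 ultimately show ?thesis by (simp add: quasi_iso_def)
qed

section \<open>Graded filtrations of the generators\<close>

locale graded_splitting = graded_space R V
 for R :: "('k, 'c) ring_scheme" and V :: "('k, 'v) dgvs" +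
 fixes Vs :: "nat => 'v set"
 assumes splitting: "internal_direct_sum R V Vs" and splitting_graded: "graded_subset V (Vs k)"
begin

sublocale D: direct_sum R V Vs by unfold_locales (rule splitting)

text \<open>The two decompositions of \<open>V\<close> are compatible since the summands are graded.\<close>

lemma hpart_summand: "v \<in> carrier V ==> component V Vs j (hpart V v i) = hpart V (component V Vs j v) i"
 unfolding hpart_component
 by (rule linear_map_component[OF D.direct_sum_axioms D.direct_sum_axioms component_linear, where s="%j. j"])
  (use splitting_graded in \<open>auto simp: graded_subset_def hpart_component\<close>)

lemma component_grade: "v \<in> grade V i ==> component V Vs j v \<in> grade V i"
 using hpart_summand[OF grade_closed, of v i j i] component_in[OF D.component_closed[OF grade_closed], of v i i j]
 by (simp add: hpart_of hpart_component[symmetric])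

lemma sum_space_graded: "graded_subset V (sum_space V Vs K)"
 unfolding graded_subset_def
proof (intro ballI allI)
 fix v i assume "v \<in> sum_space V Vs K"
 then have v: "v \<in> carrier V" "!!j. j \<notin> K ==> component V Vs j v = \<zero>\<^sub>V" by (auto simp: D.mem_sum_space_iff)
 have z: "hpart V \<zero>\<^sub>V i = \<zero>\<^sub>V"
  unfolding hpart_component by (rule lin_zero[OF module_axioms module_axioms component_linear])
 show "hpart V v i \<in> sum_space V Vs K"
  unfolding D.mem_sum_space_iff
 proof (intro conjI allI impI)
  show "hpart V v i \<in> carrier V" unfolding hpart_component by (rule component_closed[OF v(1)])
  show "component V Vs j (hpart V v i) = \<zero>\<^sub>V" if "j \<notin> K" for j
   unfolding hpart_summand[OF v(1)] v(2)[OF that] by (rule z)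
 qed
qed

primrec trunc :: "nat => 'v => 'v"
 where "trunc 0 v = \<zero>\<^sub>V" | "trunc (Suc k) v = trunc k v \<oplus>\<^sub>V component V Vs k v"

lemma trunc_linear: "linear_map R V V (trunc k)"
proof (induction k)
 case 0
 show ?case unfolding trunc.simps(1)[abs_def] by (rule lin_const_zero[OF module_axioms])
next
 case (Suc k)
 show ?case unfolding trunc.simps(2)[abs_def] by (rule lin_sum[OF module_axioms Suc D.component_linear])
qed

lemma trunc_grade: "v \<in> grade V i ==> trunc k v \<in> grade V i"
 by (induction k) (simp_all add: summandD component_grade)

lemma trunc_summand: "v \<in> Vs j ==> trunc k v = (if j < k then v else \<zero>\<^sub>V)"
proof (induction k)
 case (Suc k)
 have "v \<in> carrier V" using Suc.prems D.summandD(1) by blast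
 then show ?case using Suc D.component_of[OF Suc.prems, of k] by (auto simp: less_Suc_eq)
qed simp

lemma trunc_trunc:
 assumes "k \<le> l" "v \<in> carrier V"
 shows "trunc l (trunc k v) = trunc k v"
proof (rule D.linear_maps_eq_on_summands[OF module_axioms lin_comp[OF trunc_linear trunc_linear] trunc_linear _ assms(2)])
 show "trunc l (trunc k x) = trunc k x" if "x \<in> Vs i" for i x
  using assms(1) trunc_summand[OF that] lin_zero[OF module_axioms module_axioms trunc_linear] by auto
qed

lemma component_trunc:
 assumes "v \<in> carrier V"
 shows "component V Vs k (trunc k v) = \<zero>\<^sub>V"
proof (rule D.linear_maps_eq_on_summands[OF module_axioms lin_comp[OF trunc_linear D.component_linear] lin_const_zero[OF module_axioms] _ assms])
 show "component V Vs k (trunc k x) = \<zero>\<^sub>V" if "x \<in> Vs i" for i x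
  using trunc_summand[OF that] D.component_of[OF that] lin_zero[OF module_axioms module_axioms D.component_linear] by auto
qed

lemma trunc_sum_space:
 assumes "v \<in> sum_space V Vs {..<k}"
 shows "trunc k v = v"
 by (rule D.sum_space_eqI[OF module_axioms trunc_linear lin_ident _ assms]) (simp add: trunc_summand)

lemma trunc_mem:
 assumes v: "v \<in> carrier V" shows "trunc k v \<in> sum_space V Vs {..<k}"
proof (induction k)
 case 0
 show ?case using submodule_zero[OF module_axioms D.sum_space_submodule] by simp
next
 case (Suc k)
 have "sum_space V Vs {..<k} \<subseteq> sum_space V Vs {..<Suc k}" by (auto simp: D.mem_sum_space_iff)
 moreover have "component V Vs k v \<in> sum_space V Vs {..<Suc k}"
  by (rule subsetD[OF D.summand_subset_sum_space D.component_in[OF v]]) simp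
 ultimately show ?case using Suc submodule_add[OF module_axioms D.sum_space_submodule] by auto
qed

end

section \<open>The resolution\<close>

text \<open>
 The generators of a Sullivan model, with its triangular differential. The free algebra on \<open>add_cone V\<close> is
 the algebra \<open>F\<close> of the introduction.
\<close>

locale sullivan_lift = free_p_alg R P V d + S: graded_splitting R V Vs
 for R :: "('k, 'c) ring_scheme" and P :: "('k, 'p) operad" and V :: "('k, 'v) dgvs"
  and d :: "('k,'p,'v) tensors => ('k,'p,'v) tensors" and Vs :: "nat => 'v set" +
 assumes reflects: "reflects_homotopy_equivalences TYPE('v list) R P"
  and lower: "v \<in> Vs k ==> d (gen v) \<in> letter_span (sum_space V Vs {..<k})"
begin

abbreviation "C \<equiv> add_cone V"

definition kill_cone :: "'v list => 'v list"
 where "kill_cone x = [x ! 0, \<zero>\<^sub>V, \<zero>\<^sub>V]"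

lemma kill_cone_p_quasi_iso:
 "p_quasi_iso R P (free_algebra R P C) (free_algebra R P C) (free_map R P C kill_cone)"
 using reflects kill_cone_quasi_iso[OF X.graded_space_axioms]
 unfolding reflects_homotopy_equivalences_def kill_cone_def[abs_def] by blast

text \<open>The letters from the cone have a level of their own, so that the weight of a word tells whether it has one.\<close>

definition level :: "nat => 'v list set"
 where "level j = (case j of 0 => {[\<zero>\<^sub>V, u, w] | u w. u \<in> carrier V \<and> w \<in> carrier V}
  | Suc j => {[v, \<zero>\<^sub>V, \<zero>\<^sub>V] | v. v \<in> Vs j})"

definition level_part :: "nat => 'v list => 'v list"
 where "level_part j x = (case j of 0 => [\<zero>\<^sub>V, x ! 1, x ! 2] | Suc j => [component V Vs j (x ! 0), \<zero>\<^sub>V, \<zero>\<^sub>V])"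

lemmas V_zero_linear = lin_const_zero[OF modX]

lemma inl_linear: "linear_map R V C (%v. [v, \<zero>\<^sub>V, \<zero>\<^sub>V])"
 by (rule triple_linear[OF lin_ident V_zero_linear V_zero_linear])

lemma V_zero_grade [simp]: "\<zero>\<^sub>V \<in> grade V i" and V_zero_summand [simp]: "\<zero>\<^sub>V \<in> Vs j"
 by (rule X.summandD(2), rule S.D.summandD(2))

lemma Vs_closed: "v \<in> Vs j ==> v \<in> carrier V"
 using S.D.summandD(1) by blast

sublocale C: cochain_complex R C by (rule add_cone_complex[OF X.graded_space_axioms])

lemma inl_generated:
 assumes v: "v \<in> grade V i" and K: "v \<in> sum_space V Vs K"
 shows "[v, \<zero>\<^sub>V, \<zero>\<^sub>V] \<in> generated_submodule R C (\<Union>l\<in>Suc ` K. level l \<inter> grade C i)"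
proof -
 let ?S = "\<Union>l\<in>Suc ` K. level l \<inter> grade C i"
 have S: "?S \<subseteq> carrier C" using C.grade_closed by blast
 let ?F = "{j. component V Vs j v \<noteq> \<zero>\<^sub>V}"
 have vc: "v \<in> carrier V" by (rule X.grade_closed[OF v])
 have "[\<Oplus>\<^sub>V j\<in>?F. component V Vs j v, \<zero>\<^sub>V, \<zero>\<^sub>V] = (\<Oplus>\<^sub>C j\<in>?F. [component V Vs j v, \<zero>\<^sub>V, \<zero>\<^sub>V])"
  by (rule lin_finsum[OF modX C.module_axioms inl_linear]) (use vc in simp)
 also have "... \<in> generated_submodule R C ?S"
 proof (rule submodule_finsum[OF C.module_axioms C.generated_sub[OF S]])
  fix j assume "j \<in> ?F"
  then have "j \<in> K" using K by (auto simp: S.D.mem_sum_space_iff)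
  then have "[component V Vs j v, \<zero>\<^sub>V, \<zero>\<^sub>V] \<in> ?S"
   using S.D.component_in[OF vc] S.component_grade[OF v] by (auto simp: level_def add_cone_simps)
  then show "[component V Vs j v, \<zero>\<^sub>V, \<zero>\<^sub>V] \<in> generated_submodule R C ?S" by (rule subsetD[OF C.generated_incl])
 qed
 finally show ?thesis using S.D.component_sum[OF vc] by simp
qed

sublocale F: weighted_free_alg R P C "free_diff R P C" level level_part
proof (intro weighted_free_alg.intro free_p_alg.intro free_gens.intro)
 show "dg_operad R P" by (rule dg_operad_axioms)
 show "graded_space R C" by (rule C.graded_space_axioms)
 have "quasi_free R P C (free_diff R P C) = free_algebra R P C" by (simp add: quasi_free_def free_algebra_def)
 then show "p_algebra R P (quasi_free R P C (free_diff R P C))"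
  using kill_cone_p_quasi_iso by (simp add: p_quasi_iso_def p_morphism_def)
 show "weighted_free_alg_axioms R C level level_part"
 proof
  show "linear_map R C C (level_part j)" for j
  proof (cases j)
   case 0
   show ?thesis unfolding 0 level_part_def[abs_def] nat.case
    by (rule triple_linear[OF V_zero_linear entry_linear entry_linear]) simp_all
  next
   case (Suc k)
   show ?thesis unfolding Suc level_part_def[abs_def] nat.case
    by (rule triple_linear[OF lin_comp[OF entry_linear S.D.component_linear] V_zero_linear V_zero_linear]) simp
  qed
  show "level_part j v \<in> grade C i" if "v \<in> grade C i" for v i j
   using that S.component_grade by (cases j) (auto elim!: add_cone_gradeE simp: level_part_def add_cone_simps)
  show "level_part j v \<in> level j" if "v \<in> carrier C" for v j
   using that S.D.component_in by (cases j) (auto elim!: add_coneE simp: level_part_def level_def)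
  show "level_part j v = v" if "v \<in> level j" for v j
   using that S.D.component_of by (cases j) (auto simp: level_part_def level_def)
  show "level_part j v = \<zero>\<^sub>C" if "v \<in> level l" "l \<noteq> j" for v l j
   using that S.D.component_of lin_zero[OF modX modX S.D.component_linear]
   by (cases j; cases l) (auto simp: level_part_def level_def add_cone_simps)
  show "grade C i \<subseteq> generated_submodule R C (\<Union>j. level j \<inter> grade C i)" for i
  proof
   fix x assume "x \<in> grade C i"
   then obtain v u w where x: "x = [v, u, w]" "v \<in> grade V i" "u \<in> grade V (i + 1)" "w \<in> grade V i" by (rule add_cone_gradeE)
   let ?S = "\<Union>j. level j \<inter> grade C i"
   have S: "?S \<subseteq> carrier C" using C.grade_closed by blast
   note c = x(2-4)[THEN X.grade_closed]
   have "v \<in> sum_space V Vs UNIV" using c(1) by (simp add: S.D.mem_sum_space_iff)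
   from inl_generated[OF x(2) this] have "[v, \<zero>\<^sub>V, \<zero>\<^sub>V] \<in> generated_submodule R C ?S"
    by (rule subsetD[OF C.generated_mono[OF _ S], rotated]) blast
   moreover have "[\<zero>\<^sub>V, u, w] \<in> level 0" using c by (simp add: level_def)
   then have "[\<zero>\<^sub>V, u, w] \<in> ?S" using x(3,4) by (auto simp: add_cone_simps)
   then have "[\<zero>\<^sub>V, u, w] \<in> generated_submodule R C ?S" by (rule subsetD[OF C.generated_incl])
   ultimately have "[v, \<zero>\<^sub>V, \<zero>\<^sub>V] \<oplus>\<^sub>C [\<zero>\<^sub>V, u, w] \<in> generated_submodule R C ?S"
    by (rule submodule_add[OF C.module_axioms C.generated_sub[OF S]])
   then show "x \<in> generated_submodule R C ?S" using c by (simp add: x(1) add_cone_simps)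
  qed
 qed
qed

lemma Q_alg: "p_algebra R P Q" and F_alg: "p_algebra R P F.Q"
 by unfold_locales

lemma d_derivation: "p_derivation R P Q d"
 using Q.diff_derivation by simp

lemma d_closed: "x \<in> carrier M ==> d x \<in> carrier M" and d_d: "x \<in> carrier M ==> d (d x) = \<zero>\<^sub>M"
 using lin_closed[OF Q_d_linear] Q.diff_diff by simp_all

subsection \<open>Inclusion and retraction\<close>

definition incl :: "('k,'p,'v) tensors => ('k,'p,'v list) tensors"
 where "incl = alg_ext F.Q (%v. F.gen [v, \<zero>\<^sub>V, \<zero>\<^sub>V])"

definition retract :: "('k,'p,'v list) tensors => ('k,'p,'v) tensors"
 where "retract = F.alg_ext Q (%x. gen (x ! 0))"

lemma inl_gen: "linear_map R V F.Q (%v. F.gen [v, \<zero>\<^sub>V, \<zero>\<^sub>V])" "\<forall>i. \<forall>v\<in>grade V i. F.gen [v, \<zero>\<^sub>V, \<zero>\<^sub>V] \<in> grade F.Q i"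
 using lin_comp[OF inl_linear F.gen_linear] F.gen_grade by (simp_all add: add_cone_simps)

lemma gen_entry: "linear_map R C Q (%x. gen (x ! 0))" "\<forall>i. \<forall>x\<in>grade C i. gen (x ! 0) \<in> grade Q i"
 using lin_comp[OF entry_linear gen_linear, of 0] gen_grade by (auto elim!: add_cone_gradeE)

lemma incl_alg_map: "alg_map R P Q F.Q incl"
 unfolding incl_def by (rule alg_ext_alg_map[OF F_alg inl_gen])

lemma incl_gen: "v \<in> carrier V ==> incl (gen v) = F.gen [v, \<zero>\<^sub>V, \<zero>\<^sub>V]"
 unfolding incl_def by (rule alg_ext_gen[OF F_alg inl_gen])

lemma retract_alg_map: "alg_map R P F.Q Q retract"
 unfolding retract_def by (rule F.alg_ext_alg_map[OF Q_alg gen_entry])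

lemma retract_gen: "x \<in> carrier C ==> retract (F.gen x) = gen (x ! 0)"
 unfolding retract_def by (rule F.alg_ext_gen[OF Q_alg gen_entry])

lemma incl_linear: "linear_map R M F.M incl" and retract_linear: "linear_map R F.M M retract"
 using alg_map_linear[OF incl_alg_map] alg_map_linear[OF retract_alg_map] by simp_all

lemma inl_closed: "v \<in> carrier V ==> [v, \<zero>\<^sub>V, \<zero>\<^sub>V] \<in> carrier C"
 by (simp add: add_cone_simps)

lemma alg_map_ident: "alg_map R P A A (%x. x)"
 by (simp add: alg_map_def lin_ident)

lemma retract_incl: "x \<in> carrier M ==> retract (incl x) = x"
 by (rule alg_map_eq_carrierI[OF Q_alg alg_map_comp[OF incl_alg_map retract_alg_map] alg_map_ident])
  (simp_all add: incl_gen retract_gen inl_closed)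

subsection \<open>The twisted differential\<close>

definition twist :: "'v list => ('k,'p,'v list) tensors"
 where "twist x = incl (d (gen (x ! 0)))"

text \<open>
 The differential of the cone plus \<open>d\<close> on the letters from \<open>V\<close>. The cone letters \<open>u\<close> and \<open>w\<close> keep \<open>d u = w\<close> and
 \<open>d w = 0\<close>, so the inclusion and the retraction are chain maps.
\<close>

definition twisted_diff :: "('k,'p,'v list) tensors => ('k,'p,'v list) tensors"
 where "twisted_diff = F.der (%x. F.gen (diff C x) \<oplus>\<^sub>F.M twist x)"

lemma gen_diff_linear: "linear_map R C F.M (%x. F.gen (diff C x))"
 and gen_diff_grade: "\<forall>i. \<forall>x\<in>grade C i. F.gen (diff C x) \<in> F.G (i + 1)"
 using lin_comp[OF C.diff_linear F.gen_linear] F.gen_grade[OF C.diff_grade] by auto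

lemma twist_linear: "linear_map R C F.M twist"
 unfolding twist_def[abs_def]
 using lin_comp[OF lin_comp[OF gen_entry(1)[unfolded same_simps] Q_d_linear] incl_linear] .

lemma twist_grade: "\<forall>i. \<forall>x\<in>grade C i. twist x \<in> F.G (i + 1)"
proof (intro allI ballI)
 fix i x assume "x \<in> grade C i"
 then have "d (gen (x ! 0)) \<in> G (i + 1)" using gen_entry(2) derivation_grade[OF d_derivation] by simp
 then show "twist x \<in> F.G (i + 1)" unfolding twist_def using alg_map_grade[OF incl_alg_map] by simp
qed

lemma twisted_values: "linear_map R C F.M (%x. F.gen (diff C x) \<oplus>\<^sub>F.M twist x)"
 "\<forall>i. \<forall>x\<in>grade C i. F.gen (diff C x) \<oplus>\<^sub>F.M twist x \<in> F.G (i + 1)"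
proof -
 show "linear_map R C F.M (%x. F.gen (diff C x) \<oplus>\<^sub>F.M twist x)"
  by (rule lin_sum[OF F.modM gen_diff_linear twist_linear])
 have "submodule (F.G j) R F.M" for j
  unfolding F.G_generated by (rule F.M.generated_sub[OF F.word_grade_closed])
 then show "\<forall>i. \<forall>x\<in>grade C i. F.gen (diff C x) \<oplus>\<^sub>F.M twist x \<in> F.G (i + 1)"
  using submodule_add[OF F.modM] gen_diff_grade twist_grade by meson
qed

lemma twisted_derivation: "p_derivation R P F.Q twisted_diff"
 unfolding twisted_diff_def by (rule F.der_derivation[OF twisted_values])

lemma twisted_linear: "linear_map R F.M F.M twisted_diff"
 unfolding twisted_diff_def by (rule F.der_linear[OF twisted_values])

lemma twisted_gen: "x \<in> carrier C ==> twisted_diff (F.gen x) = F.gen (diff C x) \<oplus>\<^sub>F.M twist x"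
 unfolding twisted_diff_def by (rule F.der_gen[OF twisted_values])

lemma gen_zeros: "gen \<zero>\<^sub>V = \<zero>\<^sub>M" "F.gen \<zero>\<^sub>C = \<zero>\<^sub>F.M" "d \<zero>\<^sub>M = \<zero>\<^sub>M" "incl \<zero>\<^sub>M = \<zero>\<^sub>F.M" "retract \<zero>\<^sub>F.M = \<zero>\<^sub>M"
 "twisted_diff \<zero>\<^sub>F.M = \<zero>\<^sub>F.M"
 using lin_zero[OF modX modM gen_linear] lin_zero[OF C.module_axioms F.modM F.gen_linear]
  lin_zero[OF modM modM Q_d_linear] lin_zero[OF modM F.modM incl_linear]
  lin_zero[OF F.modM modM retract_linear] lin_zero[OF F.modM F.modM twisted_linear]
 by simp_all

lemma incl_closed: "x \<in> carrier M ==> incl x \<in> carrier F.M" and retract_closed: "y \<in> carrier F.M ==> retract y \<in> carrier M"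
 and twisted_closed: "y \<in> carrier F.M ==> twisted_diff y \<in> carrier F.M"
 by (rule lin_closed[OF incl_linear], assumption, rule lin_closed[OF retract_linear], assumption,
   rule lin_closed[OF twisted_linear])

lemma twisted_inl:
 assumes v: "v \<in> carrier V" shows "twisted_diff (F.gen [v, \<zero>\<^sub>V, \<zero>\<^sub>V]) = incl (d (gen v))"
proof -
 have "diff C [v, \<zero>\<^sub>V, \<zero>\<^sub>V] = \<zero>\<^sub>C" by (simp add: add_cone_simps)
 then show ?thesis
  unfolding twisted_gen[OF inl_closed[OF v]] twist_def
  using incl_closed[OF d_closed[OF gen_closed[OF v]]] by (simp add: gen_zeros)
qed

lemma twisted_incl: "x \<in> carrier M ==> twisted_diff (incl x) = incl (d x)"
 unfolding letter_span_UNIV[symmetric]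
 by (rule alg_map_commutes[OF F_alg incl_alg_map d_derivation twisted_derivation, symmetric])
  (simp_all add: incl_gen twisted_inl X.grade_closed)

lemma retract_twisted:
 assumes "y \<in> carrier F.M" shows "retract (twisted_diff y) = d (retract y)"
proof (rule F.alg_map_commutes[OF Q_alg retract_alg_map twisted_derivation d_derivation _ assms[folded F.letter_span_UNIV]])
 fix i x assume x: "x \<in> grade C i"
 then have xc: "x \<in> carrier C" by (rule C.grade_closed)
 have x0: "x ! 0 \<in> carrier V" using xc by (auto elim!: add_coneE)
 have dg: "d (gen (x ! 0)) \<in> carrier M" by (rule d_closed[OF gen_closed[OF x0]])
 have dx: "diff C x \<in> carrier C" by (rule lin_closed[OF C.diff_linear xc])
 show "retract (twisted_diff (F.gen x)) = d (retract (F.gen x))"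
  unfolding twisted_gen[OF xc] twist_def lin_add[OF retract_linear F.gen_closed[OF dx] incl_closed[OF dg]]
   retract_gen[OF dx] retract_gen[OF xc] retract_incl[OF dg]
  using dg by (simp add: add_cone_simps gen_zeros)
qed

lemma twisted_twisted:
 assumes "y \<in> carrier F.M" shows "twisted_diff (twisted_diff y) = \<zero>\<^sub>F.M"
proof (rule F.derivation_square_zero[OF twisted_derivation _ assms])
 fix i x assume x: "x \<in> grade C i"
 then have xc: "x \<in> carrier C" by (rule C.grade_closed)
 have x0: "x ! 0 \<in> carrier V" using xc by (auto elim!: add_coneE)
 have dg: "d (gen (x ! 0)) \<in> carrier M" by (rule d_closed[OF gen_closed[OF x0]])
 have dx: "diff C x \<in> carrier C" by (rule lin_closed[OF C.diff_linear xc])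
 have "twist (diff C x) = \<zero>\<^sub>F.M" by (simp add: twist_def add_cone_simps gen_zeros)
 then show "twisted_diff (twisted_diff (F.gen x)) = \<zero>\<^sub>F.M"
  unfolding twisted_gen[OF xc] lin_add[OF twisted_linear F.gen_closed[OF dx] incl_closed[OF dg]]
   twisted_gen[OF dx] C.diff_diff[OF xc] twist_def[of x] twisted_incl[OF dg] d_d[OF gen_closed[OF x0]]
  by (simp add: gen_zeros)
qed

subsection \<open>Acyclicity of the kernel of the retraction\<close>

lemma dead_letter:
 assumes E: "p_algebra R P E" and f: "alg_map R P F.Q E f" and kill: "!!x. x \<in> level 0 ==> f (F.gen x) = \<zero>\<^sub>E"
  and y: "y \<in> F.weight_words \<alpha>" "0 \<in># \<alpha>"
 shows "f y = \<zero>\<^sub>E"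
 using y(1)
proof (cases rule: F.weight_wordsE)
 case (1 p n xs e ds js)
 interpret E: p_algebra R P E by fact
 have n: "length xs = n" using 1(3) by (simp add: homs_iff)
 obtain i where i: "i < n" "js ! i = 0" using y(2) 1(4,6) by (metis in_set_conv_nth set_mset_mset)
 have "f (F.gen x) \<in> carrier E" if "x \<in> set xs" for x
  using lin_closed[OF alg_map_linear[OF f]] F.gen_closed subsetD[OF F.homs_closed[OF 1(3)] that] by simp
 then have "act E p (map (%x. f (F.gen x)) xs) = \<zero>\<^sub>E"
  by (intro E.act_zero_arg[OF opg_closed[OF 1(2)] _ _ i(1)]) (use n i 1(5)[OF i(1)] kill in auto)
 then show ?thesis unfolding 1(1) F.alg_map_word[OF f 1(2,3)] .
qed

lemma level_zero_entry: "x \<in> level 0 ==> x ! 0 = \<zero>\<^sub>V" and level_closed: "x \<in> level j ==> x \<in> carrier C"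
 using Vs_closed by (auto simp: level_def add_cone_simps split: nat.splits)

text \<open>The retraction kills the words with a cone letter and is undone by the inclusion on the others.\<close>

lemma minus_incl_retract:
 assumes y: "y \<in> carrier F.M" shows "y \<ominus>\<^sub>F.M incl (retract y) \<in> F.weight_span (%\<beta>. 0 \<in># \<beta>)"
proof (rule F.linear_weight_span[OF linear_map_minus[OF F.modM lin_ident lin_comp[OF retract_linear incl_linear]] _ y[folded F.weight_span_all]])
 fix \<alpha> x assume x: "x \<in> F.weight_words \<alpha>"
 have xc: "x \<in> carrier F.M" using x F.weight_words_closed by blast
 show "x \<ominus>\<^sub>F.M incl (retract x) \<in> F.weight_span (%\<beta>. 0 \<in># \<beta>)"
 proof (cases "0 \<in># \<alpha>")
  case True
  have "retract x = \<zero>\<^sub>Q"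
   by (rule dead_letter[OF Q_alg retract_alg_map _ x True]) (simp add: retract_gen level_closed level_zero_entry gen_zeros)
  then have "retract x = \<zero>\<^sub>M" by simp
  moreover have "x \<ominus>\<^sub>F.M \<zero>\<^sub>F.M = x" using xc F.M.minus_zero_iff[of x "\<zero>\<^sub>F.M"] by (simp add: a_minus_def)
  ultimately show ?thesis using F.weight_span_incl[OF x, where Z="%\<beta>. 0 \<in># \<beta>"] True by (simp add: gen_zeros)
 next
  case False
  let ?W = "(%v. [v, \<zero>\<^sub>V, \<zero>\<^sub>V]) ` carrier V"
  have "x \<in> F.letter_span ?W" using x
  proof (cases rule: F.weight_wordsE)
   case (1 p n xs e ds js)
   have n: "length xs = n" using 1(3) by (simp add: homs_iff)
   have "xs ! i \<in> ?W" if "i < n" for i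
   proof -
    have "js ! i \<noteq> 0" using False 1(4,6) that by (metis nth_mem set_mset_mset)
    then obtain j where "js ! i = Suc j" by (cases "js ! i") auto
    then show ?thesis using 1(5)[OF that] Vs_closed by (auto simp: level_def)
   qed
   then have "set xs \<subseteq> ?W" using n by (auto simp: set_conv_nth)
   then show ?thesis
    unfolding F.letter_span_def 1(1) using F.wordI[OF 1(2,3)] by (intro subsetD[OF F.M.generated_incl]) blast
  qed
  then have "incl (retract x) = x"
   by (rule F.alg_map_eqI[OF F_alg alg_map_comp[OF retract_alg_map incl_alg_map] alg_map_ident, rotated])
    (auto simp: retract_gen inl_closed incl_gen)
  then have "x \<ominus>\<^sub>F.M incl (retract x) = \<zero>\<^sub>F.M" using F.M.minus_zero_iff[OF xc xc] by simp
  then show ?thesis using F.weight_spanD(2) by simp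
 qed
qed

lemma twist_weight:
 assumes v: "v \<in> Vs j"
 shows "incl (d (gen v)) \<in> F.weight_span (%\<beta>. \<forall>l\<in>#\<beta>. 0 < l \<and> l < Suc j)"
proof (rule lin_generated_into[OF modM F.modM incl_linear F.weight_span_sub letter_words_closed])
 show "d (gen v) \<in> generated_submodule R M {T p vs | p vs. (p, vs) \<in> words P V \<and> set vs \<subseteq> sum_space V Vs {..<j}}"
  using lower[OF v] by (simp add: letter_span_def)
 fix x assume "x \<in> {T p vs | p vs. (p, vs) \<in> words P V \<and> set vs \<subseteq> sum_space V Vs {..<j}}"
 then obtain p vs where x: "x = T p vs" "(p, vs) \<in> words P V" "set vs \<subseteq> sum_space V Vs {..<j}" by blast
 obtain e ds where p: "p \<in> opg P (length vs) e" and vs: "homs (length vs) V vs ds"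
  using x(2) by (rule wordE)
 let ?i = "%v. [v, \<zero>\<^sub>V, \<zero>\<^sub>V]"
 have h: "homs (length vs) C (map ?i vs) ds"
  using vs by (simp add: homs_iff add_cone_simps)
 have "map (%v. incl (gen v)) vs = map F.gen (map ?i vs)"
  using homs_closed[OF vs] by (auto simp: incl_gen)
 then have "incl x = act F.Q p (map F.gen (map ?i vs))" unfolding x(1) alg_map_word[OF incl_alg_map p vs] by (simp only:)
 also have "... = F.T p (map ?i vs)" using F.word_gen[OF p h] by (simp only: F.quasi_free_simps)
 also have "... \<in> F.weight_span (%\<beta>. set_mset \<beta> \<subseteq> Suc ` {..<j})"
 proof (rule F.word_weight_span[OF p h])
  fix i assume i: "i < length vs"
  have "vs ! i \<in> grade V (ds ! i)" "vs ! i \<in> sum_space V Vs {..<j}" using vs x(3) i by (auto simp: homs_iff)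
  from inl_generated[OF this] show "map ?i vs ! i \<in> generated_submodule R C (\<Union>l\<in>Suc ` {..<j}. level l \<inter> grade C (ds ! i))"
   using i by simp
 qed
 finally show "incl x \<in> F.weight_span (%\<beta>. \<forall>l\<in>#\<beta>. 0 < l \<and> l < Suc j)"
  by (rule F.weight_span_mono) auto
qed

text \<open>
 The map on free algebras induced by killing the cone annihilates words with a cone letter. As it is a
 quasi-isomorphism by hypothesis, cocycles made of such words are boundaries.
\<close>

lemma untwisted_acyclic:
 assumes \<alpha>: "0 \<in># \<alpha>" and y: "y \<in> F.weight_span (%\<beta>. \<beta> = \<alpha>)" and "F.der (%x. F.gen (diff C x)) y = \<zero>\<^sub>F.M"
 shows "\<exists>z\<in>carrier F.M. F.der (%x. F.gen (diff C x)) z = y"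
proof -
 let ?f = "free_map R P C kill_cone" and ?A = "free_algebra R P C"
 have kg: "linear_map R C F.Q (%x. F.gen (kill_cone x))" "\<forall>i. \<forall>x\<in>grade C i. F.gen (kill_cone x) \<in> grade F.Q i"
  using lin_comp[OF triple_linear[OF entry_linear V_zero_linear V_zero_linear] F.gen_linear, of 0] F.gen_grade
  by (auto elim!: add_cone_gradeE simp: kill_cone_def[abs_def] add_cone_simps)
 let ?g = "F.alg_ext F.Q (%x. F.gen (kill_cone x))"
 have eq: "?f x = ?g x" if "x \<in> carrier F.M" for x
  unfolding free_map_def F.alg_ext_def same_simps
 proof -
  have "extend R F.Q (%p vs. F.T p (map kill_cone vs)) x = extend R F.Q (%p vs. act F.Q p (map (%x. F.gen (kill_cone x)) vs)) x"
  proof (rule F.extend_cong[OF F.alg_ext_respects[OF F_alg kg] F.Q.alg_module _ that])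
   fix p xs assume "(p, xs) \<in> words P C"
   then obtain e ds where p: "p \<in> opg P (length xs) e" and xs: "homs (length xs) C xs ds" by (rule F.wordE)
   have "homs (length xs) C (map kill_cone xs) ds"
    using xs by (auto simp: homs_iff kill_cone_def add_cone_simps elim!: add_cone_gradeE)
   from F.word_gen[OF p this] show "F.T p (map kill_cone xs) = act F.Q p (map (%x. F.gen (kill_cone x)) xs)"
    by (simp add: comp_def)
  qed
  then show "extend R F.M (%p vs. F.T p (map kill_cone vs)) x = extend R F.Q (%p vs. act F.Q p (map (%x. F.gen (kill_cone x)) vs)) x"
   by (simp add: extend_def)
 qed
 have g: "alg_map R P F.Q F.Q ?g" by (rule F.alg_ext_alg_map[OF F_alg kg])
 have gl: "linear_map R F.M F.M ?g" using alg_map_linear[OF g] by simp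
 have kill: "?g (F.gen x) = \<zero>\<^sub>F.Q" if "x \<in> level 0" for x
 proof -
  have "kill_cone x = \<zero>\<^sub>C" using level_zero_entry[OF that] by (simp add: kill_cone_def add_cone_simps)
  then show ?thesis using F.alg_ext_gen[OF F_alg kg level_closed[OF that]] gen_zeros(2) by simp
 qed
 have yc: "y \<in> carrier F.M" by (rule F.weight_span_closed[OF y])
 have "?g y = \<zero>\<^sub>F.M" using y
 proof (induction rule: F.weight_span_induct)
  case (words \<beta> x)
  then show ?case using dead_letter[OF F_alg g kill words(2)] \<alpha> by simp
 qed (use linear_mapD[OF gl] lin_zero[OF F.modM F.modM gl] in simp_all)
 then have f0: "?f y = \<zero>\<^sub>F.M" by (simp add: eq[OF yc])
 have D: "free_diff R P C x = F.der (%x. F.gen (diff C x)) x" if "x \<in> carrier F.M" for x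
  by (rule F.der_free_diff[OF C.diff_linear C.diff_grade that])
 have simps: "carrier ?A = carrier F.M" "zero ?A = zero F.M" "diff ?A = free_diff R P C" by (simp_all add: free_algebra_def)
 have "free_diff R P C \<zero>\<^sub>F.M = \<zero>\<^sub>F.M"
  using lin_zero[OF F.modM F.modM F.Q_d_linear] .
 then have "?f y \<in> diff ?A ` carrier ?A" unfolding f0 simps using F.M.zero_closed by (metis imageI)
 moreover have "diff ?A y = \<zero>\<^sub>?A" unfolding simps D[OF yc] by fact
 moreover have "quasi_iso R ?A ?A ?f" using kill_cone_p_quasi_iso by (simp add: p_quasi_iso_def)
 ultimately have "y \<in> diff ?A ` carrier ?A" using quasi_iso_inj[of R ?A ?A ?f y] yc simps(1) by blast
 then show ?thesis unfolding simps using D by auto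
qed

lemma retract_kernel_acyclic:
 assumes y: "y \<in> carrier F.M" "twisted_diff (y \<ominus>\<^sub>F.M incl (retract y)) = \<zero>\<^sub>F.M"
 shows "\<exists>z\<in>carrier F.M. twisted_diff z = y \<ominus>\<^sub>F.M incl (retract y)"
proof (rule F.perturbed_acyclic[where D="F.der (%x. F.gen (diff C x))"])
 show "linear_map R F.M F.M (F.der (%x. F.gen (diff C x)))" by (rule F.der_linear[OF gen_diff_linear gen_diff_grade])
 show "F.der (%x. F.gen (diff C x)) x \<in> F.weight_span (%\<beta>. \<beta> = \<alpha>)" if "x \<in> F.weight_words \<alpha>" for \<alpha> x
 proof (rule F.der_preserves_weight[OF C.diff_linear C.diff_grade _ that])
  show "diff C v \<in> level j" if "v \<in> level j" for j v
   using that by (cases j) (auto simp: level_def add_cone_simps)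
 qed
 show "\<exists>y\<in>F.weight_span (%\<beta>. \<beta> < \<alpha> \<and> (0 \<in># \<alpha> --> 0 \<in># \<beta>)). twisted_diff x = F.der (%x. F.gen (diff C x)) x \<oplus>\<^sub>F.M y"
  if "x \<in> F.weight_words \<alpha>" for \<alpha> x
  unfolding twisted_diff_def
 proof (rule F.der_add_weight[OF gen_diff_linear gen_diff_grade twist_linear twist_grade _ _ that])
  show "twist v = \<zero>\<^sub>F.M" if "v \<in> level 0" for v by (simp add: twist_def level_zero_entry[OF that] gen_zeros)
  show "twist v \<in> F.weight_span (%\<beta>. \<forall>l\<in>#\<beta>. 0 < l \<and> l < Suc j)" if "v \<in> level (Suc j)" for j v
   using that twist_weight by (auto simp: level_def twist_def)
 qed
 show "y \<ominus>\<^sub>F.M incl (retract y) \<in> F.weight_span (%\<beta>. 0 \<in># \<beta>)" by (rule minus_incl_retract[OF y(1)])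
qed (fact twisted_linear twisted_twisted untwisted_acyclic y(2))+

end

section \<open>Lifting along a quasi-isomorphism\<close>

lemma (in abelian_group) minus_swap:
 assumes "x \<in> carrier G" "c \<in> carrier G" "x \<ominus> c = a"
 shows "x \<ominus> a = c"
 unfolding assms(3)[symmetric] using assms(1,2) by (simp add: minus_eq minus_add r_neg2)

lemma (in abelian_group) minus_swap_sum:
 assumes "x \<in> carrier G" "a \<in> carrier G" "b \<in> carrier G" "c \<in> carrier G" "x \<ominus> c = a \<oplus> b"
 shows "(x \<ominus> a) \<oplus> \<ominus> b = c"
 using minus_swap[OF assms(1,4,5)] assms(1-3) by (simp add: minus_eq minus_add a_assoc)

context sullivan_lift
begin

abbreviation "stage k \<equiv> letter_span (sum_space V Vs {..<k})"

lemma stage_mono: "j \<le> k ==> stage j \<subseteq> stage k"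
 by (rule letter_span_mono) (auto simp: S.D.mem_sum_space_iff)

lemma letter_span_closed: "x \<in> letter_span W ==> x \<in> carrier M"
 using submodule_subset[OF modM letter_span_sub] by blast

lemma stage_zero: "sum_space V Vs {..<0} = {\<zero>\<^sub>V}"
 by (auto simp: sum_space_def)

lemma gen_stage:
 assumes "v \<in> sum_space V Vs K" shows "gen v \<in> letter_span (sum_space V Vs K)"
proof -
 have v: "v \<in> carrier V" using assms by (simp add: S.D.mem_sum_space_iff)
 have hp: "hpart V v i \<in> sum_space V Vs K" "hpart V v i \<in> grade V i" for i
  using S.sum_space_graded assms X.component_in[OF v] by (auto simp: graded_subset_def hpart_component)
 show ?thesis unfolding generator_def
 proof (rule submodule_finsum[OF modM letter_span_sub])
  fix i
  have "(op_unit P, [hpart V v i]) \<in> words P V" by (rule wordI[OF unit_grade gen_homogeneous(2)[OF hp(2)]])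
  then show "T (op_unit P) [hpart V v i] \<in> letter_span (sum_space V Vs K)"
   unfolding letter_span_def using hp(1)[of i]
   by (intro subsetD[OF M.generated_incl] CollectI exI[of _ "op_unit P"] exI[of _ "[hpart V v i]"]) simp
 qed
qed

text \<open>
 Elements fixed by \<open>cut k\<close> involve the cone only on the first \<open>k\<close> summands. They do not see how an extension of
 \<open>q\<close> is chosen on the rest of the cone (\<open>perturb_cong\<close>).
\<close>

definition cut :: "nat => ('k,'p,'v list) tensors => ('k,'p,'v list) tensors"
 where "cut k = F.alg_ext F.Q (%x. F.gen [x ! 0, S.trunc k (x ! 1), S.trunc k (x ! 2)])"

lemma cut_letter_linear: "linear_map R C C (%x. [x ! 0, S.trunc k (x ! 1), S.trunc k (x ! 2)])"
 by (rule triple_linear[OF entry_linear lin_comp[OF entry_linear S.trunc_linear] lin_comp[OF entry_linear S.trunc_linear]]) simp_all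

lemma cut_values: "linear_map R C F.Q (%x. F.gen [x ! 0, S.trunc k (x ! 1), S.trunc k (x ! 2)])"
 "\<forall>i. \<forall>x\<in>grade C i. F.gen [x ! 0, S.trunc k (x ! 1), S.trunc k (x ! 2)] \<in> grade F.Q i"
 using lin_comp[OF cut_letter_linear F.gen_linear] F.gen_grade
 by (auto elim!: add_cone_gradeE simp: add_cone_simps S.trunc_grade)

lemma cut_alg_map: "alg_map R P F.Q F.Q (cut k)"
 unfolding cut_def by (rule F.alg_ext_alg_map[OF F_alg cut_values])

lemma cut_linear: "linear_map R F.M F.M (cut k)"
 using alg_map_linear[OF cut_alg_map] by simp

lemma cut_gen: "x \<in> carrier C ==> cut k (F.gen x) = F.gen [x ! 0, S.trunc k (x ! 1), S.trunc k (x ! 2)]"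
 unfolding cut_def by (rule F.alg_ext_gen[OF F_alg cut_values])

lemma trunc_closed: "v \<in> carrier V ==> S.trunc k v \<in> carrier V"
 by (rule lin_closed[OF S.trunc_linear])

lemma trunc_zero [simp]: "S.trunc k \<zero>\<^sub>V = \<zero>\<^sub>V"
 by (rule lin_zero[OF modX modX S.trunc_linear])

lemma cut_incl: "x \<in> carrier M ==> cut k (incl x) = incl x"
 by (rule alg_map_eq_carrierI[OF F_alg alg_map_comp[OF incl_alg_map cut_alg_map] incl_alg_map])
  (simp_all add: incl_gen cut_gen inl_closed)

lemma cut_twisted:
 assumes "y \<in> carrier F.M" shows "cut k (twisted_diff y) = twisted_diff (cut k y)"
proof (rule F.alg_map_commutes[OF F_alg cut_alg_map twisted_derivation twisted_derivation _ assms[folded F.letter_span_UNIV]])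
 fix i x assume "x \<in> grade C i"
 then have xc: "x \<in> carrier C" by (rule C.grade_closed)
 then obtain v u w where x: "x = [v, u, w]" "v \<in> carrier V" "u \<in> carrier V" "w \<in> carrier V" by (rule add_coneE)
 have dx: "diff C x \<in> carrier C" by (rule lin_closed[OF C.diff_linear xc])
 have dg: "d (gen v) \<in> carrier M" by (rule d_closed[OF gen_closed[OF x(2)]])
 have ec: "[v, S.trunc k u, S.trunc k w] \<in> carrier C" using x trunc_closed by (simp add: add_cone_simps)
 have "cut k (twisted_diff (F.gen x)) = cut k (F.gen (diff C x)) \<oplus>\<^sub>F.M cut k (incl (d (gen v)))"
  unfolding twisted_gen[OF xc] twist_def
  using lin_add[OF cut_linear F.gen_closed[OF dx] incl_closed[OF dg]] by (simp add: x(1))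
 also have "... = F.gen [\<zero>\<^sub>V, \<zero>\<^sub>V, S.trunc k u] \<oplus>\<^sub>F.M incl (d (gen v))"
  unfolding cut_gen[OF dx] cut_incl[OF dg] by (simp add: x(1) add_cone_simps)
 also have "... = twisted_diff (cut k (F.gen x))"
  unfolding cut_gen[OF xc] using twisted_gen[OF ec] by (simp add: x(1) twist_def add_cone_simps)
 finally show "cut k (twisted_diff (F.gen x)) = twisted_diff (cut k (F.gen x))" .
qed

lemma cut_cut:
 assumes "k \<le> l" "y \<in> carrier F.M" shows "cut l (cut k y) = cut k y"
proof (rule F.alg_map_eq_carrierI[OF F_alg alg_map_comp[OF cut_alg_map cut_alg_map] cut_alg_map _ assms(2)])
 fix x assume xc: "x \<in> carrier C"
 have "[x ! 0, S.trunc k (x ! 1), S.trunc k (x ! 2)] \<in> carrier C" by (rule lin_closed[OF cut_letter_linear xc])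
 then show "cut l (cut k (F.gen x)) = cut k (F.gen x)"
  unfolding cut_gen[OF xc] using S.trunc_trunc[OF assms(1)] xc by (auto elim!: add_coneE simp: cut_gen)
qed

end

locale lifting_problem = sullivan_lift R P V d Vs + B: p_algebra R P B
 for R :: "('k, 'c) ring_scheme" and P :: "('k, 'p) operad" and V :: "('k, 'v) dgvs"
  and d :: "('k,'p,'v) tensors => ('k,'p,'v) tensors" and Vs :: "nat => 'v set"
  and B :: "('k, 'p, 'b) dg_algebra" +
 fixes q H :: "('k,'p,'v) tensors => 'b" and N :: nat
 assumes q: "p_quasi_iso R P (quasi_free R P V d) B q" and H: "alg_map R P (quasi_free R P V d) B H"
  and H_diff: "x \<in> letter_span (sum_space V Vs {..<Suc N}) ==> H (d x) = diff B (H x)"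
begin

lemma q_alg_map: "alg_map R P Q B q"
 using q p_morphism_alg_map by (auto simp: p_quasi_iso_def)

lemma q_quasi_iso: "quasi_iso R Q B q"
 using q by (simp add: p_quasi_iso_def)

lemma q_linear: "linear_map R M B q" and H_linear: "linear_map R M B H"
 using alg_map_linear[OF q_alg_map] alg_map_linear[OF H] by simp_all

lemma q_diff: "x \<in> carrier M ==> q (d x) = diff B (q x)"
 using q chain_map_diff[of R Q B q] by (simp add: p_quasi_iso_def p_morphism_def)

lemmas q_closed = lin_closed[OF q_linear] and H_closed = lin_closed[OF H_linear]
 and dB_closed = lin_closed[OF B.diff_linear]

lemma dB_zero: "diff B \<zero>\<^sub>B = \<zero>\<^sub>B"
 by (rule lin_zero[OF B.alg_module B.alg_module B.diff_linear])

subsection \<open>Maps out of the resolution\<close>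

definition homotopy :: "('v => 'b) => bool"
 where "homotopy b \<longleftrightarrow> linear_map R V B b \<and> (\<forall>i. \<forall>v\<in>grade V i. b v \<in> grade B (i - 1))"

text \<open>
 The extension of \<open>q\<close> that is \<open>b\<close> on the cone letters \<open>u\<close>; then it has to be \<open>diff B \<circ> b\<close> on the cone letters \<open>w\<close>.
\<close>

definition perturb :: "('v => 'b) => ('k,'p,'v list) tensors => 'b"
 where "perturb b = F.alg_ext B (%x. q (gen (x ! 0)) \<oplus>\<^sub>B (b (x ! 1) \<oplus>\<^sub>B diff B (b (x ! 2))))"

lemma perturb_values:
 assumes b: "homotopy b"
 shows "linear_map R C B (%x. q (gen (x ! 0)) \<oplus>\<^sub>B (b (x ! 1) \<oplus>\<^sub>B diff B (b (x ! 2))))"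
  and "\<forall>i. \<forall>x\<in>grade C i. q (gen (x ! 0)) \<oplus>\<^sub>B (b (x ! 1) \<oplus>\<^sub>B diff B (b (x ! 2))) \<in> grade B i"
proof -
 have bl: "linear_map R V B b" and bg: "!!i v. v \<in> grade V i ==> b v \<in> grade B (i - 1)" using b by (auto simp: homotopy_def)
 show "linear_map R C B (%x. q (gen (x ! 0)) \<oplus>\<^sub>B (b (x ! 1) \<oplus>\<^sub>B diff B (b (x ! 2))))"
  by (intro lin_sum[OF B.alg_module] lin_comp[OF gen_entry(1) alg_map_linear[OF q_alg_map]]
    lin_comp[OF entry_linear bl] lin_comp[OF lin_comp[OF entry_linear bl] B.diff_linear]) simp_all
 show "\<forall>i. \<forall>x\<in>grade C i. q (gen (x ! 0)) \<oplus>\<^sub>B (b (x ! 1) \<oplus>\<^sub>B diff B (b (x ! 2))) \<in> grade B i"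
 proof (intro allI ballI)
  fix i x assume "x \<in> grade C i"
  then obtain v u w where x: "x = [v, u, w]" "v \<in> grade V i" "u \<in> grade V (i + 1)" "w \<in> grade V i" by (rule add_cone_gradeE)
  have 1: "q (gen v) \<in> grade B i" using alg_map_grade[OF q_alg_map] gen_grade[OF x(2)] by simp
  have 2: "b u \<in> grade B i" "diff B (b w) \<in> grade B i"
   using bg[OF x(3)] B.diff_grade[OF bg[OF x(4)]] by simp_all
  show "q (gen (x ! 0)) \<oplus>\<^sub>B (b (x ! 1) \<oplus>\<^sub>B diff B (b (x ! 2))) \<in> grade B i"
   using B.summandD(3)[OF 1 B.summandD(3)[OF 2]] by (simp add: x(1))
 qed
qed

lemma perturb_alg_map: "homotopy b ==> alg_map R P F.Q B (perturb b)"
 unfolding perturb_def by (rule F.alg_ext_alg_map[OF B.p_algebra_axioms perturb_values])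

lemma perturb_linear: "homotopy b ==> linear_map R F.M B (perturb b)"
 using alg_map_linear[OF perturb_alg_map] by simp

lemma perturb_gen:
 "[|homotopy b; x \<in> carrier C|] ==> perturb b (F.gen x) = q (gen (x ! 0)) \<oplus>\<^sub>B (b (x ! 1) \<oplus>\<^sub>B diff B (b (x ! 2)))"
 unfolding perturb_def by (rule F.alg_ext_gen[OF B.p_algebra_axioms perturb_values])

lemma homotopy_closed: "[|homotopy b; v \<in> carrier V|] ==> b v \<in> carrier B"
 and homotopy_zero: "homotopy b ==> b \<zero>\<^sub>V = \<zero>\<^sub>B"
 using lin_closed lin_zero[OF modX B.alg_module] by (auto simp: homotopy_def)

lemma q_zero: "q \<zero>\<^sub>M = \<zero>\<^sub>B"
 by (rule lin_zero[OF modM B.alg_module q_linear])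

lemma perturb_incl:
 assumes b: "homotopy b" and x: "x \<in> carrier M"
 shows "perturb b (incl x) = q x"
proof (rule alg_map_eq_carrierI[OF B.p_algebra_axioms alg_map_comp[OF incl_alg_map perturb_alg_map[OF b]] q_alg_map _ x])
 fix v assume v: "v \<in> carrier V"
 show "perturb b (incl (gen v)) = q (gen v)"
  unfolding incl_gen[OF v] perturb_gen[OF b inl_closed[OF v]]
  using q_closed[OF gen_closed[OF v]] by (simp add: homotopy_zero[OF b] dB_zero)
qed

lemma perturb_twisted:
 assumes b: "homotopy b" and y: "y \<in> carrier F.M"
 shows "perturb b (twisted_diff y) = diff B (perturb b y)"
proof (rule F.alg_map_commutes[OF B.p_algebra_axioms perturb_alg_map[OF b] twisted_derivation B.diff_derivation _ y[folded F.letter_span_UNIV]])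
 fix i x assume "x \<in> grade C i"
 then have xc: "x \<in> carrier C" by (rule C.grade_closed)
 then obtain v u w where x: "x = [v, u, w]" "v \<in> carrier V" "u \<in> carrier V" "w \<in> carrier V" by (rule add_coneE)
 have dx: "diff C x \<in> carrier C" by (rule lin_closed[OF C.diff_linear xc])
 have dg: "d (gen v) \<in> carrier M" by (rule d_closed[OF gen_closed[OF x(2)]])
 note bc = homotopy_closed[OF b x(3)] homotopy_closed[OF b x(4)] q_closed[OF gen_closed[OF x(2)]]
 note dc = bc[THEN dB_closed]
 have "perturb b (twisted_diff (F.gen x)) = perturb b (F.gen (diff C x)) \<oplus>\<^sub>B perturb b (incl (d (gen v)))"
  unfolding twisted_gen[OF xc] twist_def
  using lin_add[OF perturb_linear[OF b] F.gen_closed[OF dx] incl_closed[OF dg]] by (simp add: x(1))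
 also have "... = diff B (b u) \<oplus>\<^sub>B diff B (q (gen v))"
  unfolding perturb_gen[OF b dx] perturb_incl[OF b dg] q_diff[OF gen_closed[OF x(2)]]
  using dc by (simp add: x(1) add_cone_simps gen_zeros q_zero homotopy_zero[OF b])
 also have "... = diff B (perturb b (F.gen x))"
  unfolding perturb_gen[OF b xc] using bc dc lin_add[OF B.diff_linear] B.diff_diff[OF bc(2)]
  by (simp add: x(1) B.M.a_comm)
 finally show "perturb b (twisted_diff (F.gen x)) = diff B (perturb b (F.gen x))" .
qed

lemma perturb_cong:
 assumes b: "homotopy b" "homotopy b'" and eq: "!!v. v \<in> carrier V ==> b (S.trunc k v) = b' (S.trunc k v)"
  and y: "y \<in> carrier F.M" "cut k y = y"
 shows "perturb b y = perturb b' y"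
proof -
 have "perturb b (cut k y) = perturb b' (cut k y)"
 proof (rule F.alg_map_eq_carrierI[OF B.p_algebra_axioms alg_map_comp[OF cut_alg_map perturb_alg_map[OF b(1)]] alg_map_comp[OF cut_alg_map perturb_alg_map[OF b(2)]] _ y(1)])
  fix x assume xc: "x \<in> carrier C"
  have c: "[x ! 0, S.trunc k (x ! 1), S.trunc k (x ! 2)] \<in> carrier C" by (rule lin_closed[OF cut_letter_linear xc])
  show "perturb b (cut k (F.gen x)) = perturb b' (cut k (F.gen x))"
   unfolding cut_gen[OF xc] perturb_gen[OF b(1) c] perturb_gen[OF b(2) c] using xc eq by (auto elim!: add_coneE)
 qed
 then show ?thesis using y(2) by simp
qed

subsection \<open>Partial lifts\<close>

text \<open>
 A strict lift of \<open>H\<close>, along the extension of \<open>q\<close> given by \<open>b\<close>, on the first \<open>k\<close> summands. Only values on generators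
 are recorded; the map itself is their extension.
\<close>

definition partial_lift :: "nat => ('v => 'b) => ('v => ('k,'p,'v list) tensors) => bool"
 where "partial_lift k b s \<longleftrightarrow> homotopy b \<and> linear_map R V F.M s \<and> (\<forall>i. \<forall>v\<in>grade V i. s v \<in> F.G i) \<and>
  (\<forall>j<k. \<forall>v\<in>Vs j. twisted_diff (s v) = alg_ext F.Q s (d (gen v)) \<and> cut k (s v) = s v \<and> perturb b (s v) = H (gen v))"

lemma lift_alg_map:
 assumes "linear_map R V F.M s" "\<forall>i. \<forall>v\<in>grade V i. s v \<in> F.G i"
 shows "alg_map R P Q F.Q (alg_ext F.Q s)" and "v \<in> carrier V ==> alg_ext F.Q s (gen v) = s v"
proof -
 have s: "linear_map R V F.Q s" "\<forall>i. \<forall>v\<in>grade V i. s v \<in> grade F.Q i" using assms by simp_all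
 show "alg_map R P Q F.Q (alg_ext F.Q s)" by (rule alg_ext_alg_map[OF F_alg s])
 show "alg_ext F.Q s (gen v) = s v" if "v \<in> carrier V" by (rule alg_ext_gen[OF F_alg s that])
qed

text \<open>The conditions on generators pass to words, along algebra maps and derivations.\<close>

lemma partial_lift_facts:
 assumes "partial_lift k b s" "x \<in> stage k"
 shows lift_twisted: "alg_ext F.Q s (d x) = twisted_diff (alg_ext F.Q s x)"
  and lift_cut: "cut k (alg_ext F.Q s x) = alg_ext F.Q s x"
  and lift_perturb: "perturb b (alg_ext F.Q s x) = H x"
proof -
 have b: "homotopy b" and s: "linear_map R V F.M s" "\<forall>i. \<forall>v\<in>grade V i. s v \<in> F.G i"
  and on: "!!j v. [|j < k; v \<in> Vs j|] ==> twisted_diff (s v) = alg_ext F.Q s (d (gen v)) \<and> cut k (s v) = s v \<and> perturb b (s v) = H (gen v)"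
  using assms(1) by (auto simp: partial_lift_def)
 note h = lift_alg_map[OF s]
 have hl: "linear_map R M F.M (alg_ext F.Q s)" using alg_map_linear[OF h(1)] by simp
 have W: "v \<in> carrier V" if "v \<in> sum_space V Vs {..<k}" for v using that by (simp add: S.D.mem_sum_space_iff)
 show "alg_ext F.Q s (d x) = twisted_diff (alg_ext F.Q s x)"
 proof (rule alg_map_commutes[OF F_alg h(1) d_derivation twisted_derivation _ assms(2)])
  fix i v assume v: "v \<in> sum_space V Vs {..<k}"
  show "alg_ext F.Q s (d (gen v)) = twisted_diff (alg_ext F.Q s (gen v))"
   unfolding h(2)[OF W[OF v]]
   by (rule S.D.sum_space_eqI[OF F.modM lin_comp[OF lin_comp[OF gen_linear Q_d_linear] hl]
      lin_comp[OF s(1) twisted_linear] _ v]) (simp add: on)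
 qed
 show "cut k (alg_ext F.Q s x) = alg_ext F.Q s x"
 proof (rule alg_map_eqI[OF F_alg alg_map_comp[OF h(1) cut_alg_map] h(1) _ assms(2)])
  fix i v assume v: "v \<in> sum_space V Vs {..<k}"
  show "cut k (alg_ext F.Q s (gen v)) = alg_ext F.Q s (gen v)"
   unfolding h(2)[OF W[OF v]]
   by (rule S.D.sum_space_eqI[OF F.modM lin_comp[OF s(1) cut_linear] s(1) _ v]) (simp add: on)
 qed
 show "perturb b (alg_ext F.Q s x) = H x"
 proof (rule alg_map_eqI[OF B.p_algebra_axioms alg_map_comp[OF h(1) perturb_alg_map[OF b]] H _ assms(2)])
  fix i v assume v: "v \<in> sum_space V Vs {..<k}"
  show "perturb b (alg_ext F.Q s (gen v)) = H (gen v)"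
   unfolding h(2)[OF W[OF v]]
   by (rule S.D.sum_space_eqI[OF B.alg_module lin_comp[OF s(1) perturb_linear[OF b]] lin_comp[OF gen_linear H_linear] _ v]) (simp add: on)
 qed
qed

text \<open>
 The obstruction to extending the lift over a generator \<open>c\<close> is the cocycle \<open>x\<close>, the lift of \<open>d c\<close>. It is a
 boundary as \<open>F \<rightarrow> Q\<close> and \<open>q\<close> are injective on cohomology and its image in \<open>B\<close> is the boundary of \<open>H c\<close>. The
 solution is then corrected by a cocycle of \<open>Q\<close>, as \<open>q\<close> is surjective on cohomology, so that its image differs
 from \<open>H c\<close> by a boundary only.
\<close>

lemma stage_solution:
 assumes L: "partial_lift k b s" and k: "k \<le> N" and c: "c \<in> Vs k" "c \<in> grade V i"
 shows "\<exists>y\<in>F.G i. twisted_diff y = alg_ext F.Q s (d (gen c)) \<and> cut k y = y \<and>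
  (\<exists>\<beta>\<in>grade B (i - 1). perturb b y \<oplus>\<^sub>B diff B \<beta> = H (gen c))"
proof -
 have b: "homotopy b" and s: "linear_map R V F.M s" "\<forall>i. \<forall>v\<in>grade V i. s v \<in> F.G i"
  using L by (auto simp: partial_lift_def)
 note h = lift_alg_map[OF s]
 let ?x = "alg_ext F.Q s (d (gen c))"
 have gc: "gen c \<in> carrier M" by (rule gen_closed[OF X.grade_closed[OF c(2)]])
 have dst: "d (gen c) \<in> stage k" by (rule lower[OF c(1)])
 have hl: "linear_map R M F.M (alg_ext F.Q s)" using alg_map_linear[OF h(1)] by simp
 note pl = perturb_linear[OF b]
 have xc: "?x \<in> carrier F.M" by (rule lin_closed[OF hl d_closed[OF gc]])
 have xg: "?x \<in> F.G (i + 1)"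
  using alg_map_grade[OF h(1)] derivation_grade[OF d_derivation] gen_grade[OF c(2)] by simp
 have Dx: "twisted_diff ?x = \<zero>\<^sub>F.M"
  unfolding lift_twisted[OF L dst, symmetric] d_d[OF gc] by (rule lin_zero[OF modM F.modM hl])
 have cx: "cut k ?x = ?x" by (rule lift_cut[OF L dst])
 have "c \<in> sum_space V Vs {..<Suc N}" using S.D.summand_subset_sum_space[of k "{..<Suc N}"] c(1) k by auto
 then have gN: "gen c \<in> stage (Suc N)" by (rule gen_stage)
 have px: "perturb b ?x = diff B (H (gen c))" unfolding lift_perturb[OF L dst] by (rule H_diff[OF gN])
 have Hc: "H (gen c) \<in> carrier B" by (rule H_closed[OF gc])
 let ?r = "retract ?x"
 have rc: "?r \<in> carrier M" by (rule retract_closed[OF xc])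
 have dr: "d ?r = \<zero>\<^sub>M" unfolding retract_twisted[OF xc, symmetric] Dx by (rule gen_zeros)
 have Dir: "twisted_diff (incl ?r) = \<zero>\<^sub>F.M" unfolding twisted_incl[OF rc] dr by (rule gen_zeros)
 \<comment> \<open>Up to a boundary, the obstruction comes from \<open>Q\<close>, where \<open>q\<close> detects that it is a boundary.\<close>
 have "twisted_diff (?x \<ominus>\<^sub>F.M incl ?r) = \<zero>\<^sub>F.M"
  unfolding lin_diff[OF F.modM F.modM twisted_linear xc incl_closed[OF rc]] Dx Dir
  using F.M.minus_zero_iff[OF F.M.zero_closed F.M.zero_closed] by simp
 then obtain y1 where y1: "y1 \<in> carrier F.M" "twisted_diff y1 = ?x \<ominus>\<^sub>F.M incl ?r"
  using retract_kernel_acyclic[OF xc] by blast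
 have y1B: "perturb b y1 \<in> carrier B" by (rule lin_closed[OF pl y1(1)])
 have "diff B (perturb b y1) = diff B (H (gen c)) \<ominus>\<^sub>B q ?r"
  unfolding perturb_twisted[OF b y1(1), symmetric] y1(2)
   lin_diff[OF F.modM B.alg_module pl xc incl_closed[OF rc]] px perturb_incl[OF b rc] ..
 from B.M.minus_swap[OF dB_closed[OF Hc] q_closed[OF rc] this[symmetric]]
 have "q ?r = diff B (H (gen c) \<ominus>\<^sub>B perturb b y1)"
  unfolding lin_diff[OF B.alg_module B.alg_module B.diff_linear Hc y1B] by (rule sym)
 then have "q ?r \<in> diff B ` carrier B" using B.M.minus_closed[OF Hc y1B] by (rule image_eqI)
 then have "?r \<in> diff Q ` carrier Q" by (intro quasi_iso_inj[OF q_quasi_iso]) (use rc dr in simp_all)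
 then obtain y2 where y2: "y2 \<in> carrier M" "d y2 = ?r" by auto
 \<comment> \<open>Cutting does not affect \<open>x\<close>, which comes from the first \<open>k\<close> summands.\<close>
 define y0 where "y0 = cut k y1 \<oplus>\<^sub>F.M incl y2"
 have cy1: "cut k y1 \<in> carrier F.M" by (rule lin_closed[OF cut_linear y1(1)])
 have y0c: "y0 \<in> carrier F.M" unfolding y0_def by (rule F.M.a_closed[OF cy1 incl_closed[OF y2(1)]])
 have "twisted_diff (cut k y1) = ?x \<ominus>\<^sub>F.M incl ?r"
  unfolding cut_twisted[OF y1(1), symmetric] y1(2)
   lin_diff[OF F.modM F.modM cut_linear xc incl_closed[OF rc]] cx cut_incl[OF rc] ..
 then have Dy0: "twisted_diff y0 = ?x"
  unfolding y0_def lin_add[OF twisted_linear cy1 incl_closed[OF y2(1)]] twisted_incl[OF y2(1)] y2(2)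
  using xc incl_closed[OF rc] by (simp add: a_minus_def F.M.a_assoc F.M.l_neg)
 have cy0: "cut k y0 = y0"
  unfolding y0_def lin_add[OF cut_linear cy1 incl_closed[OF y2(1)]] cut_cut[OF order_refl y1(1)] cut_incl[OF y2(1)] ..
 let ?u = "perturb b y0 \<ominus>\<^sub>B H (gen c)"
 have p0: "perturb b y0 \<in> carrier B" by (rule lin_closed[OF pl y0c])
 have uc: "?u \<in> carrier B" by (rule B.M.minus_closed[OF p0 Hc])
 have "diff B ?u = \<zero>\<^sub>B"
  unfolding lin_diff[OF B.alg_module B.alg_module B.diff_linear p0 Hc] perturb_twisted[OF b y0c, symmetric] Dy0 px
  using B.minus_zero_iff[OF dB_closed[OF Hc] dB_closed[OF Hc]] by simp
 from quasi_iso_surj[OF q_quasi_iso uc this] obtain z \<beta>0 where z: "z \<in> carrier M" "d z = \<zero>\<^sub>M"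
  and \<beta>0: "\<beta>0 \<in> carrier B" "?u = q z \<oplus>\<^sub>B diff B \<beta>0" by auto
 define y where "y = y0 \<ominus>\<^sub>F.M incl z"
 define \<beta> where "\<beta> = \<ominus>\<^sub>B \<beta>0"
 have zc: "incl z \<in> carrier F.M" by (rule incl_closed[OF z(1)])
 have yc: "y \<in> carrier F.M" unfolding y_def by (rule F.M.minus_closed[OF y0c zc])
 have \<beta>c: "\<beta> \<in> carrier B" unfolding \<beta>_def by (rule B.M.a_inv_closed[OF \<beta>0(1)])
 have Dz: "twisted_diff (incl z) = \<zero>\<^sub>F.M" unfolding twisted_incl[OF z(1)] z(2) by (rule gen_zeros)
 have "?x \<ominus>\<^sub>F.M \<zero>\<^sub>F.M = ?x" using xc by (simp add: a_minus_def)
 then have Dy: "twisted_diff y = ?x"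
  unfolding y_def lin_diff[OF F.modM F.modM twisted_linear y0c zc] Dy0 Dz .
 have cy: "cut k y = y"
  unfolding y_def lin_diff[OF F.modM F.modM cut_linear y0c zc] cy0 cut_incl[OF z(1)] ..
 have py: "perturb b y \<oplus>\<^sub>B diff B \<beta> = H (gen c)"
  unfolding y_def \<beta>_def lin_diff[OF F.modM B.alg_module pl y0c zc] perturb_incl[OF b z(1)]
   lin_neg[OF B.alg_module B.alg_module B.diff_linear \<beta>0(1)]
  by (rule B.M.minus_swap_sum[OF p0 q_closed[OF z(1)] dB_closed[OF \<beta>0(1)] Hc \<beta>0(2)])
 \<comment> \<open>All conditions are homogeneous, so the homogeneous parts of \<open>y\<close> and \<open>\<beta>\<close> satisfy them as well.\<close>
 let ?y = "hpart F.Q y i" and ?\<beta> = "hpart B \<beta> (i - 1)"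
 have yQ: "y \<in> carrier F.Q" using yc by simp
 have yg: "?y \<in> F.G i" using F.Q.component_in[OF yQ, of i] by (simp add: hpart_component)
 have \<beta>g: "?\<beta> \<in> grade B (i - 1)" using B.component_in[OF \<beta>c, of "i - 1"] by (simp add: hpart_component)
 have "twisted_diff ?y = hpart F.Q (twisted_diff y) (i + 1)"
  by (rule hpart_commute[OF F.Q_graded F.Q_graded derivation_linear[OF twisted_derivation] derivation_grade[OF twisted_derivation] yQ, symmetric])
 also have "... = ?x" unfolding Dy using F.Q.hpart_of[of ?x "i + 1" "i + 1"] xg by simp
 finally have 1: "twisted_diff ?y = ?x" .
 have "cut k ?y = hpart F.Q (cut k y) (i + 0)"
  by (rule hpart_commute[OF F.Q_graded F.Q_graded alg_map_linear[OF cut_alg_map] _ yQ, symmetric])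
   (use alg_map_grade[OF cut_alg_map] in simp)
 then have 2: "cut k ?y = ?y" unfolding cy by simp
 have pg: "hpart B (perturb b y) (i + 0) = perturb b ?y"
  by (rule hpart_commute[OF F.Q_graded B.alg_graded alg_map_linear[OF perturb_alg_map[OF b]] _ yQ])
   (use alg_map_grade[OF perturb_alg_map[OF b]] in simp)
 have dg: "hpart B (diff B \<beta>) (i - 1 + 1) = diff B ?\<beta>"
  by (rule hpart_commute[OF B.alg_graded B.alg_graded B.diff_linear B.diff_grade \<beta>c])
 have pc: "perturb b y \<in> carrier B" by (rule lin_closed[OF pl yc])
 have Hg: "H (gen c) \<in> grade B i" using alg_map_grade[OF H] gen_grade[OF c(2)] by simp
 have "perturb b ?y \<oplus>\<^sub>B diff B ?\<beta> = hpart B (perturb b y \<oplus>\<^sub>B diff B \<beta>) i"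
  using pg dg lin_add[OF B.component_linear pc dB_closed[OF \<beta>c], of i] by (simp add: hpart_component)
 also have "... = H (gen c)" unfolding py using B.hpart_of[OF Hg, of i] by simp
 finally have 3: "perturb b ?y \<oplus>\<^sub>B diff B ?\<beta> = H (gen c)" .
 show ?thesis using 1 2 3 yg \<beta>g by blast
qed

end

context lifting_problem
begin

text \<open>
 Solutions for the new generators can be chosen linearly, and so can elements \<open>\<beta>\<close> whose boundary is the
 remaining error. Adding to the solution for \<open>v\<close> the cone letter \<open>w\<close> on \<open>v\<close>, on which the new extension of \<open>q\<close>
 takes the value \<open>diff B (\<beta> v)\<close>, removes the error.
\<close>

lemma partial_lift_step:
 assumes L: "partial_lift k b s" and k: "k \<le> N"
 shows "\<exists>b' s'. partial_lift (Suc k) b' s'"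
proof -
 have b: "homotopy b" and s: "linear_map R V F.M s" "\<forall>i. \<forall>v\<in>grade V i. s v \<in> F.G i"
  and on: "!!j v. [|j < k; v \<in> Vs j|] ==> twisted_diff (s v) = alg_ext F.Q s (d (gen v)) \<and> cut k (s v) = s v \<and> perturb b (s v) = H (gen v)"
  using L by (auto simp: partial_lift_def)
 have bl: "linear_map R V B b" and bg: "!!i v. v \<in> grade V i ==> b v \<in> grade B (i - 1)" using b by (auto simp: homotopy_def)
 note h = lift_alg_map[OF s]
 let ?h = "alg_ext F.Q s" and ?c = "component V Vs k" and ?t = "S.trunc k"
 have hl: "linear_map R M F.M ?h" using alg_map_linear[OF h(1)] by simp
 have hc: "linear_map R V F.M (%v. ?h (d (gen (?c v))))"
  by (rule lin_comp[OF lin_comp[OF lin_comp[OF S.D.component_linear gen_linear] Q_d_linear] hl])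
 have Hc: "linear_map R V B (%v. H (gen (?c v)))"
  by (rule lin_comp[OF lin_comp[OF S.D.component_linear gen_linear] H_linear])
 note pl = perturb_linear[OF b]
 note Gsub = F.Q.summandD[unfolded F.quasi_free_simps]
 define \<Gamma> where "\<Gamma> i v y \<longleftrightarrow> v \<in> grade V i \<and> y \<in> F.G i \<and> twisted_diff y = ?h (d (gen (?c v))) \<and> cut k y = y \<and>
  (\<exists>\<beta>\<in>grade B (i - 1). perturb b y \<oplus>\<^sub>B diff B \<beta> = H (gen (?c v)))" for i v y
 have "\<exists>y. linear_map R V F.M y \<and> (\<forall>i. \<forall>v\<in>grade V i. \<Gamma> i v (y v))"
 proof (rule graded_linear_selection[OF X.graded_space_axioms F.modM])
  show "x \<in> grade V i \<and> y \<in> carrier F.M" if "\<Gamma> i x y" for i x y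
   using that F.G_closed by (auto simp: \<Gamma>_def)
  show "\<Gamma> i (x \<oplus>\<^sub>V x') (y \<oplus>\<^sub>F.M y')" if xy: "\<Gamma> i x y" "\<Gamma> i x' y'" for i x y x' y'
  proof -
   obtain \<beta> \<beta>' where \<beta>: "\<beta> \<in> grade B (i - 1)" "perturb b y \<oplus>\<^sub>B diff B \<beta> = H (gen (?c x))"
    "\<beta>' \<in> grade B (i - 1)" "perturb b y' \<oplus>\<^sub>B diff B \<beta>' = H (gen (?c x'))" using xy by (auto simp: \<Gamma>_def)
   have g: "x \<in> grade V i" "x' \<in> grade V i" "y \<in> F.G i" "y' \<in> F.G i" using xy by (auto simp: \<Gamma>_def)
   note cl = g(1,2)[THEN X.grade_closed] g(3,4)[THEN F.G_closed] \<beta>(1,3)[THEN B.grade_closed]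
   note cl' = cl(3,4)[THEN lin_closed[OF pl]] cl(5,6)[THEN dB_closed]
   have "perturb b (y \<oplus>\<^sub>F.M y') \<oplus>\<^sub>B diff B (\<beta> \<oplus>\<^sub>B \<beta>') =
     (perturb b y \<oplus>\<^sub>B diff B \<beta>) \<oplus>\<^sub>B (perturb b y' \<oplus>\<^sub>B diff B \<beta>')"
    unfolding lin_add[OF pl cl(3,4)] lin_add[OF B.diff_linear cl(5,6)] using cl' by (simp add: B.M.a_ac)
   also have "... = H (gen (?c (x \<oplus>\<^sub>V x')))" unfolding \<beta>(2,4) by (rule lin_add[OF Hc cl(1,2), symmetric])
   finally have "\<exists>\<beta>\<in>grade B (i - 1). perturb b (y \<oplus>\<^sub>F.M y') \<oplus>\<^sub>B diff B \<beta> = H (gen (?c (x \<oplus>\<^sub>V x')))"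
    using B.summandD(3)[OF \<beta>(1,3)] by blast
   then show ?thesis
    using xy lin_add[OF twisted_linear cl(3,4)] lin_add[OF cut_linear cl(3,4)] lin_add[OF hc cl(1,2)]
     X.summandD(3)[OF g(1,2)] Gsub(3)[OF g(3,4)] by (simp add: \<Gamma>_def)
  qed
  show "\<Gamma> i (r \<odot>\<^sub>V x) (r \<odot>\<^sub>F.M y)" if r: "r \<in> carrier R" and xy: "\<Gamma> i x y" for i r x y
  proof -
   obtain \<beta> where \<beta>: "\<beta> \<in> grade B (i - 1)" "perturb b y \<oplus>\<^sub>B diff B \<beta> = H (gen (?c x))" using xy by (auto simp: \<Gamma>_def)
   have g: "x \<in> grade V i" "y \<in> F.G i" using xy by (auto simp: \<Gamma>_def)
   note cl = X.grade_closed[OF g(1)] F.G_closed[OF g(2)] B.grade_closed[OF \<beta>(1)]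
   have "perturb b (r \<odot>\<^sub>F.M y) \<oplus>\<^sub>B diff B (r \<odot>\<^sub>B \<beta>) = r \<odot>\<^sub>B (perturb b y \<oplus>\<^sub>B diff B \<beta>)"
    unfolding lin_smult[OF pl r cl(2)] lin_smult[OF B.diff_linear r cl(3)]
    by (rule B.smult_r_distr[OF r lin_closed[OF pl cl(2)] dB_closed[OF cl(3)], symmetric])
   also have "... = H (gen (?c (r \<odot>\<^sub>V x)))" unfolding \<beta>(2) by (rule lin_smult[OF Hc r cl(1), symmetric])
   finally have "\<exists>\<beta>\<in>grade B (i - 1). perturb b (r \<odot>\<^sub>F.M y) \<oplus>\<^sub>B diff B \<beta> = H (gen (?c (r \<odot>\<^sub>V x)))"
    using B.summandD(4)[OF r \<beta>(1)] by blast
   then show ?thesis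
    using xy lin_smult[OF twisted_linear r cl(2)] lin_smult[OF cut_linear r cl(2)] lin_smult[OF hc r cl(1)]
     X.summandD(4)[OF r g(1)] Gsub(4)[OF r g(2)] by (simp add: \<Gamma>_def)
  qed
  show "\<exists>y. \<Gamma> i x y" if "x \<in> grade V i" for i x
   using stage_solution[OF L k S.D.component_in[OF X.grade_closed[OF that]] S.component_grade[OF that]] that
   unfolding \<Gamma>_def by blast
 qed
 then obtain y where y: "linear_map R V F.M y" and \<Gamma>y: "!!i v. v \<in> grade V i ==> \<Gamma> i v (y v)" by blast
 define \<Delta> where "\<Delta> i v \<beta> \<longleftrightarrow> v \<in> grade V i \<and> \<beta> \<in> grade B (i - 1) \<and> perturb b (y v) \<oplus>\<^sub>B diff B \<beta> = H (gen (?c v))" for i v \<beta>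
 have py: "linear_map R V B (%v. perturb b (y v))" by (rule lin_comp[OF y pl])
 have "\<exists>\<beta>. linear_map R V B \<beta> \<and> (\<forall>i. \<forall>v\<in>grade V i. \<Delta> i v (\<beta> v))"
 proof (rule graded_linear_selection[OF X.graded_space_axioms B.alg_module])
  show "x \<in> grade V i \<and> \<beta> \<in> carrier B" if "\<Delta> i x \<beta>" for i x \<beta>
   using that B.grade_closed by (auto simp: \<Delta>_def)
  show "\<Delta> i (x \<oplus>\<^sub>V x') (\<beta> \<oplus>\<^sub>B \<beta>')" if xy: "\<Delta> i x \<beta>" "\<Delta> i x' \<beta>'" for i x \<beta> x' \<beta>'
  proof -
   have g: "x \<in> grade V i" "x' \<in> grade V i" "\<beta> \<in> grade B (i - 1)" "\<beta>' \<in> grade B (i - 1)"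
    and eq: "perturb b (y x) \<oplus>\<^sub>B diff B \<beta> = H (gen (?c x))" "perturb b (y x') \<oplus>\<^sub>B diff B \<beta>' = H (gen (?c x'))"
    using xy by (auto simp: \<Delta>_def)
   note cl = g(1,2)[THEN X.grade_closed] g(3,4)[THEN B.grade_closed]
   note cl' = cl(1,2)[THEN lin_closed[OF py]] cl(3,4)[THEN dB_closed]
   have "perturb b (y (x \<oplus>\<^sub>V x')) \<oplus>\<^sub>B diff B (\<beta> \<oplus>\<^sub>B \<beta>') =
     (perturb b (y x) \<oplus>\<^sub>B diff B \<beta>) \<oplus>\<^sub>B (perturb b (y x') \<oplus>\<^sub>B diff B \<beta>')"
    unfolding lin_add[OF py cl(1,2)] lin_add[OF B.diff_linear cl(3,4)] using cl' by (simp add: B.M.a_ac)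
   also have "... = H (gen (?c (x \<oplus>\<^sub>V x')))" unfolding eq by (rule lin_add[OF Hc cl(1,2), symmetric])
   finally show ?thesis using X.summandD(3)[OF g(1,2)] B.summandD(3)[OF g(3,4)] by (simp add: \<Delta>_def)
  qed
  show "\<Delta> i (r \<odot>\<^sub>V x) (r \<odot>\<^sub>B \<beta>)" if r: "r \<in> carrier R" and xy: "\<Delta> i x \<beta>" for i r x \<beta>
  proof -
   have g: "x \<in> grade V i" "\<beta> \<in> grade B (i - 1)" and eq: "perturb b (y x) \<oplus>\<^sub>B diff B \<beta> = H (gen (?c x))"
    using xy by (auto simp: \<Delta>_def)
   note cl = X.grade_closed[OF g(1)] B.grade_closed[OF g(2)]
   have "perturb b (y (r \<odot>\<^sub>V x)) \<oplus>\<^sub>B diff B (r \<odot>\<^sub>B \<beta>) = r \<odot>\<^sub>B (perturb b (y x) \<oplus>\<^sub>B diff B \<beta>)"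
    unfolding lin_smult[OF py r cl(1)] lin_smult[OF B.diff_linear r cl(2)]
    by (rule B.smult_r_distr[OF r lin_closed[OF py cl(1)] dB_closed[OF cl(2)], symmetric])
   also have "... = H (gen (?c (r \<odot>\<^sub>V x)))" unfolding eq by (rule lin_smult[OF Hc r cl(1), symmetric])
   finally show ?thesis using X.summandD(4)[OF r g(1)] B.summandD(4)[OF r g(2)] by (simp add: \<Delta>_def)
  qed
  show "\<exists>\<beta>. \<Delta> i x \<beta>" if "x \<in> grade V i" for i x using \<Gamma>y[OF that] by (auto simp: \<Gamma>_def \<Delta>_def)
 qed
 then obtain \<beta> where \<beta>: "linear_map R V B \<beta>" and \<Delta>\<beta>: "!!i v. v \<in> grade V i ==> \<Delta> i v (\<beta> v)" by blast
 let ?w = "%v. F.gen [\<zero>\<^sub>V, \<zero>\<^sub>V, v]"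
 have w: "linear_map R V F.M ?w"
  by (rule lin_comp[OF triple_linear[OF V_zero_linear V_zero_linear lin_ident] F.gen_linear])
 have inr: "[\<zero>\<^sub>V, \<zero>\<^sub>V, v] \<in> carrier C" if "v \<in> carrier V" for v using that by (simp add: add_cone_simps)
 define s' where "s' v = s (?t v) \<oplus>\<^sub>F.M (y (?c v) \<oplus>\<^sub>F.M ?w (?c v))" for v
 define b' where "b' v = b (?t v) \<oplus>\<^sub>B \<beta> (?c v)" for v
 have s'l: "linear_map R V F.M s'"
  unfolding s'_def[abs_def]
  by (intro lin_sum[OF F.modM] lin_comp[OF S.trunc_linear s(1)]
    lin_comp[OF S.D.component_linear y] lin_comp[OF S.D.component_linear w])
 have s'g: "\<forall>i. \<forall>v\<in>grade V i. s' v \<in> F.G i"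
 proof (intro allI ballI)
  fix i v assume v: "v \<in> grade V i"
  have "y (?c v) \<in> F.G i" using \<Gamma>y[OF S.component_grade[OF v]] by (simp add: \<Gamma>_def)
  moreover have "?w (?c v) \<in> F.G i" by (rule F.gen_grade) (simp add: add_cone_simps S.component_grade[OF v])
  moreover have "s (?t v) \<in> F.G i" using s(2) S.trunc_grade[OF v] by blast
  ultimately show "s' v \<in> F.G i" unfolding s'_def by (intro Gsub(3))
 qed
 have hom': "homotopy b'" unfolding homotopy_def
 proof (intro conjI allI ballI)
  show "linear_map R V B b'" unfolding b'_def[abs_def]
   by (rule lin_sum[OF B.alg_module lin_comp[OF S.trunc_linear bl] lin_comp[OF S.D.component_linear \<beta>]])
  fix i v assume v: "v \<in> grade V i"
  have "\<beta> (?c v) \<in> grade B (i - 1)" using \<Delta>\<beta>[OF S.component_grade[OF v]] by (simp add: \<Delta>_def)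
  then show "b' v \<in> grade B (i - 1)" unfolding b'_def by (rule B.summandD(3)[OF bg[OF S.trunc_grade[OF v]]])
 qed
 note h' = lift_alg_map[OF s'l s'g]
 have zeros: "s \<zero>\<^sub>V = \<zero>\<^sub>F.M" "y \<zero>\<^sub>V = \<zero>\<^sub>F.M" "?w \<zero>\<^sub>V = \<zero>\<^sub>F.M" "\<beta> \<zero>\<^sub>V = \<zero>\<^sub>B"
  using lin_zero[OF modX F.modM s(1)] lin_zero[OF modX F.modM y]
   lin_zero[OF modX F.modM w] lin_zero[OF modX B.alg_module \<beta>] by simp_all
 have old: "s' v = s v" if "j < k" "v \<in> Vs j" for j v
  using S.trunc_summand[OF that(2), of k] S.D.component_of[OF that(2), of k] that(1)
   lin_closed[OF s(1) Vs_closed[OF that(2)]] by (simp add: s'_def zeros)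
 have new: "s' v = y v \<oplus>\<^sub>F.M ?w v" if "v \<in> Vs k" for v
  using S.trunc_summand[OF that, of k] S.D.component_of[OF that, of k]
   lin_closed[OF y Vs_closed[OF that]] lin_closed[OF w Vs_closed[OF that]] by (simp add: s'_def zeros)
 have b'new: "b' v = \<beta> v" if "v \<in> Vs k" for v
  using S.trunc_summand[OF that, of k] S.D.component_of[OF that, of k] lin_closed[OF \<beta> Vs_closed[OF that]]
  by (simp add: b'_def homotopy_zero[OF b])
 have h'h: "alg_ext F.Q s' x = ?h x" if x: "x \<in> stage k" for x
 proof (rule alg_map_eqI[OF F_alg h'(1) h(1) _ x])
  fix i v assume v: "v \<in> grade V i" "v \<in> sum_space V Vs {..<k}"
  show "alg_ext F.Q s' (gen v) = ?h (gen v)"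
   unfolding h'(2)[OF X.grade_closed[OF v(1)]] h(2)[OF X.grade_closed[OF v(1)]]
   by (rule S.D.sum_space_eqI[OF F.modM s'l s(1) _ v(2)]) (simp add: old)
 qed
 have pb: "perturb b' z = perturb b z" if "z \<in> carrier F.M" "cut k z = z" for z
 proof (rule perturb_cong[OF hom' b _ that])
  fix v assume v: "v \<in> carrier V"
  show "b' (?t v) = b (?t v)"
   using S.trunc_trunc[OF order_refl v, of k] S.component_trunc[OF v, of k] homotopy_closed[OF b trunc_closed[OF v, of k]]
   by (simp add: b'_def zeros)
 qed
 have up: "cut (Suc k) z = z" if "z \<in> carrier F.M" "cut k z = z" for z
  using cut_cut[of k "Suc k", OF _ that(1)] that(2) by simp
 have "twisted_diff (s' v) = alg_ext F.Q s' (d (gen v)) \<and> cut (Suc k) (s' v) = s' v \<and> perturb b' (s' v) = H (gen v)"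
  if j: "j < Suc k" and v: "v \<in> Vs j" for j v
 proof (cases "j < k")
  case True
  have dst: "d (gen v) \<in> stage k" using lower[OF v] stage_mono[of j k] True by auto
  have sc: "s v \<in> carrier F.M" by (rule lin_closed[OF s(1) Vs_closed[OF v]])
  show ?thesis unfolding old[OF True v] h'h[OF dst]
   using on[OF True v] up[OF sc] pb[OF sc] by simp
 next
  case False
  then have v: "v \<in> Vs k" using j v by (simp add: less_Suc_eq)
  note vc = Vs_closed[OF v]
  have cv: "?c v = v" using S.D.component_of[OF v, of k] by simp
  have dst: "d (gen v) \<in> stage k" by (rule lower[OF v])
  have yc: "y v \<in> carrier F.M" and wc: "?w v \<in> carrier F.M"
   by (rule lin_closed[OF y vc], rule lin_closed[OF w vc])
  have lin: "linear_map R (V\<lparr>carrier := Vs k\<rparr>) N' f" if "linear_map R V N' f" for N' :: "('k, 'z, 'm) module_scheme" and f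
   by (rule submodule_linear_map[OF S.D.summand_submodule modX that])
  \<comment> \<open>The selected maps satisfy their defining equations also at inhomogeneous elements.\<close>
  have yD: "twisted_diff (y v) = ?h (d (gen (?c v)))" and yC: "cut k (y v) = y v"
   and yP: "perturb b (y v) \<oplus>\<^sub>B diff B (\<beta> v) = H (gen (?c v))"
  proof -
   show "twisted_diff (y v) = ?h (d (gen (?c v)))"
    by (rule X.linear_maps_eq_on_summands[OF F.modM lin_comp[OF y twisted_linear] hc _ vc])
     (use \<Gamma>y in \<open>auto simp: \<Gamma>_def\<close>)
   show "cut k (y v) = y v"
    by (rule X.linear_maps_eq_on_summands[OF F.modM lin_comp[OF y cut_linear] y _ vc])
     (use \<Gamma>y in \<open>auto simp: \<Gamma>_def\<close>)
   show "perturb b (y v) \<oplus>\<^sub>B diff B (\<beta> v) = H (gen (?c v))"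
    by (rule X.linear_maps_eq_on_summands[OF B.alg_module lin_sum[OF B.alg_module py lin_comp[OF \<beta> B.diff_linear]] Hc _ vc])
     (use \<Delta>\<beta> in \<open>auto simp: \<Delta>_def\<close>)
  qed
  have wD: "twisted_diff (?w v) = \<zero>\<^sub>F.M"
  proof -
   have "diff C [\<zero>\<^sub>V, \<zero>\<^sub>V, v] = \<zero>\<^sub>C" by (simp add: add_cone_simps)
   then show ?thesis unfolding twisted_gen[OF inr[OF vc]] by (simp add: twist_def gen_zeros)
  qed
  have wC: "cut (Suc k) (?w v) = ?w v"
   unfolding cut_gen[OF inr[OF vc]] using S.trunc_summand[OF v, of "Suc k"] trunc_zero[of "Suc k"] by (simp del: S.trunc.simps)
  have dc: "diff B (\<beta> v) \<in> carrier B" by (rule dB_closed[OF lin_closed[OF \<beta> vc]])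
  have wP: "perturb b' (?w v) = diff B (\<beta> v)"
   unfolding perturb_gen[OF hom' inr[OF vc]] using dc by (simp add: gen_zeros q_zero homotopy_zero[OF hom'] b'new[OF v])
  show ?thesis
   unfolding new[OF v] h'h[OF dst] lin_add[OF twisted_linear yc wc] lin_add[OF cut_linear yc wc]
    lin_add[OF perturb_linear[OF hom'] yc wc] wD wC wP pb[OF yc yC] up[OF yc yC] yP
   using yD lin_closed[OF hl d_closed[OF gen_closed[OF vc]]] by (simp add: cv)
 qed
 then have "partial_lift (Suc k) b' s'" using hom' s'l s'g unfolding partial_lift_def by blast
 then show ?thesis by blast
qed

lemma partial_lift_exists: "k \<le> Suc N ==> \<exists>b s. partial_lift k b s"
proof (induction k)
 case 0
 have "partial_lift 0 (%v. \<zero>\<^sub>B) (%v. \<zero>\<^sub>F.M)"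
  using lin_const_zero[OF B.alg_module, where M=V] lin_const_zero[OF F.modM, where M=V] B.summandD(2)
   F.Q.summandD(2)[unfolded F.quasi_free_simps] by (simp add: partial_lift_def homotopy_def)
 then show ?case by blast
next
 case (Suc k)
 then show ?case using partial_lift_step by auto
qed

text \<open>
 For the complete lift \<open>s\<close> and an element \<open>x\<close> whose differential is in the image of \<open>P(0)\<close>, where \<open>s\<close> is the
 inclusion, the element \<open>s x\<close> differs from its retraction by a cocycle, hence by a boundary.
\<close>

theorem lift_up_to_boundaries:
 "\<exists>g. alg_map R P Q Q g \<and> (\<forall>x\<in>stage (Suc N). g (d x) = d (g x)) \<and> (\<forall>x\<in>stage 0. g x = x) \<and>
  (\<forall>x\<in>stage (Suc N). d x \<in> stage 0 --> H x \<ominus>\<^sub>B q (g x) \<in> diff B ` carrier B)"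
proof -
 obtain b s where L: "partial_lift (Suc N) b s" using partial_lift_exists by blast
 have b: "homotopy b" and s: "linear_map R V F.M s" "\<forall>i. \<forall>v\<in>grade V i. s v \<in> F.G i" using L by (auto simp: partial_lift_def)
 note h = lift_alg_map[OF s]
 let ?h = "alg_ext F.Q s"
 let ?g = "%x. retract (?h x)"
 have hl: "linear_map R M F.M ?h" using alg_map_linear[OF h(1)] by simp
 have g: "alg_map R P Q Q ?g" by (rule alg_map_comp[OF h(1) retract_alg_map])
 have hi: "?h x = incl x" if x: "x \<in> stage 0" for x
 proof (rule alg_map_eqI[OF F_alg h(1) incl_alg_map _ x])
  fix i v assume "v \<in> sum_space V Vs {..<0}"
  then have "v = \<zero>\<^sub>V" unfolding stage_zero by simp
  then show "?h (gen v) = incl (gen v)"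
   using lin_zero[OF modM F.modM hl] by (simp add: gen_zeros)
 qed
 have "?g (d x) = d (?g x)" if x: "x \<in> stage (Suc N)" for x
  unfolding lift_twisted[OF L x] by (rule retract_twisted[OF lin_closed[OF hl letter_span_closed[OF x]]])
 moreover have g0: "?g x = x" if x: "x \<in> stage 0" for x
  unfolding hi[OF x] by (rule retract_incl[OF letter_span_closed[OF x]])
 moreover have "H x \<ominus>\<^sub>B q (?g x) \<in> diff B ` carrier B" if x: "x \<in> stage (Suc N)" and dx: "d x \<in> stage 0" for x
 proof -
  note xc = letter_span_closed[OF x] and pl = perturb_linear[OF b]
  have hc: "?h x \<in> carrier F.M" by (rule lin_closed[OF hl xc])
  have rc: "?g x \<in> carrier M" by (rule retract_closed[OF hc])
  have "twisted_diff (incl (?g x)) = ?h (d x)"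
   unfolding twisted_incl[OF rc] retract_twisted[OF hc, symmetric] lift_twisted[OF L x, symmetric] hi[OF dx] retract_incl[OF letter_span_closed[OF dx]] ..
  then have "twisted_diff (?h x \<ominus>\<^sub>F.M incl (?g x)) = \<zero>\<^sub>F.M"
   unfolding lin_diff[OF F.modM F.modM twisted_linear hc incl_closed[OF rc]] lift_twisted[OF L x]
   using F.M.minus_zero_iff[OF twisted_closed[OF hc] twisted_closed[OF hc]] by simp
  then obtain z where z: "z \<in> carrier F.M" "twisted_diff z = ?h x \<ominus>\<^sub>F.M incl (?g x)"
   using retract_kernel_acyclic[OF hc] by blast
  have "diff B (perturb b z) = H x \<ominus>\<^sub>B q (?g x)"
   unfolding perturb_twisted[OF b z(1), symmetric] z(2) lin_diff[OF F.modM B.alg_module pl hc incl_closed[OF rc]]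
    perturb_incl[OF b rc] lift_perturb[OF L x] ..
  then show ?thesis using lin_closed[OF pl z(1)] by (intro image_eqI[of _ _ "perturb b z"]) simp_all
 qed
 ultimately show ?thesis using g by (intro exI[of _ ?g]) blast
qed

end

section \<open>Stages of a model\<close>

context sullivan_lift
begin

lemma sullivan_stage_restrict: "sullivan_stage R P V Vs d N = restrict_to Q (stage (Suc N))"
 unfolding sullivan_stage_def lessThan_Suc_atMost
 by (simp add: free_on_letter_span[OF S.D.sum_space_submodule S.sum_space_graded])

lemma stage_simps:
 "carrier (sullivan_stage R P V Vs d N) = stage (Suc N)" "add (sullivan_stage R P V Vs d N) = add M"
 "smult (sullivan_stage R P V Vs d N) = smult M" "zero (sullivan_stage R P V Vs d N) = zero M"
 "grade (sullivan_stage R P V Vs d N) i = G i \<inter> stage (Suc N)" "diff (sullivan_stage R P V Vs d N) = d"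
 "act (sullivan_stage R P V Vs d N) = pact"
 unfolding sullivan_stage_restrict by (simp_all add: restrict_to_def)

lemma p_morphism_restrict:
 assumes S: "p_algebra R P (sullivan_stage R P V Vs d N)" and E: "p_algebra R P E" and g: "alg_map R P Q E g"
  and gd: "!!x. x \<in> stage (Suc N) ==> g (d x) = diff E (g x)"
 shows "p_morphism R P (sullivan_stage R P V Vs d N) E g"
 unfolding p_morphism_def chain_map_def
proof (intro conjI allI ballI impI S E)
 show "cochain_complex R (sullivan_stage R P V Vs d N)" "cochain_complex R E"
  by (rule p_algebra.axioms(2)[OF S], rule p_algebra.axioms(2)[OF E])
 show "linear_map R (sullivan_stage R P V Vs d N) E g"
  using alg_map_linear[OF g] letter_span_closed by (simp add: linear_map_def stage_simps)
 show "g x \<in> grade E i" if "x \<in> grade (sullivan_stage R P V Vs d N) i" for x i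
  using that alg_map_grade[OF g] by (simp add: stage_simps)
 show "g (diff (sullivan_stage R P V Vs d N) x) = diff E (g x)" if "x \<in> carrier (sullivan_stage R P V Vs d N)" for x
  using that gd by (simp add: stage_simps)
 fix n p as assume p: "p \<in> opc P n" and as: "elements (replicate n (sullivan_stage R P V Vs d N)) as"
 then have "length as = n" "set as \<subseteq> carrier Q" using letter_span_closed by (auto simp: elements_replicate stage_simps)
 from alg_map_act[OF g p this] show "g (act (sullivan_stage R P V Vs d N) p as) = act E p (map g as)"
  by (simp add: stage_simps)
qed

text \<open>
 A morphism on a stage extends, by zero on the later generators, to a map of graded algebras on all of \<open>Q\<close>.
\<close>

lemma p_morphism_extend:
 assumes h: "p_morphism R P (sullivan_stage R P V Vs d N) E h"
 obtains H where "alg_map R P Q E H" "!!x. x \<in> stage (Suc N) ==> H x = h x"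
proof -
 have E: "p_algebra R P E" and ch: "chain_map R (sullivan_stage R P V Vs d N) E h"
  and act: "!!n p as. [|p \<in> opc P n; elements (replicate n (sullivan_stage R P V Vs d N)) as|] ==>
   h (act (sullivan_stage R P V Vs d N) p as) = act E p (map h as)"
  using h by (auto simp: p_morphism_def)
 note hl = linear_mapD[OF chain_map_linear[OF ch], unfolded stage_simps]
 let ?\<phi> = "%v. h (gen (S.trunc (Suc N) v))"
 have gs: "gen (S.trunc (Suc N) v) \<in> stage (Suc N)" if "v \<in> carrier V" for v
  by (rule gen_stage[OF S.trunc_mem[OF that]])
 note tl = lin_comp[OF S.trunc_linear gen_linear, of "Suc N"]
 have lin: "linear_map R V E ?\<phi>"
 proof (rule linear_mapI)
  show "?\<phi> v \<in> carrier E" if "v \<in> carrier V" for v by (rule hl(1)[OF gs[OF that]])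
  show "?\<phi> (v \<oplus>\<^sub>V w) = ?\<phi> v \<oplus>\<^sub>E ?\<phi> w" if "v \<in> carrier V" "w \<in> carrier V" for v w
   unfolding lin_add[OF tl that] by (rule hl(2)[OF gs[OF that(1)] gs[OF that(2)]])
  show "?\<phi> (r \<odot>\<^sub>V v) = r \<odot>\<^sub>E ?\<phi> v" if "r \<in> carrier R" "v \<in> carrier V" for r v
   unfolding lin_smult[OF tl that] by (rule hl(3)[OF that(1) gs[OF that(2)]])
 qed
 have deg: "\<forall>i. \<forall>v\<in>grade V i. ?\<phi> v \<in> grade E i"
 proof (intro allI ballI)
  fix i v assume v: "v \<in> grade V i"
  have "gen (S.trunc (Suc N) v) \<in> grade (sullivan_stage R P V Vs d N) i"
   unfolding stage_simps by (intro IntI gen_grade S.trunc_grade v gs X.grade_closed[OF v])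
  then show "?\<phi> v \<in> grade E i" by (rule chain_map_grade[OF ch])
 qed
 let ?H = "alg_ext E ?\<phi>"
 have H: "alg_map R P Q E ?H" by (rule alg_ext_alg_map[OF E lin deg])
 have "?H x = h x" if x: "x \<in> stage (Suc N)" for x
 proof (rule letter_span_eqI[OF p_algebra.alg_module[OF E] _ _ _ x])
  show "linear_map R (M\<lparr>carrier := stage (Suc N)\<rparr>) E ?H"
   using submodule_linear_map[OF letter_span_sub modM alg_ext_linear[OF E lin deg]] .
  show "linear_map R (M\<lparr>carrier := stage (Suc N)\<rparr>) E h" by (rule linear_mapI) (simp_all add: hl)
  fix n p e vs ds assume p: "p \<in> opg P n e" and vs: "homs n V vs ds"
   and W: "set vs \<subseteq> sum_space V Vs {..<Suc N}"
  have n: "length vs = n" using vs by (simp add: homs_iff)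
  have "elements (replicate n (sullivan_stage R P V Vs d N)) (map gen vs)"
   unfolding elements_replicate stage_simps using n W gen_stage by auto
  from act[OF opg_closed[OF p] this] have "h (T p vs) = act E p (map h (map gen vs))"
   unfolding stage_simps word_gen[OF p vs] .
  also have "map h (map gen vs) = map (%v. ?H (gen v)) vs"
   unfolding map_map comp_def
  proof (rule map_cong[OF refl])
   fix v assume v: "v \<in> set vs"
   show "h (gen v) = ?H (gen v)"
    unfolding alg_ext_gen[OF E lin deg subsetD[OF homs_closed[OF vs] v]] S.trunc_sum_space[OF subsetD[OF W v]] ..
  qed
  finally show "?H (T p vs) = h (T p vs)" unfolding alg_map_word[OF H p vs] ..
 qed
 with H show ?thesis by (rule that)
qed

end

section \<open>Cotriple product sets\<close>

lemma chain_map_class: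
 assumes "chain_map R X Y f" "z \<in> carrier X"
 shows "coh_map Y f (coh_class X z) = coh_class Y (f z)"
proof -
 note c = chain_mapD[OF assms(1)]
 show ?thesis
  by (rule coh_map_class[OF complex_module[OF c(2)] complex_diff_linear[OF c(2)] complex_module[OF c(3)] complex_diff_linear[OF c(3)] c(1,5) assms(2)])
qed

lemma complex_class_eq_iff:
 assumes "cochain_complex R X" "x \<in> carrier X" "y \<in> carrier X"
 shows "coh_class X x = coh_class X y \<longleftrightarrow> x \<ominus>\<^sub>X y \<in> diff X ` carrier X"
 by (rule coh_class_eq_iff[OF complex_module[OF assms(1)] complex_diff_linear[OF assms(1)] assms(2,3)])

lemma p_morphism_comp:
 assumes f: "p_morphism R P A B f" and g: "p_morphism R P B C g"
 shows "p_morphism R P A C (%x. g (f x))"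
proof -
 note a = alg_mapD[OF alg_map_comp[OF f[THEN p_morphism_alg_map] g[THEN p_morphism_alg_map]]]
 have f': "p_algebra R P A" "chain_map R A B f" and g': "p_algebra R P C" "chain_map R B C g"
  using f g by (auto simp: p_morphism_def)
 have "g (f (diff A x)) = diff C (g (f x))" if "x \<in> carrier A" for x
  using chain_map_diff[OF f'(2) that] chain_map_diff[OF g'(2)] lin_closed[OF chain_map_linear[OF f'(2)] that] by simp
 then show ?thesis
  using f'(1) g'(1) chain_map_source[OF f'(2)] chain_map_target[OF g'(2)] a
  by (auto simp: p_morphism_def chain_map_def elements_replicate comp_def)
qed

lemma p_quasi_iso_comp:
 assumes f: "p_quasi_iso R P A B f" and g: "p_quasi_iso R P B C g"
 shows "p_quasi_iso R P A C (%x. g (f x))"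
proof -
 have fm: "p_morphism R P A B f" and fb: "bij_betw (coh_map B f) (cohomology A) (cohomology B)" and fc: "chain_map R A B f"
  using f by (auto simp: p_quasi_iso_def quasi_iso_def)
 have gm: "p_morphism R P B C g" and gb: "bij_betw (coh_map C g) (cohomology B) (cohomology C)" and gc: "chain_map R B C g"
  using g by (auto simp: p_quasi_iso_def quasi_iso_def)
 have m: "p_morphism R P A C (%x. g (f x))" by (rule p_morphism_comp[OF fm gm])
 then have c: "chain_map R A C (%x. g (f x))" by (simp add: p_morphism_def)
 have eq: "coh_map C (%x. g (f x)) k = (coh_map C g \<circ> coh_map B f) k" if k: "k \<in> cohomology A" for k
 proof -
  obtain z where z: "z \<in> carrier A" "k = coh_class A z" using k by (auto simp: cohomology_def cocycles_def)
  show ?thesis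
   using chain_map_class[OF c z(1)] chain_map_class[OF fc z(1)]
    chain_map_class[OF gc lin_closed[OF chain_map_linear[OF fc] z(1)]] by (simp add: z(2))
 qed
 have "bij_betw (coh_map C (%x. g (f x))) (cohomology A) (cohomology C)"
  using iffD2[OF bij_betw_cong bij_betw_trans[OF fb gb]] eq .
 then show ?thesis using m c by (simp add: p_quasi_iso_def quasi_iso_def)
qed

theorem proposition3p10:
  fixes R :: "('k, 'c) ring_scheme"
    and P :: "('k, 'p) operad"
    and A :: "('k, 'p, 'a) dg_algebra"
    and B :: "('k, 'p, 'b) dg_algebra"
    and V :: "('k, 'v) dgvs"
    and Vs :: "nat => 'v set"
    and d :: "('k,'p,'v) tensors => ('k,'p,'v) tensors"
    and m :: "('k,'p,'v) tensors => 'a"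
    and f :: "'a => 'b"
    and N :: nat
    and \<sigma> :: "('k,'p,'v) tensors"
  assumes "dg_operad R P"
    and "reflects_homotopy_equivalences TYPE('v list) R P"
    and "p_morphism R P A B f"
    and "sullivan_model R P A V Vs d m"
    and "\<sigma> \<in> higher_ideal R P V Vs d N"
    and "\<sigma> \<in> cocycles (sullivan_stage R P V Vs d N)"
  defines "prodA \<equiv> cotriple_product_set R P V Vs d N A (coh_map A m) \<sigma>"
    and "prodB \<equiv> cotriple_product_set R P V Vs d N B (coh_map B f \<circ> coh_map A m) \<sigma>"
  shows "coh_map B f ` prodA \<subseteq> prodB \<and>
    (quasi_iso R A B f --> bij_betw (coh_map B f) prodA prodB)"
proof -
 let ?Q = "quasi_free R P V d" and ?S = "sullivan_stage R P V Vs d N"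
 have V: "graded_space R V" "internal_direct_sum R V Vs" "!!k. graded_subset V (Vs k)"
  and m: "p_quasi_iso R P ?Q A m"
  and low: "!!k. d ` generator R P V ` Vs k \<subseteq> free_on R P V (sum_space V Vs {..<k})"
  using assms(4) by (simp_all add: sullivan_model_def Let_def)
 interpret S: graded_splitting R V Vs
  by (intro graded_splitting.intro graded_splitting_axioms.intro V)
 interpret Q: free_p_alg R P V d
  using m by (intro free_p_alg.intro free_gens.intro assms(1) V(1)) (simp add: p_quasi_iso_def p_morphism_def)
 interpret L: sullivan_lift R P V d Vs
 proof
  show "d (Q.gen v) \<in> Q.letter_span (sum_space V Vs {..<k})" if "v \<in> Vs k" for v k
   using subsetD[OF low imageI[OF imageI[OF that]]] by (simp add: Q.free_on_letter_span[OF S.D.sum_space_submodule S.sum_space_graded])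
 qed (rule assms(2))
 have mm: "p_morphism R P ?Q A m" and mc: "chain_map R ?Q A m" using m by (auto simp: p_quasi_iso_def p_morphism_def)
 have fm: "p_morphism R P A B f" by (rule assms(3))
 have fc: "chain_map R A B f" using fm by (simp add: p_morphism_def)
 note fl = chain_map_linear[OF fc] and Ac = chain_map_source[OF fc] and Bc = chain_map_target[OF fc]
 interpret A: module R A by (rule complex_module[OF Ac])
 interpret B: module R B by (rule complex_module[OF Bc])
 have \<sigma>: "\<sigma> \<in> carrier ?S" "diff ?S \<sigma> = \<zero>\<^sub>?S" using assms(6) by (auto simp: cocycles_def)
 have gS: "Q.gen v \<in> carrier ?S" if "v \<in> Vs 0" for v
  unfolding L.stage_simps
  by (rule L.gen_stage[OF subsetD[OF S.D.summand_subset_sum_space that]]) simp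
 have SQ: "x \<in> carrier ?Q" if "x \<in> carrier ?S" for x
  using that L.letter_span_closed by (simp add: L.stage_simps)
 have mS: "chain_map R ?S A m" if "p_algebra R P ?S"
 proof -
  have "p_morphism R P ?S A m"
   by (rule L.p_morphism_restrict[OF that _ p_morphism_alg_map[OF mm]])
    (use mm chain_map_diff[OF mc] L.letter_span_closed in \<open>auto simp: p_morphism_def\<close>)
  then show ?thesis by (simp add: p_morphism_def)
 qed
 have sys: "defining_system R P V Vs d N E \<phi> h \<longleftrightarrow> p_morphism R P ?S E h \<and>
   (\<forall>v\<in>Vs 0. coh_map E h (coh_class ?S (Q.gen v)) = \<phi> (coh_class ?S (Q.gen v)))" for E \<phi> h
  by (simp add: defining_system_def Let_def)
 have morph: "chain_map R ?S E h" "p_algebra R P ?S" if "p_morphism R P ?S E h" for E h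
  using that by (auto simp: p_morphism_def)
 have image: "coh_map B f ` prodA \<subseteq> prodB"
 proof
  fix x assume "x \<in> coh_map B f ` prodA"
  then obtain g where g: "p_morphism R P ?S A g"
   "!!v. v \<in> Vs 0 ==> coh_map A g (coh_class ?S (Q.gen v)) = coh_map A m (coh_class ?S (Q.gen v))"
   and x: "x = coh_map B f (coh_map A g (coh_class ?S \<sigma>))"
   by (auto simp: prodA_def cotriple_product_set_def sys)
  have h: "p_morphism R P ?S B (%x. f (g x))" by (rule p_morphism_comp[OF g(1) fm])
  have comp: "coh_map B (%x. f (g x)) (coh_class ?S z) = coh_map B f (coh_map A g (coh_class ?S z))" if z: "z \<in> carrier ?S" for z
   using chain_map_class[OF morph(1)[OF h] z] chain_map_class[OF morph(1)[OF g(1)] z]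
    chain_map_class[OF fc lin_closed[OF chain_map_linear[OF morph(1)[OF g(1)]] z]] by simp
  have "defining_system R P V Vs d N B (coh_map B f \<circ> coh_map A m) (%x. f (g x))"
   unfolding sys using h comp[OF gS] g(2) by simp
  then show "x \<in> prodB" unfolding prodB_def cotriple_product_set_def x comp[OF \<sigma>(1), symmetric] by blast
 qed
 have "bij_betw (coh_map B f) prodA prodB" if q: "quasi_iso R A B f"
 proof -
  have prodA_coh: "prodA \<subseteq> cohomology A"
  proof
   fix x assume "x \<in> prodA"
   then obtain g where g: "p_morphism R P ?S A g" and x: "x = coh_map A g (coh_class ?S \<sigma>)"
    by (auto simp: prodA_def cotriple_product_set_def sys)
   note gc = morph(1)[OF g]
   have "diff A (g \<sigma>) = \<zero>\<^sub>A"
    using chain_map_diff[OF gc \<sigma>(1)] \<sigma>(2) lin_zero[OF complex_module[OF chain_map_source[OF gc]] A.module_axioms chain_map_linear[OF gc]] by simp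
   then show "x \<in> cohomology A"
    unfolding x chain_map_class[OF gc \<sigma>(1)] cohomology_def cocycles_def using lin_closed[OF chain_map_linear[OF gc] \<sigma>(1)] by blast
  qed
  have inj: "inj_on (coh_map B f) prodA"
   using q inj_on_subset[OF _ prodA_coh] by (auto simp: quasi_iso_def bij_betw_def)
  have fq: "p_quasi_iso R P A B f" using fm q by (simp add: p_quasi_iso_def)
  have "prodB \<subseteq> coh_map B f ` prodA"
  proof
   fix x assume "x \<in> prodB"
   then obtain h where h: "p_morphism R P ?S B h"
    "!!v. v \<in> Vs 0 ==> coh_map B h (coh_class ?S (Q.gen v)) = coh_map B f (coh_map A m (coh_class ?S (Q.gen v)))"
    and x: "x = coh_map B h (coh_class ?S \<sigma>)"
    by (auto simp: prodB_def cotriple_product_set_def sys)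
   note hc = morph[OF h(1)]
   obtain H where H: "alg_map R P ?Q B H" "!!x. x \<in> L.stage (Suc N) ==> H x = h x"
    using L.p_morphism_extend[OF h(1)] by blast
   let ?q = "%x. f (m x)"
   have st: "x \<in> L.stage (Suc N) \<longleftrightarrow> x \<in> carrier ?S" for x by (simp add: L.stage_simps)
   have dS: "d x \<in> carrier ?S" if "x \<in> carrier ?S" for x
    using lin_closed[OF complex_diff_linear[OF chain_map_source[OF hc(1)]] that] by (simp add: L.stage_simps)
   interpret pr: lifting_problem R P V d Vs B ?q H N
   proof (intro lifting_problem.intro lifting_problem_axioms.intro L.sullivan_lift_axioms)
    show "p_algebra R P B" using h(1) by (simp add: p_morphism_def)
    show "p_quasi_iso R P ?Q B ?q" by (rule p_quasi_iso_comp[OF m fq])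
    show "H (d x) = diff B (H x)" if "x \<in> Q.letter_span (sum_space V Vs {..<Suc N})" for x
     using chain_map_diff[OF hc(1), of x] that H(2) dS by (simp add: st L.stage_simps(6))
   qed (rule H(1))
   obtain g where G: "alg_map R P ?Q ?Q g \<and> (\<forall>x\<in>L.stage (Suc N). g (d x) = d (g x)) \<and> (\<forall>x\<in>L.stage 0. g x = x) \<and>
    (\<forall>x\<in>L.stage (Suc N). d x \<in> L.stage 0 --> H x \<ominus>\<^sub>B f (m (g x)) \<in> diff B ` carrier B)"
    using pr.lift_up_to_boundaries by (rule exE)
   note g1 = conjunct1[OF G] and g' = conjunct1[OF conjunct2[OF G]] conjunct1[OF conjunct2[OF conjunct2[OF G]]]
    conjunct2[OF conjunct2[OF conjunct2[OF G]]]
   have g2: "g (d x) = d (g x)" if "x \<in> carrier ?S" for x by (rule bspec[OF g'(1) that[folded st]])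
   have g3: "g x = x" if "x \<in> L.stage 0" for x by (rule bspec[OF g'(2) that])
   have lift: "H x \<ominus>\<^sub>B f (m (g x)) \<in> diff B ` carrier B" if "x \<in> carrier ?S" "d x \<in> L.stage 0" for x
    by (rule mp[OF bspec[OF g'(3) that(1)[folded st]] that(2)])
   note g = g1 g2 g3
   have gQ: "g x \<in> carrier ?Q" if "x \<in> carrier ?S" for x by (rule lin_closed[OF alg_map_linear[OF g(1)] SQ[OF that]])
   note ml = lin_closed[OF chain_map_linear[OF mc]] and fcl = lin_closed[OF fl]
   have gm: "p_morphism R P ?S A (%x. m (g x))"
   proof (rule L.p_morphism_restrict[OF hc(2) _ alg_map_comp[OF g(1) p_morphism_alg_map[OF mm]]])
    show "p_algebra R P A" using mm by (simp add: p_morphism_def)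
    show "m (g (d x)) = diff A (m (g x))" if "x \<in> L.stage (Suc N)" for x
     using that chain_map_diff[OF mc gQ, of x] g(2)[of x] by (simp add: st)
   qed
   have hmg: "coh_class B (h x) = coh_class B (f (m (g x)))" if x: "x \<in> carrier ?S" "d x \<in> L.stage 0" for x
    using lift[OF x] complex_class_eq_iff[OF Bc lin_closed[OF chain_map_linear[OF hc(1)] x(1)] fcl[OF ml[OF gQ[OF x(1)]]]] H(2) x(1)
    by (simp add: st)
   have "coh_map A (%x. m (g x)) (coh_class ?S (Q.gen v)) = coh_map A m (coh_class ?S (Q.gen v))" if v: "v \<in> Vs 0" for v
   proof -
    let ?z = "Q.gen v"
    note z = gS[OF v]
    have dz: "d ?z \<in> L.stage 0" by (rule L.lower[OF v])
    \<comment> \<open>This cocycle is a boundary as \<open>f\<close> maps it to one: \<open>h\<close> is a defining system, and \<open>q \<circ> g\<close> agrees with \<open>h\<close> up to a boundary.\<close>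
    let ?a = "m (g ?z) \<ominus>\<^sub>A m ?z"
    have ac: "m (g ?z) \<in> carrier A" "m ?z \<in> carrier A" using ml gQ[OF z] SQ[OF z] by blast+
    have "diff A ?a = m (d (g ?z)) \<ominus>\<^sub>A m (d ?z)"
     using lin_diff[OF A.module_axioms A.module_axioms complex_diff_linear[OF Ac] ac]
      chain_map_diff[OF mc gQ[OF z]] chain_map_diff[OF mc SQ[OF z]] by simp
    also have "d (g ?z) = d ?z" using g(2)[OF z] g(3)[OF dz] by simp
    also have "m (d ?z) \<ominus>\<^sub>A m (d ?z) = \<zero>\<^sub>A"
     using A.minus_zero_iff ml[OF SQ[OF dS[OF z]]] by blast
    finally have da: "diff A ?a = \<zero>\<^sub>A" .
    have "coh_class B (f (m (g ?z))) = coh_class B (f (m ?z))"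
     using h(2)[OF v] unfolding chain_map_class[OF hc(1) z] chain_map_class[OF mS[OF hc(2)] z] chain_map_class[OF fc ac(2)] hmg[OF z dz] .
    then have "f ?a \<in> diff B ` carrier B"
     unfolding complex_class_eq_iff[OF Bc fcl[OF ac(1)] fcl[OF ac(2)]] lin_diff[OF A.module_axioms B.module_axioms fl ac] .
    from quasi_iso_inj[OF q A.minus_closed[OF ac] da this] show ?thesis
     unfolding chain_map_class[OF morph(1)[OF gm] z] chain_map_class[OF mS[OF hc(2)] z] complex_class_eq_iff[OF Ac ac] .
   qed
   then have "defining_system R P V Vs d N A (coh_map A m) (%x. m (g x))" unfolding sys using gm by blast
   then have mem: "coh_map A (%x. m (g x)) (coh_class ?S \<sigma>) \<in> prodA" unfolding prodA_def cotriple_product_set_def by blast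
   have "d \<sigma> \<in> L.stage 0"
    using \<sigma>(2) submodule_zero[OF Q.M.module_axioms Q.letter_span_sub] by (simp add: L.stage_simps)
   then have "x = coh_map B f (coh_map A (%x. m (g x)) (coh_class ?S \<sigma>))"
    unfolding x chain_map_class[OF hc(1) \<sigma>(1)] chain_map_class[OF morph(1)[OF gm] \<sigma>(1)]
     chain_map_class[OF fc ml[OF gQ[OF \<sigma>(1)]]] by (rule hmg[OF \<sigma>(1)])
   then show "x \<in> coh_map B f ` prodA" using mem by blast
  qed
  then show ?thesis using inj image by (auto simp: bij_betw_def)
 qed
 then show ?thesis using image by blast
qed

end
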